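(* Let $n\ge 2$. Let $\{P_j\}_{j=1}^{\infty}$ be a sequence of orthogonal complementary projections on $H^2(\mathbb{D}^{n-1})$ and let $\{\varphi_j\}_{j=1}^{\infty}\subseteq H^\infty(\mathbb{D})$ be an increasing inner sequence. Set $\Theta(z)=\sum_{j=1}^{\infty}\varphi_j(z)P_j$ for $z\in\mathbb{D}$, $\mathcal{S}=\Theta H^2_{H^2(\mathbb{D}^{n-1})}(\mathbb{D})$ (regarded as a closed subspace of $H^2(\mathbb{D}^n)$), and $\mathcal{S}_j:=\bigoplus_{k=1}^{j}\operatorname{Ran}P_k$ for $j\ge 1$. (a) $\mathcal{S}$ is an invariant subspace of $H^2(\mathbb{D}^n)$ if and only if $\mathcal{S}_j$ is an invariant subspace of $H^2(\mathbb{D}^{n-1})$ for all $j\ge 1$. (b) There exists a decreasing inner sequence $\{\psi_j\}_{j=1}^\infty\subseteq H^\infty(\mathbb{D}^{n-1})$ such that $$\mathcal{S}=\bigvee_{j=1}^{\infty}\varphi_jH^2(\mathbb{D})\otimes\psi_jH^2(\mathbb{D}^{n-1})$$ if and only if $\mathcal{S}_j$ is a doubly commuting invariant subspace of $H^2(\mathbb{D}^{n-1})$ for all $j\ge 1$.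
   Context: $\mathbb{N}$ includes $0$. For a separable Hilbert space $\mathcal{E}$ and $m\ge 1$, $H^2_{\mathcal{E}}(\mathbb{D}^m)$ is the Hardy space of functions $f(z)=\sum_{k\in\mathbb{N}^m}z^{k}\eta_k$ on the polydisc $\mathbb{D}^m$ with $\eta_k\in\mathcal{E}$ and $\|f\|^2=\sum_k\|\eta_k\|^2_{\mathcal{E}}<\infty$; $H^2(\mathbb{D}^m)$ is the case $\mathcal{E}=\mathbb{C}$. The shifts on it are $(M_{z_i}f)(w)=w_if(w)$, $i=1,\dots,m$. An invariant subspace of $H^2(\mathbb{D}^m)$ is a closed subspace $\mathcal{S}$ with $M_{z_i}\mathcal{S}\subseteq\mathcal{S}$ for all $i=1,\dots,m$. It is doubly commuting if, with $R_{z_i}=M_{z_i}|_{\mathcal{S}}\in\mathcal{B}(\mathcal{S})$, one has $R_{z_i}R_{z_j}^*=R_{z_j}^*R_{z_i}$ for all $1\le i\ne j\le m$. $H^2(\mathbb{D}^n)$ is identified with the Hilbert space tensor product $H^2(\mathbb{D})\otimes H^2(\mathbb{D}^{n-1})$ and with $H^2_{H^2(\mathbb{D}^{n-1})}(\mathbb{D})$, where the first factor (the variable of $\mathbb{D}$) corresponds to $z_1$ and $H^2(\mathbb{D}^{n-1})$ corresponds to the variables $z_2,\dots,z_n$; thus $f\otimes g$ is the function $f(z_1)g(z_2,\dots,z_n)$. $\Theta H^2_{H^2(\mathbb{D}^{n-1})}(\mathbb{D})$ denotes $\{\Theta f: f\in H^2_{H^2(\mathbb{D}^{n-1})}(\mathbb{D})\}$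 with $(\Theta f)(w)=\Theta(w)f(w)$. $H^\infty(\mathbb{D}^m)$ is the space of bounded analytic functions on $\mathbb{D}^m$; an inner function is an element of it whose boundary values have modulus $1$ almost everywhere on the distinguished boundary $\mathbb{T}^m$. A sequence of inner functions $\{\varphi_j\}_{j=1}^\infty$ in $H^\infty(\mathbb{D}^m)$ is increasing (respectively decreasing) if $\varphi_{j+1}/\varphi_j$ (respectively $\varphi_j/\varphi_{j+1}$) is a non-constant inner function for every $j\ge1$; an increasing (decreasing) inner sequence is such a sequence. A sequence of orthogonal complementary projections on $H^2(\mathbb{D}^m)$ is a sequence $\{P_j\}_{j=1}^\infty$ of pairwise orthogonal (orthogonal) projections on $H^2(\mathbb{D}^m)$ with $\sum_{j=1}^\infty P_j=I$ in the strong operator topology. $\operatorname{Ran}$ denotes range and $\bigvee$ denotes closed linear span.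
   Formalization: Part (b) is stated for sequences in which every projection P_j is nonzero; with zero projections allowed it fails, e.g. P_1 = 0, P_2 = I, P_j = 0 for j ≥ 3, where all S_j are doubly commuting invariant but no decreasing inner sequence ψ_j exists. *)

theory Defs
  imports "HOL-Analysis.Analysis"
begin

section \<open>Complex Hilbert spaces\<close>

text \<open>
  The inner product is linear in its first argument.  The real inner product and norm inherited
  from \<^class>\<open>real_inner\<close> are those of the underlying real Hilbert space, so that the
  library's topology, limits and series apply.
\<close>

class complex_hilbert = real_inner + complete_space +
  fixes scaleC :: "complex \<Rightarrow> 'a \<Rightarrow> 'a"  (infixr \<open>*\<^sub>C\<close> 75)
    and cinner :: "'a \<Rightarrow> 'a \<Rightarrow> complex"
  assumes scaleC_add_right: "c *\<^sub>C (x + y) = c *\<^sub>C x + c *\<^sub>C y"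
    and scaleC_add_left: "(c + d) *\<^sub>C x = c *\<^sub>C x + d *\<^sub>C x"
    and scaleC_scaleC: "c *\<^sub>C (d *\<^sub>C x) = (c * d) *\<^sub>C x"
    and scaleC_of_real: "complex_of_real r *\<^sub>C x = r *\<^sub>R x"
    and cinner_commute: "cinner x y = cnj (cinner y x)"
    and cinner_add_left: "cinner (x + y) z = cinner x z + cinner y z"
    and cinner_scaleC_left: "cinner (c *\<^sub>C x) y = c * cinner x y"
    and Re_cinner: "Re (cinner x y) = inner x y"

global_interpretation complex_vector: vector_space "scaleC :: complex \<Rightarrow> 'a \<Rightarrow> 'a::complex_hilbert"
proof
  show "1 *\<^sub>C x = x" for x :: 'a
    using scaleC_of_real[of 1 x] by simp
qed (simp_all add: scaleC_add_right scaleC_add_left scaleC_scaleC)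

instantiation complex :: complex_hilbert
begin

definition scaleC_complex :: "complex \<Rightarrow> complex \<Rightarrow> complex"
  where "scaleC_complex c x = c * x"

definition cinner_complex :: "complex \<Rightarrow> complex \<Rightarrow> complex"
  where "cinner_complex x y = x * cnj y"

instance
  by standard
    (auto simp: scaleC_complex_def cinner_complex_def algebra_simps inner_complex_def scaleR_conv_of_real)

end

text \<open>
  An everywhere defined linear self-adjoint idempotent is automatically bounded, so this is the
  usual notion of an orthogonal projection.
\<close>

definition orthogonal_projection :: "('a::complex_hilbert \<Rightarrow> 'a) \<Rightarrow> bool" where
  "orthogonal_projection P \<longleftrightarrow>
     Vector_Spaces.linear scaleC scaleC P \<and>
     (\<forall>x. P (P x) = P x) \<and>
     (\<forall>x y. cinner (P x) y = cinner x (P y))"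

text \<open>Sequences indexed by \<open>j \<ge> 1\<close> in the literature are indexed by \<open>j \<ge> 0\<close> here.\<close>

definition complementary_projections :: "(nat \<Rightarrow> 'a::complex_hilbert \<Rightarrow> 'a) \<Rightarrow> bool" where
  "complementary_projections P \<longleftrightarrow>
     (\<forall>j. orthogonal_projection (P j)) \<and>
     (\<forall>j k x. j \<noteq> k \<longrightarrow> P j (P k x) = 0) \<and>
     (\<forall>x. (\<lambda>j. P j x) sums x)"

definition range_sum :: "(nat \<Rightarrow> 'a \<Rightarrow> 'a::complex_hilbert) \<Rightarrow> nat \<Rightarrow> 'a set" where
  "range_sum P j = {(\<Sum>k\<le>j. x k) | x. \<forall>k\<le>j. x k \<in> range (P k)}"

definition closed_subspace :: "'a::complex_hilbert set \<Rightarrow> bool" where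
  "closed_subspace S \<longleftrightarrow> complex_vector.subspace S \<and> closed S"

definition closed_span :: "'a::complex_hilbert set \<Rightarrow> 'a set" where
  "closed_span X = closure (complex_vector.span X)"

text \<open>
  The Hilbert space adjoint of an operator \<open>T\<close> on the closed subspace \<open>S\<close>, where \<open>S\<close>
  carries the inner product of the ambient space; it is meaningful for bounded \<open>T\<close> mapping
  \<open>S\<close> into itself, and only at arguments in \<open>S\<close>.
\<close>

definition adjoint_on :: "'a::complex_hilbert set \<Rightarrow> ('a \<Rightarrow> 'a) \<Rightarrow> 'a \<Rightarrow> 'a" where
  "adjoint_on S T y = (THE w. w \<in> S \<and> (\<forall>x\<in>S. cinner (T x) y = cinner x w))"


section \<open>Hardy spaces on the polydisc\<close>

text \<open>
  The polydisc of dimension \<open>m\<close> consists of vectors indexed by a finite type \<open>'i\<close> with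
  \<open>m\<close> elements; multi-indices are functions \<open>'i \<Rightarrow> nat\<close>.
\<close>

definition polydisc :: "(complex^'i) set" where
  "polydisc = {z. \<forall>i. norm (z $ i) < 1}"

definition zpow :: "complex^'i \<Rightarrow> ('i \<Rightarrow> nat) \<Rightarrow> complex" where
  "zpow z k = (\<Prod>i\<in>UNIV. z $ i ^ k i)"

definition hardy_coeffs :: "(complex^'i \<Rightarrow> 'e::complex_hilbert) \<Rightarrow> (('i \<Rightarrow> nat) \<Rightarrow> 'e) \<Rightarrow> bool" where
  "hardy_coeffs f \<eta> \<longleftrightarrow>
     (\<lambda>k. (norm (\<eta> k))\<^sup>2) summable_on UNIV \<and>
     (\<forall>z\<in>polydisc. ((\<lambda>k. zpow z k *\<^sub>C \<eta> k) has_sum f z) UNIV)"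

text \<open>
  The \<open>'e\<close>-valued Hardy space.  A function on the polydisc is represented by its extension by
  zero to the whole of \<open>complex^'i\<close>.
\<close>

definition hardy_space :: "(complex^'i \<Rightarrow> 'e::complex_hilbert) set" where
  "hardy_space = {f. (\<exists>\<eta>. hardy_coeffs f \<eta>) \<and> (\<forall>z. z \<notin> polydisc \<longrightarrow> f z = 0)}"

text \<open>The scalar-valued Hardy space as a type, with \<open>Rep_H2\<close> giving the underlying function.\<close>

typedef 'i H2 = "hardy_space :: (complex^'i::finite \<Rightarrow> complex) set"
proof
  show "(\<lambda>z. 0) \<in> (hardy_space :: (complex^'i \<Rightarrow> complex) set)"
    by (auto simp: hardy_space_def hardy_coeffs_def scaleC_complex_def intro!: exI[of _ "\<lambda>_. 0"])
qed

definition H2_coeff :: "'i::finite H2 \<Rightarrow> ('i \<Rightarrow> nat) \<Rightarrow> complex" where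
  "H2_coeff f = (SOME a. hardy_coeffs (Rep_H2 f) a)"


subsection \<open>Uniqueness and square summability of the coefficients\<close>

lemma zpow_summable:
  fixes z :: "complex^'i::finite"
  assumes "z \<in> polydisc"
  shows "(\<lambda>k. norm (zpow z k)) summable_on UNIV"
proof (rule nonneg_bdd_above_summable_on)
  show "bdd_above (sum (\<lambda>k. norm (zpow z k)) ` {F. F \<subseteq> UNIV \<and> finite F})"
  proof (rule bdd_aboveI2)
    fix F :: "('i \<Rightarrow> nat) set" assume "F \<in> {F. F \<subseteq> UNIV \<and> finite F}"
    then have fin: "finite F" by simp
    define N where "N = (\<Sum>k\<in>F. \<Sum>i\<in>UNIV. k i)"
    have le: "k i \<le> N" if "k \<in> F" for k i
    proof -
      have "k i \<le> (\<Sum>i\<in>UNIV. k i)" by (rule member_le_sum) auto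
      also have "\<dots> \<le> N" unfolding N_def by (rule member_le_sum[OF that]) (use fin in auto)
      finally show ?thesis .
    qed
    have "(\<Sum>k\<in>F. norm (zpow z k)) \<le> (\<Sum>k\<in>PiE UNIV (\<lambda>_. {..N}). norm (zpow z k))"
      by (rule sum_mono2) (use le in \<open>auto intro!: finite_PiE\<close>)
    also have "\<dots> = (\<Prod>i\<in>UNIV. \<Sum>n\<le>N. norm (z $ i) ^ n)"
      by (subst prod_sum_PiE) (auto simp: zpow_def prod_norm[symmetric] norm_power)
    also have "\<dots> \<le> (\<Prod>i\<in>UNIV. 1 / (1 - norm (z $ i)))"
    proof (rule prod_mono, safe)
      fix i :: 'i
      have lt: "norm (z $ i) < 1" using assms by (auto simp: polydisc_def)
      show "0 \<le> (\<Sum>n\<le>N. norm (z $ i) ^ n)" by (intro sum_nonneg) auto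
      have "(\<Sum>n\<le>N. norm (z $ i) ^ n) \<le> (\<Sum>n. norm (z $ i) ^ n)"
        by (rule sum_le_suminf) (use lt in \<open>auto intro!: summable_geometric\<close>)
      also have "\<dots> = 1 / (1 - norm (z $ i))"
        by (rule suminf_geometric) (use lt in auto)
      finally show "(\<Sum>n\<le>N. norm (z $ i) ^ n) \<le> 1 / (1 - norm (z $ i))" .
    qed
    finally show "(\<Sum>k\<in>F. norm (zpow z k)) \<le> (\<Prod>i\<in>UNIV. 1 / (1 - norm (z $ i)))" .
  qed
qed auto

lemma zpow_le_1:
  fixes z :: "complex^'i::finite"
  assumes "z \<in> polydisc"
  shows "norm (zpow z k) \<le> 1"
  unfolding zpow_def prod_norm[symmetric] norm_power
  by (rule prod_le_1) (use assms in \<open>auto simp: polydisc_def less_imp_le intro!: power_le_one\<close>)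

lemma zpow_series_abs_summable:
  fixes z :: "complex^'i::finite" and a :: "('i \<Rightarrow> nat) \<Rightarrow> complex"
  assumes "z \<in> polydisc" and a: "(\<lambda>k. (norm (a k))\<^sup>2) summable_on UNIV"
  shows "(\<lambda>k. norm (zpow z k * a k)) summable_on UNIV"
proof (rule summable_on_comparison_test)
  show "(\<lambda>k. (norm (a k))\<^sup>2 + norm (zpow z k)) summable_on UNIV"
    by (intro summable_on_add a zpow_summable assms)
  fix k
  show "norm (zpow z k * a k) \<le> (norm (a k))\<^sup>2 + norm (zpow z k)"
  proof -
    let ?x = "norm (zpow z k)" and ?y = "norm (a k)"
    have 1: "?x \<le> 1" "0 \<le> ?x" using zpow_le_1[OF assms(1)] by auto
    have "2 * (?x * ?y) \<le> ?x\<^sup>2 + ?y\<^sup>2"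
      using sum_squares_bound[of ?x ?y] by (simp add: mult.assoc)
    moreover have "?x\<^sup>2 \<le> ?x"
      using 1 by (simp add: power2_eq_square mult_left_le)
    moreover have "0 \<le> ?x * ?y" by simp
    ultimately show ?thesis unfolding norm_mult by linarith
  qed
qed auto

lemma power_series_coeffs_0:
  fixes b :: "nat \<Rightarrow> complex"
  assumes "\<And>w. norm w < 1 \<Longrightarrow> ((\<lambda>n. b n * w ^ n) has_sum 0) UNIV"
  shows "b n = 0"
proof (induction n rule: less_induct)
  case (less n)
  have "(\<lambda>m. b (m + n) * w ^ m) sums 0" if "w \<noteq> 0" "norm w < 1" for w
  proof -
    have "(\<lambda>m. b m * w ^ m) sums 0"
      using assms[OF that(2)] by (rule has_sum_imp_sums)
    then have "(\<lambda>m. b (m + n) * w ^ (m + n)) sums 0"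
      using sums_iff_shift[of "\<lambda>m. b m * w ^ m" n 0] less by simp
    then have "(\<lambda>m. b (m + n) * w ^ (m + n) / w ^ n) sums (0 / w ^ n)"
      by (rule sums_divide)
    then show ?thesis using that by (simp add: power_add)
  qed
  then have "((\<lambda>w. 0) \<longlongrightarrow> b (0 + n)) (at (0::complex))"
    by (intro powser_limit_0_strong[of 1 "\<lambda>m. b (m + n)" "\<lambda>_. 0"]) auto
  then show ?case
    by (simp add: tendsto_const_iff)
qed

lemma zpow_coeffs_0:
  fixes a :: "('i::finite \<Rightarrow> nat) \<Rightarrow> complex"
  assumes zero: "\<And>z. z \<in> polydisc \<Longrightarrow> ((\<lambda>k. zpow z k * a k) has_sum 0) UNIV"
  shows "a c = 0"
proof -
  have "\<forall>z\<in>polydisc. ((\<lambda>k. (\<Prod>j\<in>-B. z $ j ^ k j) * a k) has_sum 0) {k. \<forall>j\<in>B. k j = c j}"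
    if "finite B" for B :: "'i set"
    using that
  proof induction
    case empty
    then show ?case using zero by (simp add: zpow_def)
  next
    case (insert i B)
    show ?case
    proof
      fix z :: "complex^'i" assume z: "z \<in> polydisc"
      define T where "T = {k. \<forall>j\<in>B. k j = c j}"
      define Tn where "Tn n = {k \<in> T. k i = n}" for n
      define r where "r k = (\<Prod>j\<in>-insert i B. z $ j ^ k j) * a k" for k
      have *: "((\<lambda>k. w ^ k i * r k) has_sum 0) T" if "norm w < 1" for w
      proof -
        define z' where "z' = (\<chi> j. if j = i then w else z $ j)"
        have "z' \<in> polydisc"
          using z that by (auto simp: polydisc_def z'_def)
        then have "((\<lambda>k. (\<Prod>j\<in>-B. z' $ j ^ k j) * a k) has_sum 0) T"
          using insert.IH by (auto simp: T_def)
        moreover have "(\<Prod>j\<in>-B. z' $ j ^ k j) = w ^ k i * (\<Prod>j\<in>-insert i B. z $ j ^ k j)" for k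
        proof -
          have eq: "-B = insert i (-insert i B)" using insert.hyps by auto
          have "(\<Prod>j\<in>-B. z' $ j ^ k j) = w ^ k i * (\<Prod>j\<in>-insert i B. z' $ j ^ k j)"
            by (subst eq, subst prod.insert) (auto simp: z'_def)
          also have "(\<Prod>j\<in>-insert i B. z' $ j ^ k j) = (\<Prod>j\<in>-insert i B. z $ j ^ k j)"
            by (rule prod.cong) (auto simp: z'_def)
          finally show ?thesis .
        qed
        ultimately show ?thesis by (simp add: r_def mult.assoc)
      qed
      have bij: "bij_betw snd (Sigma UNIV Tn) T"
        by (rule bij_betwI[where g = "\<lambda>k. (k i, k)"]) (auto simp: Tn_def)
      have summ: "r summable_on Tn n" for n
      proof -
        have "(\<lambda>k. (1/2) ^ k i * r k) summable_on T"
          using *[of "1/2"] by (auto simp: summable_on_def)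
        then have "(\<lambda>k. (1/2) ^ k i * r k) summable_on Tn n"
          by (rule summable_on_subset_banach) (auto simp: Tn_def)
        then have "(\<lambda>k. (1/2) ^ n * r k) summable_on Tn n"
          by (rule summable_on_cong[THEN iffD1, rotated]) (auto simp: Tn_def)
        then have "(\<lambda>k. 2 ^ n * ((1/2) ^ n * r k)) summable_on Tn n"
          by (rule summable_on_cmult_right)
        then show ?thesis by (simp add: power_one_over)
      qed
      have "((\<lambda>n. infsum r (Tn n) * w ^ n) has_sum 0) UNIV" if w: "norm w < 1" for w
      proof -
        have "((\<lambda>p. w ^ snd p i * r (snd p)) has_sum 0) (Sigma UNIV Tn)"
          using has_sum_reindex_bij_betw[OF bij, of "\<lambda>k. w ^ k i * r k"] *[OF w] by simp
        then show ?thesis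
        proof (rule has_sum_SigmaD)
          fix n
          have "((\<lambda>k. r k * w ^ n) has_sum infsum r (Tn n) * w ^ n) (Tn n)"
            by (intro has_sum_cmult_left has_sum_infsum summ)
          then show "((\<lambda>k. w ^ snd (n, k) i * r (snd (n, k))) has_sum infsum r (Tn n) * w ^ n) (Tn n)"
            by (rule has_sum_cong[THEN iffD1, rotated]) (auto simp: Tn_def)
        qed
      qed
      then have "infsum r (Tn (c i)) = 0" by (rule power_series_coeffs_0)
      then have "(r has_sum 0) (Tn (c i))" using summ by (metis has_sum_infsum)
      moreover have "Tn (c i) = {k. \<forall>j\<in>insert i B. k j = c j}"
        by (auto simp: Tn_def T_def)
      ultimately show "((\<lambda>k. (\<Prod>j\<in>-insert i B. z $ j ^ k j) * a k) has_sum 0)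
          {k. \<forall>j\<in>insert i B. k j = c j}"
        by (simp add: r_def[abs_def])
    qed
  qed
  from this[of UNIV] have "\<forall>z\<in>(polydisc :: (complex^'i) set). (a has_sum 0) {k. \<forall>j. k j = c j}"
    by simp
  moreover have "(0 :: complex^'i) \<in> polydisc" by (simp add: polydisc_def)
  moreover have "{k. \<forall>j. k j = c j} = {c}" by auto
  ultimately show ?thesis by (auto simp: has_sum_finite_iff)
qed

lemma has_sum_diff_complex:
  fixes f g :: "'k \<Rightarrow> complex"
  assumes "(f has_sum a) A" "(g has_sum b) A"
  shows "((\<lambda>k. f k - g k) has_sum (a - b)) A"
  using has_sum_add[OF assms(1) has_sum_uminusI[OF assms(2)]] by simp

lemma H2_coeff: "hardy_coeffs (Rep_H2 f) (H2_coeff f)"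
proof -
  have "\<exists>a. hardy_coeffs (Rep_H2 f) a"
    using Rep_H2[of f] by (auto simp: hardy_space_def)
  then show ?thesis unfolding H2_coeff_def by (rule someI_ex)
qed

lemma H2_coeff_summable: "(\<lambda>k. (norm (H2_coeff f k))\<^sup>2) summable_on UNIV"
  using H2_coeff[of f] by (simp add: hardy_coeffs_def)

lemma H2_coeff_has_sum: "z \<in> polydisc \<Longrightarrow> ((\<lambda>k. zpow z k * H2_coeff f k) has_sum Rep_H2 f z) UNIV"
  using H2_coeff[of f] by (simp add: hardy_coeffs_def scaleC_complex_def)

lemma Rep_H2_outside: "z \<notin> polydisc \<Longrightarrow> Rep_H2 f z = 0"
  using Rep_H2[of f] by (auto simp: hardy_space_def)

lemma H2_coeff_unique:
  assumes "\<And>z. z \<in> polydisc \<Longrightarrow> ((\<lambda>k. zpow z k * a k) has_sum Rep_H2 f z) UNIV"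
  shows "H2_coeff f = a"
proof
  fix c
  have "((\<lambda>k. zpow z k * (H2_coeff f k - a k)) has_sum 0) UNIV" if "z \<in> polydisc" for z
    using has_sum_diff_complex[OF H2_coeff_has_sum[OF that, of f] assms[OF that]]
    by (simp add: algebra_simps)
  then have "H2_coeff f c - a c = 0" by (rule zpow_coeffs_0)
  then show "H2_coeff f c = a c" by simp
qed

lemma H2_eqI: "(\<And>z. z \<in> polydisc \<Longrightarrow> Rep_H2 f z = Rep_H2 g z) \<Longrightarrow> f = g"
  by (metis Rep_H2_inject Rep_H2_outside ext)

lemma H2_coeff_inject: "H2_coeff f = H2_coeff g \<Longrightarrow> f = g"
  by (intro H2_eqI) (metis H2_coeff_has_sum has_sum_unique)

lemma Abs_H2_inverse_coeffs:
  assumes "(\<lambda>k. (norm (a k))\<^sup>2) summable_on UNIV"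
    and "\<And>z. z \<in> polydisc \<Longrightarrow> ((\<lambda>k. zpow z k * a k) has_sum f z) UNIV"
    and "\<And>z. z \<notin> polydisc \<Longrightarrow> f z = 0"
  shows "Rep_H2 (Abs_H2 f) = f"
  by (rule Abs_H2_inverse)
    (use assms in \<open>auto simp: hardy_space_def hardy_coeffs_def scaleC_complex_def\<close>)

lemma H2_ex_coeff:
  assumes "(\<lambda>k. (norm (a k))\<^sup>2) summable_on UNIV"
  shows "\<exists>f. H2_coeff f = a"
proof -
  define g where "g z = (if z \<in> polydisc then (\<Sum>\<^sub>\<infinity>k. zpow z k * a k) else 0)" for z
  have *: "((\<lambda>k. zpow z k * a k) has_sum g z) UNIV" if "z \<in> polydisc" for z
    using abs_summable_summable[OF zpow_series_abs_summable[OF that assms]] that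
    by (simp add: g_def has_sum_infsum)
  then have "Rep_H2 (Abs_H2 g) = g"
    by (intro Abs_H2_inverse_coeffs[OF assms]) (auto simp: g_def)
  then have "H2_coeff (Abs_H2 g) = a"
    by (intro H2_coeff_unique) (use * in simp)
  then show ?thesis ..
qed

lemma square_summable_product:
  fixes a b :: "'k \<Rightarrow> complex"
  assumes "(\<lambda>k. (norm (a k))\<^sup>2) summable_on UNIV" "(\<lambda>k. (norm (b k))\<^sup>2) summable_on UNIV"
  shows "(\<lambda>k. a k * cnj (b k)) summable_on UNIV"
proof (rule abs_summable_summable, rule summable_on_comparison_test)
  show "(\<lambda>k. (norm (a k))\<^sup>2 + (norm (b k))\<^sup>2) summable_on UNIV"
    by (intro summable_on_add assms)
  show "norm (a k * cnj (b k)) \<le> (norm (a k))\<^sup>2 + (norm (b k))\<^sup>2" for k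
  proof -
    have "2 * (norm (a k) * norm (b k)) \<le> (norm (a k))\<^sup>2 + (norm (b k))\<^sup>2"
      using sum_squares_bound[of "norm (a k)" "norm (b k)"] by (simp add: mult.assoc)
    moreover have "0 \<le> norm (a k) * norm (b k)" by simp
    ultimately show ?thesis unfolding norm_mult complex_mod_cnj by linarith
  qed
qed auto

lemma square_summable_add:
  fixes a b :: "'k \<Rightarrow> complex"
  assumes "(\<lambda>k. (norm (a k))\<^sup>2) summable_on UNIV" "(\<lambda>k. (norm (b k))\<^sup>2) summable_on UNIV"
  shows "(\<lambda>k. (norm (a k + b k))\<^sup>2) summable_on UNIV"
proof (rule summable_on_comparison_test)
  show "(\<lambda>k. 2 * ((norm (a k))\<^sup>2 + (norm (b k))\<^sup>2)) summable_on UNIV"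
    by (intro summable_on_cmult_right summable_on_add assms)
  show "(norm (a k + b k))\<^sup>2 \<le> 2 * ((norm (a k))\<^sup>2 + (norm (b k))\<^sup>2)" for k
  proof -
    have "(norm (a k + b k))\<^sup>2 \<le> (norm (a k) + norm (b k))\<^sup>2"
      by (intro power_mono norm_triangle_ineq) auto
    also have "\<dots> \<le> 2 * ((norm (a k))\<^sup>2 + (norm (b k))\<^sup>2)"
      using sum_squares_bound[of "norm (a k)" "norm (b k)"] by (simp add: power2_sum)
    finally show ?thesis .
  qed
qed auto

lemma square_summable_scale:
  fixes a :: "'k \<Rightarrow> complex"
  assumes "(\<lambda>k. (norm (a k))\<^sup>2) summable_on UNIV"
  shows "(\<lambda>k. (norm (c * a k))\<^sup>2) summable_on UNIV"
  unfolding norm_mult power_mult_distrib by (intro summable_on_cmult_right assms)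


subsection \<open>The Hilbert space structure\<close>

instantiation H2 :: (finite) real_vector
begin

definition zero_H2 :: "'a H2" where "zero_H2 = Abs_H2 (\<lambda>z. 0)"
definition plus_H2 :: "'a H2 \<Rightarrow> 'a H2 \<Rightarrow> 'a H2"
  where "plus_H2 f g = Abs_H2 (\<lambda>z. Rep_H2 f z + Rep_H2 g z)"
definition uminus_H2 :: "'a H2 \<Rightarrow> 'a H2" where "uminus_H2 f = Abs_H2 (\<lambda>z. - Rep_H2 f z)"
definition minus_H2 :: "'a H2 \<Rightarrow> 'a H2 \<Rightarrow> 'a H2"
  where "minus_H2 f g = Abs_H2 (\<lambda>z. Rep_H2 f z - Rep_H2 g z)"
definition scaleR_H2 :: "real \<Rightarrow> 'a H2 \<Rightarrow> 'a H2"
  where "scaleR_H2 r f = Abs_H2 (\<lambda>z. r *\<^sub>R Rep_H2 f z)"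
lemma Rep_zero_H2 [simp]: "Rep_H2 0 = (\<lambda>z. 0)"
  unfolding zero_H2_def by (rule Abs_H2_inverse_coeffs[of "\<lambda>_. 0"]) auto

lemma Rep_plus_H2 [simp]: "Rep_H2 (f + g) = (\<lambda>z. Rep_H2 f z + Rep_H2 g z)"
  unfolding plus_H2_def
  by (rule Abs_H2_inverse_coeffs[of "\<lambda>k. H2_coeff f k + H2_coeff g k"])
    (auto simp: Rep_H2_outside distrib_left
      intro!: square_summable_add H2_coeff_summable has_sum_add H2_coeff_has_sum)

lemma Rep_uminus_H2 [simp]: "Rep_H2 (- f) = (\<lambda>z. - Rep_H2 f z)"
  unfolding uminus_H2_def
  by (rule Abs_H2_inverse_coeffs[of "\<lambda>k. - H2_coeff f k"])
    (auto simp: Rep_H2_outside intro!: H2_coeff_summable has_sum_uminusI H2_coeff_has_sum)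

lemma Rep_minus_H2 [simp]: "Rep_H2 (f - g) = (\<lambda>z. Rep_H2 f z - Rep_H2 g z)"
proof -
  have "f - g = f + - g"
    unfolding minus_H2_def plus_H2_def Rep_uminus_H2 by simp
  then show ?thesis by simp
qed

lemma scaled_H2_inverse: "Rep_H2 (Abs_H2 (\<lambda>z. c * Rep_H2 f z)) = (\<lambda>z. c * Rep_H2 f z)"
proof (rule Abs_H2_inverse_coeffs[of "\<lambda>k. c * H2_coeff f k"])
  show "((\<lambda>k. zpow z k * (c * H2_coeff f k)) has_sum c * Rep_H2 f z) UNIV" if "z \<in> polydisc" for z
    using has_sum_cmult_right[OF H2_coeff_has_sum[OF that, of f], of c] by (simp add: mult_ac)
qed (auto simp: Rep_H2_outside intro!: square_summable_scale H2_coeff_summable)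

lemma Rep_scaleR_H2 [simp]: "Rep_H2 (r *\<^sub>R f) = (\<lambda>z. r *\<^sub>R Rep_H2 f z)"
  unfolding scaleR_H2_def scaleR_conv_of_real by (rule scaled_H2_inverse)

lemma H2_coeff_plus [simp]: "H2_coeff (f + g) = (\<lambda>k. H2_coeff f k + H2_coeff g k)"
  by (rule H2_coeff_unique) (auto simp: distrib_left intro!: has_sum_add H2_coeff_has_sum)

lemma H2_coeff_zero [simp]: "H2_coeff 0 = (\<lambda>k. 0)"
  by (rule H2_coeff_unique) auto

lemma H2_coeff_scaleR [simp]: "H2_coeff (r *\<^sub>R f) = (\<lambda>k. of_real r * H2_coeff f k)"
proof (rule H2_coeff_unique)
  show "((\<lambda>k. zpow z k * (of_real r * H2_coeff f k)) has_sum Rep_H2 (r *\<^sub>R f) z) UNIV"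
    if "z \<in> polydisc" for z
    using has_sum_cmult_right[OF H2_coeff_has_sum[OF that, of f], of "of_real r"]
    by (simp add: mult_ac scaleR_conv_of_real)
qed

instance
proof
  fix f g h :: "'a H2" and r s :: real
  show "f + g + h = f + (g + h)" "f + g = g + f" "0 + f = f" "- f + f = 0" "f - g = f + - g"
    "r *\<^sub>R (f + g) = r *\<^sub>R f + r *\<^sub>R g" "(r + s) *\<^sub>R f = r *\<^sub>R f + s *\<^sub>R f"
    "r *\<^sub>R s *\<^sub>R f = (r * s) *\<^sub>R f" "1 *\<^sub>R f = f"
    by (rule H2_eqI; simp add: algebra_simps)+
qed

end

instantiation H2 :: (finite) real_inner
begin

definition inner_H2 :: "'a H2 \<Rightarrow> 'a H2 \<Rightarrow> real"
  where "inner_H2 f g = Re (\<Sum>\<^sub>\<infinity>k. H2_coeff f k * cnj (H2_coeff g k))"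
definition norm_H2 :: "'a H2 \<Rightarrow> real" where "norm_H2 f = sqrt (inner f f)"
definition sgn_H2 :: "'a H2 \<Rightarrow> 'a H2" where "sgn_H2 f = f /\<^sub>R norm f"
definition dist_H2 :: "'a H2 \<Rightarrow> 'a H2 \<Rightarrow> real" where "dist_H2 f g = norm (f - g)"
definition uniformity_H2 :: "('a H2 \<times> 'a H2) filter"
  where "uniformity_H2 = (INF e\<in>{0<..}. principal {(x, y). dist x y < e})"
definition open_H2 :: "'a H2 set \<Rightarrow> bool"
  where "open_H2 U \<longleftrightarrow> (\<forall>x\<in>U. eventually (\<lambda>(x', y). x' = x \<longrightarrow> y \<in> U) uniformity)"

lemma inner_summable: "(\<lambda>k. H2_coeff f k * cnj (H2_coeff g k)) summable_on UNIV"
  by (intro square_summable_product H2_coeff_summable)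

lemma inner_self_H2: "inner f f = (\<Sum>\<^sub>\<infinity>k. (norm (H2_coeff f k))\<^sup>2)" for f :: "'a H2"
  unfolding inner_H2_def infsum_Re[OF inner_summable, symmetric]
  by (simp add: complex_norm_square[symmetric])

instance
proof
  fix f g h :: "'a H2" and r s :: real
  show "sgn f = f /\<^sub>R norm f" "dist f g = norm (f - g)" "norm f = sqrt (inner f f)"
    by (simp_all add: sgn_H2_def dist_H2_def norm_H2_def)
  show "uniformity = (INF e\<in>{0<..}. principal {(x :: 'a H2, y). dist x y < e})"
    by (rule uniformity_H2_def)
  show "open U \<longleftrightarrow> (\<forall>x\<in>U. eventually (\<lambda>(x', y). x' = x \<longrightarrow> y \<in> U) uniformity)" for U :: "'a H2 set"
    by (rule open_H2_def)
  have "(\<Sum>\<^sub>\<infinity>k. H2_coeff f k * cnj (H2_coeff g k)) = cnj (\<Sum>\<^sub>\<infinity>k. H2_coeff g k * cnj (H2_coeff f k))"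
    by (simp add: infsum_cnj[symmetric] mult.commute del: infsum_cnj)
  then show "inner f g = inner g f" unfolding inner_H2_def by simp
  show "inner (f + g) h = inner f h + inner g h"
    unfolding inner_H2_def
    by (simp add: distrib_right infsum_add[OF inner_summable inner_summable])
  show "inner (r *\<^sub>R f) g = r * inner f g"
    unfolding inner_H2_def by (simp add: mult.assoc infsum_cmult_right')
  show "0 \<le> inner f f"
    unfolding inner_self_H2 by (intro infsum_nonneg) auto
  show "inner f f = 0 \<longleftrightarrow> f = 0"
  proof
    assume "inner f f = 0"
    then have "(norm (H2_coeff f k))\<^sup>2 = 0" for k
      unfolding inner_self_H2
      by (rule nonneg_infsum_le_0D[OF eq_refl]) (auto intro: H2_coeff_summable)
    then have "H2_coeff f = H2_coeff 0" by auto
    then show "f = 0" by (rule H2_coeff_inject)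
  qed (simp add: inner_self_H2)
qed

end

lemma norm_H2_eq: "norm f = sqrt (\<Sum>\<^sub>\<infinity>k. (norm (H2_coeff f k))\<^sup>2)"
  by (simp add: norm_H2_def inner_self_H2)

lemma H2_coeff_minus [simp]: "H2_coeff (f - g) = (\<lambda>k. H2_coeff f k - H2_coeff g k)"
  by (rule H2_coeff_unique) (auto simp: right_diff_distrib intro!: has_sum_diff_complex H2_coeff_has_sum)

lemma H2_sum_coeff_le:
  assumes "finite F"
  shows "(\<Sum>k\<in>F. (norm (H2_coeff f k))\<^sup>2) \<le> (norm f)\<^sup>2"
proof -
  have "(\<Sum>k\<in>F. (norm (H2_coeff f k))\<^sup>2) \<le> (\<Sum>\<^sub>\<infinity>k. (norm (H2_coeff f k))\<^sup>2)"
    by (rule finite_sum_le_infsum) (use assms H2_coeff_summable in auto)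
  then show ?thesis by (simp add: norm_H2_eq infsum_nonneg)
qed

lemma H2_coeff_le: "norm (H2_coeff f k) \<le> norm f"
  using H2_sum_coeff_le[of "{k}" f] by (simp add: power2_le_iff_abs_le)

instance H2 :: (finite) complete_space
proof
  fix X :: "nat \<Rightarrow> 'a H2" assume X: "Cauchy X"
  have "Cauchy (\<lambda>n. H2_coeff (X n) k)" for k
  proof (rule metric_CauchyI)
    fix e :: real assume "e > 0"
    then obtain N where N: "\<And>m n. m \<ge> N \<Longrightarrow> n \<ge> N \<Longrightarrow> dist (X m) (X n) < e"
      using metric_CauchyD[OF X] by blast
    have "dist (H2_coeff (X m) k) (H2_coeff (X n) k) < e" if "m \<ge> N" "n \<ge> N" for m n
      using N[OF that] H2_coeff_le[of "X m - X n" k] by (simp add: dist_norm)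
    then show "\<exists>N. \<forall>m\<ge>N. \<forall>n\<ge>N. dist (H2_coeff (X m) k) (H2_coeff (X n) k) < e" by blast
  qed
  then have "\<exists>l. (\<lambda>n. H2_coeff (X n) k) \<longlonglongrightarrow> l" for k
    by (simp add: Cauchy_convergent_iff convergent_def)
  then obtain a where a: "\<And>k. (\<lambda>n. H2_coeff (X n) k) \<longlonglongrightarrow> a k" by metis
  have tail: "\<exists>N. \<forall>m\<ge>N. \<forall>F. finite F \<longrightarrow> (\<Sum>k\<in>F. (norm (H2_coeff (X m) k - a k))\<^sup>2) \<le> e\<^sup>2"
    if "e > 0" for e :: real
  proof -
    obtain N where N: "\<And>m n. m \<ge> N \<Longrightarrow> n \<ge> N \<Longrightarrow> dist (X m) (X n) < e"
      using metric_CauchyD[OF X \<open>e > 0\<close>] by blast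
    have "(\<Sum>k\<in>F. (norm (H2_coeff (X m) k - a k))\<^sup>2) \<le> e\<^sup>2" if "m \<ge> N" "finite F" for m F
    proof (rule LIMSEQ_le_const2)
      show "(\<lambda>n. \<Sum>k\<in>F. (norm (H2_coeff (X m) k - H2_coeff (X n) k))\<^sup>2)
          \<longlonglongrightarrow> (\<Sum>k\<in>F. (norm (H2_coeff (X m) k - a k))\<^sup>2)"
        by (intro tendsto_intros a)
      have "(\<Sum>k\<in>F. (norm (H2_coeff (X m) k - H2_coeff (X n) k))\<^sup>2) \<le> e\<^sup>2" if "n \<ge> N" for n
      proof -
        have "(\<Sum>k\<in>F. (norm (H2_coeff (X m) k - H2_coeff (X n) k))\<^sup>2) \<le> (norm (X m - X n))\<^sup>2"
          using H2_sum_coeff_le[OF \<open>finite F\<close>, of "X m - X n"] by simp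
        also have "\<dots> \<le> e\<^sup>2"
          using N[OF \<open>m \<ge> N\<close> that] by (intro power_mono) (auto simp: dist_norm)
        finally show ?thesis .
      qed
      then show "\<exists>N. \<forall>n\<ge>N. (\<Sum>k\<in>F. (norm (H2_coeff (X m) k - H2_coeff (X n) k))\<^sup>2) \<le> e\<^sup>2"
        by blast
    qed
    then show ?thesis by blast
  qed
  have tail_summable: "(\<lambda>k. (norm (H2_coeff (X m) k - a k))\<^sup>2) summable_on UNIV"
    if "\<forall>F. finite F \<longrightarrow> (\<Sum>k\<in>F. (norm (H2_coeff (X m) k - a k))\<^sup>2) \<le> e\<^sup>2" for m and e :: real
    by (rule nonneg_bdd_above_summable_on) (use that in \<open>auto intro!: bdd_aboveI2\<close>)
  have "(\<lambda>k. (norm (a k))\<^sup>2) summable_on UNIV"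
  proof -
    obtain N where "\<forall>F. finite F \<longrightarrow> (\<Sum>k\<in>F. (norm (H2_coeff (X N) k - a k))\<^sup>2) \<le> 1\<^sup>2"
      using tail[of 1] by auto
    then have "(\<lambda>k. (norm (H2_coeff (X N) k - a k))\<^sup>2) summable_on UNIV"
      by (rule tail_summable)
    from square_summable_add[OF H2_coeff_summable square_summable_scale[OF this, of "-1"], of "X N"]
    show ?thesis by simp
  qed
  then obtain f where f: "H2_coeff f = a" using H2_ex_coeff by blast
  have "X \<longlonglongrightarrow> f"
  proof (rule metric_LIMSEQ_I)
    fix e :: real assume "e > 0"
    then obtain N where
      N: "\<forall>m\<ge>N. \<forall>F. finite F \<longrightarrow> (\<Sum>k\<in>F. (norm (H2_coeff (X m) k - a k))\<^sup>2) \<le> (e/2)\<^sup>2"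
      using tail[of "e/2"] by auto
    have "dist (X m) f < e" if "m \<ge> N" for m
    proof -
      have "(\<Sum>\<^sub>\<infinity>k. (norm (H2_coeff (X m) k - a k))\<^sup>2) \<le> (e/2)\<^sup>2"
        by (rule infsum_le_finite_sums[OF tail_summable]) (use N that in auto)
      then have "norm (X m - f) \<le> e/2"
        using \<open>e > 0\<close> unfolding norm_H2_eq by (intro real_le_lsqrt) (auto simp: f)
      then show ?thesis using \<open>e > 0\<close> by (simp add: dist_norm)
    qed
    then show "\<exists>N. \<forall>n\<ge>N. dist (X n) f < e" by blast
  qed
  then show "convergent X" by (auto simp: convergent_def)
qed

instantiation H2 :: (finite) complex_hilbert
begin

definition scaleC_H2 :: "complex \<Rightarrow> 'a H2 \<Rightarrow> 'a H2"
  where "scaleC_H2 c f = Abs_H2 (\<lambda>z. c * Rep_H2 f z)"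

definition cinner_H2 :: "'a H2 \<Rightarrow> 'a H2 \<Rightarrow> complex"
  where "cinner_H2 f g = (\<Sum>\<^sub>\<infinity>k. H2_coeff f k * cnj (H2_coeff g k))"

lemma Rep_scaleC_H2 [simp]: "Rep_H2 (c *\<^sub>C f) = (\<lambda>z. c * Rep_H2 f z)"
  unfolding scaleC_H2_def by (rule scaled_H2_inverse)

lemma H2_coeff_scaleC [simp]: "H2_coeff (c *\<^sub>C f) = (\<lambda>k. c * H2_coeff f k)"
proof (rule H2_coeff_unique)
  show "((\<lambda>k. zpow z k * (c * H2_coeff f k)) has_sum Rep_H2 (c *\<^sub>C f) z) UNIV"
    if "z \<in> polydisc" for z
    using has_sum_cmult_right[OF H2_coeff_has_sum[OF that, of f], of c] by (simp add: mult_ac)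
qed

instance
proof
  fix f g h :: "'a H2" and c d :: complex and r :: real
  show "c *\<^sub>C (f + g) = c *\<^sub>C f + c *\<^sub>C g" "(c + d) *\<^sub>C f = c *\<^sub>C f + d *\<^sub>C f"
    "c *\<^sub>C d *\<^sub>C f = (c * d) *\<^sub>C f" "complex_of_real r *\<^sub>C f = r *\<^sub>R f"
    by (rule H2_eqI; simp add: algebra_simps scaleR_conv_of_real)+
  show "cinner f g = cnj (cinner g f)"
    unfolding cinner_H2_def by (simp add: infsum_cnj[symmetric] mult.commute del: infsum_cnj)
  show "cinner (f + g) h = cinner f h + cinner g h"
    unfolding cinner_H2_def
    by (simp add: distrib_right infsum_add[OF inner_summable inner_summable])
  show "cinner (c *\<^sub>C f) g = c * cinner f g"
    unfolding cinner_H2_def by (simp add: mult.assoc infsum_cmult_right')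
  show "Re (cinner f g) = inner f g"
    unfolding cinner_H2_def inner_H2_def ..
qed

end

subsection \<open>Shifts and invariant subspaces\<close>

definition shift :: "'i \<Rightarrow> 'i::finite H2 \<Rightarrow> 'i H2" where
  "shift i f = Abs_H2 (\<lambda>w. w $ i * Rep_H2 f w)"

lemma Rep_shift [simp]: "Rep_H2 (shift i f) = (\<lambda>w. w $ i * Rep_H2 f w)"
  unfolding shift_def
proof (rule Abs_H2_inverse_coeffs)
  define up where "up k = k(i := Suc (k i))" for k :: "'a \<Rightarrow> nat"
  define dn where "dn k = k(i := k i - 1)" for k :: "'a \<Rightarrow> nat"
  define a where "a k = (if k i = 0 then 0 else H2_coeff f (dn k))" for k
  have bij: "bij_betw up UNIV {k. k i \<noteq> 0}"
    by (rule bij_betwI[where g = dn]) (auto simp: up_def dn_def)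
  have a_up: "a (up k) = H2_coeff f k" for k
    by (simp add: a_def up_def dn_def)
  have "(\<lambda>k. (norm (a (up k)))\<^sup>2) summable_on UNIV"
    unfolding a_up by (rule H2_coeff_summable)
  then have "(\<lambda>k. (norm (a k))\<^sup>2) summable_on {k. k i \<noteq> 0}"
    using summable_on_reindex_bij_betw[OF bij, of "\<lambda>k. (norm (a k))\<^sup>2"] by simp
  then show "(\<lambda>k. (norm (a k))\<^sup>2) summable_on UNIV"
    by (rule summable_on_cong_neutral[THEN iffD1, rotated -1]) (auto simp: a_def)
  fix z :: "complex^'a"
  show "((\<lambda>k. zpow z k * a k) has_sum z $ i * Rep_H2 f z) UNIV" if z: "z \<in> polydisc"
  proof -
    have "zpow z (up k) = z $ i * zpow z k" for k
    proof -
      have "zpow z (up k) = (\<Prod>j\<in>UNIV. (if j = i then z $ i else 1) * z $ j ^ k j)"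
        unfolding zpow_def by (rule prod.cong) (auto simp: up_def)
      then show ?thesis by (simp add: zpow_def prod.distrib)
    qed
    then have "((\<lambda>k. zpow z (up k) * a (up k)) has_sum z $ i * Rep_H2 f z) UNIV"
      using has_sum_cmult_right[OF H2_coeff_has_sum[OF z, of f], of "z $ i"]
      by (simp add: a_up mult_ac)
    then have "((\<lambda>k. zpow z k * a k) has_sum z $ i * Rep_H2 f z) {k. k i \<noteq> 0}"
      using has_sum_reindex_bij_betw[OF bij, of "\<lambda>k. zpow z k * a k"] by simp
    then show ?thesis
      by (rule has_sum_cong_neutral[THEN iffD1, rotated -1]) (auto simp: a_def)
  qed
qed (simp add: Rep_H2_outside)

definition invariant_subspace :: "'i::finite H2 set \<Rightarrow> bool" where
  "invariant_subspace S \<longleftrightarrow> closed_subspace S \<and> (\<forall>i. shift i ` S \<subseteq> S)"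

definition doubly_commuting :: "'i::finite H2 set \<Rightarrow> bool" where
  "doubly_commuting S \<longleftrightarrow>
     (\<forall>i j. i \<noteq> j \<longrightarrow>
       (\<forall>f\<in>S. shift i (adjoint_on S (shift j) f) = adjoint_on S (shift j) (shift i f)))"


section \<open>Inner functions\<close>

text \<open>
  Functions in \<open>H\<^sup>\<infinity>\<close> and inner functions are plain functions on \<open>complex^'i\<close> of which only the
  values on the polydisc matter.  Analytic means continuous and holomorphic in each variable
  separately.
\<close>

definition H_infinity :: "(complex^'i::finite \<Rightarrow> complex) set" where
  "H_infinity = {f.
     continuous_on polydisc f \<and>
     (\<forall>z\<in>polydisc. \<forall>i. (\<lambda>w. f (\<chi> j. if j = i then w else z $ j)) holomorphic_on ball 0 1) \<and>
     bounded (f ` polydisc)}"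

text \<open>
  Boundary values are radial limits.  The torus is parametrised by the angles
  \<open>\<theta> \<in> real^'i\<close>; by periodicity, almost everywhere on the torus amounts to almost everywhere
  in \<open>real^'i\<close>.
\<close>

definition inner_function :: "(complex^'i::finite \<Rightarrow> complex) \<Rightarrow> bool" where
  "inner_function f \<longleftrightarrow> f \<in> H_infinity \<and>
     (AE \<theta> in (lborel :: (real^'i) measure).
        \<exists>l. ((\<lambda>r. f (\<chi> i. of_real r * cis (\<theta> $ i))) \<longlongrightarrow> l) (at_left (1::real)) \<and> norm l = 1)"

text \<open>
  The quotient \<open>f / g\<close> is a non-constant inner function.  It is expressed by multiplication, since
  \<open>g\<close> may have zeros, where the quotient means its analytic continuation.
\<close>

definition nonconstant_inner_quotient ::
    "(complex^'i::finite \<Rightarrow> complex) \<Rightarrow> (complex^'i \<Rightarrow> complex) \<Rightarrow> bool" where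
  "nonconstant_inner_quotient f g \<longleftrightarrow>
     (\<exists>q. inner_function q \<and> \<not> q constant_on polydisc \<and> (\<forall>z\<in>polydisc. f z = q z * g z))"

definition increasing_inner :: "(nat \<Rightarrow> complex^'i::finite \<Rightarrow> complex) \<Rightarrow> bool" where
  "increasing_inner \<phi> \<longleftrightarrow>
     (\<forall>j. inner_function (\<phi> j)) \<and> (\<forall>j. nonconstant_inner_quotient (\<phi> (Suc j)) (\<phi> j))"

definition decreasing_inner :: "(nat \<Rightarrow> complex^'i::finite \<Rightarrow> complex) \<Rightarrow> bool" where
  "decreasing_inner \<psi> \<longleftrightarrow>
     (\<forall>j. inner_function (\<psi> j)) \<and> (\<forall>j. nonconstant_inner_quotient (\<psi> j) (\<psi> (Suc j)))"

definition multiples :: "(complex^'i::finite \<Rightarrow> complex) \<Rightarrow> 'i H2 set" where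
  "multiples \<phi> = {h. \<exists>f. \<forall>z\<in>polydisc. Rep_H2 h z = \<phi> z * Rep_H2 f z}"


section \<open>Splitting off the first variable\<close>

text \<open>
  If \<open>'m\<close> has \<open>n - 1\<close> elements, then \<open>'m option\<close> has \<open>n\<close> elements: the index \<open>None\<close> stands
  for the variable \<open>z\<^sub>1\<close> and the indices \<open>Some i\<close> for \<open>z\<^sub>2, \<dots>, z\<^sub>n\<close>.  The disc is the polydisc
  with index type \<open>1\<close>.
\<close>

definition first_var :: "complex^('m::finite option) \<Rightarrow> complex^1" where
  "first_var z = (\<chi> _. z $ None)"

definition other_vars :: "complex^('m::finite option) \<Rightarrow> complex^'m" where
  "other_vars z = (\<chi> i. z $ Some i)"

text \<open>The Hilbert space tensor product of closed subspaces of the two Hardy spaces.\<close>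

definition hardy_tensor :: "1 H2 set \<Rightarrow> 'm::finite H2 set \<Rightarrow> 'm option H2 set" where
  "hardy_tensor A B = closed_span
     {h. \<exists>f\<in>A. \<exists>g\<in>B. \<forall>z\<in>polydisc. Rep_H2 h z = Rep_H2 f (first_var z) * Rep_H2 g (other_vars z)}"

text \<open>The series converges in the strong operator topology, that is, at each vector.\<close>

definition Theta ::
    "(nat \<Rightarrow> complex^1 \<Rightarrow> complex) \<Rightarrow> (nat \<Rightarrow> 'a \<Rightarrow> 'a) \<Rightarrow> complex^1 \<Rightarrow> 'a \<Rightarrow> 'a::complex_hilbert" where
  "Theta \<phi> P w x = (\<Sum>j. \<phi> j w *\<^sub>C P j x)"

text \<open>
  The range of multiplication by \<open>\<Theta>\<close> on the Hardy space of the disc with values in \<open>'m H2\<close>, where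
  a function \<open>g\<close> in the latter is identified with \<open>g(z\<^sub>1)(z\<^sub>2, \<dots>, z\<^sub>n)\<close>.
\<close>

definition Theta_range ::
    "(nat \<Rightarrow> complex^1 \<Rightarrow> complex) \<Rightarrow> (nat \<Rightarrow> 'm::finite H2 \<Rightarrow> 'm H2) \<Rightarrow> 'm option H2 set" where
  "Theta_range \<phi> P =
     {F. \<exists>f\<in>hardy_space. \<forall>z\<in>polydisc.
        Rep_H2 F z = Rep_H2 (Theta \<phi> P (first_var z) (f (first_var z))) (other_vars z)}"

end

theory Submission
  imports Defs "HOL-Complex_Analysis.Cauchy_Integral_Formula"
begin

text \<open>
  The Hilbert space arguments use inner functions only through one property: \<open>\<psi>\<close> is inner if and
  only if multiplication by \<open>\<psi>\<close> is an isometry of the Hardy space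
  (\<open>inner_function_iff_isometric_multiplier\<close>).  If \<open>\<psi>\<close> is inner, then the Cauchy formula puts the
  bounded analytic functions \<open>\<psi> z\<^sup>k\<close> into the Hardy space, and Parseval's identity on tori of radius
  tending to one shows that they are orthonormal.  Conversely, an isometric multiplier is bounded by
  one; by Fatou's theorem on the discs through the origin and Fubini it has radial limits almost
  everywhere, and since their mean square is \<open>\<parallel>\<psi> \<cdot> 1\<parallel>\<^sup>2 = 1\<close>, they are unimodular.  The theorem of
  Fatou is proved for power series with square summable coefficients: such a series is the Poisson
  integral of an integrable function, and a Poisson integral converges radially at Lebesgue points.

  Multiplication by \<open>\<Theta>\<close> maps \<open>h \<otimes> x\<close> to \<open>\<phi>\<^sub>j h \<otimes> x\<close> for \<open>x \<in> Ran P\<^sub>j\<close>.  It preserves the inner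
  products of these vectors, so that \<open>\<S>\<close> is the closed span of the spaces \<open>\<phi>\<^sub>j H\<^sup>2 \<otimes> Ran P\<^sub>j\<close>.
  As \<open>\<phi>\<^sub>j\<close> is a multiple of \<open>\<phi>\<^sub>k\<close> for \<open>k \<le> j\<close>, this is also the closed span of the spaces
  \<open>\<phi>\<^sub>j H\<^sup>2 \<otimes> \<S>\<^sub>j\<close> (\<open>Theta_range_eq_tensor_span\<close>).

  The point of the proof is that the closed span of spaces \<open>\<phi>\<^sub>j H\<^sup>2 \<otimes> M\<^sub>j\<close> with \<open>M\<^sub>0 \<subseteq> M\<^sub>1 \<subseteq> \<dots>\<close>
  determines every \<open>M\<^sub>k\<close> (\<open>in_tensor_span_iff\<close>).  Since \<open>\<phi>\<^sub>k\<^sub>+\<^sub>1 / \<phi>\<^sub>k\<close> is not constant, there is a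
  vector \<open>u\<close> that is orthogonal to \<open>\<phi>\<^sub>j H\<^sup>2\<close> for all \<open>j > k\<close> but not to \<open>\<phi>\<^sub>k\<close>; tested against \<open>u \<otimes> y\<close>
  with \<open>y \<bottom> M\<^sub>k\<close>, the whole span vanishes, while \<open>\<phi>\<^sub>k \<otimes> f\<close> gives a non-zero multiple of
  \<open>\<langle>f, y\<rangle>\<close>.

  For (a), the shift in the first variable acts on the factors \<open>\<phi>\<^sub>j H\<^sup>2\<close> and the other shifts act
  on the spaces \<open>\<S>\<^sub>j\<close>, which the span determines.  For (b), the representation of \<open>\<S>\<close> by
  \<open>\<psi>\<^sub>j\<close> says exactly that \<open>\<S>\<^sub>j = \<psi>\<^sub>j H\<^sup>2\<close> for all \<open>j\<close>.  Now the subspaces \<open>\<psi> H\<^sup>2\<close> with \<open>\<psi>\<close> inner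
  are the non-zero doubly commuting invariant subspaces: multiplication by \<open>\<psi>\<close> carries the
  double commutation of the full shifts to \<open>\<psi> H\<^sup>2\<close>
  (\<open>multiples_invariant_doubly_commuting\<close>), and conversely a doubly commuting subspace is generated by
  its wandering subspace, which is spanned by a single inner function
  (\<open>doubly_commuting_imp_multiples\<close>).  Finally the proper inclusions \<open>\<S>\<^sub>j \<subset> \<S>\<^sub>j\<^sub>+\<^sub>1\<close> make the quotients
  \<open>\<psi>\<^sub>j / \<psi>\<^sub>j\<^sub>+\<^sub>1\<close> non-constant inner functions.
\<close>


section \<open>Geometry of complex Hilbert spaces\<close>

lemma cinner_add_right: "cinner x (y + z) = cinner x y + cinner x z"
  by (metis cinner_add_left cinner_commute complex_cnj_add)

lemma cinner_scaleC_right: "cinner x (c *\<^sub>C y) = cnj c * cinner x y"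
  by (metis cinner_scaleC_left cinner_commute complex_cnj_mult)

lemma cinner_zero_left [simp]: "cinner 0 y = 0"
  using cinner_add_left[of 0 0 y] by simp

lemma cinner_zero_right [simp]: "cinner x 0 = 0"
  using cinner_add_right[of x 0 0] by simp

lemma cinner_minus_left: "cinner (- x) y = - cinner x y"
  using cinner_add_left[of "-x" x y] by (simp add: add_eq_0_iff2)

lemma cinner_diff_left: "cinner (x - y) z = cinner x z - cinner y z"
  using cinner_add_left[of x "-y" z] by (simp add: cinner_minus_left)

lemma cinner_diff_right: "cinner x (y - z) = cinner x y - cinner x z"
  by (metis cinner_diff_left cinner_commute complex_cnj_diff)

lemma cinner_sum_left: "cinner (\<Sum>i\<in>A. f i) y = (\<Sum>i\<in>A. cinner (f i) y)"
  by (induction A rule: infinite_finite_induct) (auto simp: cinner_add_left)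

lemma cinner_sum_right: "cinner x (\<Sum>i\<in>A. f i) = (\<Sum>i\<in>A. cinner x (f i))"
  by (induction A rule: infinite_finite_induct) (auto simp: cinner_add_right)

lemma cinner_self: "cinner x x = of_real ((norm x)\<^sup>2)"
proof (rule complex_eqI)
  show "Im (cinner x x) = Im (of_real ((norm x)\<^sup>2))"
    using arg_cong[OF cinner_commute[of x x], of Im] by simp
qed (simp add: Re_cinner power2_norm_eq_inner)

lemma cinner_self_eq_0 [simp]: "cinner x x = 0 \<longleftrightarrow> x = 0"
  by (simp add: cinner_self)

lemma norm_scaleC: "norm (c *\<^sub>C x) = norm c * norm x"
proof -
  have "complex_of_real ((norm (c *\<^sub>C x))\<^sup>2) = c * cnj c * cinner x x"
    by (simp add: cinner_self[symmetric] cinner_scaleC_left cinner_scaleC_right mult.assoc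
        del: of_real_power)
  also have "\<dots> = of_real ((norm c * norm x)\<^sup>2)"
    by (simp add: cinner_self complex_norm_square[symmetric] power_mult_distrib)
  finally show ?thesis
    by (simp only: of_real_eq_iff) (simp add: power2_eq_iff_nonneg)
qed

lemma norm_cinner_le: "norm (cinner x y) \<le> norm x * norm y"
proof (cases "cinner x y = 0")
  case False
  define c where "c = cnj (sgn (cinner x y))"
  have c: "norm c = 1" using False by (simp add: c_def norm_sgn)
  have "c * cinner x y = of_real (norm (cinner x y))"
    using False
    by (simp add: c_def sgn_eq complex_norm_square[symmetric] power2_eq_square field_simps)
  then have "norm (cinner x y) = inner (c *\<^sub>C x) y"
    by (simp add: Re_cinner[symmetric] cinner_scaleC_left)
  also have "\<dots> \<le> norm (c *\<^sub>C x) * norm y" by (rule norm_cauchy_schwarz)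
  finally show ?thesis by (simp add: norm_scaleC c)
qed simp

lemma scaleR_eq_scaleC: "r *\<^sub>R x = of_real r *\<^sub>C x"
  by (simp add: scaleC_of_real)

lemma bounded_bilinear_cinner: "bounded_bilinear cinner"
  by (rule bounded_bilinear.intro)
    (auto simp: cinner_add_left cinner_add_right scaleR_eq_scaleC cinner_scaleC_left
      cinner_scaleC_right scaleR_conv_of_real scaleC_complex_def
      intro!: exI[of _ 1] norm_cinner_le)

lemma bounded_bilinear_scaleC: "bounded_bilinear scaleC"
  by (rule bounded_bilinear.intro)
    (auto simp: scaleC_add_left scaleC_add_right scaleR_eq_scaleC scaleC_scaleC norm_scaleC
      scaleC_complex_def mult.commute intro!: exI[of _ 1])

lemmas tendsto_cinner = bounded_bilinear.tendsto[OF bounded_bilinear_cinner]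
lemmas tendsto_scaleC = bounded_bilinear.tendsto[OF bounded_bilinear_scaleC]
lemmas bounded_linear_cinner_left = bounded_bilinear.bounded_linear_left[OF bounded_bilinear_cinner]
lemmas bounded_linear_scaleC = bounded_bilinear.bounded_linear_right[OF bounded_bilinear_scaleC]

lemma norm_add_orthogonal:
  assumes "cinner x y = 0"
  shows "(norm (x + y))\<^sup>2 = (norm x)\<^sup>2 + (norm y)\<^sup>2"
proof -
  have "inner x y = 0" using assms by (simp add: Re_cinner[symmetric])
  then show ?thesis by (simp add: power2_norm_eq_inner inner_add_left inner_add_right inner_commute)
qed

lemma closed_subspaceD:
  assumes "closed_subspace S"
  shows closed_subspace_0: "0 \<in> S"
    and closed_subspace_add: "x \<in> S \<Longrightarrow> y \<in> S \<Longrightarrow> x + y \<in> S"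
    and closed_subspace_diff: "x \<in> S \<Longrightarrow> y \<in> S \<Longrightarrow> x - y \<in> S"
    and closed_subspace_scaleC: "x \<in> S \<Longrightarrow> c *\<^sub>C x \<in> S"
    and closed_subspace_sum: "(\<And>i. i \<in> A \<Longrightarrow> f i \<in> S) \<Longrightarrow> (\<Sum>i\<in>A. f i) \<in> S"
    and closed_subspace_limit: "(\<And>n. X n \<in> S) \<Longrightarrow> X \<longlonglongrightarrow> x \<Longrightarrow> x \<in> S"
  using assms closed_sequentially[of S X x] unfolding closed_subspace_def
  by (auto simp: complex_vector.subspace_0 complex_vector.subspace_add complex_vector.subspace_diff
      complex_vector.subspace_scale complex_vector.subspace_sum)

lemma closed_subspaceI:
  assumes "0 \<in> S" "\<And>x y. x \<in> S \<Longrightarrow> y \<in> S \<Longrightarrow> x + y \<in> S" "\<And>c x. x \<in> S \<Longrightarrow> c *\<^sub>C x \<in> S"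
    "\<And>X x. (\<And>n. X n \<in> S) \<Longrightarrow> X \<longlonglongrightarrow> x \<Longrightarrow> x \<in> S"
  shows "closed_subspace S"
  using assms unfolding closed_subspace_def complex_vector.subspace_def closed_sequential_limits
  by blast

lemma closed_subspace_closed_span: "closed_subspace (closed_span X)"
proof (rule closed_subspaceI)
  let ?V = "complex_vector.span X"
  show "0 \<in> closed_span X"
    unfolding closed_span_def using closure_subset complex_vector.span_zero by blast
  show "x + y \<in> closed_span X" if xy: "x \<in> closed_span X" "y \<in> closed_span X" for x y
  proof -
    obtain u where "\<And>n. u n \<in> ?V" "u \<longlonglongrightarrow> x"
      using xy(1) unfolding closed_span_def closure_sequential by blast
    moreover obtain v where "\<And>n. v n \<in> ?V" "v \<longlonglongrightarrow> y"
      using xy(2) unfolding closed_span_def closure_sequential by blast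
    ultimately show ?thesis
      unfolding closed_span_def closure_sequential
      by (intro exI[of _ "\<lambda>n. u n + v n"]) (auto intro: tendsto_add complex_vector.span_add)
  qed
  show "c *\<^sub>C x \<in> closed_span X" if x: "x \<in> closed_span X" for c x
  proof -
    obtain u where "\<And>n. u n \<in> ?V" "u \<longlonglongrightarrow> x"
      using x unfolding closed_span_def closure_sequential by blast
    then show ?thesis
      unfolding closed_span_def closure_sequential
      by (intro exI[of _ "\<lambda>n. c *\<^sub>C u n"])
        (auto intro: bounded_linear.tendsto[OF bounded_linear_scaleC] complex_vector.span_scale)
  qed
  show "x \<in> closed_span X" if "\<And>n. u n \<in> closed_span X" "u \<longlonglongrightarrow> x" for u x
    using that closed_closure[of ?V] unfolding closed_span_def closed_sequential_limits by blast
qed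

lemma closed_span_superset: "X \<subseteq> closed_span X"
  unfolding closed_span_def using closure_subset complex_vector.span_superset by blast

lemma closed_span_least:
  assumes "X \<subseteq> S" "closed_subspace S"
  shows "closed_span X \<subseteq> S"
  using assms unfolding closed_span_def closed_subspace_def
  by (intro closure_minimal complex_vector.span_minimal) auto

lemma closed_span_mono: "X \<subseteq> Y \<Longrightarrow> closed_span X \<subseteq> closed_span Y"
  by (meson closed_span_least closed_span_superset closed_subspace_closed_span order_trans)

text \<open>The projection theorem: the minimising sequence for the distance from \<open>x\<close> to \<open>S\<close> is
  Cauchy by the parallelogram law, and its limit is the foot of the perpendicular.\<close>

lemma closed_subspace_projection:
  fixes x :: "'a::complex_hilbert"
  assumes S: "closed_subspace S"
  obtains p where "p \<in> S" "\<And>y. y \<in> S \<Longrightarrow> cinner (x - p) y = 0"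
proof -
  define d where "d = infdist x S"
  have ne: "S \<noteq> {}" using closed_subspace_0[OF S] by auto
  have d_le: "d \<le> norm (x - y)" if "y \<in> S" for y
    using infdist_le[OF that, of x] by (simp add: d_def dist_norm)
  have d0: "0 \<le> d" by (simp add: d_def infdist_nonneg)
  have "\<exists>y\<in>S. norm (x - y) < d + 1 / real (Suc n)" for n
  proof -
    have "infdist x S < d + 1 / real (Suc n)" by (simp add: d_def)
    then show ?thesis
      using ne cInf_lessD[of "dist x ` S" "d + 1 / real (Suc n)"]
      by (auto simp: infdist_def dist_norm)
  qed
  then obtain u where uS: "\<And>n. u n \<in> S" and u: "\<And>n. norm (x - u n) < d + 1 / real (Suc n)"
    by metis
  have lim: "(\<lambda>n. norm (x - u n)) \<longlonglongrightarrow> d"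
  proof (rule tendsto_sandwich[of "\<lambda>_. d"])
    show "(\<lambda>n. d + 1 / real (Suc n)) \<longlonglongrightarrow> d"
      using tendsto_add[OF tendsto_const LIMSEQ_inverse_real_of_nat, of d]
      by (simp add: inverse_eq_divide)
  qed (use u d_le uS in \<open>auto intro!: always_eventually less_imp_le\<close>)
  have par: "(norm (u m - u n))\<^sup>2 \<le> 2 * ((norm (x - u m))\<^sup>2 - d\<^sup>2) + 2 * ((norm (x - u n))\<^sup>2 - d\<^sup>2)"
    for m n
  proof -
    let ?a = "x - u m" and ?b = "x - u n"
    have mid: "(1/2) *\<^sub>R (u m + u n) \<in> S"
      unfolding scaleR_eq_scaleC by (intro closed_subspace_scaleC closed_subspace_add S uS)
    have "?a + ?b = 2 *\<^sub>R (x - (1/2) *\<^sub>R (u m + u n))" by (simp add: algebra_simps scaleR_2)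
    then have "norm (?a + ?b) \<ge> 2 * d" using d_le[OF mid] by simp
    then have "(2 * d)\<^sup>2 \<le> (norm (?a + ?b))\<^sup>2" using d0 by (intro power_mono) auto
    moreover have "(norm (?a + ?b))\<^sup>2 + (norm (?b - ?a))\<^sup>2 = 2 * (norm ?a)\<^sup>2 + 2 * (norm ?b)\<^sup>2"
      by (simp only: power2_norm_eq_inner) (simp add: inner_add inner_diff inner_commute)
    ultimately show ?thesis by (simp add: power_mult_distrib)
  qed
  have "Cauchy u"
  proof (rule metric_CauchyI)
    fix e :: real assume e: "e > 0"
    have "(\<lambda>n. (norm (x - u n))\<^sup>2 - d\<^sup>2) \<longlonglongrightarrow> d\<^sup>2 - d\<^sup>2"
      by (intro tendsto_intros lim)
    then have "\<forall>\<^sub>F n in sequentially. (norm (x - u n))\<^sup>2 - d\<^sup>2 < e\<^sup>2 / 4"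
      by (rule order_tendstoD) (use e in simp)
    then obtain N where N: "\<And>n. n \<ge> N \<Longrightarrow> (norm (x - u n))\<^sup>2 - d\<^sup>2 < e\<^sup>2 / 4"
      by (auto simp: eventually_sequentially)
    have "dist (u m) (u n) < e" if "m \<ge> N" "n \<ge> N" for m n
    proof -
      have "(norm (u m - u n))\<^sup>2 < e\<^sup>2" using par[of m n] N[OF that(1)] N[OF that(2)] by (simp add: field_simps)
      then show ?thesis using e by (simp add: dist_norm power_less_imp_less_base)
    qed
    then show "\<exists>N. \<forall>m\<ge>N. \<forall>n\<ge>N. dist (u m) (u n) < e" by blast
  qed
  then obtain p where p: "u \<longlonglongrightarrow> p" by (auto simp: Cauchy_convergent_iff convergent_def)
  have pS: "p \<in> S" by (rule closed_subspace_limit[OF S uS p])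
  have "(\<lambda>n. norm (x - u n)) \<longlonglongrightarrow> norm (x - p)" by (intro tendsto_intros p)
  then have np: "norm (x - p) = d" using lim LIMSEQ_unique by blast
  have "cinner (x - p) y = 0" if y: "y \<in> S" for y
  proof (rule ccontr)
    assume nz: "cinner (x - p) y \<noteq> 0"
    then have y0: "y \<noteq> 0" by auto
    \<comment> \<open>Moving from \<open>p\<close> along the component of \<open>x - p\<close> in direction \<open>y\<close> decreases the distance.\<close>
    define c where "c = cinner (x - p) y / of_real ((norm y)\<^sup>2)"
    let ?r = "x - (p + c *\<^sub>C y)"
    have r: "cinner ?r (c *\<^sub>C y) = 0"
      using y0 unfolding c_def
      by (simp add: cinner_diff_left cinner_add_left cinner_scaleC_left cinner_scaleC_right cinner_self
          del: of_real_power)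
    have "d\<^sup>2 = (norm (?r + c *\<^sub>C y))\<^sup>2" using np by simp
    also have "\<dots> = (norm ?r)\<^sup>2 + (norm (c *\<^sub>C y))\<^sup>2" by (rule norm_add_orthogonal[OF r])
    finally have "d\<^sup>2 > (norm ?r)\<^sup>2" using nz y0 by (simp add: norm_scaleC c_def)
    moreover have "d \<le> norm ?r" by (intro d_le closed_subspace_add closed_subspace_scaleC S pS y)
    ultimately show False using d0 power_mono[of d "norm ?r" 2] by linarith
  qed
  then show ?thesis using that pS by blast
qed

text \<open>A closed subspace is its own double orthogonal complement.\<close>

lemma in_closed_subspace_if_orthogonal:
  assumes S: "closed_subspace S"
    and orth: "\<And>y. (\<And>z. z \<in> S \<Longrightarrow> cinner z y = 0) \<Longrightarrow> cinner x y = 0"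
  shows "x \<in> S"
proof -
  obtain p where p: "p \<in> S" "\<And>y. y \<in> S \<Longrightarrow> cinner (x - p) y = 0"
    using closed_subspace_projection[OF S] by blast
  have z: "cinner z (x - p) = 0" if "z \<in> S" for z
    using p(2)[OF that] cinner_commute[of z "x - p"] by simp
  have "cinner (x - p) (x - p) = 0"
    using orth[OF z] z[OF p(1)] by (simp add: cinner_diff_left)
  then show ?thesis using p(1) by simp
qed

lemma closed_subspace_orthogonal: "closed_subspace {x. cinner x y = 0}"
proof (rule closed_subspaceI)
  fix X x assume "\<And>n. X n \<in> {x. cinner x y = 0}" "X \<longlonglongrightarrow> x"
  then have "(\<lambda>n. 0) \<longlonglongrightarrow> cinner x y"
    using bounded_linear.tendsto[OF bounded_linear_cinner_left, of X x sequentially y] by simp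
  then show "x \<in> {x. cinner x y = 0}" by (simp add: tendsto_const_iff)
qed (auto simp: cinner_add_left cinner_scaleC_left)

lemma orthogonal_closed_span:
  assumes "\<And>x. x \<in> X \<Longrightarrow> cinner x y = 0" "x \<in> closed_span X"
  shows "cinner x y = 0"
  using closed_span_least[OF _ closed_subspace_orthogonal, of X y] assms by blast

lemma in_closed_span_if_orthogonal:
  assumes "\<And>y. (\<And>z. z \<in> X \<Longrightarrow> cinner z y = 0) \<Longrightarrow> cinner x y = 0"
  shows "x \<in> closed_span X"
  by (rule in_closed_subspace_if_orthogonal[OF closed_subspace_closed_span])
    (use assms closed_span_superset in blast)

definition linear_isometry :: "('a::complex_hilbert \<Rightarrow> 'b::complex_hilbert) \<Rightarrow> bool" where
  "linear_isometry T \<longleftrightarrow>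
     (\<forall>x y. T (x + y) = T x + T y) \<and> (\<forall>c x. T (c *\<^sub>C x) = c *\<^sub>C T x) \<and> (\<forall>x. norm (T x) = norm x)"

lemma linear_isometryD:
  assumes "linear_isometry T"
  shows "T (x + y) = T x + T y" "T (c *\<^sub>C x) = c *\<^sub>C T x" "norm (T x) = norm x"
    "T 0 = 0" "T (x - y) = T x - T y" "T (\<Sum>i\<in>A. f i) = (\<Sum>i\<in>A. T (f i))"
proof -
  show *: "T (x + y) = T x + T y" "T (c *\<^sub>C x) = c *\<^sub>C T x" "norm (T x) = norm x" for x y c
    using assms by (auto simp: linear_isometry_def)
  show T0: "T 0 = 0" using *(3)[of 0] by simp
  show "T (x - y) = T x - T y" using *(1)[of "x - y" y] by simp
  show "T (\<Sum>i\<in>A. f i) = (\<Sum>i\<in>A. T (f i))"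
    by (induction A rule: infinite_finite_induct) (auto simp: * T0)
qed

lemma linear_isometry_bounded_linear: "linear_isometry T \<Longrightarrow> bounded_linear T"
  by (rule bounded_linear_intro[of _ 1]) (auto simp: linear_isometryD scaleR_eq_scaleC)

lemmas linear_isometry_tendsto = bounded_linear.tendsto[OF linear_isometry_bounded_linear]

lemma linear_isometry_inner:
  assumes "linear_isometry T"
  shows "inner (T x) (T y) = inner x y"
  using linear_isometryD(3)[OF assms, of "x + y"]
  by (simp add: dot_norm linear_isometryD(1,3)[OF assms])

lemma linear_isometry_cinner:
  assumes T: "linear_isometry T"
  shows "cinner (T x) (T y) = cinner x y"
proof (rule complex_eqI)
  show "Re (cinner (T x) (T y)) = Re (cinner x y)"
    by (simp add: Re_cinner linear_isometry_inner[OF T])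
  have "Re (cinner (T (\<i> *\<^sub>C x)) (T y)) = Re (cinner (\<i> *\<^sub>C x) y)"
    by (simp only: Re_cinner linear_isometry_inner[OF T])
  then show "Im (cinner (T x) (T y)) = Im (cinner x y)"
    by (simp add: linear_isometryD[OF T] cinner_scaleC_left)
qed

lemma linear_isometry_vimage:
  assumes T: "linear_isometry T" and S: "closed_subspace S"
  shows "closed_subspace {x. T x \<in> S}"
proof (rule closed_subspaceI)
  fix X x assume "\<And>n. X n \<in> {x. T x \<in> S}" "X \<longlonglongrightarrow> x"
  then show "x \<in> {x. T x \<in> S}"
    using closed_subspace_limit[OF S, of "\<lambda>n. T (X n)" "T x"] linear_isometry_tendsto[OF T] by blast
qed (auto simp: linear_isometryD[OF T] closed_subspaceD[OF S])

lemma linear_isometry_closed_span: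
  assumes T: "linear_isometry T" and S: "closed_subspace S" and TX: "T ` X \<subseteq> S"
  shows "T ` closed_span X \<subseteq> S"
  using closed_span_least[OF _ linear_isometry_vimage[OF T S], of X] TX by auto

lemma linear_isometry_image:
  assumes T: "linear_isometry T" and S: "closed_subspace S"
  shows "closed_subspace (T ` S)"
proof (rule closed_subspaceI)
  fix Y y assume "\<And>n. Y n \<in> T ` S" and lim: "Y \<longlonglongrightarrow> y"
  then have "\<forall>n. \<exists>x. x \<in> S \<and> Y n = T x" by blast
  then obtain X where X: "\<And>n. X n \<in> S" "\<And>n. Y n = T (X n)" by metis
  have "dist (X m) (X n) = dist (Y m) (Y n)" for m n
    by (simp add: X dist_norm linear_isometryD(3)[OF T] flip: linear_isometryD(5)[OF T])
  then have "Cauchy X" using LIMSEQ_imp_Cauchy[OF lim] by (simp add: Cauchy_def)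
  then obtain x where x: "X \<longlonglongrightarrow> x" by (auto simp: Cauchy_convergent_iff convergent_def)
  have "Y \<longlonglongrightarrow> T x" using linear_isometry_tendsto[OF T x] by (simp flip: X(2))
  then have "y = T x" using lim LIMSEQ_unique by blast
  then show "y \<in> T ` S" using closed_subspace_limit[OF S X(1) x] by blast
next
  show "0 \<in> T ` S"
    using closed_subspace_0[OF S] linear_isometryD(4)[OF T] by force
  show "x + y \<in> T ` S" if "x \<in> T ` S" "y \<in> T ` S" for x y
    using that closed_subspace_add[OF S] by (auto simp flip: linear_isometryD(1)[OF T])
  show "c *\<^sub>C x \<in> T ` S" if "x \<in> T ` S" for c x
    using that closed_subspace_scaleC[OF S] by (auto simp flip: linear_isometryD(2)[OF T])
qed


section \<open>Monomials and the reproducing kernel\<close>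

definition H2_of_coeff :: "(('i::finite \<Rightarrow> nat) \<Rightarrow> complex) \<Rightarrow> 'i H2" where
  "H2_of_coeff a = (SOME f. H2_coeff f = a)"

lemma H2_coeff_of_coeff:
  "(\<lambda>k. (norm (a k))\<^sup>2) summable_on UNIV \<Longrightarrow> H2_coeff (H2_of_coeff a) = a"
  unfolding H2_of_coeff_def by (rule someI_ex) (rule H2_ex_coeff)

definition monomial :: "('i::finite \<Rightarrow> nat) \<Rightarrow> 'i H2" where
  "monomial k = H2_of_coeff (\<lambda>l. if l = k then 1 else 0)"

lemma H2_coeff_monomial: "H2_coeff (monomial k) = (\<lambda>l. if l = k then 1 else 0)"
  unfolding monomial_def
proof (rule H2_coeff_of_coeff)
  have "((\<lambda>l. (norm (if l = k then 1 else 0 :: complex))\<^sup>2) has_sum 1) UNIV"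
    by (rule has_sum_finite_neutralI[of "{k}"]) auto
  then show "(\<lambda>l. (norm (if l = k then 1 else 0 :: complex))\<^sup>2) summable_on UNIV"
    by (rule has_sum_imp_summable)
qed

lemma Rep_monomial: "z \<in> polydisc \<Longrightarrow> Rep_H2 (monomial k) z = zpow z k"
proof -
  assume z: "z \<in> polydisc"
  have "((\<lambda>l. zpow z l * (if l = k then 1 else 0)) has_sum zpow z k) UNIV"
    by (rule has_sum_finite_neutralI[of "{k}"]) auto
  then show ?thesis
    using H2_coeff_has_sum[OF z, of "monomial k"] has_sum_unique by (auto simp: H2_coeff_monomial)
qed

lemma cinner_monomial: "cinner f (monomial k) = H2_coeff f k"
proof -
  have "((\<lambda>l. H2_coeff f l * cnj (H2_coeff (monomial k) l)) has_sum H2_coeff f k) UNIV"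
    by (rule has_sum_finite_neutralI[of "{k}"]) (auto simp: H2_coeff_monomial)
  then show ?thesis unfolding cinner_H2_def by (rule infsumI)
qed

lemma cinner_monomial_monomial: "cinner (monomial k) (monomial l) = (if k = l then 1 else 0)"
  by (auto simp: cinner_monomial H2_coeff_monomial)

lemma norm_monomial: "norm (monomial k) = 1"
  by (simp add: norm_eq_sqrt_inner Re_cinner[symmetric] cinner_monomial_monomial)

lemma norm_power2_H2: "((\<lambda>k. (norm (H2_coeff f k))\<^sup>2) has_sum (norm f)\<^sup>2) UNIV"
  using H2_coeff_summable[of f] by (simp add: norm_H2_eq infsum_nonneg has_sum_infsum)

lemma cinner_has_sum: "((\<lambda>k. H2_coeff f k * cnj (H2_coeff g k)) has_sum cinner f g) UNIV"
  unfolding cinner_H2_def by (rule has_sum_infsum[OF inner_summable])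

definition degree_box :: "nat \<Rightarrow> ('i::finite \<Rightarrow> nat) set" where
  "degree_box n = {k. \<forall>i. k i \<le> n}"

lemma finite_degree_box [simp]: "finite (degree_box n)"
proof -
  have "(degree_box n :: ('a \<Rightarrow> nat) set) = PiE UNIV (\<lambda>_. {..n})" by (auto simp: degree_box_def)
  then show ?thesis by (simp add: finite_PiE)
qed

lemma degree_box_mono: "m \<le> n \<Longrightarrow> degree_box m \<subseteq> degree_box n"
  by (auto simp: degree_box_def intro: order_trans)

lemma filterlim_degree_box:
  "filterlim (degree_box :: nat \<Rightarrow> ('i::finite \<Rightarrow> nat) set) (finite_subsets_at_top UNIV) sequentially"
  unfolding filterlim_finite_subsets_at_top
proof safe
  fix X :: "('i \<Rightarrow> nat) set" assume X: "finite X"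
  define N where "N = (\<Sum>k\<in>X. \<Sum>i\<in>UNIV. k i)"
  have "X \<subseteq> degree_box N"
  proof
    fix k assume k: "k \<in> X"
    have "k i \<le> N" for i
    proof -
      have "k i \<le> (\<Sum>i\<in>UNIV. k i)" by (rule member_le_sum) auto
      also have "\<dots> \<le> N" unfolding N_def by (rule member_le_sum[OF k]) (use X in auto)
      finally show ?thesis .
    qed
    then show "k \<in> degree_box N" by (simp add: degree_box_def)
  qed
  then show "\<forall>\<^sub>F n in sequentially. finite (degree_box n) \<and> X \<subseteq> degree_box n \<and> degree_box n \<subseteq> UNIV"
    using degree_box_mono by (fastforce simp: eventually_sequentially intro!: exI[of _ N])
qed

lemma has_sum_degree_box: "(f has_sum s) UNIV \<Longrightarrow> (\<lambda>n. sum f (degree_box n)) \<longlonglongrightarrow> s"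
  unfolding has_sum_def by (rule filterlim_compose[OF _ filterlim_degree_box])

definition truncate :: "nat \<Rightarrow> 'i::finite H2 \<Rightarrow> 'i H2" where
  "truncate n f = (\<Sum>k\<in>degree_box n. H2_coeff f k *\<^sub>C monomial k)"

lemma H2_coeff_sum: "H2_coeff (\<Sum>x\<in>A. f x) k = (\<Sum>x\<in>A. H2_coeff (f x) k)"
  by (simp add: cinner_monomial[symmetric] cinner_sum_left)

lemma H2_coeff_truncate: "H2_coeff (truncate n f) k = (if k \<in> degree_box n then H2_coeff f k else 0)"
proof -
  have "H2_coeff (truncate n f) k = (\<Sum>l\<in>degree_box n. if l = k then H2_coeff f k else 0)"
    unfolding truncate_def H2_coeff_sum by (rule sum.cong) (auto simp: H2_coeff_monomial)
  then show ?thesis by simp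
qed

lemma truncate_tendsto: "(\<lambda>n. truncate n f) \<longlonglongrightarrow> f"
proof -
  have *: "(norm (f - truncate n f))\<^sup>2 = (norm f)\<^sup>2 - (\<Sum>k\<in>degree_box n. (norm (H2_coeff f k))\<^sup>2)" for n
  proof -
    let ?b = "\<lambda>k. if k \<in> degree_box n then (norm (H2_coeff f k))\<^sup>2 else 0"
    have "(?b has_sum (\<Sum>k\<in>degree_box n. (norm (H2_coeff f k))\<^sup>2)) UNIV"
      by (rule has_sum_finite_neutralI[of "degree_box n"]) auto
    from has_sum_add[OF norm_power2_H2[of f] has_sum_uminusI[OF this]]
    have "((\<lambda>k. (norm (H2_coeff f k))\<^sup>2 + - ?b k) has_sum
        (norm f)\<^sup>2 - (\<Sum>k\<in>degree_box n. (norm (H2_coeff f k))\<^sup>2)) UNIV" by simp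
    moreover have "(norm (H2_coeff f k))\<^sup>2 + - ?b k = (norm (H2_coeff (f - truncate n f) k))\<^sup>2" for k
      by (simp add: H2_coeff_truncate)
    ultimately have "((\<lambda>k. (norm (H2_coeff (f - truncate n f) k))\<^sup>2) has_sum
        (norm f)\<^sup>2 - (\<Sum>k\<in>degree_box n. (norm (H2_coeff f k))\<^sup>2)) UNIV" by (simp only:)
    then show ?thesis using norm_power2_H2 has_sum_unique by blast
  qed
  have "(\<lambda>n. (norm (f - truncate n f))\<^sup>2) \<longlonglongrightarrow> (norm f)\<^sup>2 - (norm f)\<^sup>2"
    unfolding * by (intro tendsto_diff tendsto_const has_sum_degree_box norm_power2_H2)
  then have "(\<lambda>n. sqrt ((norm (f - truncate n f))\<^sup>2)) \<longlonglongrightarrow> sqrt 0"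
    by (intro tendsto_real_sqrt) simp
  then have "(\<lambda>n. norm (f - truncate n f)) \<longlonglongrightarrow> 0" by simp
  then have "(\<lambda>n. f - (f - truncate n f)) \<longlonglongrightarrow> f - 0"
    by (intro tendsto_diff tendsto_const) (rule tendsto_norm_zero_cancel)
  then show ?thesis by simp
qed

lemma closed_span_monomials: "closed_span (range monomial) = UNIV"
proof -
  have "f \<in> closed_span (range monomial)" for f :: "'a H2"
  proof (rule closed_subspace_limit[OF closed_subspace_closed_span _ truncate_tendsto])
    have "monomial k \<in> closed_span (range monomial)" for k :: "'a \<Rightarrow> nat"
      by (rule subsetD[OF closed_span_superset]) simp
    then show "truncate n f \<in> closed_span (range monomial)" for n
      unfolding truncate_def
      by (simp add: closed_subspace_sum closed_subspace_scaleC closed_subspace_closed_span)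
  qed
  then show ?thesis by blast
qed

text \<open>Evaluation at \<open>z\<close> is the inner product with the Szego kernel.\<close>

definition szego_kernel :: "complex^'i \<Rightarrow> 'i::finite H2" where
  "szego_kernel z = H2_of_coeff (\<lambda>k. cnj (zpow z k))"

lemma zpow_square_le: "z \<in> polydisc \<Longrightarrow> (norm (zpow z k))\<^sup>2 \<le> norm (zpow z k)"
  using zpow_le_1[of z k] by (simp add: power2_eq_square mult_left_le)

lemma H2_coeff_szego_kernel:
  assumes "z \<in> polydisc"
  shows "H2_coeff (szego_kernel z) = (\<lambda>k. cnj (zpow z k))"
  unfolding szego_kernel_def
proof (rule H2_coeff_of_coeff)
  show "(\<lambda>k. (norm (cnj (zpow z k)))\<^sup>2) summable_on UNIV"
    by (rule summable_on_comparison_test[OF zpow_summable[OF assms]]) (auto simp: zpow_square_le assms)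
qed

lemma Rep_H2_eq_cinner:
  assumes "z \<in> polydisc"
  shows "Rep_H2 f z = cinner f (szego_kernel z)"
  using cinner_has_sum[of f "szego_kernel z"] H2_coeff_has_sum[OF assms, of f] has_sum_unique
  by (simp add: H2_coeff_szego_kernel assms mult.commute)

lemma has_sum_zpow:
  fixes z :: "complex^'i::finite"
  assumes "z \<in> polydisc"
  shows "((\<lambda>k. zpow z k) has_sum (\<Prod>i\<in>UNIV. 1 / (1 - z $ i))) UNIV"
proof -
  have lt: "norm (z $ i) < 1" for i using assms by (simp add: polydisc_def)
  have geo: "(\<lambda>n. norm ((z $ i) ^ n)) summable_on UNIV" "(\<Sum>\<^sub>\<infinity>n. (z $ i) ^ n) = 1 / (1 - z $ i)" for i
  proof -
    show abs: "(\<lambda>n. norm ((z $ i) ^ n)) summable_on UNIV"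
      unfolding norm_power
      by (subst summable_on_UNIV_nonneg_real_iff) (use lt[of i] in \<open>auto intro: summable_geometric\<close>)
    have "(\<lambda>n. (z $ i) ^ n) sums (\<Sum>\<^sub>\<infinity>n. (z $ i) ^ n)"
      by (rule has_sum_imp_sums[OF has_sum_infsum[OF abs_summable_summable[OF abs]]])
    then show "(\<Sum>\<^sub>\<infinity>n. (z $ i) ^ n) = 1 / (1 - z $ i)"
      by (rule sums_unique2) (rule geometric_sums[OF lt[of i]])
  qed
  have "infsum (\<lambda>k. zpow z k) (PiE UNIV (\<lambda>_. UNIV)) = (\<Prod>i\<in>UNIV. \<Sum>\<^sub>\<infinity>n. (z $ i) ^ n)"
    unfolding zpow_def by (rule infsum_prod_PiE_abs) (use geo in auto)
  then have "infsum (zpow z) UNIV = (\<Prod>i\<in>UNIV. 1 / (1 - z $ i))"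
    by (simp only: geo(2) PiE_UNIV)
  then show ?thesis
    using has_sum_infsum[OF abs_summable_summable[OF zpow_summable[OF assms]]] by simp
qed

lemma norm_szego_kernel_le:
  fixes z :: "complex^'i::finite"
  assumes \<rho>: "\<rho> < 1" "\<And>i. norm (z $ i) \<le> \<rho>"
  shows "(norm (szego_kernel z))\<^sup>2 \<le> (1 / (1 - \<rho>)) ^ CARD('i)"
proof -
  define w where "w = (\<chi> i. complex_of_real (norm (z $ i)))"
  have lt: "norm (z $ i) < 1" for i by (rule le_less_trans[OF \<rho>(2) \<rho>(1)])
  have z: "z \<in> polydisc" and w: "w \<in> polydisc" by (simp_all add: polydisc_def w_def lt)
  have nz: "zpow w k = of_real (norm (zpow z k))" for k
    by (simp add: zpow_def w_def norm_power flip: prod_norm)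
  have "((\<lambda>k. of_real (norm (zpow z k))) has_sum (of_real (\<Prod>i\<in>UNIV. 1 / (1 - norm (z $ i))) :: complex)) UNIV"
    using has_sum_zpow[OF w] unfolding nz by (simp add: w_def)
  then have s: "((\<lambda>k. norm (zpow z k)) has_sum (\<Prod>i\<in>UNIV. 1 / (1 - norm (z $ i)))) UNIV"
    by (simp only: has_sum_of_real_iff)
  have "(norm (szego_kernel z))\<^sup>2 \<le> (\<Prod>i\<in>UNIV. 1 / (1 - norm (z $ i)))"
    using norm_power2_H2[of "szego_kernel z"] s
    by (rule has_sum_mono) (simp add: H2_coeff_szego_kernel z zpow_square_le)
  also have "\<dots> \<le> (\<Prod>i\<in>(UNIV::'i set). 1 / (1 - \<rho>))"
    by (rule prod_mono) (use \<rho> lt in \<open>auto intro!: frac_le simp: less_imp_le\<close>)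
  finally show ?thesis by simp
qed

lemma tendsto_Rep_H2:
  assumes "X \<longlonglongrightarrow> f"
  shows "(\<lambda>n. Rep_H2 (X n) z) \<longlonglongrightarrow> Rep_H2 f z"
proof (cases "z \<in> polydisc")
  case True
  then show ?thesis
    using bounded_linear.tendsto[OF bounded_linear_cinner_left assms]
    by (simp add: Rep_H2_eq_cinner)
qed (simp add: Rep_H2_outside)

lemma Rep_sum_H2 [simp]: "Rep_H2 (\<Sum>x\<in>A. f x) z = (\<Sum>x\<in>A. Rep_H2 (f x) z)"
  by (induction A rule: infinite_finite_induct) auto

lemma Rep_truncate:
  "z \<in> polydisc \<Longrightarrow> Rep_H2 (truncate n f) z = (\<Sum>k\<in>degree_box n. H2_coeff f k * zpow z k)"
  by (simp add: truncate_def Rep_monomial)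


section \<open>Analyticity of Hardy space functions\<close>

lemma polydisc_radius:
  fixes z :: "complex^'i::finite"
  assumes "z \<in> polydisc"
  obtains \<rho> where "0 < \<rho>" "\<rho> < 1" "\<And>i. norm (z $ i) < \<rho>"
proof -
  define m where "m = Max (range (\<lambda>i. norm (z $ i)))"
  have le: "norm (z $ i) \<le> m" for i unfolding m_def by (rule Max_ge) auto
  have "m \<in> range (\<lambda>i. norm (z $ i))" unfolding m_def by (rule Max_in) auto
  then have "m < 1" "0 \<le> m" using assms by (auto simp: polydisc_def)
  then show ?thesis
    using that[of "(m + 1) / 2"] le le_less_trans[OF le, of "(m + 1) / 2"] by simp
qed

text \<open>The Szego kernels are bounded in norm on a smaller polydisc, so that norm convergence
  implies uniform convergence there.\<close>

lemma uniform_limit_truncate: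
  fixes f :: "'i::finite H2"
  assumes "\<rho> < 1" "\<And>x i. x \<in> A \<Longrightarrow> norm (\<gamma> x $ i) \<le> \<rho>"
  shows "uniform_limit A (\<lambda>n x. Rep_H2 (truncate n f) (\<gamma> x)) (\<lambda>x. Rep_H2 f (\<gamma> x)) sequentially"
proof (rule uniform_limitI)
  fix e :: real assume e: "e > 0"
  define K where "K = sqrt ((1 / (1 - \<rho>)) ^ CARD('i))"
  have K: "K > 0" using assms(1) by (simp add: K_def)
  have "\<forall>\<^sub>F n in sequentially. norm (truncate n f - f) < e / K"
    using truncate_tendsto[of f] e K by (simp add: tendsto_iff dist_norm)
  then show "\<forall>\<^sub>F n in sequentially. \<forall>x\<in>A. dist (Rep_H2 (truncate n f) (\<gamma> x)) (Rep_H2 f (\<gamma> x)) < e"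
  proof eventually_elim
    case (elim n)
    show ?case
    proof
      fix x assume x: "x \<in> A"
      have pd: "\<gamma> x \<in> polydisc" using le_less_trans[OF assms(2)[OF x] assms(1)] by (simp add: polydisc_def)
      have "norm (szego_kernel (\<gamma> x)) \<le> K"
        unfolding K_def by (rule real_le_rsqrt) (intro norm_szego_kernel_le assms x)
      have "dist (Rep_H2 (truncate n f) (\<gamma> x)) (Rep_H2 f (\<gamma> x))
          = norm (cinner (truncate n f - f) (szego_kernel (\<gamma> x)))"
        by (simp add: dist_norm Rep_H2_eq_cinner pd cinner_diff_left)
      also have "\<dots> \<le> norm (truncate n f - f) * norm (szego_kernel (\<gamma> x))" by (rule norm_cinner_le)
      also have "\<dots> \<le> norm (truncate n f - f) * K"
        by (intro mult_left_mono \<open>norm (szego_kernel (\<gamma> x)) \<le> K\<close>) auto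
      also have "\<dots> < e" using elim K by (simp add: field_simps)
      finally show "dist (Rep_H2 (truncate n f) (\<gamma> x)) (Rep_H2 f (\<gamma> x)) < e" .
    qed
  qed
qed

lemma open_polydisc: "open (polydisc :: (complex^'i::finite) set)"
proof -
  have "open {z :: complex^'i. norm (z $ i) < 1}" for i
    by (intro open_Collect_less continuous_intros)
  then have "open (\<Inter>i. {z :: complex^'i. norm (z $ i) < 1})" by (intro open_INT) auto
  moreover have "polydisc = (\<Inter>i. {z :: complex^'i. norm (z $ i) < 1})" by (auto simp: polydisc_def)
  ultimately show ?thesis by simp
qed

lemma eventually_in_smaller_polydisc:
  fixes \<gamma> :: "'a::metric_space \<Rightarrow> complex^'i::finite"
  assumes "open V" "x \<in> V" "continuous_on V \<gamma>" "\<gamma> x \<in> polydisc"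
  obtains d \<rho> where "d > 0" "ball x d \<subseteq> V" "\<rho> < 1" "\<And>y i. y \<in> ball x d \<Longrightarrow> norm (\<gamma> y $ i) \<le> \<rho>"
proof -
  obtain \<rho> where \<rho>: "\<rho> < 1" "\<And>i. norm (\<gamma> x $ i) < \<rho>" using polydisc_radius[OF assms(4)] by metis
  have cont: "isCont \<gamma> x" using assms by (simp add: continuous_on_eq_continuous_at)
  have "\<forall>\<^sub>F y in nhds x. \<forall>i. norm (\<gamma> y $ i) < \<rho>"
  proof (rule eventually_all_finite)
    fix i
    have "((\<lambda>y. norm (\<gamma> y $ i)) \<longlongrightarrow> norm (\<gamma> x $ i)) (nhds x)"
      using cont unfolding isCont_def by (intro tendsto_intros) (simp add: tendsto_nhds_iff)
    then show "\<forall>\<^sub>F y in nhds x. norm (\<gamma> y $ i) < \<rho>"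
      by (rule order_tendstoD) (rule \<rho>(2))
  qed
  moreover have "\<forall>\<^sub>F y in nhds x. y \<in> V" using assms(1,2) by (rule eventually_nhds_in_open)
  ultimately have "\<forall>\<^sub>F y in nhds x. y \<in> V \<and> (\<forall>i. norm (\<gamma> y $ i) < \<rho>)" by eventually_elim auto
  then obtain d where d: "d > 0" "\<And>y. dist y x < d \<Longrightarrow> y \<in> V \<and> (\<forall>i. norm (\<gamma> y $ i) < \<rho>)"
    unfolding eventually_nhds_metric by blast
  show ?thesis
  proof (rule that[OF d(1) _ \<rho>(1)])
    show "ball x d \<subseteq> V" using d(2) by (auto simp: dist_commute)
    show "norm (\<gamma> y $ i) \<le> \<rho>" if "y \<in> ball x d" for y i
      using d(2)[of y] that by (simp add: dist_commute less_imp_le)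
  qed
qed

lemma continuous_on_zpow: "continuous_on A (\<lambda>z. zpow z k)"
  unfolding zpow_def by (intro continuous_intros)

lemma continuous_on_Rep_H2: "continuous_on polydisc (Rep_H2 f)"
  unfolding continuous_on_eq_continuous_at[OF open_polydisc]
proof
  fix z :: "complex^'a" assume z: "z \<in> polydisc"
  obtain d \<rho> where d: "d > 0" "ball z d \<subseteq> polydisc" "\<rho> < 1" "\<And>y i. y \<in> ball z d \<Longrightarrow> norm (y $ i) \<le> \<rho>"
    using eventually_in_smaller_polydisc[OF open_polydisc z continuous_on_id z] by blast
  have "continuous_on (ball z d) (Rep_H2 f)"
  proof (rule uniform_limit_theorem)
    show "uniform_limit (ball z d) (\<lambda>n x. Rep_H2 (truncate n f) x) (Rep_H2 f) sequentially"
      by (rule uniform_limit_truncate[OF d(3), where \<gamma> = "\<lambda>x. x"]) (rule d(4))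
    have "continuous_on (ball z d) (\<lambda>x. \<Sum>k\<in>degree_box n. H2_coeff f k * zpow x k)" for n
      by (intro continuous_intros continuous_on_zpow)
    then show "\<forall>\<^sub>F n in sequentially. continuous_on (ball z d) (\<lambda>x. Rep_H2 (truncate n f) x)"
      using d(2) by (auto simp: Rep_truncate subset_iff cong: continuous_on_cong_simp intro!: always_eventually)
  qed simp
  then show "isCont (Rep_H2 f) z"
    by (rule continuous_on_interior) (use d(1) in simp)
qed

lemma holomorphic_on_Rep_H2_compose:
  fixes \<gamma> :: "complex \<Rightarrow> complex^'i::finite"
  assumes V: "open V" and hol: "\<And>i. (\<lambda>w. \<gamma> w $ i) holomorphic_on V"
    and pd: "\<And>w. w \<in> V \<Longrightarrow> \<gamma> w \<in> polydisc"
  shows "(\<lambda>w. Rep_H2 f (\<gamma> w)) holomorphic_on V"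
proof (rule holomorphic_uniform_sequence[OF V])
  have "(\<lambda>w. \<Sum>k\<in>degree_box n. H2_coeff f k * zpow (\<gamma> w) k) holomorphic_on V" for n
    unfolding zpow_def by (intro holomorphic_intros hol)
  then show "(\<lambda>w. Rep_H2 (truncate n f) (\<gamma> w)) holomorphic_on V" for n
    by (rule holomorphic_transform) (simp add: Rep_truncate pd)
  fix x assume x: "x \<in> V"
  have "continuous_on V (\<lambda>w. \<chi> i. \<gamma> w $ i)"
    by (intro continuous_on_vec_lambda holomorphic_on_imp_continuous_on hol)
  then have "continuous_on V \<gamma>" by simp
  from eventually_in_smaller_polydisc[OF V x this pd[OF x]]
  obtain d \<rho> where d: "d > 0" "ball x d \<subseteq> V" "\<rho> < 1" "\<And>y i. y \<in> ball x d \<Longrightarrow> norm (\<gamma> y $ i) \<le> \<rho>"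
    by blast
  have sub: "cball x (d/2) \<subseteq> ball x d" using d(1) by auto
  have "uniform_limit (cball x (d/2)) (\<lambda>n w. Rep_H2 (truncate n f) (\<gamma> w)) (\<lambda>w. Rep_H2 f (\<gamma> w)) sequentially"
    by (rule uniform_limit_truncate[OF d(3)]) (use d(4) sub in blast)
  then show "\<exists>d>0. cball x d \<subseteq> V \<and>
      uniform_limit (cball x d) (\<lambda>n w. Rep_H2 (truncate n f) (\<gamma> w)) (\<lambda>w. Rep_H2 f (\<gamma> w)) sequentially"
    using d(1,2) sub by (intro exI[of _ "d/2"]) auto
qed

lemma Rep_H2_holomorphic_coordinate:
  assumes "z \<in> polydisc"
  shows "(\<lambda>w. Rep_H2 f (\<chi> j. if j = i then w else z $ j)) holomorphic_on ball 0 1"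
proof (rule holomorphic_on_Rep_H2_compose)
  show "(\<lambda>w. (\<chi> j. if j = i then w else z $ j) $ j) holomorphic_on ball 0 1" for j
    by (cases "j = i") (auto intro: holomorphic_intros)
qed (use assms in \<open>auto simp: polydisc_def\<close>)


section \<open>Isometric multipliers\<close>

text \<open>These are exactly the inner functions.  This form of the notion carries the Hilbert space
  arguments; boundary values enter only in the proof of the equivalence.\<close>

definition isometric_multiplier :: "(complex^'i::finite \<Rightarrow> complex) \<Rightarrow> bool" where
  "isometric_multiplier \<psi> \<longleftrightarrow>
     (\<forall>f. \<exists>g. (\<forall>z\<in>polydisc. Rep_H2 g z = \<psi> z * Rep_H2 f z) \<and> norm g = norm f)"

definition mult_op :: "(complex^'i::finite \<Rightarrow> complex) \<Rightarrow> 'i H2 \<Rightarrow> 'i H2" where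
  "mult_op \<psi> f = Abs_H2 (\<lambda>z. \<psi> z * Rep_H2 f z)"

lemma mult_op_eqI:
  assumes "\<And>z. z \<in> polydisc \<Longrightarrow> Rep_H2 g z = \<psi> z * Rep_H2 f z"
  shows "mult_op \<psi> f = g"
proof -
  have "Rep_H2 g = (\<lambda>z. \<psi> z * Rep_H2 f z)" using assms Rep_H2_outside by fastforce
  then show ?thesis unfolding mult_op_def by (metis Rep_H2_inverse)
qed

lemma
  assumes "isometric_multiplier \<psi>"
  shows Rep_mult_op: "z \<in> polydisc \<Longrightarrow> Rep_H2 (mult_op \<psi> f) z = \<psi> z * Rep_H2 f z"
    and linear_isometry_mult_op: "linear_isometry (mult_op \<psi>)"
proof -
  have *: "(\<forall>z\<in>polydisc. Rep_H2 (mult_op \<psi> f) z = \<psi> z * Rep_H2 f z) \<and> norm (mult_op \<psi> f) = norm f" for f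
    using assms mult_op_eqI[of _ \<psi> f] unfolding isometric_multiplier_def by metis
  show "z \<in> polydisc \<Longrightarrow> Rep_H2 (mult_op \<psi> f) z = \<psi> z * Rep_H2 f z" using * by blast
  show "linear_isometry (mult_op \<psi>)"
    unfolding linear_isometry_def using * by (auto intro!: mult_op_eqI simp: distrib_left)
qed

lemma multiples_eq_range:
  assumes "isometric_multiplier \<psi>"
  shows "multiples \<psi> = range (mult_op \<psi>)"
  unfolding multiples_def using Rep_mult_op[OF assms] mult_op_eqI by (auto, metis rangeI)

lemma closed_subspace_UNIV: "closed_subspace UNIV"
  by (rule closed_subspaceI) auto

lemma closed_subspace_multiples:
  "isometric_multiplier \<psi> \<Longrightarrow> closed_subspace (multiples \<psi>)"
  using linear_isometry_image[OF linear_isometry_mult_op closed_subspace_UNIV]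
  by (simp add: multiples_eq_range)

lemma isometric_multiplier_mult:
  assumes "isometric_multiplier \<psi>" "isometric_multiplier \<phi>"
  shows "isometric_multiplier (\<lambda>z. \<psi> z * \<phi> z)"
  unfolding isometric_multiplier_def
proof
  fix f
  show "\<exists>g. (\<forall>z\<in>polydisc. Rep_H2 g z = \<psi> z * \<phi> z * Rep_H2 f z) \<and> norm g = norm f"
    by (rule exI[of _ "mult_op \<psi> (mult_op \<phi> f)"])
      (auto simp: Rep_mult_op assms linear_isometryD[OF linear_isometry_mult_op] mult.assoc)
qed

lemma isometric_multiplier_1: "isometric_multiplier (\<lambda>z. 1)"
  unfolding isometric_multiplier_def by auto

lemma mult_op_commute:
  assumes "isometric_multiplier \<psi>" "isometric_multiplier \<phi>"
  shows "mult_op \<psi> (mult_op \<phi> f) = mult_op \<phi> (mult_op \<psi> f)"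
  by (rule H2_eqI) (simp add: Rep_mult_op assms)

text \<open>Multiplication by \<open>\<psi>\<close> is isometric as soon as it maps the orthonormal basis of monomials to
  an orthonormal system: on polynomials this is clear, and truncations converge in norm and
  pointwise.\<close>

lemma isometric_multiplierI:
  fixes \<psi> :: "complex^'i::finite \<Rightarrow> complex"
  assumes e: "\<And>k z. z \<in> polydisc \<Longrightarrow> Rep_H2 (e k) z = \<psi> z * zpow z k"
    and orth: "\<And>k l. cinner (e k) (e l) = (if k = l then 1 else 0)"
  shows "isometric_multiplier \<psi>"
  unfolding isometric_multiplier_def
proof
  fix f :: "'i H2"
  define T where "T n = (\<Sum>k\<in>degree_box n. H2_coeff f k *\<^sub>C e k)" for n
  have iso: "norm (\<Sum>k\<in>A. c k *\<^sub>C e k) = norm (\<Sum>k\<in>A. c k *\<^sub>C monomial k)" if "finite A" for A c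
  proof -
    have "cinner (\<Sum>k\<in>A. c k *\<^sub>C e k) (\<Sum>k\<in>A. c k *\<^sub>C e k)
        = cinner (\<Sum>k\<in>A. c k *\<^sub>C monomial k) (\<Sum>k\<in>A. c k *\<^sub>C monomial k)"
      by (simp add: cinner_sum_left cinner_sum_right cinner_scaleC_left cinner_scaleC_right orth
          cinner_monomial_monomial)
    then show ?thesis by (simp add: cinner_self power2_eq_iff_nonneg flip: of_real_power)
  qed
  have diff: "dist (T m) (T n) = dist (truncate m f) (truncate n f)" for m n
  proof -
    define c where "c k = (if k \<in> degree_box m then H2_coeff f k else 0) - (if k \<in> degree_box n then H2_coeff f k else 0)" for k
    let ?A = "degree_box m \<union> degree_box n :: ('i \<Rightarrow> nat) set"
    have *: "(\<Sum>k\<in>degree_box j. H2_coeff f k *\<^sub>C v k) = (\<Sum>k\<in>?A. (if k \<in> degree_box j then H2_coeff f k else 0) *\<^sub>C v k)"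
      if "j = m \<or> j = n" for j and v :: "_ \<Rightarrow> 'i H2"
      by (rule sum.mono_neutral_cong_left) (use that in auto)
    have "T m - T n = (\<Sum>k\<in>?A. c k *\<^sub>C e k)" "truncate m f - truncate n f = (\<Sum>k\<in>?A. c k *\<^sub>C monomial k)"
      by (simp_all add: T_def truncate_def * c_def complex_vector.scale_left_diff_distrib sum_subtractf)
    then show ?thesis using iso[of ?A c] by (simp add: dist_norm)
  qed
  have "Cauchy (\<lambda>n. truncate n f)" by (rule LIMSEQ_imp_Cauchy[OF truncate_tendsto])
  then have "Cauchy T" unfolding Cauchy_def diff .
  then obtain g where g: "T \<longlonglongrightarrow> g" by (auto simp: Cauchy_convergent_iff convergent_def)
  have "Rep_H2 g z = \<psi> z * Rep_H2 f z" if z: "z \<in> polydisc" for z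
  proof (rule LIMSEQ_unique[OF tendsto_Rep_H2[OF g]])
    have "(\<lambda>n. \<psi> z * Rep_H2 (truncate n f) z) \<longlonglongrightarrow> \<psi> z * Rep_H2 f z"
      by (intro tendsto_intros tendsto_Rep_H2 truncate_tendsto)
    then show "(\<lambda>n. Rep_H2 (T n) z) \<longlonglongrightarrow> \<psi> z * Rep_H2 f z"
      by (simp add: T_def Rep_truncate z e sum_distrib_left mult_ac)
  qed
  moreover have "norm g = norm f"
  proof (rule LIMSEQ_unique[OF tendsto_norm[OF g]])
    have "norm (T n) = norm (truncate n f)" for n unfolding T_def truncate_def by (rule iso) simp
    then show "(\<lambda>n. norm (T n)) \<longlonglongrightarrow> norm f" using tendsto_norm[OF truncate_tendsto[of f]] by simp
  qed
  ultimately show "\<exists>g. (\<forall>z\<in>polydisc. Rep_H2 g z = \<psi> z * Rep_H2 f z) \<and> norm g = norm f" by blast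
qed

text \<open>All powers of an isometric multiplier have norm one as elements of the Hardy space, while
  evaluation at a point is bounded; hence an isometric multiplier is bounded by one.\<close>

lemma isometric_multiplier_le_1:
  assumes \<psi>: "isometric_multiplier \<psi>" and z: "z \<in> polydisc"
  shows "norm (\<psi> z) \<le> 1"
proof (rule ccontr)
  assume "\<not> norm (\<psi> z) \<le> 1"
  moreover have "norm (\<psi> z) ^ n \<le> norm (szego_kernel z)" for n
  proof -
    have pow: "isometric_multiplier (\<lambda>z. \<psi> z ^ n)"
      by (induction n) (auto intro: isometric_multiplier_1 isometric_multiplier_mult \<psi>)
    let ?g = "mult_op (\<lambda>z. \<psi> z ^ n) (monomial (\<lambda>_. 0))"
    have "norm (\<psi> z) ^ n = norm (Rep_H2 ?g z)"
      by (simp add: Rep_mult_op[OF pow z] Rep_monomial[OF z] norm_power norm_mult zpow_def)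
    also have "\<dots> \<le> norm ?g * norm (szego_kernel z)"
      unfolding Rep_H2_eq_cinner[OF z] by (rule norm_cinner_le)
    finally show ?thesis by (simp add: linear_isometryD[OF linear_isometry_mult_op[OF pow]] norm_monomial)
  qed
  ultimately show False
    using real_arch_pow[of "norm (\<psi> z)" "norm (szego_kernel z)"] by (metis not_le)
qed


section \<open>Shifts and backward shifts\<close>

lemma zpow_upd: "zpow z (k(i := Suc (k i))) = z $ i * zpow z k"
proof -
  have "zpow z (k(i := Suc (k i))) = (\<Prod>j\<in>UNIV. (if j = i then z $ i else 1) * z $ j ^ k j)"
    unfolding zpow_def by (rule prod.cong) auto
  then show ?thesis by (simp add: zpow_def prod.distrib)
qed

lemma H2_coeff_shift:
  "H2_coeff (shift i f) k = (if k i = 0 then 0 else H2_coeff f (k(i := k i - 1)))"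
proof -
  define up where "up k = k(i := Suc (k i))" for k :: "'a \<Rightarrow> nat"
  define a where "a k = (if k i = 0 then 0 else H2_coeff f (k(i := k i - 1)))" for k
  have bij: "bij_betw up UNIV {k. k i \<noteq> 0}"
    by (rule bij_betwI[where g = "\<lambda>k. k(i := k i - 1)"]) (auto simp: up_def)
  have a_up: "a (up k) = H2_coeff f k" for k by (simp add: a_def up_def)
  have "H2_coeff (shift i f) = a"
  proof (rule H2_coeff_unique)
    fix z :: "complex^'a" assume z: "z \<in> polydisc"
    have "zpow z (up k) = z $ i * zpow z k" for k unfolding up_def by (rule zpow_upd)
    then have "((\<lambda>k. zpow z (up k) * a (up k)) has_sum Rep_H2 (shift i f) z) UNIV"
      using has_sum_cmult_right[OF H2_coeff_has_sum[OF z, of f], of "z $ i"]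
      by (simp add: a_up mult_ac)
    then have "((\<lambda>k. zpow z k * a k) has_sum Rep_H2 (shift i f) z) {k. k i \<noteq> 0}"
      using has_sum_reindex_bij_betw[OF bij, of "\<lambda>k. zpow z k * a k"] by simp
    then show "((\<lambda>k. zpow z k * a k) has_sum Rep_H2 (shift i f) z) UNIV"
      by (rule has_sum_cong_neutral[THEN iffD1, rotated -1]) (auto simp: a_def)
  qed
  then show ?thesis by (simp add: a_def)
qed

lemma shift_monomial: "shift i (monomial k) = monomial (k(i := Suc (k i)))"
  by (rule H2_coeff_inject) (auto simp: fun_eq_iff H2_coeff_shift H2_coeff_monomial)

lemma isometric_multiplier_coordinate: "isometric_multiplier (\<lambda>z :: complex^'i::finite. z $ i)"
proof (rule isometric_multiplierI[where e = "\<lambda>k. monomial (k(i := Suc (k i)))"])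
  fix k l :: "'i \<Rightarrow> nat"
  have "k(i := Suc (k i)) = l(i := Suc (l i)) \<longleftrightarrow> k = l"
    by (metis fun_upd_idem_iff fun_upd_same fun_upd_triv fun_upd_upd nat.inject)
  then show "cinner (monomial (k(i := Suc (k i)))) (monomial (l(i := Suc (l i)))) = (if k = l then 1 else 0)"
    by (simp add: cinner_monomial_monomial)
qed (simp add: Rep_monomial zpow_upd)

lemma shift_eq_mult_op: "shift i = mult_op (\<lambda>z. z $ i)"
  by (simp add: fun_eq_iff shift_def mult_op_def)

lemma linear_isometry_shift: "linear_isometry (shift i)"
  unfolding shift_eq_mult_op by (rule linear_isometry_mult_op[OF isometric_multiplier_coordinate])

lemma isometric_multiplier_zpow: "isometric_multiplier (\<lambda>z :: complex^'i::finite. zpow z k)"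
proof -
  have pow: "isometric_multiplier (\<lambda>z. z $ i ^ n)" for i :: 'i and n
    by (induction n) (auto intro: isometric_multiplier_1 isometric_multiplier_mult isometric_multiplier_coordinate)
  have "isometric_multiplier (\<lambda>z. \<Prod>i\<in>I. z $ i ^ k i)" if "finite I" for I :: "'i set"
    using that by induction (auto intro: isometric_multiplier_1 isometric_multiplier_mult pow)
  then show ?thesis unfolding zpow_def by simp
qed

lemma zpow_add: "zpow z (\<lambda>i. k i + l i) = zpow z k * zpow z l"
  by (simp add: zpow_def power_add prod.distrib)

text \<open>The backward shift is the adjoint of the shift on the whole Hardy space.\<close>

definition backward_shift :: "'i \<Rightarrow> 'i::finite H2 \<Rightarrow> 'i H2" where
  "backward_shift i f = H2_of_coeff (\<lambda>k. H2_coeff f (k(i := Suc (k i))))"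

lemma H2_coeff_backward_shift: "H2_coeff (backward_shift i f) k = H2_coeff f (k(i := Suc (k i)))"
proof -
  have inj: "inj (\<lambda>k :: 'a \<Rightarrow> nat. k(i := Suc (k i)))"
    by (rule injI) (metis fun_upd_idem_iff fun_upd_same fun_upd_triv fun_upd_upd nat.inject)
  have "(\<lambda>k. (norm (H2_coeff f (k(i := Suc (k i)))))\<^sup>2) summable_on UNIV"
    using summable_on_reindex[OF inj, of "\<lambda>k. (norm (H2_coeff f k))\<^sup>2"]
      summable_on_subset_banach[OF H2_coeff_summable[of f]] by (simp add: o_def)
  then show ?thesis unfolding backward_shift_def by (simp add: H2_coeff_of_coeff)
qed

lemma cinner_shift: "cinner (shift i g) f = cinner g (backward_shift i f)"
proof -
  let ?S = "{g. cinner (shift i g) f = cinner g (backward_shift i f)}"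
  have "closed_subspace ?S"
  proof (rule closed_subspaceI)
    fix X x assume X: "\<And>n. X n \<in> ?S" "X \<longlonglongrightarrow> x"
    have "(\<lambda>n. cinner (shift i (X n)) f) \<longlonglongrightarrow> cinner (shift i x) f"
      by (intro tendsto_cinner tendsto_const linear_isometry_tendsto[OF linear_isometry_shift] X(2))
    moreover have "(\<lambda>n. cinner (X n) (backward_shift i f)) \<longlonglongrightarrow> cinner x (backward_shift i f)"
      by (intro tendsto_cinner tendsto_const X(2))
    ultimately show "x \<in> ?S" using X(1) LIMSEQ_unique by auto
  qed (auto simp: linear_isometryD[OF linear_isometry_shift] cinner_add_left cinner_scaleC_left)
  moreover have "range monomial \<subseteq> ?S"
    by (auto simp: shift_monomial cinner_commute[of "monomial _"] cinner_monomial H2_coeff_backward_shift)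
  ultimately show ?thesis using closed_span_least[of "range monomial" ?S] closed_span_monomials by blast
qed

lemma shift_backward_shift_commute:
  "i \<noteq> j \<Longrightarrow> shift i (backward_shift j f) = backward_shift j (shift i f)"
  by (rule H2_coeff_inject) (auto simp: fun_eq_iff H2_coeff_shift H2_coeff_backward_shift fun_upd_twist)

lemma shift_commute: "shift i (shift j f) = shift j (shift i f)"
  unfolding shift_eq_mult_op by (intro mult_op_commute isometric_multiplier_coordinate)


section \<open>Integration over the torus\<close>

definition torus_point :: "real \<Rightarrow> real^'i::finite \<Rightarrow> complex^'i" where
  "torus_point r \<theta> = (\<chi> i. of_real r * cis (\<theta> $ i))"

text \<open>Several periods in each angle are allowed, because a statement about almost all angles
  in \<open>real^'i\<close> is reduced to boxes that exhaust the space.\<close>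

definition torus_box :: "real \<Rightarrow> nat \<Rightarrow> (real^'i::finite) set" where
  "torus_box a N = {\<theta>. \<forall>i. \<theta> $ i \<in> {a..a + 2 * pi * N}}"

lemma measurable_vec_lambda_PiM:
  "vec_lambda \<in> PiM UNIV (\<lambda>_. lborel) \<rightarrow>\<^sub>M (borel :: (real^'i::finite) measure)"
  by (rule borel_measurable_euclidean_space[THEN iffD2]) (auto simp: Basis_vec_def inner_axis)

text \<open>Both measures give a box the product of its side lengths.  In this form Lebesgue measure is
  accessible to Fubini's theorem one coordinate at a time.\<close>

lemma lborel_vec: "(lborel :: (real^'i::finite) measure) = distr (PiM UNIV (\<lambda>_. lborel)) borel vec_lambda"
proof (rule lborel_eqI)
  note meas = measurable_vec_lambda_PiM
  interpret product_sigma_finite "\<lambda>_::'i. lborel :: real measure" ..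
  fix l u :: "real^'i" assume lu: "\<And>b. b \<in> Basis \<Longrightarrow> l \<bullet> b \<le> u \<bullet> b"
  have le: "l $ i \<le> u $ i" for i using lu[of "axis i 1"] by (simp add: inner_axis axis_in_Basis_iff)
  have pre: "vec_lambda -` box l u \<inter> space (PiM UNIV (\<lambda>_. lborel)) = PiE UNIV (\<lambda>i. {l $ i <..< u $ i})"
    by (auto simp: space_PiM mem_box_cart PiE_UNIV_domain Pi_iff)
  have "emeasure (distr (PiM UNIV (\<lambda>_. lborel)) borel vec_lambda) (box l u)
      = emeasure (PiM UNIV (\<lambda>_. lborel)) (PiE UNIV (\<lambda>i. {l $ i <..< u $ i}))"
    unfolding pre[symmetric] by (rule emeasure_distr[OF meas]) (rule borel_open[OF open_box])
  also have "\<dots> = (\<Prod>i\<in>UNIV. emeasure lborel {l $ i <..< u $ i})"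
    by (rule emeasure_PiM[OF finite]) simp
  also have "\<dots> = ennreal (\<Prod>i\<in>UNIV. u $ i - l $ i)"
    using le by (simp add: prod_ennreal)
  also have "(\<Prod>i\<in>UNIV. u $ i - l $ i) = (\<Prod>b\<in>Basis. (u - l) \<bullet> b)"
  proof -
    have B: "(Basis :: (real^'i) set) = (\<lambda>i. axis i 1) ` UNIV" by (auto simp: Basis_vec_def)
    have "inj (\<lambda>i :: 'i. axis i (1 :: real))" by (auto simp: inj_on_def axis_eq_axis)
    then show ?thesis unfolding B by (subst prod.reindex) (auto simp: inner_axis)
  qed
  finally show "emeasure (distr (PiM UNIV (\<lambda>_. lborel)) borel vec_lambda) (box l u)
      = ennreal (\<Prod>b\<in>Basis. (u - l) \<bullet> b)" .
qed simp

lemma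
  fixes g :: "'i::finite \<Rightarrow> real \<Rightarrow> 'b::{real_normed_field,banach,second_countable_topology}"
  assumes "\<And>i. integrable lborel (g i)"
  shows integral_lborel_vec_prod: "(\<integral>\<theta>. (\<Prod>i\<in>UNIV. g i (\<theta> $ i)) \<partial>lborel) = (\<Prod>i\<in>UNIV. integral\<^sup>L lborel (g i))"
    and integrable_lborel_vec_prod: "integrable lborel (\<lambda>\<theta> :: real^'i. \<Prod>i\<in>UNIV. g i (\<theta> $ i))"
proof -
  interpret product_sigma_finite "\<lambda>_::'i. lborel :: real measure" ..
  have [measurable]: "g i \<in> borel_measurable borel" for i
    using borel_measurable_integrable[OF assms[of i]] by simp
  have m: "(\<lambda>\<theta> :: real^'i. \<Prod>i\<in>UNIV. g i (\<theta> $ i)) \<in> borel_measurable borel"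
    by measurable
  show "(\<integral>\<theta>. (\<Prod>i\<in>UNIV. g i (\<theta> $ i)) \<partial>lborel) = (\<Prod>i\<in>UNIV. integral\<^sup>L lborel (g i))"
    using product_integral_prod[of UNIV g] assms
    by (subst lborel_vec, subst integral_distr[OF measurable_vec_lambda_PiM m]) simp
  show "integrable lborel (\<lambda>\<theta> :: real^'i. \<Prod>i\<in>UNIV. g i (\<theta> $ i))"
    using product_integrable_prod[of UNIV g] assms
    by (subst lborel_vec, subst integrable_distr_eq[OF measurable_vec_lambda_PiM m]) simp
qed

lemma indicator_torus_box:
  "indicator (torus_box a N) \<theta> = (\<Prod>i\<in>UNIV. indicator {a..a + 2 * pi * N} (\<theta> $ i) :: real)"
proof (cases "\<theta> \<in> torus_box a N")
  case False
  then obtain i where "\<theta> $ i \<notin> {a..a + 2 * pi * N}" by (auto simp: torus_box_def)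
  then have "(\<Prod>i\<in>UNIV. indicator {a..a + 2 * pi * N} (\<theta> $ i) :: real) = 0"
    by (intro prod_zero) (auto intro!: exI[of _ i])
  then show ?thesis using False by simp
qed (auto simp: torus_box_def)

lemma integrable_Icc_indicator:
  fixes f :: "real \<Rightarrow> complex"
  assumes "continuous_on {a..b} f"
  shows "integrable lborel (\<lambda>t. indicator {a..b} t *\<^sub>R f t)"
  using borel_integrable_atLeastAtMost'[OF assms] by (simp add: set_integrable_def)

lemma
  shows integrable_torus_box: "integrable lborel (indicator (torus_box a N) :: real^'i::finite \<Rightarrow> real)"
    and integral_torus_box: "(\<integral>\<theta>. indicator (torus_box a N :: (real^'i) set) \<theta> \<partial>lborel) = (2 * pi * N) ^ CARD('i)"
proof -
  have i: "integrable lborel (indicator {a..a + 2 * pi * N} :: real \<Rightarrow> real)"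
    by (rule integrable_real_indicator) auto
  have "indicator (torus_box a N) = (\<lambda>\<theta> :: real^'i. \<Prod>i\<in>UNIV. indicator {a..a + 2 * pi * N} (\<theta> $ i) :: real)"
    by (simp add: fun_eq_iff indicator_torus_box)
  then show "integrable lborel (indicator (torus_box a N) :: real^'i \<Rightarrow> real)"
      "(\<integral>\<theta>. indicator (torus_box a N :: (real^'i) set) \<theta> \<partial>lborel) = (2 * pi * N) ^ CARD('i)"
    using integrable_lborel_vec_prod[of "\<lambda>_::'i. indicator {a..a + 2 * pi * N} :: real \<Rightarrow> real", OF i]
      integral_lborel_vec_prod[of "\<lambda>_::'i. indicator {a..a + 2 * pi * N} :: real \<Rightarrow> real", OF i]
    by simp_all
qed

lemma integrable_torus_box_bounded:
  fixes f :: "real^'i::finite \<Rightarrow> complex"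
  assumes "f \<in> borel_measurable borel" "\<And>\<theta>. norm (f \<theta>) \<le> C"
  shows "integrable lborel (\<lambda>\<theta>. indicator (torus_box a N) \<theta> *\<^sub>R f \<theta>)"
proof (rule Bochner_Integration.integrable_bound)
  show "integrable lborel (\<lambda>\<theta> :: real^'i. C * indicator (torus_box a N) \<theta>)"
    by (intro integrable_mult_right integrable_torus_box)
  have [measurable]: "(indicator (torus_box a N) :: real^'i \<Rightarrow> real) \<in> borel_measurable borel"
    using borel_measurable_integrable[OF integrable_torus_box] by simp
  show "(\<lambda>\<theta>. indicator (torus_box a N) \<theta> *\<^sub>R f \<theta>) \<in> borel_measurable lborel"
    using assms(1) by simp
  show "AE \<theta> in lborel. norm (indicator (torus_box a N) \<theta> *\<^sub>R f \<theta>) \<le> norm (C * indicator (torus_box a N) \<theta>)"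
    using order_trans[OF assms(2) abs_ge_self] by (auto simp: indicator_def intro!: AE_I2)
qed

lemma torus_integral_dominated_convergence:
  fixes f :: "nat \<Rightarrow> real^'i::finite \<Rightarrow> complex"
  assumes "\<And>n. f n \<in> borel_measurable borel" "g \<in> borel_measurable borel"
    and bound: "\<And>n \<theta>. norm (f n \<theta>) \<le> C"
    and lim: "AE \<theta> in lborel. \<theta> \<in> torus_box a N \<longrightarrow> (\<lambda>n. f n \<theta>) \<longlonglongrightarrow> g \<theta>"
  shows "(\<lambda>n. \<integral>\<theta>. indicator (torus_box a N) \<theta> *\<^sub>R f n \<theta> \<partial>lborel)
    \<longlonglongrightarrow> (\<integral>\<theta>. indicator (torus_box a N) \<theta> *\<^sub>R g \<theta> \<partial>lborel)"
proof (rule integral_dominated_convergence)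
  have [measurable]: "(indicator (torus_box a N) :: real^'i \<Rightarrow> real) \<in> borel_measurable borel"
    using borel_measurable_integrable[OF integrable_torus_box] by simp
  show "(\<lambda>\<theta>. indicator (torus_box a N) \<theta> *\<^sub>R g \<theta>) \<in> borel_measurable lborel"
    "(\<lambda>\<theta>. indicator (torus_box a N) \<theta> *\<^sub>R f n \<theta>) \<in> borel_measurable lborel" for n
    using assms(1,2) by simp_all
  show "integrable lborel (\<lambda>\<theta> :: real^'i. C * indicator (torus_box a N) \<theta>)"
    by (intro integrable_mult_right integrable_torus_box)
  show "AE \<theta> in lborel. norm (indicator (torus_box a N) \<theta> *\<^sub>R f n \<theta>) \<le> C * indicator (torus_box a N) \<theta>" for n
    using bound by (auto simp: indicator_def intro!: AE_I2)
  show "AE \<theta> in lborel. (\<lambda>n. indicator (torus_box a N) \<theta> *\<^sub>R f n \<theta>)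
      \<longlonglongrightarrow> indicator (torus_box a N) \<theta> *\<^sub>R g \<theta>"
    using lim by eventually_elim (auto simp: indicator_def)
qed

lemma integral_cis_period:
  fixes n :: int
  shows "(\<integral>t. indicator {a..a + 2 * pi * real N} t *\<^sub>R cis (of_int n * t) \<partial>lborel)
    = (if n = 0 then of_real (2 * pi * real N) else 0)"
proof (cases "n = 0")
  case True
  have "(\<integral>t. indicator {a..a + 2 * pi * real N} t *\<^sub>R (1 :: complex) \<partial>lborel)
      = complex_of_real (a + 2 * pi * real N) - complex_of_real a"
  proof (rule integral_FTC_atLeastAtMost)
    show "(complex_of_real has_vector_derivative 1) (at x within {a..a + 2 * pi * real N})" for x
      using has_vector_derivative_of_real[OF DERIV_ident] by (simp add: id_def)
  qed auto
  then show ?thesis using True by simp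
next
  case False
  define F where "F t = cis (of_int n * t) / (\<i> * of_int n)" for t :: real
  have "(\<integral>t. indicator {a..a + 2 * pi * real N} t *\<^sub>R cis (of_int n * t) \<partial>lborel)
      = F (a + 2 * pi * real N) - F a"
  proof (rule integral_FTC_atLeastAtMost)
    fix t
    have "((\<lambda>t. exp (\<i> * of_int n * of_real t)) has_vector_derivative
        exp (\<i> * of_int n * of_real t) * (\<i> * of_int n)) (at t within {a..a + 2 * pi * real N})"
      by (rule has_vector_derivative_real_field) (auto intro!: derivative_eq_intros)
    then have "((\<lambda>t. exp (\<i> * of_int n * of_real t) / (\<i> * of_int n)) has_vector_derivative
        exp (\<i> * of_int n * of_real t) * (\<i> * of_int n) / (\<i> * of_int n)) (at t within {a..a + 2 * pi * real N})"
      by (rule has_vector_derivative_divide)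
    then show "(F has_vector_derivative cis (of_int n * t)) (at t within {a..a + 2 * pi * real N})"
      using False by (simp add: F_def[abs_def] cis_conv_exp mult.assoc)
  qed (auto intro!: continuous_intros)
  moreover have "cis (of_int n * (a + 2 * pi * real N)) = cis (of_int n * a) * cis (2 * pi * of_int (n * int N))"
    by (simp add: cis_mult algebra_simps)
  then have "F (a + 2 * pi * real N) = F a"
    using cis_multiple_2pi[of "of_int (n * int N)"] by (simp add: F_def)
  ultimately show ?thesis using False by simp
qed

definition total_degree :: "('i::finite \<Rightarrow> nat) \<Rightarrow> nat" where
  "total_degree k = (\<Sum>i\<in>UNIV. k i)"

lemma zpow_scale: "zpow (\<chi> i. c * z $ i) k = c ^ total_degree k * zpow z k"
  by (simp add: zpow_def total_degree_def power_mult_distrib prod.distrib power_sum)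

lemma zpow_torus_point: "zpow (torus_point r \<theta>) k = of_real (r ^ total_degree k) * zpow (torus_point 1 \<theta>) k"
  using zpow_scale[of "of_real r" "torus_point 1 \<theta>" k] by (simp add: torus_point_def)

lemma norm_zpow_torus_point_1: "norm (zpow (torus_point 1 \<theta>) k) = 1"
  by (simp add: zpow_def torus_point_def norm_power flip: prod_norm)

lemma torus_orthogonality:
  fixes k l :: "'i::finite \<Rightarrow> nat"
  shows "(\<integral>\<theta>. indicator (torus_box a N) \<theta> *\<^sub>R (zpow (torus_point 1 \<theta>) k * cnj (zpow (torus_point 1 \<theta>) l)) \<partial>lborel)
    = (if k = l then of_real ((2 * pi * N) ^ CARD('i)) else 0)"
proof -
  define g where "g i t = indicator {a..a + 2 * pi * N} t *\<^sub>R cis (of_int (int (k i) - int (l i)) * t)" for i t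
  have "zpow (torus_point 1 \<theta>) k * cnj (zpow (torus_point 1 \<theta>) l)
      = (\<Prod>i\<in>UNIV. cis (of_int (int (k i) - int (l i)) * \<theta> $ i))" for \<theta> :: "real^'i"
    unfolding zpow_def cnj_prod prod.distrib[symmetric] torus_point_def
    by (rule prod.cong) (auto simp: DeMoivre cis_cnj cis_mult algebra_simps Complex.DeMoivre)
  then have "indicator (torus_box a N) \<theta> *\<^sub>R (zpow (torus_point 1 \<theta>) k * cnj (zpow (torus_point 1 \<theta>) l))
      = (\<Prod>i\<in>UNIV. g i (\<theta> $ i))" for \<theta> :: "real^'i"
    by (simp add: indicator_torus_box g_def prod.distrib scaleR_conv_of_real)
  moreover have "integrable lborel (g i)" for i
    unfolding g_def by (intro integrable_Icc_indicator continuous_intros)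
  ultimately have "(\<integral>\<theta>. indicator (torus_box a N) \<theta> *\<^sub>R (zpow (torus_point 1 \<theta>) k * cnj (zpow (torus_point 1 \<theta>) l)) \<partial>lborel)
      = (\<Prod>i\<in>UNIV. integral\<^sup>L lborel (g i))"
    using integral_lborel_vec_prod[of g] by simp
  also have "\<dots> = (\<Prod>i\<in>UNIV. if k i = l i then of_real (2 * pi * N) else 0)"
    unfolding g_def integral_cis_period by simp
  also have "\<dots> = (if k = l then of_real ((2 * pi * N) ^ CARD('i)) else 0)"
  proof (cases "k = l")
    case False
    then obtain i where "k i \<noteq> l i" by auto
    then have "(\<Prod>i\<in>UNIV. if k i = l i then of_real (2 * pi * N) else (0 :: complex)) = 0"
      by (intro prod_zero) (auto intro!: exI[of _ i])
    then show ?thesis using False by simp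
  qed simp
  finally show ?thesis .
qed


section \<open>Dilations and the Parseval identity\<close>

definition dilate :: "real \<Rightarrow> 'i::finite H2 \<Rightarrow> 'i H2" where
  "dilate r f = H2_of_coeff (\<lambda>k. of_real (r ^ total_degree k) * H2_coeff f k)"

lemma H2_coeff_dilate:
  assumes "0 \<le> r" "r \<le> 1"
  shows "H2_coeff (dilate r f) k = of_real (r ^ total_degree k) * H2_coeff f k"
proof -
  have "(\<lambda>k. (norm (of_real (r ^ total_degree k) * H2_coeff f k))\<^sup>2) summable_on UNIV"
  proof (rule summable_on_comparison_test[OF H2_coeff_summable[of f]])
    fix k
    have "norm (of_real (r ^ total_degree k) * H2_coeff f k) \<le> 1 * norm (H2_coeff f k)"
      unfolding norm_mult using assms
      by (intro mult_right_mono) (auto simp: norm_power power_le_one)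
    then show "(norm (of_real (r ^ total_degree k) * H2_coeff f k))\<^sup>2 \<le> (norm (H2_coeff f k))\<^sup>2"
      by (intro power_mono) auto
  qed auto
  then show ?thesis unfolding dilate_def by (simp add: H2_coeff_of_coeff)
qed

lemma Rep_dilate:
  assumes "0 \<le> r" "r \<le> 1" "z \<in> polydisc"
  shows "Rep_H2 (dilate r f) z = Rep_H2 f (\<chi> i. of_real r * z $ i)"
proof -
  have "norm (of_real r * z $ i) < 1" for i
    using assms mult_left_le_one_le[of "norm (z $ i)" r] by (auto simp: polydisc_def norm_mult intro: le_less_trans)
  then have "(\<chi> i. of_real r * z $ i) \<in> polydisc" by (simp add: polydisc_def)
  from H2_coeff_has_sum[OF this, of f]
  have "((\<lambda>k. zpow z k * H2_coeff (dilate r f) k) has_sum Rep_H2 f (\<chi> i. of_real r * z $ i)) UNIV"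
    by (simp add: zpow_scale H2_coeff_dilate assms mult_ac)
  then show ?thesis using H2_coeff_has_sum[OF assms(3), of "dilate r f"] has_sum_unique by blast
qed

lemma norm_dilate_le:
  assumes "0 \<le> r" "r \<le> 1"
  shows "norm (dilate r f) \<le> norm f"
proof -
  have "(norm (dilate r f))\<^sup>2 \<le> (norm f)\<^sup>2"
    using norm_power2_H2 norm_power2_H2
  proof (rule has_sum_mono)
    fix k
    have "norm (of_real (r ^ total_degree k) * H2_coeff f k) \<le> 1 * norm (H2_coeff f k)"
      unfolding norm_mult using assms
      by (intro mult_right_mono) (auto simp: norm_power power_le_one)
    then show "(norm (H2_coeff (dilate r f) k))\<^sup>2 \<le> (norm (H2_coeff f k))\<^sup>2"
      unfolding H2_coeff_dilate[OF assms] by (intro power_mono) auto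
  qed
  then show ?thesis by (simp add: power2_le_iff_abs_le)
qed

lemma dilate_tendsto:
  fixes f :: "'i::finite H2"
  assumes r: "\<And>n. 0 \<le> r n" "\<And>n. r n \<le> 1" and lim: "r \<longlonglongrightarrow> 1"
  shows "(\<lambda>n. dilate (r n) f) \<longlonglongrightarrow> f"
proof (rule metric_LIMSEQ_I)
  fix e :: real assume e: "e > 0"
  obtain m where m: "norm (truncate m f - f) < e / 3"
    using LIMSEQ_D[OF truncate_tendsto, of "e / 3" f] e by auto
  define p where "p = truncate m f"
  have lin: "dilate s (g - h) = dilate s g - dilate s h" if "0 \<le> s" "s \<le> 1" for s and g h :: "'i H2"
    by (rule H2_coeff_inject) (simp add: fun_eq_iff H2_coeff_dilate that right_diff_distrib)
  have dp: "dilate s p = (\<Sum>k\<in>degree_box m. (of_real (s ^ total_degree k) * H2_coeff f k) *\<^sub>C monomial k)"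
    if "0 \<le> s" "s \<le> 1" for s
    by (rule H2_coeff_inject)
      (rule ext, simp only: H2_coeff_dilate[OF that] H2_coeff_sum H2_coeff_monomial p_def H2_coeff_truncate
        H2_coeff_scaleC if_distrib[of "\<lambda>x. _ * x"], simp add: eq_commute[of _ "_ :: 'i \<Rightarrow> nat"] cong: if_cong)
  have "(\<lambda>n. \<Sum>k\<in>degree_box m. (of_real (r n ^ total_degree k) * H2_coeff f k) *\<^sub>C monomial k)
      \<longlonglongrightarrow> (\<Sum>k\<in>degree_box m. (of_real (1 ^ total_degree k) * H2_coeff f k) *\<^sub>C monomial k)"
    by (intro tendsto_sum tendsto_scaleC tendsto_const tendsto_mult tendsto_of_real tendsto_power lim)
  then have "(\<lambda>n. dilate (r n) p) \<longlonglongrightarrow> p"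
    unfolding dp[OF r] by (simp add: p_def truncate_def)
  then obtain N where N: "\<And>n. n \<ge> N \<Longrightarrow> norm (dilate (r n) p - p) < e / 3"
    using LIMSEQ_D[of "\<lambda>n. dilate (r n) p" p "e / 3"] e by auto
  have "dist (dilate (r n) f) f < e" if "n \<ge> N" for n
  proof -
    have "dilate (r n) f - f = dilate (r n) (f - p) + (dilate (r n) p - p) + (p - f)"
      by (simp add: lin r)
    then have "norm (dilate (r n) f - f) \<le> norm (dilate (r n) (f - p)) + norm (dilate (r n) p - p) + norm (p - f)"
      using norm_triangle_ineq[of "dilate (r n) (f - p) + (dilate (r n) p - p)" "p - f"]
        norm_triangle_ineq[of "dilate (r n) (f - p)" "dilate (r n) p - p"] by simp
    moreover have "norm (dilate (r n) (f - p)) < e / 3" "norm (p - f) < e / 3"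
      using m norm_dilate_le[OF r, of n "f - p"] by (auto simp: p_def norm_minus_commute)
    ultimately show ?thesis using N[OF that] by (simp add: dist_norm)
  qed
  then show "\<exists>N. \<forall>n\<ge>N. dist (dilate (r n) f) f < e" by blast
qed

lemma torus_point_in_polydisc: "0 \<le> r \<Longrightarrow> r < 1 \<Longrightarrow> torus_point r \<theta> \<in> polydisc"
  by (simp add: polydisc_def torus_point_def norm_mult)

lemma continuous_on_torus_point: "continuous_on A (torus_point r)"
  unfolding torus_point_def by (intro continuous_on_vec_lambda continuous_intros)

lemma borel_measurable_torus_point:
  fixes f :: "complex^'i::finite \<Rightarrow> complex"
  assumes "continuous_on polydisc f" "0 \<le> r" "r < 1"
  shows "(\<lambda>\<theta>. f (torus_point r \<theta>)) \<in> borel_measurable borel"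
  by (rule borel_measurable_continuous_onI)
    (intro continuous_on_compose2[OF assms(1)] continuous_on_torus_point, use assms torus_point_in_polydisc in auto)

lemma Rep_H2_torus_bound:
  fixes f :: "'i::finite H2"
  assumes "0 \<le> r" "r < 1"
  shows "norm (Rep_H2 f (torus_point r \<theta>)) \<le> norm f * sqrt ((1 / (1 - r)) ^ CARD('i))"
proof -
  have "norm (szego_kernel (torus_point r \<theta> :: complex^'i)) \<le> sqrt ((1 / (1 - r)) ^ CARD('i))"
    by (rule real_le_rsqrt, rule norm_szego_kernel_le) (use assms in \<open>auto simp: torus_point_def norm_mult\<close>)
  then show ?thesis
    unfolding Rep_H2_eq_cinner[OF torus_point_in_polydisc[OF assms]]
    by (intro order_trans[OF norm_cinner_le] mult_left_mono) auto
qed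

lemma norm_truncate_le: "norm (truncate n f) \<le> norm f"
proof -
  have "(norm (truncate n f))\<^sup>2 \<le> (norm f)\<^sup>2"
    using norm_power2_H2 norm_power2_H2
    by (rule has_sum_mono) (auto simp: H2_coeff_truncate)
  then show ?thesis by (simp add: power2_le_iff_abs_le)
qed

lemma borel_measurable_cnj':
  assumes "f \<in> borel_measurable M"
  shows "(\<lambda>x. cnj (f x)) \<in> borel_measurable M"
  using measurable_compose[OF assms borel_measurable_continuous_onI[of cnj]] by (simp add: continuous_on_cnj)

text \<open>For truncations this is the orthogonality of the monomials on the torus; the truncations
  converge boundedly on the torus of radius \<open>r < 1\<close>.\<close>

lemma torus_parseval:
  fixes f g :: "'i::finite H2"
  assumes r: "0 \<le> r" "r < 1"
  shows "(\<integral>\<theta>. indicator (torus_box a N) \<theta> *\<^sub>R (Rep_H2 f (torus_point r \<theta>) * cnj (Rep_H2 g (torus_point r \<theta>))) \<partial>lborel)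
    = of_real ((2 * pi * N) ^ CARD('i)) * cinner (dilate r f) (dilate r g)"
proof -
  define c where "c = complex_of_real ((2 * pi * N) ^ CARD('i))"
  define K where "K = sqrt ((1 / (1 - r)) ^ CARD('i))"
  define I where "I u v = (\<integral>\<theta>. indicator (torus_box a N) \<theta> *\<^sub>R
      (Rep_H2 u (torus_point r \<theta>) * cnj (Rep_H2 v (torus_point r \<theta>))) \<partial>lborel)" for u v :: "'i H2"
  have meas: "(\<lambda>\<theta>. Rep_H2 u (torus_point r \<theta>)) \<in> borel_measurable borel" for u :: "'i H2"
    by (rule borel_measurable_torus_point[OF continuous_on_Rep_H2 r])
  have "(\<lambda>n. I (truncate n f) (truncate n g)) \<longlonglongrightarrow> I f g"
    unfolding I_def
  proof (rule torus_integral_dominated_convergence)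
    show "(\<lambda>\<theta>. Rep_H2 u (torus_point r \<theta>) * cnj (Rep_H2 v (torus_point r \<theta>))) \<in> borel_measurable borel" for u v :: "'i H2"
      by (intro borel_measurable_times meas borel_measurable_cnj')
    then show "(\<lambda>\<theta>. Rep_H2 f (torus_point r \<theta>) * cnj (Rep_H2 g (torus_point r \<theta>))) \<in> borel_measurable borel" .
    fix n and \<theta> :: "real^'i"
    have K: "norm (Rep_H2 (truncate n u) (torus_point r \<theta>)) \<le> norm u * K" for u
      using order_trans[OF Rep_H2_torus_bound[OF r, of "truncate n u" \<theta>]
          mult_right_mono[OF norm_truncate_le[of n u]]] r by (simp add: K_def)
    have "norm (Rep_H2 (truncate n f) (torus_point r \<theta>)) * norm (Rep_H2 (truncate n g) (torus_point r \<theta>))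
        \<le> (norm f * K) * (norm g * K)"
      by (intro mult_mono K) (use order_trans[OF norm_ge_zero K] in auto)
    then show "norm (Rep_H2 (truncate n f) (torus_point r \<theta>) * cnj (Rep_H2 (truncate n g) (torus_point r \<theta>)))
        \<le> (norm f * K) * (norm g * K)"
      by (simp add: norm_mult)
  next
    show "AE \<theta> in lborel. \<theta> \<in> torus_box a N \<longrightarrow>
        (\<lambda>n. Rep_H2 (truncate n f) (torus_point r \<theta>) * cnj (Rep_H2 (truncate n g) (torus_point r \<theta>)))
        \<longlonglongrightarrow> Rep_H2 f (torus_point r \<theta>) * cnj (Rep_H2 g (torus_point r \<theta>))"
      by (intro AE_I2 impI tendsto_intros tendsto_Rep_H2 truncate_tendsto)
  qed
  moreover have "I (truncate n f) (truncate n g)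
      = c * (\<Sum>k\<in>degree_box n. H2_coeff (dilate r f) k * cnj (H2_coeff (dilate r g) k))" for n
  proof -
    let ?z = "\<lambda>\<theta> k. zpow (torus_point 1 \<theta>) k"
    let ?a = "\<lambda>k. H2_coeff (dilate r f) k" and ?b = "\<lambda>k. H2_coeff (dilate r g) k"
    have Rep: "Rep_H2 (truncate n u) (torus_point r \<theta>) = (\<Sum>k\<in>degree_box n. H2_coeff (dilate r u) k * ?z \<theta> k)"
      for u and \<theta> :: "real^'i"
      using r by (subst Rep_truncate[OF torus_point_in_polydisc[OF r]], subst zpow_torus_point)
        (simp add: H2_coeff_dilate mult_ac)
    have int: "integrable lborel (\<lambda>\<theta>. indicator (torus_box a N) \<theta> *\<^sub>R (?z \<theta> k * cnj (?z \<theta> l)))" for k l :: "'i \<Rightarrow> nat"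
    proof (rule integrable_torus_box_bounded)
      show "(\<lambda>\<theta>. ?z \<theta> k * cnj (?z \<theta> l)) \<in> borel_measurable borel"
        by (intro borel_measurable_continuous_onI continuous_intros
            continuous_on_compose2[OF continuous_on_zpow[of UNIV] continuous_on_torus_point]) auto
      show "norm (?z \<theta> k * cnj (?z \<theta> l)) \<le> 1" for \<theta> by (simp add: norm_mult norm_zpow_torus_point_1)
    qed
    have "I (truncate n f) (truncate n g) = (\<integral>\<theta>. (\<Sum>k\<in>degree_box n. \<Sum>l\<in>degree_box n.
        (?a k * cnj (?b l)) * (indicator (torus_box a N) \<theta> *\<^sub>R (?z \<theta> k * cnj (?z \<theta> l)))) \<partial>lborel)"
      unfolding I_def Rep cnj_sum sum_product scaleR_sum_right
      by (intro Bochner_Integration.integral_cong sum.cong refl) (simp add: scaleR_conv_of_real mult_ac)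
    also have "\<dots> = (\<Sum>k\<in>degree_box n. \<Sum>l\<in>degree_box n.
        (\<integral>\<theta>. (?a k * cnj (?b l)) * (indicator (torus_box a N) \<theta> *\<^sub>R (?z \<theta> k * cnj (?z \<theta> l))) \<partial>lborel))"
      by (subst Bochner_Integration.integral_sum,
          intro Bochner_Integration.integrable_sum integrable_mult_right int,
          intro sum.cong refl, rule Bochner_Integration.integral_sum, intro integrable_mult_right int)
    also have "\<dots> = (\<Sum>k\<in>degree_box n. \<Sum>l\<in>degree_box n. (?a k * cnj (?b l)) * (if k = l then c else 0))"
      by (simp only: integral_mult_right_zero torus_orthogonality c_def)
    also have "\<dots> = c * (\<Sum>k\<in>degree_box n. ?a k * cnj (?b k))"
      by (simp add: if_distrib[of "\<lambda>x. _ * x"] sum_distrib_left mult_ac cong: if_cong)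
    finally show ?thesis .
  qed
  moreover have "(\<lambda>n. c * (\<Sum>k\<in>degree_box n. H2_coeff (dilate r f) k * cnj (H2_coeff (dilate r g) k)))
      \<longlonglongrightarrow> c * cinner (dilate r f) (dilate r g)"
    by (intro tendsto_mult tendsto_const has_sum_degree_box cinner_has_sum)
  ultimately have "I f g = c * cinner (dilate r f) (dilate r g)" using LIMSEQ_unique by simp
  then show ?thesis by (simp add: I_def c_def)
qed


section \<open>Power series of bounded analytic functions\<close>

text \<open>The weight with which the Cauchy formula on the circle of radius \<open>r\<close> becomes an integral
  over the angle.\<close>

definition cauchy_kernel :: "real \<Rightarrow> complex \<Rightarrow> real \<Rightarrow> complex" where
  "cauchy_kernel r \<zeta> t = indicator {0..2 * pi} t *\<^sub>R (1 / (2 * of_real pi * (1 - \<zeta> * cis (- t) / of_real r)))"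

lemma cauchy_kernel_nonzero:
  assumes "0 < r" "norm \<zeta> < r"
  shows "1 - \<zeta> * cis (- t) / of_real r \<noteq> 0"
proof
  assume "1 - \<zeta> * cis (- t) / of_real r = 0"
  then have "\<zeta> * cis (- t) / of_real r = 1" by simp
  then have "norm (\<zeta> * cis (- t) / of_real r) = 1" by simp
  then show False using assms by (simp add: norm_mult norm_divide)
qed

lemma integrable_cauchy_kernel:
  assumes "0 < r" "norm \<zeta> < r"
  shows "integrable lborel (cauchy_kernel r \<zeta>)"
  unfolding cauchy_kernel_def using cauchy_kernel_nonzero[OF assms] assms
  by (intro integrable_Icc_indicator continuous_intros) auto

lemma cauchy_integral_circle:
  assumes hol: "h holomorphic_on ball 0 1" and r: "0 < r" "r < 1" and \<zeta>: "norm \<zeta> < r"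
  shows "(\<integral>t. h (of_real r * cis t) * cauchy_kernel r \<zeta> t \<partial>lborel) = h \<zeta>"
proof -
  define \<phi> where "\<phi> t = h (of_real r * cis t) * (1 / (2 * of_real pi * (1 - \<zeta> * cis (- t) / of_real r)))" for t
  have "((\<lambda>u. h u / (u - \<zeta>)) has_contour_integral (2 * of_real pi * \<i> * h \<zeta>)) (circlepath 0 r)"
    by (rule Cauchy_integral_circlepath_simple) (use hol r \<zeta> in \<open>auto intro: holomorphic_on_subset\<close>)
  then have "((\<lambda>t. h (0 + of_real r * cis t) / (0 + of_real r * cis t - \<zeta>) * of_real r * \<i> * cis t)
      has_integral (2 * of_real pi * \<i> * h \<zeta>)) {0..2 * pi}"
    unfolding circlepath_def by (subst (asm) has_contour_integral_part_circlepath_iff) auto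
  then have "((\<lambda>t. h (0 + of_real r * cis t) / (0 + of_real r * cis t - \<zeta>) * of_real r * \<i> * cis t * (1 / (2 * of_real pi * \<i>)))
      has_integral (2 * of_real pi * \<i> * h \<zeta> * (1 / (2 * of_real pi * \<i>)))) {0..2 * pi}"
    by (rule has_integral_mult_left)
  moreover have "h (0 + of_real r * cis t) / (0 + of_real r * cis t - \<zeta>) * of_real r * \<i> * cis t * (1 / (2 * of_real pi * \<i>)) = \<phi> t" for t
  proof -
    have ne: "of_real r * cis t - \<zeta> \<noteq> 0"
    proof
      assume "of_real r * cis t - \<zeta> = 0"
      then have "norm \<zeta> = norm (of_real r * cis t)" by simp
      then show False using \<zeta> r by (simp add: norm_mult)
    qed
    have "1 - \<zeta> * cis (- t) / of_real r = (of_real r * cis t - \<zeta>) / (of_real r * cis t)"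
      using r by (simp add: cis_inverse[symmetric] field_simps)
    then show ?thesis using ne r unfolding \<phi>_def by (simp only:) (simp add: field_simps)
  qed
  ultimately have hk: "(\<phi> has_integral h \<zeta>) {0..2 * pi}" by simp
  have "continuous_on {0..2 * pi} \<phi>"
    unfolding \<phi>_def
    by (intro continuous_intros continuous_on_compose2[OF holomorphic_on_imp_continuous_on[OF hol]])
      (use r cauchy_kernel_nonzero[OF r(1) \<zeta>] in \<open>auto simp: norm_mult\<close>)
  then have "set_integrable lborel {0..2 * pi} \<phi>" by (rule borel_integrable_atLeastAtMost')
  then have "(LINT t:{0..2 * pi}|lborel. \<phi> t) = integral {0..2 * pi} \<phi>"
    by (rule set_borel_integral_eq_integral(2))
  then have "(LINT t:{0..2 * pi}|lborel. \<phi> t) = h \<zeta>" using integral_unique[OF hk] by simp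
  then show ?thesis
    unfolding set_lebesgue_integral_def cauchy_kernel_def \<phi>_def by (simp add: scaleR_conv_of_real mult_ac)
qed

lemma borel_measurable_partial_torus_point:
  fixes z :: "complex^'i::finite"
  shows "(\<lambda>x. \<chi> j. if j \<in> J then of_real r * cis (x j) else z $ j) \<in> PiM J (\<lambda>_. lborel) \<rightarrow>\<^sub>M borel"
proof (rule borel_measurable_euclidean_space[THEN iffD2], rule ballI)
  fix b :: "complex^'i" assume "b \<in> Basis"
  then obtain i u where b: "b = axis i u" by (auto simp: Basis_vec_def)
  have cis: "cis \<in> borel_measurable borel" by (intro borel_measurable_continuous_onI continuous_intros)
  have "(\<lambda>x. (if i \<in> J then of_real r * cis (x i) else z $ i) \<bullet> u) \<in> borel_measurable (PiM J (\<lambda>_. lborel))"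
  proof (cases "i \<in> J")
    case True
    have "(\<lambda>x. x i) \<in> PiM J (\<lambda>_. lborel :: real measure) \<rightarrow>\<^sub>M borel"
      using measurable_component_singleton[OF True, of "\<lambda>_. lborel :: real measure"] by simp
    from measurable_compose[OF this cis] show ?thesis using True by simp
  qed simp
  then show "(\<lambda>x. (\<chi> j. if j \<in> J then of_real r * cis (x j) else z $ j) \<bullet> b) \<in> borel_measurable (PiM J (\<lambda>_. lborel))"
    by (simp add: b inner_axis)
qed

lemma H_infinityD:
  assumes "f \<in> H_infinity"
  shows "continuous_on polydisc f"
    and "z \<in> polydisc \<Longrightarrow> (\<lambda>w. f (\<chi> j. if j = i then w else z $ j)) holomorphic_on ball 0 1"
    and "\<exists>M. \<forall>z\<in>polydisc. norm (f z) \<le> M"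
  using assms by (auto simp: H_infinity_def bounded_iff)

text \<open>The iterated Cauchy formula: the variables in \<open>I\<close> are moved to the circle of radius \<open>r\<close> one
  after the other, by Fubini and the formula in one variable.\<close>

lemma cauchy_integral_polydisc_partial:
  fixes f :: "complex^'i::finite \<Rightarrow> complex"
  assumes f: "f \<in> H_infinity" and r: "0 < r" "r < 1" and z: "z \<in> polydisc"
    and I: "finite I" "\<And>i. i \<in> I \<Longrightarrow> norm (z $ i) < r"
  shows "(\<integral>x. f (\<chi> j. if j \<in> I then of_real r * cis (x j) else z $ j) * (\<Prod>j\<in>I. cauchy_kernel r (z $ j) (x j))
    \<partial>PiM I (\<lambda>_. lborel)) = f z"
  using I
proof induction
  case empty
  have "(\<chi> j. z $ j) = z" by simp
  then show ?case by (simp add: PiM_empty lebesgue_integral_count_space_finite)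
next
  case (insert i I)
  interpret product_sigma_finite "\<lambda>_::'i. lborel :: real measure" by standard
  let ?J = "insert i I"
  define w where "w J x = (\<chi> j. if j \<in> J then of_real r * cis (x j) else z $ j)" for J and x :: "'i \<Rightarrow> real"
  define F where "F x = f (w ?J x) * (\<Prod>j\<in>?J. cauchy_kernel r (z $ j) (x j))" for x
  have w: "w J x \<in> polydisc" for J x
    using z r by (auto simp: polydisc_def w_def norm_mult)
  obtain M where M: "\<And>z. z \<in> polydisc \<Longrightarrow> norm (f z) \<le> M" using H_infinityD(3)[OF f] by blast
  have intK: "integrable lborel (cauchy_kernel r (z $ j))" if "j \<in> ?J" for j
    by (rule integrable_cauchy_kernel[OF r(1) insert.prems[OF that]])
  have intP: "integrable (PiM ?J (\<lambda>_. lborel)) (\<lambda>x. \<Prod>j\<in>?J. cauchy_kernel r (z $ j) (x j))"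
    by (rule product_integrable_prod) (use insert.hyps intK in auto)
  have intF: "integrable (PiM ?J (\<lambda>_. lborel)) F"
  proof (rule Bochner_Integration.integrable_bound)
    show "integrable (PiM ?J (\<lambda>_. lborel)) (\<lambda>x. of_real M * (\<Prod>j\<in>?J. cauchy_kernel r (z $ j) (x j)))"
      by (rule integrable_mult_right[OF intP])
    have f': "(\<lambda>z. indicator polydisc z *\<^sub>R f z) \<in> borel_measurable borel"
      by (rule borel_measurable_continuous_on_indicator) (use borel_open[OF open_polydisc] H_infinityD(1)[OF f] in auto)
    have "(\<lambda>x. indicator polydisc (w ?J x) *\<^sub>R f (w ?J x)) \<in> borel_measurable (PiM ?J (\<lambda>_. lborel))"
      unfolding w_def by (rule measurable_compose[OF borel_measurable_partial_torus_point f'])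
    then have "(\<lambda>x. f (w ?J x)) \<in> borel_measurable (PiM ?J (\<lambda>_. lborel))" by (simp add: w)
    then show "F \<in> borel_measurable (PiM ?J (\<lambda>_. lborel))"
      unfolding F_def[abs_def] using borel_measurable_integrable[OF intP] by (rule borel_measurable_times)
    have "norm (F x) \<le> norm (of_real M * (\<Prod>j\<in>?J. cauchy_kernel r (z $ j) (x j)))" for x
      unfolding F_def norm_mult using M[OF w, of ?J x] by (intro mult_right_mono) auto
    then show "AE x in PiM ?J (\<lambda>_. lborel). norm (F x) \<le> norm (of_real M * (\<Prod>j\<in>?J. cauchy_kernel r (z $ j) (x j)))"
      by simp
  qed
  have "integral\<^sup>L (PiM ?J (\<lambda>_. lborel)) F = (\<integral>x. (\<integral>y. F (x(i := y)) \<partial>lborel) \<partial>PiM I (\<lambda>_. lborel))"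
    by (rule product_integral_insert[OF insert.hyps(1,2) intF])
  also have "\<dots> = (\<integral>x. f (w I x) * (\<Prod>j\<in>I. cauchy_kernel r (z $ j) (x j)) \<partial>PiM I (\<lambda>_. lborel))"
  proof (rule Bochner_Integration.integral_cong[OF refl])
    fix x :: "'i \<Rightarrow> real"
    let ?P = "\<Prod>j\<in>I. cauchy_kernel r (z $ j) (x j)"
    have "F (x(i := y)) = ?P * (f (\<chi> j. if j = i then of_real r * cis y else w I x $ j) * cauchy_kernel r (z $ i) y)" for y
    proof -
      have "w ?J (x(i := y)) = (\<chi> j. if j = i then of_real r * cis y else w I x $ j)"
        by (auto simp: w_def vec_eq_iff)
      moreover have "(\<Prod>j\<in>?J. cauchy_kernel r (z $ j) ((x(i := y)) j)) = cauchy_kernel r (z $ i) y * ?P"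
        using insert.hyps by (subst prod.insert) (auto intro!: arg_cong2[of _ _ _ _ "(*)"] prod.cong)
      ultimately show ?thesis by (simp add: F_def mult_ac)
    qed
    then have "(\<integral>y. F (x(i := y)) \<partial>lborel)
        = ?P * (\<integral>y. f (\<chi> j. if j = i then of_real r * cis y else w I x $ j) * cauchy_kernel r (z $ i) y \<partial>lborel)"
      by simp
    also have "(\<integral>y. f (\<chi> j. if j = i then of_real r * cis y else w I x $ j) * cauchy_kernel r (z $ i) y \<partial>lborel)
        = f (\<chi> j. if j = i then z $ i else w I x $ j)"
      by (rule cauchy_integral_circle[OF H_infinityD(2)[OF f w] r]) (use insert.prems in auto)
    also have "(\<chi> j. if j = i then z $ i else w I x $ j) = w I x"
      using insert.hyps(2) by (auto simp: w_def vec_eq_iff)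
    finally show "(\<integral>y. F (x(i := y)) \<partial>lborel) = f (w I x) * ?P" by (simp only: mult.commute)
  qed
  also have "\<dots> = f z" unfolding w_def by (rule insert.IH) (use insert.prems in auto)
  finally have "integral\<^sup>L (PiM ?J (\<lambda>_. lborel)) F = f z" .
  then show ?case unfolding F_def[abs_def] w_def .
qed

lemma norm_torus_integral_le:
  fixes f :: "real^'i::finite \<Rightarrow> complex"
  assumes f: "f \<in> borel_measurable borel" "\<And>\<theta>. norm (f \<theta>) \<le> C"
  shows "norm (\<integral>\<theta>. indicator (torus_box a N) \<theta> *\<^sub>R f \<theta> \<partial>lborel) \<le> C * (2 * pi * N) ^ CARD('i)"
proof -
  have "norm (\<integral>\<theta>. indicator (torus_box a N) \<theta> *\<^sub>R f \<theta> \<partial>lborel)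
      \<le> (\<integral>\<theta>. norm (indicator (torus_box a N) \<theta> *\<^sub>R f \<theta>) \<partial>lborel)"
    by (rule integral_norm_bound)
  also have "\<dots> \<le> (\<integral>\<theta>. C * indicator (torus_box a N) \<theta> \<partial>(lborel :: (real^'i) measure))"
  proof (rule integral_mono)
    show "integrable lborel (\<lambda>\<theta>. norm (indicator (torus_box a N) \<theta> *\<^sub>R f \<theta>))"
      by (rule integrable_norm[OF integrable_torus_box_bounded[OF f]])
    show "integrable lborel (\<lambda>\<theta> :: real^'i. C * indicator (torus_box a N) \<theta>)"
      by (intro integrable_mult_right integrable_torus_box)
  qed (use f(2) in \<open>auto simp: indicator_def\<close>)
  also have "\<dots> = C * (2 * pi * N) ^ CARD('i)"
    unfolding integral_mult_right_zero integral_torus_box by simp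
  finally show ?thesis .
qed

text \<open>In the Cauchy formula over the torus of radius \<open>r\<close> the kernel is expanded into a geometric
  series, whose partial sums are bounded on the torus, so that the series may be integrated term by
  term.  The coefficients \<open>c k\<close> are averages of \<open>f\<close> times unimodular functions; this bounds them by \<open>M\<close>.\<close>

lemma H_infinity_series_on_smaller_polydisc:
  fixes f :: "complex^'i::finite \<Rightarrow> complex"
  assumes f: "f \<in> H_infinity" and M: "\<And>z. z \<in> polydisc \<Longrightarrow> norm (f z) \<le> M" and r: "0 < r" "r < 1"
  obtains c where "\<And>k. norm (c k) \<le> M"
    "\<And>z. (\<And>i. norm (z $ i) < r) \<Longrightarrow>
      (\<lambda>n. \<Sum>k\<in>degree_box n. zpow z k * (c k / of_real (r ^ total_degree k))) \<longlonglongrightarrow> f z"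
proof -
  let ?B = "torus_box 0 1 :: (real^'i) set"
  define V where "V = complex_of_real ((2 * pi) ^ CARD('i))"
  have V: "V \<noteq> 0" and nV: "norm V = (2 * pi) ^ CARD('i)" by (simp_all add: V_def norm_power norm_mult)
  let ?I = "\<lambda>g :: real^'i \<Rightarrow> complex. \<integral>\<theta>. indicator ?B \<theta> *\<^sub>R g \<theta> \<partial>lborel"
  define c where "c k = ?I (\<lambda>\<theta>. f (torus_point r \<theta>) * cnj (zpow (torus_point 1 \<theta>) k)) / V" for k
  have r0: "0 \<le> r" using r by simp
  have mf: "(\<lambda>\<theta>. f (torus_point r \<theta>)) \<in> borel_measurable borel"
    by (rule borel_measurable_torus_point[OF H_infinityD(1)[OF f] r0 r(2)])
  have nf: "norm (f (torus_point r \<theta>)) \<le> M" for \<theta>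
    by (rule M[OF torus_point_in_polydisc[OF r0 r(2)]])
  have mz: "(\<lambda>\<theta>. cnj (zpow (torus_point 1 \<theta>) k)) \<in> borel_measurable borel" for k :: "'i \<Rightarrow> nat"
    by (intro borel_measurable_continuous_onI continuous_intros
        continuous_on_compose2[OF continuous_on_zpow[of UNIV] continuous_on_torus_point]) auto
  have mfz: "(\<lambda>\<theta>. f (torus_point r \<theta>) * cnj (zpow (torus_point 1 \<theta>) k)) \<in> borel_measurable borel" for k
    by (rule borel_measurable_times[OF mf mz])
  have nfz: "norm (f (torus_point r \<theta>) * cnj (zpow (torus_point 1 \<theta>) k)) \<le> M" for k \<theta>
    using nf by (simp add: norm_mult norm_zpow_torus_point_1)
  have "norm (c k) \<le> M" for k
    using norm_torus_integral_le[OF mfz nfz, of 0 1 k] by (simp add: c_def norm_divide nV divide_le_eq)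
  moreover have "(\<lambda>n. \<Sum>k\<in>degree_box n. zpow z k * (c k / of_real (r ^ total_degree k))) \<longlonglongrightarrow> f z"
    if zr: "\<And>i. norm (z $ i) < r" for z
  proof -
    have z: "z \<in> polydisc" using less_trans[OF zr r(2)] by (simp add: polydisc_def)
    define u where "u \<theta> = (\<chi> i. z $ i * cis (- \<theta> $ i) / of_real r)" for \<theta> :: "real^'i"
    have u: "u \<theta> \<in> polydisc" for \<theta>
      using zr r by (auto simp: polydisc_def u_def norm_mult norm_divide)
    have zu: "zpow (u \<theta>) k = zpow z k / of_real (r ^ total_degree k) * cnj (zpow (torus_point 1 \<theta>) k)" for \<theta> k
    proof -
      have "cis (- t) = cnj (cis t)" for t by (simp add: cis_cnj)
      then show ?thesis
        by (simp add: zpow_def u_def torus_point_def total_degree_def power_sum power_mult_distrib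
            power_divide prod.distrib prod_dividef mult_ac)
    qed
    have nzu: "norm (zpow (u \<theta>) k) = norm (zpow (\<chi> i. z $ i / of_real r) k)" for \<theta> k
      by (simp add: zpow_def u_def norm_power norm_mult norm_divide flip: prod_norm)
    have zr': "(\<chi> i. z $ i / of_real r) \<in> polydisc" using zr r by (auto simp: polydisc_def norm_divide)
    define K where "K = (\<Sum>\<^sub>\<infinity>k. norm (zpow (\<chi> i. z $ i / of_real r) k))"
    let ?S = "\<lambda>n \<theta>. \<Sum>k\<in>degree_box n. zpow (u \<theta>) k"
    have nS: "norm (?S n \<theta>) \<le> K" for n \<theta>
    proof -
      have "norm (?S n \<theta>) \<le> (\<Sum>k\<in>degree_box n. norm (zpow (\<chi> i. z $ i / of_real r) k))"
        using norm_sum[of "\<lambda>k. zpow (u \<theta>) k" "degree_box n"] by (simp add: nzu)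
      also have "\<dots> \<le> K"
        unfolding K_def by (rule finite_sum_le_infsum[OF zpow_summable[OF zr']]) auto
      finally show ?thesis .
    qed
    have mS: "(\<lambda>\<theta>. ?S n \<theta>) \<in> borel_measurable borel" for n
      unfolding zu by (intro borel_measurable_sum borel_measurable_times borel_measurable_const mz)
    have mu: "(\<lambda>\<theta>. \<Prod>i\<in>UNIV. 1 / (1 - u \<theta> $ i)) \<in> borel_measurable borel"
    proof (rule borel_measurable_LIMSEQ_metric[OF mS])
      show "(\<lambda>n. ?S n \<theta>) \<longlonglongrightarrow> (\<Prod>i\<in>UNIV. 1 / (1 - u \<theta> $ i))" for \<theta>
        by (rule has_sum_degree_box[OF has_sum_zpow[OF u]])
    qed
    have lim: "(\<lambda>n. ?I (\<lambda>\<theta>. f (torus_point r \<theta>) * ?S n \<theta>)) \<longlonglongrightarrow> ?I (\<lambda>\<theta>. f (torus_point r \<theta>) * (\<Prod>i\<in>UNIV. 1 / (1 - u \<theta> $ i)))"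
    proof (rule torus_integral_dominated_convergence[where C = "M * K"])
      show "norm (f (torus_point r \<theta>) * ?S n \<theta>) \<le> M * K" for n \<theta>
        unfolding norm_mult by (intro mult_mono nf nS) (use order_trans[OF norm_ge_zero nf] in auto)
      show "AE \<theta> in lborel. \<theta> \<in> ?B \<longrightarrow> (\<lambda>n. f (torus_point r \<theta>) * ?S n \<theta>)
          \<longlonglongrightarrow> f (torus_point r \<theta>) * (\<Prod>i\<in>UNIV. 1 / (1 - u \<theta> $ i))"
        by (intro AE_I2 impI tendsto_mult tendsto_const has_sum_degree_box has_sum_zpow u)
    qed (intro borel_measurable_times mf mS mu)+
    have "?I (\<lambda>\<theta>. f (torus_point r \<theta>) * ?S n \<theta>) / V
        = (\<Sum>k\<in>degree_box n. zpow z k * (c k / of_real (r ^ total_degree k)))" for n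
    proof -
      have "?I (\<lambda>\<theta>. f (torus_point r \<theta>) * ?S n \<theta>) = (\<integral>\<theta>. (\<Sum>k\<in>degree_box n. (zpow z k / of_real (r ^ total_degree k)) *
          (indicator ?B \<theta> *\<^sub>R (f (torus_point r \<theta>) * cnj (zpow (torus_point 1 \<theta>) k)))) \<partial>lborel)"
        unfolding zu sum_distrib_left scaleR_sum_right
        by (intro Bochner_Integration.integral_cong sum.cong refl) (simp add: scaleR_conv_of_real mult_ac)
      also have "\<dots> = (\<Sum>k\<in>degree_box n. \<integral>\<theta>. (zpow z k / of_real (r ^ total_degree k)) *
          (indicator ?B \<theta> *\<^sub>R (f (torus_point r \<theta>) * cnj (zpow (torus_point 1 \<theta>) k))) \<partial>lborel)"
        by (rule Bochner_Integration.integral_sum)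
          (intro integrable_mult_right integrable_torus_box_bounded[OF mfz nfz])
      also have "\<dots> = (\<Sum>k\<in>degree_box n. (zpow z k / of_real (r ^ total_degree k)) * (c k * V))"
        unfolding integral_mult_right_zero c_def using V by simp
      finally show ?thesis using V by (simp add: sum_divide_distrib)
    qed
    moreover have "?I (\<lambda>\<theta>. f (torus_point r \<theta>) * (\<Prod>i\<in>UNIV. 1 / (1 - u \<theta> $ i))) / V = f z"
    proof -
      let ?G = "\<lambda>\<theta> :: real^'i. f (torus_point r \<theta>) * (\<Prod>i\<in>UNIV. cauchy_kernel r (z $ i) (\<theta> $ i))"
      have G: "?G \<theta> = (indicator ?B \<theta> *\<^sub>R (f (torus_point r \<theta>) * (\<Prod>i\<in>UNIV. 1 / (1 - u \<theta> $ i)))) / V" for \<theta>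
      proof -
        have "(\<Prod>i\<in>UNIV. cauchy_kernel r (z $ i) (\<theta> $ i))
            = (\<Prod>i\<in>UNIV. complex_of_real (indicator {0..2 * pi} (\<theta> $ i)) * ((1 / (2 * of_real pi)) * (1 / (1 - u \<theta> $ i))))"
          unfolding cauchy_kernel_def u_def by (rule prod.cong) (auto simp: scaleR_conv_of_real)
        also have "\<dots> = complex_of_real (indicator ?B \<theta>) * ((1 / V) * (\<Prod>i\<in>UNIV. 1 / (1 - u \<theta> $ i)))"
          unfolding prod.distrib indicator_torus_box by (simp add: V_def power_one_over)
        finally show ?thesis by (simp add: scaleR_conv_of_real)
      qed
      have mG: "?G \<in> borel_measurable borel"
      proof -
        have "(indicator ?B :: real^'i \<Rightarrow> real) \<in> borel_measurable borel"
          using borel_measurable_integrable[OF integrable_torus_box] by simp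
        then show ?thesis
          unfolding G by (intro borel_measurable_divide borel_measurable_scaleR borel_measurable_times mf mu) auto
      qed
      have "(\<integral>\<theta>. ?G \<theta> \<partial>lborel) = (\<integral>x. ?G (vec_lambda x) \<partial>PiM UNIV (\<lambda>_. lborel))"
        by (subst lborel_vec) (rule integral_distr[OF measurable_vec_lambda_PiM mG])
      also have "\<dots> = f z"
        using cauchy_integral_polydisc_partial[OF f r z finite, of UNIV] zr by (simp add: torus_point_def)
      finally show ?thesis unfolding G by simp
    qed
    ultimately show ?thesis using tendsto_divide[OF lim tendsto_const[of V] V] by simp
  qed
  ultimately show ?thesis using that by blast
qed

text \<open>The offset makes all radii positive.\<close>

definition radius_seq :: "nat \<Rightarrow> real" where "radius_seq n = 1 - 1 / real (n + 2)"

lemma radius_seq: "0 \<le> radius_seq n" "radius_seq n < 1" "radius_seq n \<le> 1" "0 < radius_seq n"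
  by (auto simp: radius_seq_def field_simps)

lemma radius_seq_tendsto: "radius_seq \<longlonglongrightarrow> 1"
proof -
  have "(\<lambda>n. 1 - 1 / real (n + 2)) \<longlonglongrightarrow> 1 - 0"
    by (intro tendsto_diff tendsto_const) (use LIMSEQ_ignore_initial_segment[OF lim_1_over_n, of 2] in simp)
  then show ?thesis by (simp add: radius_seq_def[abs_def])
qed

lemma radius_seq_at_left: "filterlim radius_seq (at_left 1) sequentially"
  by (rule tendsto_imp_filterlim_at_left[OF radius_seq_tendsto]) (use radius_seq in auto)

lemma norm_zpow_const: "0 \<le> q \<Longrightarrow> norm (zpow (\<chi> i. complex_of_real q) k) = q ^ total_degree k"
  by (simp add: zpow_def total_degree_def norm_power power_sum flip: prod_norm)

text \<open>The coefficients of \<open>f (s z)\<close> decay geometrically in the total degree, which puts this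
  function into the Hardy space.  Its norm is the limit of its mean squares over tori of radius less
  than one, where it is bounded by \<open>M\<close>.\<close>

lemma H_infinity_dilation:
  fixes f :: "complex^'i::finite \<Rightarrow> complex"
  assumes f: "f \<in> H_infinity" and M: "\<And>z. z \<in> polydisc \<Longrightarrow> norm (f z) \<le> M" and s: "0 < s" "s < 1"
  obtains F where "\<And>z. z \<in> polydisc \<Longrightarrow> Rep_H2 F z = f (\<chi> i. of_real s * z $ i)" "norm F \<le> M"
proof -
  \<comment> \<open>Expanding on a polydisc of radius \<open>r > s\<close> leaves the decay \<open>(s / r) ^ total_degree k\<close>.\<close>
  define r where "r = (1 + s) / 2"
  have r: "0 < r" "r < 1" "s < r" using s by (auto simp: r_def)
  obtain c where c: "\<And>k. norm (c k) \<le> M" "\<And>z. (\<And>i. norm (z $ i) < r) \<Longrightarrow>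
      (\<lambda>n. \<Sum>k\<in>degree_box n. zpow z k * (c k / of_real (r ^ total_degree k))) \<longlonglongrightarrow> f z"
    using H_infinity_series_on_smaller_polydisc[OF f M r(1,2)] by blast
  define q where "q = s / r"
  have q: "0 \<le> q" "q < 1" using r s by (auto simp: q_def)
  define b where "b k = c k * of_real (q ^ total_degree k)" for k :: "'i \<Rightarrow> nat"
  have M0: "0 \<le> M" using order_trans[OF norm_ge_zero c(1)] .
  have "(\<lambda>k. (norm (b k))\<^sup>2) summable_on UNIV"
  proof (rule summable_on_comparison_test)
    have "(\<chi> i::'i. complex_of_real q) \<in> polydisc" using q by (simp add: polydisc_def)
    then show "(\<lambda>k :: 'i \<Rightarrow> nat. M\<^sup>2 * norm (zpow (\<chi> i. complex_of_real q) k)) summable_on UNIV"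
      by (intro summable_on_cmult_right zpow_summable)
    fix k :: "'i \<Rightarrow> nat"
    have "(norm (c k))\<^sup>2 \<le> M\<^sup>2" by (intro power_mono c) auto
    moreover have "(q ^ total_degree k)\<^sup>2 \<le> q ^ total_degree k"
      using q by (simp add: power2_eq_square mult_left_le power_le_one)
    ultimately have "(norm (c k))\<^sup>2 * (q ^ total_degree k)\<^sup>2 \<le> M\<^sup>2 * q ^ total_degree k"
      by (intro mult_mono) (use q in auto)
    then show "(norm (b k))\<^sup>2 \<le> M\<^sup>2 * norm (zpow (\<chi> i. complex_of_real q) k)"
      using q by (simp add: norm_zpow_const b_def norm_mult norm_power power_mult_distrib)
  qed auto
  then have coeff: "H2_coeff (H2_of_coeff b) = b" by (rule H2_coeff_of_coeff)
  let ?F = "H2_of_coeff b"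
  have Rep: "Rep_H2 ?F z = f (\<chi> i. of_real s * z $ i)" if z: "z \<in> polydisc" for z
  proof (rule LIMSEQ_unique)
    show "(\<lambda>n. \<Sum>k\<in>degree_box n. zpow z k * b k) \<longlonglongrightarrow> Rep_H2 ?F z"
      using has_sum_degree_box[OF H2_coeff_has_sum[OF z, of ?F]] by (simp add: coeff)
    have "norm ((\<chi> i. of_real s * z $ i) $ i) < r" for i
    proof -
      have "s * norm (z $ i) \<le> s * 1" using z s by (intro mult_left_mono) (auto simp: polydisc_def less_imp_le)
      then have "s * norm (z $ i) < r" using r by linarith
      then show ?thesis using s by (simp add: norm_mult)
    qed
    from c(2)[OF this]
    show "(\<lambda>n. \<Sum>k\<in>degree_box n. zpow z k * b k) \<longlonglongrightarrow> f (\<chi> i. of_real s * z $ i)"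
      by (simp add: zpow_scale b_def q_def power_divide mult_ac)
  qed
  note t = radius_seq(1-3)
  have "norm (dilate (radius_seq n) ?F) \<le> M" for n
  proof -
    let ?g = "\<lambda>\<theta>. Rep_H2 ?F (torus_point (radius_seq n) \<theta>) * cnj (Rep_H2 ?F (torus_point (radius_seq n) \<theta>))"
    have m: "(\<lambda>\<theta>. Rep_H2 ?F (torus_point (radius_seq n) \<theta>)) \<in> borel_measurable borel"
      by (rule borel_measurable_torus_point[OF continuous_on_Rep_H2 t(1,2)])
    have "norm (?g \<theta>) \<le> M * M" for \<theta>
    proof -
      have p: "torus_point (radius_seq n) \<theta> \<in> polydisc" by (rule torus_point_in_polydisc[OF t(1,2)])
      have "(\<chi> i. of_real s * torus_point (radius_seq n) \<theta> $ i) = torus_point (s * radius_seq n) \<theta>"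
        by (simp add: torus_point_def vec_eq_iff)
      moreover have "torus_point (s * radius_seq n) \<theta> \<in> polydisc"
        by (rule torus_point_in_polydisc) (use s t[of n] mult_strict_mono[of s 1 "radius_seq n" 1] in auto)
      ultimately have "norm (Rep_H2 ?F (torus_point (radius_seq n) \<theta>)) \<le> M" using M by (simp add: Rep[OF p])
      then show ?thesis unfolding norm_mult complex_mod_cnj by (intro mult_mono) (use M0 in auto)
    qed
    then have "norm (\<integral>\<theta>. indicator (torus_box 0 1) \<theta> *\<^sub>R ?g \<theta> \<partial>lborel) \<le> M * M * (2 * pi * real 1) ^ CARD('i)"
      by (intro norm_torus_integral_le borel_measurable_times borel_measurable_cnj' m)
    then have "(norm (dilate (radius_seq n) ?F))\<^sup>2 \<le> M\<^sup>2"
      unfolding torus_parseval[OF t(1,2)] cinner_self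
      by (simp add: norm_mult norm_power power2_eq_square)
    then show ?thesis using M0 by (simp add: power2_le_iff_abs_le)
  qed
  moreover have "(\<lambda>n. norm (dilate (radius_seq n) ?F)) \<longlonglongrightarrow> norm ?F"
    by (intro tendsto_norm dilate_tendsto t radius_seq_tendsto)
  ultimately have "norm ?F \<le> M" by (intro LIMSEQ_le_const2[of "\<lambda>n. norm (dilate (radius_seq n) ?F)"]) auto
  then show ?thesis using that Rep by blast
qed

text \<open>The coefficients of \<open>f (s z)\<close> are \<open>s ^ total_degree k * a k\<close> with \<open>a\<close> independent of \<open>s\<close>.  As the
  norms stay bounded for \<open>s\<close> tending to one, \<open>a\<close> is square summable.\<close>

theorem H_infinity_in_H2:
  fixes f :: "complex^'i::finite \<Rightarrow> complex"
  assumes f: "f \<in> H_infinity"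
  obtains g where "\<And>z. z \<in> polydisc \<Longrightarrow> Rep_H2 g z = f z"
proof -
  obtain M where M: "\<And>z. z \<in> polydisc \<Longrightarrow> norm (f z) \<le> M" using H_infinityD(3)[OF f] by blast
  have "\<exists>F. (\<forall>z\<in>polydisc. Rep_H2 F z = f (\<chi> i. of_real s * z $ i)) \<and> norm F \<le> M" if "0 < s" "s < 1" for s
    using H_infinity_dilation[OF f M that] by metis
  then obtain F where F: "\<And>s z. 0 < s \<Longrightarrow> s < 1 \<Longrightarrow> z \<in> polydisc \<Longrightarrow> Rep_H2 (F s) z = f (\<chi> i. of_real s * z $ i)"
    and nF: "\<And>s. 0 < s \<Longrightarrow> s < 1 \<Longrightarrow> norm (F s) \<le> M" by metis
  have scale: "(\<chi> i. of_real s * z $ i) \<in> polydisc" if "0 < s" "s < 1" "z \<in> polydisc" for s and z :: "complex^'i"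
  proof -
    have "s * norm (z $ i) < 1" for i
      using that mult_strict_mono[of s 1 "norm (z $ i)" 1] by (auto simp: polydisc_def)
    then show ?thesis using that by (simp add: polydisc_def norm_mult)
  qed
  \<comment> \<open>The value \<open>s = 1/2\<close> is arbitrary; \<open>a\<close> is the coefficient sequence of \<open>f\<close>.\<close>
  define a where "a k = 2 ^ total_degree k * H2_coeff (F (1/2)) k" for k
  have coeff: "H2_coeff (F s) k = of_real (s ^ total_degree k) * a k" if s: "0 < s" "s < 1" for s k
  proof -
    have "dilate (1/2) (F s) = dilate s (F (1/2))"
    proof (rule H2_eqI)
      fix z :: "complex^'i" assume z: "z \<in> polydisc"
      have "Rep_H2 (dilate (1/2) (F s)) z = Rep_H2 (F s) (\<chi> i. of_real (1/2) * z $ i)"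
        by (rule Rep_dilate) (use z in auto)
      also have "\<dots> = f (\<chi> i. of_real s * (\<chi> i. of_real (1/2) * z $ i) $ i)"
        by (rule F[OF s scale]) (use z in auto)
      also have "\<dots> = f (\<chi> i. of_real (1/2) * (\<chi> i. of_real s * z $ i) $ i)" by (simp add: mult_ac)
      also have "\<dots> = Rep_H2 (F (1/2)) (\<chi> i. of_real s * z $ i)"
        by (rule F[symmetric]) (use s z scale in auto)
      also have "\<dots> = Rep_H2 (dilate s (F (1/2))) z"
        by (rule Rep_dilate[symmetric]) (use s z in auto)
      finally show "Rep_H2 (dilate (1/2) (F s)) z = Rep_H2 (dilate s (F (1/2))) z" .
    qed
    then have "H2_coeff (dilate (1/2) (F s)) k = H2_coeff (dilate s (F (1/2))) k" by simp
    then show ?thesis using s by (simp add: H2_coeff_dilate a_def power_divide field_simps)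
  qed
  have le: "(\<Sum>k\<in>A. (norm (a k))\<^sup>2) \<le> M\<^sup>2" if A: "finite A" for A
  proof (rule LIMSEQ_le_const2)
    note t = radius_seq(4,2)
    have "(\<lambda>n. \<Sum>k\<in>A. (norm (of_real (radius_seq n ^ total_degree k) * a k))\<^sup>2) \<longlonglongrightarrow> (\<Sum>k\<in>A. (norm (of_real (1 ^ total_degree k) * a k))\<^sup>2)"
      by (intro tendsto_intros radius_seq_tendsto)
    then show "(\<lambda>n. \<Sum>k\<in>A. (norm (H2_coeff (F (radius_seq n)) k))\<^sup>2) \<longlonglongrightarrow> (\<Sum>k\<in>A. (norm (a k))\<^sup>2)"
      by (simp add: coeff t)
    have "(\<Sum>k\<in>A. (norm (H2_coeff (F (radius_seq n)) k))\<^sup>2) \<le> M\<^sup>2" for n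
      using H2_sum_coeff_le[OF A, of "F (radius_seq n)"] power_mono[OF nF[OF t], of n 2] by simp
    then show "\<exists>N. \<forall>n\<ge>N. (\<Sum>k\<in>A. (norm (H2_coeff (F (radius_seq n)) k))\<^sup>2) \<le> M\<^sup>2" by blast
  qed
  have "(\<lambda>k. (norm (a k))\<^sup>2) summable_on UNIV"
    by (rule nonneg_bdd_above_summable_on) (use le in \<open>auto intro!: bdd_aboveI2\<close>)
  then have ca: "H2_coeff (H2_of_coeff a) = a" by (rule H2_coeff_of_coeff)
  have "Rep_H2 (H2_of_coeff a) z = f z" if z: "z \<in> polydisc" for z
  proof -
    obtain \<rho> where \<rho>: "0 < \<rho>" "\<rho> < 1" "\<And>i. norm (z $ i) < \<rho>" using polydisc_radius[OF z] by metis
    let ?w = "\<chi> i. z $ i / of_real \<rho>"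
    have w: "?w \<in> polydisc" using \<rho> by (auto simp: polydisc_def norm_divide)
    have z': "(\<chi> i. of_real \<rho> * ?w $ i) = z" using \<rho>(1) by (simp add: vec_eq_iff)
    have "F \<rho> = dilate \<rho> (H2_of_coeff a)"
      by (rule H2_coeff_inject) (use \<rho> in \<open>simp add: fun_eq_iff coeff H2_coeff_dilate ca\<close>)
    then show ?thesis using F[OF \<rho>(1,2) w] Rep_dilate[of \<rho> ?w "H2_of_coeff a"] \<rho> w z' by simp
  qed
  then show ?thesis using that by blast
qed


section \<open>Inner functions are isometric multipliers\<close>

lemma H_infinity_mult_zpow:
  assumes "\<psi> \<in> H_infinity"
  shows "(\<lambda>z. \<psi> z * zpow z k) \<in> H_infinity"
proof -
  obtain M where M: "\<And>z. z \<in> polydisc \<Longrightarrow> norm (\<psi> z) \<le> M" using H_infinityD(3)[OF assms] by blast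
  have "norm (\<psi> z * zpow z k) \<le> M * 1" if "z \<in> polydisc" for z
    unfolding norm_mult by (intro mult_mono M zpow_le_1 that) (use order_trans[OF norm_ge_zero M[OF that]] in auto)
  then have "bounded ((\<lambda>z. \<psi> z * zpow z k) ` polydisc)" unfolding bounded_iff by blast
  moreover have "(\<lambda>w. \<psi> (\<chi> j. if j = i then w else z $ j) * zpow (\<chi> j. if j = i then w else z $ j) k) holomorphic_on ball 0 1"
    if "z \<in> polydisc" for z i
  proof -
    have "(\<lambda>w. if j = i then w else z $ j) holomorphic_on ball 0 1" for j
      by (cases "j = i") (auto intro: holomorphic_intros)
    then show ?thesis
      unfolding zpow_def vec_lambda_beta
      by (intro holomorphic_on_mult holomorphic_on_prod holomorphic_on_power H_infinityD(2)[OF assms that])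
  qed
  ultimately show ?thesis
    unfolding H_infinity_def
    by (auto intro!: continuous_on_mult H_infinityD(1)[OF assms] continuous_on_zpow)
qed

text \<open>The functions \<open>\<psi> z\<^sup>k\<close> are orthonormal: on tori of radius tending to one, the integrand
  \<open>\<psi> z\<^sup>k cnj (\<psi> z\<^sup>l)\<close> of Parseval's identity tends almost everywhere to \<open>z\<^sup>k cnj (z\<^sup>l)\<close>, because the radial
  limit of \<open>\<psi>\<close> is unimodular.\<close>

theorem inner_function_imp_isometric_multiplier:
  fixes \<psi> :: "complex^'i::finite \<Rightarrow> complex"
  assumes \<psi>: "inner_function \<psi>"
  shows "isometric_multiplier \<psi>"
proof -
  have Hinf: "\<psi> \<in> H_infinity" using \<psi> by (simp add: inner_function_def)
  obtain M where M: "\<And>z. z \<in> polydisc \<Longrightarrow> norm (\<psi> z) \<le> M" using H_infinityD(3)[OF Hinf] by blast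
  have "\<exists>e. \<forall>z\<in>polydisc. Rep_H2 e z = \<psi> z * zpow z k" for k
    using H_infinity_in_H2[OF H_infinity_mult_zpow[OF Hinf, of k]] by metis
  then obtain e where e: "\<And>k z. z \<in> polydisc \<Longrightarrow> Rep_H2 (e k) z = \<psi> z * zpow z k" by metis
  have "cinner (e k) (e l) = (if k = l then 1 else 0)" for k l
  proof -
    define V where "V = complex_of_real ((2 * pi * real 1) ^ CARD('i))"
    have V: "V \<noteq> 0" by (simp add: V_def)
    let ?B = "torus_box 0 1 :: (real^'i) set"
    let ?p = "\<lambda>n. torus_point (radius_seq n) :: real^'i \<Rightarrow> complex^'i"
    have p: "?p n \<theta> \<in> polydisc" for n \<theta> by (rule torus_point_in_polydisc[OF radius_seq(1,2)])
    let ?f = "\<lambda>n \<theta>. Rep_H2 (e k) (?p n \<theta>) * cnj (Rep_H2 (e l) (?p n \<theta>))"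
    let ?g = "\<lambda>\<theta> :: real^'i. zpow (torus_point 1 \<theta>) k * cnj (zpow (torus_point 1 \<theta>) l)"
    have "(\<lambda>n. \<integral>\<theta>. indicator ?B \<theta> *\<^sub>R ?f n \<theta> \<partial>lborel) \<longlonglongrightarrow> (\<integral>\<theta>. indicator ?B \<theta> *\<^sub>R ?g \<theta> \<partial>lborel)"
    proof (rule torus_integral_dominated_convergence[where C = "M * M"])
      show "(\<lambda>\<theta>. ?f n \<theta>) \<in> borel_measurable borel" for n
        by (intro borel_measurable_times borel_measurable_cnj'
            borel_measurable_torus_point[OF continuous_on_Rep_H2 radius_seq(1,2)])
      show "?g \<in> borel_measurable borel"
        by (intro borel_measurable_continuous_onI continuous_intros
            continuous_on_compose2[OF continuous_on_zpow[of UNIV] continuous_on_torus_point]) auto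
      show "norm (?f n \<theta>) \<le> M * M" for n \<theta>
      proof -
        have "norm (Rep_H2 (e k) (?p n \<theta>)) \<le> M" for k
          unfolding e[OF p] norm_mult using M[OF p, of n \<theta>] zpow_le_1[OF p, of n \<theta> k]
          by (meson mult_left_le norm_ge_zero order_trans)
        then show ?thesis unfolding norm_mult complex_mod_cnj
          by (intro mult_mono) (use order_trans[OF norm_ge_zero M[OF p]] in auto)
      qed
      have "AE \<theta> in (lborel :: (real^'i) measure).
          \<exists>c. ((\<lambda>r. \<psi> (torus_point r \<theta>)) \<longlongrightarrow> c) (at_left (1::real)) \<and> norm c = 1"
        using \<psi> by (simp add: inner_function_def torus_point_def)
      then show "AE \<theta> in lborel. \<theta> \<in> ?B \<longrightarrow> (\<lambda>n. ?f n \<theta>) \<longlonglongrightarrow> ?g \<theta>"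
      proof eventually_elim
        case (elim \<theta>)
        then obtain c where c: "((\<lambda>r. \<psi> (torus_point r \<theta>)) \<longlongrightarrow> c) (at_left (1::real))" "norm c = 1" by blast
        have \<psi>c: "(\<lambda>n. \<psi> (?p n \<theta>)) \<longlonglongrightarrow> c" by (rule filterlim_compose[OF c(1) radius_seq_at_left])
        have z: "(\<lambda>n. zpow (?p n \<theta>) j) \<longlonglongrightarrow> zpow (torus_point 1 \<theta>) j" for j
        proof -
          have "(\<lambda>n. of_real (radius_seq n ^ total_degree j) * zpow (torus_point 1 \<theta>) j)
              \<longlonglongrightarrow> of_real (1 ^ total_degree j) * zpow (torus_point 1 \<theta>) j"
            by (intro tendsto_intros radius_seq_tendsto)
          then show ?thesis by (subst zpow_torus_point) simp
        qed
        have "(\<lambda>n. ?f n \<theta>) \<longlonglongrightarrow> c * zpow (torus_point 1 \<theta>) k * cnj (c * zpow (torus_point 1 \<theta>) l)"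
          unfolding e[OF p] by (intro tendsto_intros \<psi>c z)
        moreover have "c * zpow (torus_point 1 \<theta>) k * cnj (c * zpow (torus_point 1 \<theta>) l) = (c * cnj c) * ?g \<theta>" by simp
        moreover have "c * cnj c = 1" using c(2) by (simp add: complex_norm_square[symmetric])
        ultimately have "(\<lambda>n. ?f n \<theta>) \<longlonglongrightarrow> ?g \<theta>" by (simp only: mult_1)
        then show ?case by blast
      qed
    qed
    then have "(\<lambda>n. V * cinner (dilate (radius_seq n) (e k)) (dilate (radius_seq n) (e l))) \<longlonglongrightarrow> (if k = l then V else 0)"
      unfolding torus_parseval[OF radius_seq(1,2)] torus_orthogonality V_def .
    moreover have "(\<lambda>n. V * cinner (dilate (radius_seq n) (e k)) (dilate (radius_seq n) (e l))) \<longlonglongrightarrow> V * cinner (e k) (e l)"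
      by (intro tendsto_mult tendsto_const tendsto_cinner dilate_tendsto radius_seq radius_seq_tendsto)
    ultimately have "V * cinner (e k) (e l) = (if k = l then V else 0)" using LIMSEQ_unique by blast
    then show ?thesis using V by (auto split: if_splits)
  qed
  then show ?thesis using e by (intro isometric_multiplierI[of e \<psi>]) auto
qed


section \<open>The Poisson kernel\<close>

definition poisson :: "real \<Rightarrow> real \<Rightarrow> real" where
  "poisson r s = (1 - r\<^sup>2) / (1 - 2 * r * cos s + r\<^sup>2)"

text \<open>Minus the derivative of the Poisson kernel.\<close>

definition poisson_slope :: "real \<Rightarrow> real \<Rightarrow> real" where
  "poisson_slope r s = 2 * r * (1 - r\<^sup>2) * sin s / (1 - 2 * r * cos s + r\<^sup>2)\<^sup>2"

lemma poisson_denominator: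
  fixes r s :: real
  assumes "0 \<le> r" "r < 1"
  shows "0 < 1 - 2 * r * cos s + r\<^sup>2"
proof -
  have "0 < 1 - r" using assms by simp
  then have "0 < (1 - r)\<^sup>2" by (rule zero_less_power)
  also have "\<dots> \<le> 1 - 2 * r * cos s + r\<^sup>2"
    using assms mult_left_mono[OF cos_le_one[of s], of r] by (simp add: power2_eq_square algebra_simps)
  finally show ?thesis .
qed

lemma poisson_nonneg: "0 \<le> r \<Longrightarrow> r < 1 \<Longrightarrow> 0 \<le> poisson r s"
  unfolding poisson_def using poisson_denominator[of r s]
  by (intro divide_nonneg_pos) (auto simp: power_le_one)

lemma poisson_slope_nonneg: "0 \<le> r \<Longrightarrow> r < 1 \<Longrightarrow> 0 \<le> s \<Longrightarrow> s \<le> pi \<Longrightarrow> 0 \<le> poisson_slope r s"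
  unfolding poisson_slope_def
  by (intro divide_nonneg_nonneg mult_nonneg_nonneg sin_ge_zero) (auto simp: power_le_one)

lemma continuous_on_poisson [continuous_intros]:
  "0 \<le> r \<Longrightarrow> r < 1 \<Longrightarrow> continuous_on A (poisson r)"
  unfolding poisson_def[abs_def] using less_imp_neq[OF poisson_denominator[of r]]
  by (intro continuous_intros) (metis)

lemma continuous_on_poisson_slope [continuous_intros]:
  "0 \<le> r \<Longrightarrow> r < 1 \<Longrightarrow> continuous_on A (poisson_slope r)"
  unfolding poisson_slope_def[abs_def] using less_imp_neq[OF poisson_denominator[of r]]
  by (intro continuous_intros) (metis zero_eq_power2)

lemma poisson_derivative:
  assumes "0 \<le> r" "r < 1"
  shows "(poisson r has_real_derivative - poisson_slope r s) (at s within A)"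
proof -
  have "1 - 2 * r * cos s + r\<^sup>2 \<noteq> 0" using poisson_denominator[OF assms, of s] by simp
  then show ?thesis
    unfolding poisson_def[abs_def] poisson_slope_def
    by (auto intro!: derivative_eq_intros simp: power2_eq_square field_simps)
      (subst minus_divide_left, simp)
qed

lemma borel_measurable_poisson: "0 \<le> r \<Longrightarrow> r < 1 \<Longrightarrow> poisson r \<in> borel_measurable borel"
  by (intro borel_measurable_continuous_onI continuous_intros)

lemma integral_cis_symmetric_period:
  fixes k :: int
  shows "(\<integral>s. indicator {-pi..pi} s *\<^sub>R cis (of_int k * s) \<partial>lborel) = (if k = 0 then 2 * of_real pi else 0)"
  using integral_cis_period[where a = "-pi" and N = 1 and n = k] by simp

lemma integrable_indicator_Icc_const: "integrable lborel (\<lambda>s :: real. indicator {a..b} s * c :: real)"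
  by (intro integrable_mult_left integrable_real_indicator) (auto simp: emeasure_lborel_Icc_eq)

text \<open>The Poisson kernel is the sum of \<open>r\<^bsup>\<bar>m\<bar>\<^esup> cis (m s)\<close> over all integers \<open>m\<close>, which converges
  absolutely and can be integrated term by term.\<close>

lemma poisson_fourier:
  assumes r: "0 \<le> r" "r < 1"
  shows "(\<integral>s. indicator {-pi..pi} s *\<^sub>R (of_real (poisson r s) * cis (of_nat n * s)) \<partial>lborel) = 2 * of_real pi * of_real (r ^ n)"
proof -
  \<comment> \<open>The frequencies \<open>m\<close> and \<open>- Suc m\<close> are grouped, so that the series is indexed by the natural numbers.\<close>
  define f where "f m s = indicator {-pi..pi} s *\<^sub>R
      ((of_real (r ^ m) * cis (of_nat m * s) + of_real (r ^ Suc m) * cis (- of_nat (Suc m) * s)) * cis (of_nat n * s))" for m s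
  have "f m s = of_real (r ^ m) * (indicator {-pi..pi} s *\<^sub>R cis (of_int (int m + int n) * s))
      + of_real (r ^ Suc m) * (indicator {-pi..pi} s *\<^sub>R cis (of_int (int n - int (Suc m)) * s))" for m s
    by (simp add: f_def scaleR_conv_of_real algebra_simps cis_mult)
  then have f_eq: "f m = (\<lambda>s. of_real (r ^ m) * (indicator {-pi..pi} s *\<^sub>R cis (of_int (int m + int n) * s))
      + of_real (r ^ Suc m) * (indicator {-pi..pi} s *\<^sub>R cis (of_int (int n - int (Suc m)) * s)))" for m
    by blast
  have ic: "integrable lborel (\<lambda>s. indicator {-pi..pi} s *\<^sub>R cis (of_int k * s))" for k :: int
    by (intro integrable_Icc_indicator continuous_intros)
  have int: "integrable lborel (f m)" for m
    unfolding f_eq by (intro Bochner_Integration.integrable_add integrable_mult_right ic)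
  have val: "integral\<^sup>L lborel (f m) = 2 * of_real pi * (of_real (r ^ m) * of_bool (m = 0 \<and> n = 0) + of_real (r ^ Suc m) * of_bool (n = Suc m))" for m
  proof -
    have "integral\<^sup>L lborel (f m) = of_real (r ^ m) * (if int m + int n = 0 then 2 * of_real pi else 0)
        + of_real (r ^ Suc m) * (if int n - int (Suc m) = 0 then 2 * of_real pi else 0)"
      unfolding f_eq
      by (subst Bochner_Integration.integral_add)
        (intro integrable_mult_right ic, intro integrable_mult_right ic,
          simp only: integral_mult_right_zero integral_cis_symmetric_period)
    also have "int m + int n = 0 \<longleftrightarrow> m = 0 \<and> n = 0" by linarith
    also have "int n - int (Suc m) = 0 \<longleftrightarrow> n = Suc m" by linarith
    finally show ?thesis by simp
  qed
  have nf: "norm (f m s) \<le> indicator {-pi..pi} s * (2 * r ^ m)" for m s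
  proof -
    have "norm (of_real (r ^ m) * cis (of_nat m * s) + of_real (r ^ Suc m) * cis (- of_nat (Suc m) * s)) \<le> r ^ m + r ^ Suc m"
      using norm_triangle_ineq[of "of_real (r ^ m) * cis (of_nat m * s)" "of_real (r ^ Suc m) * cis (- of_nat (Suc m) * s)"] r
      by (simp add: norm_mult norm_power)
    also have "r ^ Suc m \<le> r ^ m" using r by (intro power_decreasing) auto
    finally show ?thesis by (auto simp: f_def norm_mult indicator_def)
  qed
  have sum_r: "summable (\<lambda>m. 2 * r ^ m)" using r by (intro summable_mult summable_geometric) auto
  have abs: "summable (\<lambda>m. norm (f m s))" for s
    by (rule summable_comparison_test'[OF sum_r, of 0]) (use order_trans[OF nf] r in \<open>auto simp: indicator_def\<close>)
  have "(\<lambda>m. integral\<^sup>L lborel (f m)) sums (\<integral>s. (\<Sum>m. f m s) \<partial>lborel)"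
  proof (rule sums_integral[OF int])
    show "AE s in lborel. summable (\<lambda>m. norm (f m s))" using abs by simp
    show "summable (\<lambda>m. \<integral>s. norm (f m s) \<partial>lborel)"
    proof (rule summable_comparison_test')
      show "summable (\<lambda>m. 2 * pi * (2 * r ^ m))" by (intro summable_mult[OF sum_r])
      fix m
      have "(\<integral>s. norm (f m s) \<partial>lborel) \<le> (\<integral>s. indicator {-pi..pi} s * (2 * r ^ m) \<partial>lborel)"
        by (rule integral_mono[OF integrable_norm[OF int] integrable_indicator_Icc_const nf])
      also have "\<dots> = 2 * pi * (2 * r ^ m)" by simp
      finally show "norm (\<integral>s. norm (f m s) \<partial>lborel) \<le> 2 * pi * (2 * r ^ m)" by simp
    qed
  qed
  moreover have "(\<lambda>m. integral\<^sup>L lborel (f m)) sums (2 * of_real pi * of_real (r ^ n))"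
  proof (cases n)
    case 0
    have "(\<lambda>m. integral\<^sup>L lborel (f m)) sums (\<Sum>m\<in>{0}. integral\<^sup>L lborel (f m))"
      by (rule sums_finite) (auto simp: val 0)
    then show ?thesis by (simp add: val 0)
  next
    case (Suc k)
    have "(\<lambda>m. integral\<^sup>L lborel (f m)) sums (\<Sum>m\<in>{k}. integral\<^sup>L lborel (f m))"
      by (rule sums_finite) (auto simp: val Suc)
    then show ?thesis by (simp add: val Suc)
  qed
  ultimately have "(\<integral>s. (\<Sum>m. f m s) \<partial>lborel) = 2 * of_real pi * of_real (r ^ n)" by (rule sums_unique2)
  moreover have "(\<Sum>m. f m s) = indicator {-pi..pi} s *\<^sub>R (of_real (poisson r s) * cis (of_nat n * s))" for s
  proof -
    define z where "z = of_real r * cis s"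
    have nr: "norm z = r" using r by (simp add: z_def norm_mult)
    have nz: "norm z < 1" "norm (cnj z) < 1" using r nr by auto
    have "(\<lambda>m. z ^ m + cnj z * cnj z ^ m) sums (1 / (1 - z) + cnj z * (1 / (1 - cnj z)))"
      by (intro sums_add sums_mult geometric_sums nz)
    also have "1 / (1 - z) + cnj z * (1 / (1 - cnj z)) = of_real (poisson r s)"
    proof -
      have "1 - z \<noteq> 0" "1 - cnj z \<noteq> 0" using nz by auto
      then have "1 / (1 - z) + cnj z * (1 / (1 - cnj z)) = (1 - z * cnj z) / ((1 - z) * (1 - cnj z))"
        by (simp add: field_simps)
      also have "z * cnj z = of_real (r\<^sup>2)" by (subst complex_norm_square[symmetric]) (simp add: nr)
      also have "(1 - z) * (1 - cnj z) = of_real (1 - 2 * r * cos s + r\<^sup>2)"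
      proof -
        have "(1 - z) * (1 - cnj z) = 1 - (z + cnj z) + z * cnj z" by (simp add: algebra_simps)
        also have "z + cnj z = of_real (2 * r * cos s)"
          by (subst complex_add_cnj) (simp add: z_def)
        also have "z * cnj z = of_real (r\<^sup>2)" by (subst complex_norm_square[symmetric]) (simp add: nr)
        finally show ?thesis by simp
      qed
      finally show ?thesis by (simp add: poisson_def)
    qed
    finally have "(\<lambda>m. indicator {-pi..pi} s *\<^sub>R ((z ^ m + cnj z * cnj z ^ m) * cis (of_nat n * s))) sums
        (indicator {-pi..pi} s *\<^sub>R (of_real (poisson r s) * cis (of_nat n * s)))"
      by (intro sums_scaleR_right sums_mult2)
    moreover have "indicator {-pi..pi} s *\<^sub>R ((z ^ m + cnj z * cnj z ^ m) * cis (of_nat n * s)) = f m s" for m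
    proof -
      have "z ^ m = of_real (r ^ m) * cis (of_nat m * s)"
        by (simp add: z_def power_mult_distrib Complex.DeMoivre)
      moreover have "cnj z * cnj z ^ m = of_real (r ^ Suc m) * cis (- of_nat (Suc m) * s)"
      proof -
        have "cnj z = of_real r * cis (- s)" by (simp add: z_def cis_cnj)
        then have "cnj z ^ Suc m = of_real (r ^ Suc m) * cis (of_nat (Suc m) * (- s))"
          by (simp only: power_mult_distrib Complex.DeMoivre of_real_power)
        then show ?thesis by (simp only: power_Suc mult_minus_left mult_minus_right)
      qed
      ultimately show ?thesis by (simp add: f_def)
    qed
    ultimately show ?thesis by (simp add: sums_iff)
  qed
  ultimately show ?thesis by simp
qed

text \<open>The Poisson kernel decreases on \<open>{0..pi}\<close>, so it is a positive mixture of indicators of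
  intervals \<open>{0..x}\<close>; integrating against it is controlled by the averages over these intervals.\<close>

lemma poisson_by_parts:
  fixes h :: "real \<Rightarrow> complex"
  assumes r: "0 \<le> r" "r < 1" and h: "integrable lborel (\<lambda>s. indicator {0..pi} s *\<^sub>R h s)"
  defines "H \<equiv> \<lambda>x. \<integral>s. indicator {0..x} s *\<^sub>R h s \<partial>lborel"
  shows "(\<integral>s. indicator {0..pi} s *\<^sub>R (of_real (poisson r s) * h s) \<partial>lborel)
    = of_real (poisson r pi) * H pi + (\<integral>x. indicator {0..pi} x *\<^sub>R (of_real (poisson_slope r x) * H x) \<partial>lborel)"
    and "integrable lborel (\<lambda>x. indicator {0..pi} x *\<^sub>R (of_real (poisson_slope r x) * H x))"
proof -
  define k where "k s = indicator {0..pi} s *\<^sub>R h s" for s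
  define q where "q x = indicator {0..pi} x *\<^sub>R complex_of_real (poisson_slope r x)" for x
  define f where "f s x = (if s \<le> x then 1 else 0) * (q x * k s)" for s x :: real
  have k: "integrable lborel k" using h by (simp add: k_def[abs_def])
  have q: "integrable lborel q"
    unfolding q_def[abs_def] using r by (intro integrable_Icc_indicator continuous_intros)
  have mk: "k \<in> borel_measurable borel" and mq: "q \<in> borel_measurable borel"
    using borel_measurable_integrable[OF k] borel_measurable_integrable[OF q] by simp_all
  have mf: "case_prod f \<in> borel_measurable (lborel \<Otimes>\<^sub>M lborel)"
    unfolding f_def[abs_def] using mk mq by measurable
  have ms: "(\<lambda>x. f s x) \<in> borel_measurable lborel" for s
    using measurable_Pair2[OF mf, of s] by simp
  have mx: "(\<lambda>s. f s x) \<in> borel_measurable lborel" for x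
    using measurable_Pair1[OF mf, of x] by simp
  have le: "norm (f s x) \<le> norm (k s * q x)" for s x by (auto simp: f_def norm_mult)
  have int2: "integrable lborel (\<lambda>x. f s x)" for s
    by (rule Bochner_Integration.integrable_bound[OF integrable_mult_right[OF q, of "k s"] ms]) (use le in auto)
  have int: "integrable (lborel \<Otimes>\<^sub>M lborel) (case_prod f)"
  proof (rule lborel_pair.Fubini_integrable[OF mf])
    show "AE s in lborel. integrable lborel (\<lambda>x. case_prod f (s, x))" using int2 by simp
    show "integrable lborel (\<lambda>s. \<integral>x. norm (case_prod f (s, x)) \<partial>lborel)"
    proof (rule Bochner_Integration.integrable_bound)
      show "integrable lborel (\<lambda>s. norm (k s) * (\<integral>x. norm (q x) \<partial>lborel))"
        by (intro integrable_mult_left integrable_norm k)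
      have "(\<lambda>p. norm (case_prod f p)) \<in> borel_measurable (lborel \<Otimes>\<^sub>M lborel)" using mf by simp
      then show "(\<lambda>s. \<integral>x. norm (case_prod f (s, x)) \<partial>lborel) \<in> borel_measurable lborel"
        by (intro lborel.borel_measurable_lebesgue_integral) (simp add: case_prod_beta')
      have "(\<integral>x. norm (f s x) \<partial>lborel) \<le> norm (k s) * (\<integral>x. norm (q x) \<partial>lborel)" for s
      proof -
        have "(\<integral>x. norm (f s x) \<partial>lborel) \<le> (\<integral>x. norm (k s) * norm (q x) \<partial>lborel)"
          using le by (intro integral_mono integrable_norm int2 integrable_mult_right q) (simp add: norm_mult)
        then show ?thesis by simp
      qed
      moreover have "0 \<le> (\<integral>x. norm (f s x) \<partial>lborel)" "0 \<le> (\<integral>x. norm (q x) \<partial>lborel)" for s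
        by (intro Bochner_Integration.integral_nonneg; simp)+
      ultimately show "AE s in lborel. norm (\<integral>x. norm (case_prod f (s, x)) \<partial>lborel) \<le> norm (norm (k s) * (\<integral>x. norm (q x) \<partial>lborel))"
        by simp
    qed
  qed
  have swap: "(\<integral>x. (\<integral>s. f s x \<partial>lborel) \<partial>lborel) = (\<integral>s. (\<integral>x. f s x \<partial>lborel) \<partial>lborel)"
    by (rule lborel_pair.Fubini_integral[OF int])
  have left: "(\<integral>x. f s x \<partial>lborel) = indicator {0..pi} s *\<^sub>R (of_real (poisson r s) * h s) - of_real (poisson r pi) * k s" for s
  proof (cases "s \<in> {0..pi}")
    case True
    have "(\<integral>x. indicator {s..pi} x *\<^sub>R complex_of_real (poisson_slope r x) \<partial>lborel)
        = (- of_real (poisson r pi)) - (- of_real (poisson r s))"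
    proof (rule integral_FTC_atLeastAtMost)
      fix x
      have "((\<lambda>x. complex_of_real (- poisson r x)) has_vector_derivative of_real (- (- poisson_slope r x))) (at x within {s..pi})"
        by (rule has_vector_derivative_of_real[OF DERIV_minus[OF poisson_derivative[OF r]]])
      then show "((\<lambda>x. - complex_of_real (poisson r x)) has_vector_derivative of_real (poisson_slope r x)) (at x within {s..pi})"
        by simp
    qed (use True r in \<open>auto intro!: continuous_intros\<close>)
    moreover have "f s x = k s * (indicator {s..pi} x *\<^sub>R complex_of_real (poisson_slope r x))" for x
      using True by (auto simp: f_def q_def indicator_def)
    ultimately have "(\<integral>x. f s x \<partial>lborel) = k s * (- of_real (poisson r pi) + of_real (poisson r s))"
      by (simp only: integral_mult_right_zero) simp
    then show ?thesis using True by (simp add: k_def algebra_simps)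
  qed (simp add: f_def k_def)
  have right: "(\<integral>s. f s x \<partial>lborel) = indicator {0..pi} x *\<^sub>R (of_real (poisson_slope r x) * H x)" for x
  proof -
    have "f s x = q x * (indicator {0..x} s *\<^sub>R h s)" for s
      by (auto simp: f_def q_def k_def indicator_def)
    then show ?thesis by (simp add: H_def q_def scaleR_conv_of_real)
  qed
  have intP: "integrable lborel (\<lambda>s. indicator {0..pi} s *\<^sub>R (of_real (poisson r s) * h s))"
  proof -
    have "integrable lborel (\<lambda>s. \<integral>x. f s x \<partial>lborel)"
      using lborel_pair.integrable_fst'[OF int] by simp
    then have "integrable lborel (\<lambda>s. (\<integral>x. f s x \<partial>lborel) + of_real (poisson r pi) * k s)"
      by (intro Bochner_Integration.integrable_add integrable_mult_right k)
    then show ?thesis by (simp add: left)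
  qed
  have "(\<integral>s. (\<integral>x. f s x \<partial>lborel) \<partial>lborel)
      = (\<integral>s. indicator {0..pi} s *\<^sub>R (of_real (poisson r s) * h s) \<partial>lborel) - of_real (poisson r pi) * (\<integral>s. k s \<partial>lborel)"
    unfolding left by (subst Bochner_Integration.integral_diff[OF intP integrable_mult_right[OF k]]) simp
  moreover have "(\<integral>s. k s \<partial>lborel) = H pi" by (simp add: k_def H_def)
  ultimately show "(\<integral>s. indicator {0..pi} s *\<^sub>R (of_real (poisson r s) * h s) \<partial>lborel)
    = of_real (poisson r pi) * H pi + (\<integral>x. indicator {0..pi} x *\<^sub>R (of_real (poisson_slope r x) * H x) \<partial>lborel)"
    using swap unfolding right by (simp add: algebra_simps)
  show "integrable lborel (\<lambda>x. indicator {0..pi} x *\<^sub>R (of_real (poisson_slope r x) * H x))"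
    using lborel_pair.integrable_snd[OF int] unfolding right .
qed

lemma integrable_poisson_mult:
  fixes h :: "real \<Rightarrow> complex"
  assumes r: "0 \<le> r" "r < 1" and h: "integrable lborel (\<lambda>s. indicator {a..b} s *\<^sub>R h s)"
  shows "integrable lborel (\<lambda>s. indicator {a..b} s *\<^sub>R (of_real (poisson r s) * h s))"
proof (rule Bochner_Integration.integrable_bound)
  define C where "C = (1 - r\<^sup>2) / (1 - r)\<^sup>2"
  have C: "poisson r s \<le> C" for s
  proof -
    have "(1 - r)\<^sup>2 \<le> 1 - 2 * r * cos s + r\<^sup>2"
      using r mult_left_mono[OF cos_le_one[of s], of r] by (simp add: power2_eq_square algebra_simps)
    then show ?thesis
      unfolding poisson_def C_def using r by (intro divide_left_mono) (auto simp: power_le_one poisson_denominator)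
  qed
  show "integrable lborel (\<lambda>s. of_real C * (indicator {a..b} s *\<^sub>R h s))"
    by (rule integrable_mult_right[OF h])
  have "(\<lambda>s. of_real (poisson r s) * (indicator {a..b} s *\<^sub>R h s)) \<in> borel_measurable borel"
    using borel_measurable_integrable[OF h] borel_measurable_poisson[OF r] by measurable
  then show "(\<lambda>s. indicator {a..b} s *\<^sub>R (of_real (poisson r s) * h s)) \<in> borel_measurable lborel"
    by (simp add: scaleR_conv_of_real mult_ac)
  have "norm (indicator {a..b} s *\<^sub>R (of_real (poisson r s) * h s)) \<le> norm (of_real C * (indicator {a..b} s *\<^sub>R h s))" for s
    using C[of s] poisson_nonneg[OF r, of s] by (auto simp: norm_mult indicator_def intro!: mult_right_mono)
  then show "AE s in lborel. norm (indicator {a..b} s *\<^sub>R (of_real (poisson r s) * h s)) \<le> norm (of_real C * (indicator {a..b} s *\<^sub>R h s))"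
    by simp
qed

text \<open>By integration by parts for the constant function one, this moment is at most the integral of
  the Poisson kernel over a half period.  What matters is that the bound is uniform in \<open>r\<close>.\<close>

lemma poisson_slope_moment:
  assumes r: "0 \<le> r" "r < 1"
  shows "(\<integral>x. indicator {0..pi} x * (poisson_slope r x * x) \<partial>lborel) \<le> 2 * pi"
proof -
  have H: "(\<integral>s. indicator {0..x} s *\<^sub>R (1 :: complex) \<partial>lborel) = of_real x" if "0 \<le> x" for x
    using that by (simp add: scaleR_conv_of_real)
  have i1: "integrable lborel (\<lambda>s. indicator {0..pi} s *\<^sub>R (1 :: complex))"
    by (intro integrable_Icc_indicator continuous_intros)
  have iP: "integrable lborel (\<lambda>s. indicator {a..b} s * poisson r s)" for a b
    using borel_integrable_atLeastAtMost'[OF continuous_on_poisson[OF r]] by (simp add: set_integrable_def)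
  have "(\<integral>s. indicator {0..pi} s *\<^sub>R (of_real (poisson r s) * (1 :: complex)) \<partial>lborel)
      = of_real (poisson r pi) * of_real pi + (\<integral>x. indicator {0..pi} x *\<^sub>R (of_real (poisson_slope r x) *
        (\<integral>s. indicator {0..x} s *\<^sub>R (1 :: complex) \<partial>lborel)) \<partial>lborel)"
    using poisson_by_parts(1)[OF r i1] unfolding H[OF pi_ge_zero] .
  also have "(\<integral>x. indicator {0..pi} x *\<^sub>R (of_real (poisson_slope r x) *
        (\<integral>s. indicator {0..x} s *\<^sub>R (1 :: complex) \<partial>lborel)) \<partial>lborel)
      = (\<integral>x. complex_of_real (indicator {0..pi} x * (poisson_slope r x * x)) \<partial>lborel)"
  proof (rule Bochner_Integration.integral_cong[OF refl])
    show "indicator {0..pi} x *\<^sub>R (of_real (poisson_slope r x) * (\<integral>s. indicator {0..x} s *\<^sub>R (1 :: complex) \<partial>lborel))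
        = complex_of_real (indicator {0..pi} x * (poisson_slope r x * x))" for x
    proof (cases "x \<in> {0..pi}")
      case True
      then show ?thesis by (subst H) simp_all
    qed simp
  qed
  also have "(\<integral>s. indicator {0..pi} s *\<^sub>R (of_real (poisson r s) * (1 :: complex)) \<partial>lborel)
      = (\<integral>s. complex_of_real (indicator {0..pi} s * poisson r s) \<partial>lborel)"
    by (rule Bochner_Integration.integral_cong) (auto simp: indicator_def)
  finally have "(\<integral>s. indicator {0..pi} s * poisson r s \<partial>lborel)
      = poisson r pi * pi + (\<integral>x. indicator {0..pi} x * (poisson_slope r x * x) \<partial>lborel)"
    unfolding integral_complex_of_real by (simp only: of_real_mult[symmetric] of_real_add[symmetric] of_real_eq_iff)
  moreover have "0 \<le> poisson r pi * pi" using poisson_nonneg[OF r] by simp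
  moreover have "(\<integral>s. indicator {0..pi} s * poisson r s \<partial>lborel) \<le> (\<integral>s. indicator {-pi..pi} s * poisson r s \<partial>lborel)"
    by (rule integral_mono[OF iP iP]) (use poisson_nonneg[OF r] in \<open>auto simp: indicator_def\<close>)
  moreover have "(\<integral>s. indicator {-pi..pi} s * poisson r s \<partial>lborel) = 2 * pi"
  proof -
    have "(\<integral>s. complex_of_real (indicator {-pi..pi} s * poisson r s) \<partial>lborel) = complex_of_real (2 * pi)"
      using poisson_fourier[OF r, of 0] by (simp add: scaleR_conv_of_real)
    then show ?thesis unfolding integral_complex_of_real of_real_eq_iff .
  qed
  ultimately show ?thesis by linarith
qed

lemma poisson_tendsto_0:
  assumes "0 < s" "s \<le> pi"
  shows "((\<lambda>r. poisson r s) \<longlongrightarrow> 0) (at_left 1)"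
proof -
  have "cos s < cos 0" using assms by (intro cos_monotone_0_pi) auto
  then have "1 - 2 * 1 * cos s + 1\<^sup>2 \<noteq> 0" by simp
  then have "((\<lambda>r. poisson r s) \<longlongrightarrow> (1 - 1\<^sup>2) / (1 - 2 * 1 * cos s + 1\<^sup>2)) (at_left 1)"
    unfolding poisson_def by (intro tendsto_intros)
  then show ?thesis by simp
qed

text \<open>Integration by parts leaves the averages \<open>H x\<close> of \<open>h\<close> over \<open>{0..x}\<close> against the slope of the
  kernel.  For small \<open>x\<close> they are at most \<open>e * x\<close>, which the first moment of the slope controls; for
  \<open>x \<ge> d\<close> they are bounded, and the slope has total mass at most \<open>poisson r d\<close>, which tends to \<open>0\<close>.\<close>

lemma poisson_one_sided_limit:
  fixes h :: "real \<Rightarrow> complex"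
  assumes h: "integrable lborel (\<lambda>s. indicator {0..pi} s *\<^sub>R h s)"
    and small: "\<And>e. e > 0 \<Longrightarrow> \<exists>d>0. \<forall>x. 0 < x \<longrightarrow> x < d \<longrightarrow> norm (\<integral>s. indicator {0..x} s *\<^sub>R h s \<partial>lborel) \<le> e * x"
  shows "((\<lambda>r. \<integral>s. indicator {0..pi} s *\<^sub>R (of_real (poisson r s) * h s) \<partial>lborel) \<longlongrightarrow> 0) (at_left 1)"
proof -
  define H where "H x = (\<integral>s. indicator {0..x} s *\<^sub>R h s \<partial>lborel)" for x
  define C where "C = (\<integral>s. norm (indicator {0..pi} s *\<^sub>R h s) \<partial>lborel)"
  have C0: "0 \<le> C" unfolding C_def by (rule Bochner_Integration.integral_nonneg) simp
  have HC: "norm (H x) \<le> C" if "x \<le> pi" for x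
  proof -
    have eq: "indicator {0..x} s *\<^sub>R h s = indicator {0..x} s *\<^sub>R (indicator {0..pi} s *\<^sub>R h s)" for s
      using that by (auto simp: indicator_def)
    have ix: "integrable lborel (\<lambda>s. indicator {0..x} s *\<^sub>R h s)"
      unfolding eq by (rule integrable_mult_indicator[OF _ h]) simp
    have "norm (H x) \<le> (\<integral>s. norm (indicator {0..x} s *\<^sub>R h s) \<partial>lborel)"
      unfolding H_def by (rule integral_norm_bound)
    also have "\<dots> \<le> C"
      unfolding C_def using that by (intro integral_mono integrable_norm ix h) (auto simp: indicator_def)
    finally show ?thesis .
  qed
  show ?thesis
    unfolding tendsto_iff
  proof safe
    fix e :: real assume e: "e > 0"
    define e' where "e' = e / (8 * pi)"
    have e': "e' > 0" using e by (simp add: e'_def)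
    obtain d0 where d0: "d0 > 0" "\<And>x. 0 < x \<Longrightarrow> x < d0 \<Longrightarrow> norm (H x) \<le> e' * x"
      using small[OF e'] unfolding H_def by blast
    define d where "d = min (d0 / 2) pi"
    have d: "0 < d" "d \<le> pi" "d < d0" using d0(1) by (auto simp: d_def)
    have Hle: "norm (H x) \<le> e' * x + indicator {d..pi} x * C" if "0 \<le> x" "x \<le> pi" for x
    proof (cases "x < d")
      case True
      show ?thesis
      proof (cases "x = 0")
        case True
        have "AE s in (lborel :: real measure). s \<noteq> 0" by (rule AE_lborel_singleton)
        then have "AE s in lborel. indicator {0..0} s *\<^sub>R h s = 0" by eventually_elim (auto simp: indicator_def)
        then have "H 0 = 0" unfolding H_def by (rule integral_eq_zero_AE)
        then show ?thesis using True C0 by (simp add: indicator_def)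
      qed (use that True d d0(2)[of x] C0 in \<open>auto simp: indicator_def\<close>)
    next
      case False
      then show ?thesis using that HC[of x] e' by (simp add: indicator_def add_increasing)
    qed
    have bound: "norm (\<integral>s. indicator {0..pi} s *\<^sub>R (of_real (poisson r s) * h s) \<partial>lborel)
        \<le> e' * (2 * pi) + C * (poisson r d + poisson r pi)" if r: "0 \<le> r" "r < 1" for r
    proof -
      let ?Q = "\<lambda>x. indicator {0..pi} x * (poisson_slope r x * x)"
      let ?R = "\<lambda>x. indicator {d..pi} x * poisson_slope r x"
      have "continuous_on {0..pi} (\<lambda>x. poisson_slope r x * x)" "continuous_on {d..pi} (poisson_slope r)"
        by (intro continuous_on_mult continuous_on_poisson_slope continuous_on_id r)+
      from this[THEN borel_integrable_atLeastAtMost']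
      have iQ: "integrable lborel ?Q" and iR: "integrable lborel ?R" by (simp_all add: set_integrable_def)
      have "norm (\<integral>x. indicator {0..pi} x *\<^sub>R (of_real (poisson_slope r x) * H x) \<partial>lborel)
          \<le> (\<integral>x. e' * ?Q x + C * ?R x \<partial>lborel)"
      proof (rule order_trans[OF integral_norm_bound integral_mono])
        show "integrable lborel (\<lambda>x. e' * ?Q x + C * ?R x)"
          by (intro Bochner_Integration.integrable_add integrable_mult_right iQ iR)
        show "integrable lborel (\<lambda>x. norm (indicator {0..pi} x *\<^sub>R (of_real (poisson_slope r x) * H x)))"
          unfolding H_def by (rule integrable_norm[OF poisson_by_parts(2)[OF r h]])
        fix x
        show "norm (indicator {0..pi} x *\<^sub>R (of_real (poisson_slope r x) * H x)) \<le> e' * ?Q x + C * ?R x"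
        proof (cases "x \<in> {0..pi}")
          case True
          have "poisson_slope r x * norm (H x) \<le> poisson_slope r x * (e' * x + indicator {d..pi} x * C)"
            using True Hle[of x] poisson_slope_nonneg[OF r, of x] by (intro mult_left_mono) auto
          then show ?thesis
            using True poisson_slope_nonneg[OF r, of x] by (simp add: norm_mult algebra_simps)
        qed (use d in \<open>auto simp: indicator_def\<close>)
      qed
      also have "\<dots> = e' * integral\<^sup>L lborel ?Q + C * integral\<^sup>L lborel ?R"
        by (subst Bochner_Integration.integral_add) (auto intro!: integrable_mult_right iQ iR)
      also have "integral\<^sup>L lborel ?R = poisson r d - poisson r pi"
      proof -
        have "(\<integral>x. indicator {d..pi} x *\<^sub>R poisson_slope r x \<partial>lborel) = (- poisson r pi) - (- poisson r d)"
        proof (rule integral_FTC_atLeastAtMost)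
          show "((\<lambda>x. - poisson r x) has_vector_derivative poisson_slope r x) (at x within {d..pi})" for x
            using DERIV_minus[OF poisson_derivative[OF r, of x "{d..pi}"]]
            by (simp add: has_real_derivative_iff_has_vector_derivative)
        qed (use d r in \<open>auto intro!: continuous_intros\<close>)
        then show ?thesis by simp
      qed
      also have "e' * integral\<^sup>L lborel ?Q \<le> e' * (2 * pi)"
        using e' poisson_slope_moment[OF r] by (intro mult_left_mono) auto
      finally have "norm (\<integral>x. indicator {0..pi} x *\<^sub>R (of_real (poisson_slope r x) * H x) \<partial>lborel)
          \<le> e' * (2 * pi) + C * (poisson r d - poisson r pi)" by simp
      moreover have "norm (of_real (poisson r pi) * H pi) \<le> poisson r pi * C"
        using poisson_nonneg[OF r, of pi] HC[of pi] by (simp add: norm_mult mult_left_mono)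
      moreover have "0 \<le> C * poisson r pi" using C0 poisson_nonneg[OF r] by simp
      ultimately show ?thesis
        using norm_triangle_ineq[of "of_real (poisson r pi) * H pi" "\<integral>x. indicator {0..pi} x *\<^sub>R (of_real (poisson_slope r x) * H x) \<partial>lborel"]
        unfolding poisson_by_parts(1)[OF r h] H_def[symmetric] by (simp add: algebra_simps)
    qed
    have "((\<lambda>r. C * (poisson r d + poisson r pi)) \<longlongrightarrow> C * (0 + 0)) (at_left 1)"
      using d by (intro tendsto_intros poisson_tendsto_0) auto
    then have "\<forall>\<^sub>F r in at_left 1. C * (poisson r d + poisson r pi) < e / 2"
      by (rule order_tendstoD) (use e in simp)
    moreover have "\<forall>\<^sub>F r in at_left 1. 0 \<le> r \<and> r < (1 :: real)"
      by (rule eventually_at_leftI[of 0]) auto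
    ultimately show "\<forall>\<^sub>F r in at_left 1. dist (\<integral>s. indicator {0..pi} s *\<^sub>R (of_real (poisson r s) * h s) \<partial>lborel) 0 < e"
    proof eventually_elim
      case (elim r)
      have "e' * (2 * pi) = e / 4" by (simp add: e'_def)
      then show ?case using bound[of r] elim e by simp
    qed
  qed
qed


section \<open>Radial limits in the disc\<close>

text \<open>The theorem of Lebesgue is needed on each side of \<open>t\<close> separately, because the Poisson kernel is
  monotone only on each half of the period.\<close>

lemma lebesgue_differentiation_right:
  fixes F :: "real \<Rightarrow> complex"
  assumes F: "integrable lborel F"
  shows "AE t in lborel. \<forall>e>0. \<exists>d>0. \<forall>x. 0 < x \<longrightarrow> x < d \<longrightarrow>
    norm (\<integral>s. indicator {0..x} s *\<^sub>R (F (t + s) - F t) \<partial>lborel) \<le> e * x"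
proof -
  have "F integrable_on UNIV" using has_integral_integral_lborel[OF F] by blast
  then have "F integrable_on cbox a b" for a b by (rule integrable_on_subcbox) simp
  then obtain N where N: "negligible N" "\<And>x e. x \<notin> N \<Longrightarrow> 0 < e \<Longrightarrow>
      \<exists>d>0. \<forall>h. 0 < h \<and> h < d \<longrightarrow> norm (integral (cbox x (x + h *\<^sub>R One)) F /\<^sub>R h ^ DIM(real) - F x) < e"
    using integrable_ccontinuous_explicit[of F] by metis
  have "AE t in lebesgue. t \<notin> N"
    using N(1) by (intro AE_not_in) (simp add: negligible_iff_null_sets)
  then have "AE t in lborel. t \<notin> N" by (simp add: AE_completion_iff)
  then show ?thesis
  proof eventually_elim
    case (elim t)
    show ?case
    proof safe
      fix e :: real assume e: "e > 0"
      obtain d where d: "d > 0" "\<And>h. 0 < h \<Longrightarrow> h < d \<Longrightarrow> norm (integral (cbox t (t + h *\<^sub>R One)) F /\<^sub>R h ^ DIM(real) - F t) < e"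
        using N(2)[OF elim e] by blast
      have "norm (\<integral>s. indicator {0..x} s *\<^sub>R (F (t + s) - F t) \<partial>lborel) \<le> e * x" if x: "0 < x" "x < d" for x
      proof -
        have si: "set_integrable lborel {t..t + x} F"
          unfolding set_integrable_def by (rule integrable_mult_indicator[OF _ F]) simp
        have "(\<integral>s. indicator {0..x} s *\<^sub>R F (t + s) \<partial>lborel) = (\<integral>u. indicator {t..t + x} u *\<^sub>R F u \<partial>lborel)"
          by (subst lborel_integral_real_affine[where c = 1 and t = t])
            (auto intro!: Bochner_Integration.integral_cong simp: indicator_def)
        also have "\<dots> = integral {t..t + x} F"
          using set_borel_integral_eq_integral(2)[OF si] by (simp add: set_lebesgue_integral_def)
        finally have 1: "(\<integral>s. indicator {0..x} s *\<^sub>R F (t + s) \<partial>lborel) = integral {t..t + x} F" .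
        have 2: "(\<integral>s. indicator {0..x} s *\<^sub>R F t \<partial>lborel) = x *\<^sub>R F t" using x by simp
        have i1: "integrable lborel (\<lambda>s. indicator {0..x} s *\<^sub>R F (t + s))"
          using lborel_integrable_real_affine[OF F, of 1 t] by (intro integrable_mult_indicator) auto
        have i2: "integrable lborel (\<lambda>s. indicator {0..x} s *\<^sub>R F t)"
          by (intro integrable_Icc_indicator continuous_intros)
        have "(\<integral>s. indicator {0..x} s *\<^sub>R (F (t + s) - F t) \<partial>lborel) = integral {t..t + x} F - x *\<^sub>R F t"
          unfolding scaleR_diff_right Bochner_Integration.integral_diff[OF i1 i2] 1 2 ..
        also have "\<dots> = x *\<^sub>R (integral {t..t + x} F /\<^sub>R x - F t)"
          using x by (simp add: scaleR_diff_right)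
        also have "norm \<dots> \<le> x * e"
          using d(2)[OF x] x by (simp add: less_imp_le)
        finally show ?thesis by (simp add: mult.commute)
      qed
      then show "\<exists>d>0. \<forall>x. 0 < x \<longrightarrow> x < d \<longrightarrow> norm (\<integral>s. indicator {0..x} s *\<^sub>R (F (t + s) - F t) \<partial>lborel) \<le> e * x"
        using d(1) by blast
    qed
  qed
qed

lemma lebesgue_differentiation_left:
  fixes F :: "real \<Rightarrow> complex"
  assumes F: "integrable lborel F"
  shows "AE t in lborel. \<forall>e>0. \<exists>d>0. \<forall>x. 0 < x \<longrightarrow> x < d \<longrightarrow>
    norm (\<integral>s. indicator {0..x} s *\<^sub>R (F (t - s) - F t) \<partial>lborel) \<le> e * x"
proof -
  have "integrable lborel (\<lambda>s. F (- s))"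
    using lborel_integrable_real_affine[OF F, of "-1" 0] by simp
  from lebesgue_differentiation_right[OF this]
  have "AE t in distr lborel borel uminus. \<forall>e>0. \<exists>d>0. \<forall>x. 0 < x \<longrightarrow> x < d \<longrightarrow>
      norm (\<integral>s. indicator {0..x} s *\<^sub>R (F (- (t + s)) - F (- t)) \<partial>lborel) \<le> e * x"
    unfolding lborel_distr_uminus .
  from AE_distrD[OF _ this] show ?thesis by simp
qed

lemma AE_summable_of_summable_integrals:
  fixes f :: "nat \<Rightarrow> real \<Rightarrow> complex"
  assumes int: "\<And>k. integrable lborel (f k)" and sum: "summable (\<lambda>k. \<integral>x. norm (f k x) \<partial>lborel)"
  shows "AE x in lborel. summable (\<lambda>k. norm (f k x))"
proof -
  have m: "(\<lambda>x. ennreal (norm (f k x))) \<in> borel_measurable lborel" for k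
    using borel_measurable_integrable[OF int[of k]] by simp
  have "(\<integral>\<^sup>+x. (\<Sum>k. ennreal (norm (f k x))) \<partial>lborel) = (\<Sum>k. \<integral>\<^sup>+x. ennreal (norm (f k x)) \<partial>lborel)"
    by (rule nn_integral_suminf[OF m])
  also have "\<dots> = (\<Sum>k. ennreal (\<integral>x. norm (f k x) \<partial>lborel))"
    by (subst nn_integral_eq_integral[OF integrable_norm[OF int]]) auto
  also have "\<dots> \<noteq> \<infinity>"
    using sum by (subst suminf_ennreal2) (auto intro!: Bochner_Integration.integral_nonneg)
  finally have "AE x in lborel. (\<Sum>k. ennreal (norm (f k x))) \<noteq> \<infinity>"
    by (intro nn_integral_noteq_infinite borel_measurable_suminf_order m)
  then show ?thesis
    by eventually_elim (auto intro: summable_suminf_not_top)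
qed

lemma trigonometric_parseval:
  fixes a :: "nat \<Rightarrow> complex"
  assumes "finite A"
  shows "(\<integral>u. indicator {-(2*pi*real M)..2*pi*real M} u * (norm (\<Sum>n\<in>A. a n * cis (of_nat n * u)))\<^sup>2 \<partial>lborel)
    = 2 * (2 * pi * real M) * (\<Sum>n\<in>A. (norm (a n))\<^sup>2)"
proof -
  let ?J = "{-(2*pi*real M)..2*pi*real M}"
  have J: "?J = {-(2*pi*real M)..-(2*pi*real M) + 2 * pi * real (2 * M)}" by simp
  have c: "(\<integral>u. indicator ?J u *\<^sub>R cis (of_int k * u) \<partial>lborel) = (if k = 0 then of_real (2 * (2 * pi * real M)) else 0)" for k :: int
    unfolding J integral_cis_period by simp
  have i: "integrable lborel (\<lambda>u. (a n * cnj (a m)) * (indicator ?J u *\<^sub>R cis (of_int (int n - int m) * u)))" for n m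
    by (intro integrable_mult_right integrable_Icc_indicator continuous_intros)
  have "complex_of_real (indicator ?J u * (norm (\<Sum>n\<in>A. a n * cis (of_nat n * u)))\<^sup>2)
      = (\<Sum>n\<in>A. \<Sum>m\<in>A. (a n * cnj (a m)) * (indicator ?J u *\<^sub>R cis (of_int (int n - int m) * u)))" for u
  proof -
    have "complex_of_real ((norm (\<Sum>n\<in>A. a n * cis (of_nat n * u)))\<^sup>2)
        = (\<Sum>n\<in>A. \<Sum>m\<in>A. (a n * cis (of_nat n * u)) * cnj (a m * cis (of_nat m * u)))"
      unfolding complex_norm_square cnj_sum sum_product ..
    also have "\<dots> = (\<Sum>n\<in>A. \<Sum>m\<in>A. (a n * cnj (a m)) * cis (of_int (int n - int m) * u))"
    proof (intro sum.cong refl)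
      fix n m
      have "cis (of_nat n * u) * cnj (cis (of_nat m * u)) = cis (of_int (int n - int m) * u)"
        by (simp add: cis_cnj cis_mult left_diff_distrib)
      then show "(a n * cis (of_nat n * u)) * cnj (a m * cis (of_nat m * u)) = (a n * cnj (a m)) * cis (of_int (int n - int m) * u)"
        by (simp add: mult_ac)
    qed
    finally show ?thesis by (auto simp: indicator_def)
  qed
  then have "complex_of_real (\<integral>u. indicator ?J u * (norm (\<Sum>n\<in>A. a n * cis (of_nat n * u)))\<^sup>2 \<partial>lborel)
      = (\<integral>u. (\<Sum>n\<in>A. \<Sum>m\<in>A. (a n * cnj (a m)) * (indicator ?J u *\<^sub>R cis (of_int (int n - int m) * u))) \<partial>lborel)"
    by (simp only: integral_complex_of_real[symmetric])
  also have "\<dots> = (\<Sum>n\<in>A. \<Sum>m\<in>A. (\<integral>u. (a n * cnj (a m)) * (indicator ?J u *\<^sub>R cis (of_int (int n - int m) * u)) \<partial>lborel))"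
    by (subst Bochner_Integration.integral_sum, intro Bochner_Integration.integrable_sum i,
        intro sum.cong refl, rule Bochner_Integration.integral_sum, rule i)
  also have "\<dots> = (\<Sum>n\<in>A. \<Sum>m\<in>A. (a n * cnj (a m)) * (if n = m then of_real (2 * (2 * pi * real M)) else 0))"
    unfolding integral_mult_right_zero c by (intro sum.cong refl) simp
  also have "\<dots> = (\<Sum>n\<in>A. of_real (2 * (2 * pi * real M) * (norm (a n))\<^sup>2))"
  proof (rule sum.cong[OF refl])
    fix n assume n: "n \<in> A"
    have "(\<Sum>m\<in>A. (a n * cnj (a m)) * (if n = m then of_real (2 * (2 * pi * real M)) else 0))
        = (\<Sum>m\<in>A. if n = m then (a n * cnj (a n)) * of_real (2 * (2 * pi * real M)) else 0)"
      by (rule sum.cong) auto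
    also have "\<dots> = (a n * cnj (a n)) * of_real (2 * (2 * pi * real M))"
      using n assms by simp
    also have "a n * cnj (a n) = of_real ((norm (a n))\<^sup>2)" by (rule complex_norm_square[symmetric])
    finally show "(\<Sum>m\<in>A. (a n * cnj (a m)) * (if n = m then of_real (2 * (2 * pi * real M)) else 0))
        = of_real (2 * (2 * pi * real M) * (norm (a n))\<^sup>2)" by simp
  qed
  finally show ?thesis
    unfolding of_real_sum[symmetric] of_real_eq_iff sum_distrib_left .
qed

text \<open>The mean is bounded by the square mean through \<open>x \<le> (\<epsilon> + x\<^sup>2 / \<epsilon>) / 2\<close>.\<close>

lemma trigonometric_L1_bound:
  fixes a :: "nat \<Rightarrow> complex"
  assumes "finite A" "0 < \<epsilon>" "(\<Sum>n\<in>A. (norm (a n))\<^sup>2) \<le> \<epsilon>\<^sup>2"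
  shows "(\<integral>u. norm (indicator {-(2*pi*real M)..2*pi*real M} u *\<^sub>R (\<Sum>n\<in>A. a n * cis (of_nat n * u))) \<partial>lborel)
    \<le> 2 * (2 * pi * real M) * \<epsilon>"
proof -
  let ?J = "{-(2*pi*real M)..2*pi*real M}"
  let ?T = "\<lambda>u. \<Sum>n\<in>A. a n * cis (of_nat n * u)"
  let ?g = "\<lambda>u. (1/2) * (indicator ?J u * \<epsilon> + (1 / \<epsilon>) * (indicator ?J u * (norm (?T u))\<^sup>2))"
  have cT: "continuous_on S ?T" for S by (intro continuous_intros)
  have i1: "integrable lborel (\<lambda>u. indicator ?J u *\<^sub>R ?T u)" by (rule integrable_Icc_indicator[OF cT])
  have "continuous_on ?J (\<lambda>u. (norm (?T u))\<^sup>2)" by (intro continuous_intros cT)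
  from borel_integrable_atLeastAtMost'[OF this]
  have i2: "integrable lborel (\<lambda>u. indicator ?J u * (norm (?T u))\<^sup>2)" by (simp add: set_integrable_def)
  have i3: "integrable lborel (\<lambda>u. indicator ?J u * \<epsilon>)" by (rule integrable_indicator_Icc_const)
  have ig: "integrable lborel ?g" by (intro integrable_mult_right Bochner_Integration.integrable_add i2 i3)
  have le: "x \<le> (1/2) * (\<epsilon> + (1 / \<epsilon>) * x\<^sup>2)" for x :: real
  proof -
    have "2 * \<epsilon> * x \<le> \<epsilon>\<^sup>2 + x\<^sup>2" by (rule sum_squares_bound)
    then show ?thesis using assms(2) by (simp add: field_simps power2_eq_square)
  qed
  have "(\<integral>u. norm (indicator ?J u *\<^sub>R ?T u) \<partial>lborel) \<le> integral\<^sup>L lborel ?g"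
    by (rule integral_mono[OF integrable_norm[OF i1] ig]) (use le in \<open>auto simp: indicator_def\<close>)
  also have "integral\<^sup>L lborel ?g = (1/2) * (2 * (2 * pi * real M) * \<epsilon> + (1 / \<epsilon>) * (2 * (2 * pi * real M) * (\<Sum>n\<in>A. (norm (a n))\<^sup>2)))"
    unfolding integral_mult_right_zero Bochner_Integration.integral_add[OF i3 integrable_mult_right[OF i2]]
      trigonometric_parseval[OF assms(1)] by simp
  also have "\<dots> \<le> (1/2) * (2 * (2 * pi * real M) * \<epsilon> + (1 / \<epsilon>) * (2 * (2 * pi * real M) * \<epsilon>\<^sup>2))"
    using assms by (intro mult_left_mono add_left_mono) auto
  also have "\<dots> = 2 * (2 * pi * real M) * \<epsilon>" using assms(2) by (simp add: field_simps power2_eq_square)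
  finally show ?thesis .
qed

text \<open>Cutting a square summable sequence into blocks whose norms decrease geometrically makes the
  trigonometric series converge absolutely in mean, block by block.\<close>

lemma square_summable_blocks:
  fixes a :: "nat \<Rightarrow> complex"
  assumes "summable (\<lambda>n. (norm (a n))\<^sup>2)"
  obtains N where "N 0 = 0" "strict_mono N"
    "\<And>k. k > 0 \<Longrightarrow> (\<Sum>n\<in>{N k..<N (Suc k)}. (norm (a n))\<^sup>2) \<le> ((1/2) ^ k)\<^sup>2"
proof -
  have "\<exists>M. \<forall>m\<ge>M. \<forall>n. norm (sum (\<lambda>n. (norm (a n))\<^sup>2) {m..<n}) < ((1/2) ^ k)\<^sup>2" for k
    using assms unfolding summable_Cauchy by (rule allE[of _ "((1/2) ^ k)\<^sup>2"]) auto
  then obtain M where M: "\<And>k m n. m \<ge> M k \<Longrightarrow> norm (sum (\<lambda>n. (norm (a n))\<^sup>2) {m..<n}) < ((1/2) ^ k)\<^sup>2"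
    by metis
  define N where "N k = (if k = 0 then 0 else k + (\<Sum>i\<le>k. M i))" for k
  show ?thesis
  proof (rule that[of N])
    show "strict_mono N" by (rule strict_monoI_Suc) (auto simp: N_def)
    fix k :: nat assume "k > 0"
    then have "N k \<ge> M k" by (auto simp: N_def intro!: trans_le_add2 member_le_sum)
    from M[OF this, of "N (Suc k)"]
    show "(\<Sum>n\<in>{N k..<N (Suc k)}. (norm (a n))\<^sup>2) \<le> ((1/2) ^ k)\<^sup>2" by simp
  qed (simp add: N_def)
qed

lemma sum_blocks:
  fixes f :: "nat \<Rightarrow> complex"
  assumes "N 0 = 0" "strict_mono N" "summable f"
  shows "(\<lambda>k. sum f {N k..<N (Suc k)}) sums suminf f"
proof -
  have "(\<Sum>k<m. sum f {N k..<N (Suc k)}) = sum f {..<N m}" for m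
  proof (induction m)
    case (Suc m)
    have "{..<N (Suc m)} = {..<N m} \<union> {N m..<N (Suc m)}"
      using strict_mono_less_eq[OF assms(2), of m "Suc m"] by auto
    moreover have "sum f ({..<N m} \<union> {N m..<N (Suc m)}) = sum f {..<N m} + sum f {N m..<N (Suc m)}"
      by (rule sum.union_disjoint) auto
    ultimately show ?case using Suc by simp
  qed (simp add: assms)
  moreover have "(\<lambda>m. sum f {..<N m}) \<longlonglongrightarrow> suminf f"
    using LIMSEQ_subseq_LIMSEQ[OF summable_LIMSEQ[OF assms(3)] assms(2)] by (simp add: o_def)
  ultimately show ?thesis by (simp add: sums_def)
qed

lemma power_series_summable_of_square_summable:
  fixes a :: "nat \<Rightarrow> complex"
  assumes "summable (\<lambda>n. (norm (a n))\<^sup>2)" "norm x < 1"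
  shows "summable (\<lambda>n. a n * x ^ n)"
proof (rule summable_comparison_test')
  show "summable (\<lambda>n. (norm (a n))\<^sup>2 + norm x ^ n)"
    by (intro summable_add assms summable_geometric) (use assms in auto)
  fix n
  have x: "norm x ^ n \<le> 1" "0 \<le> norm x ^ n" using assms by (auto intro: power_le_one)
  have "2 * (norm (a n) * norm x ^ n) \<le> (norm (a n))\<^sup>2 + (norm x ^ n)\<^sup>2"
    using sum_squares_bound[of "norm (a n)" "norm x ^ n"] by (simp add: mult.assoc)
  moreover have "(norm x ^ n)\<^sup>2 \<le> norm x ^ n" using x by (simp add: power2_eq_square mult_left_le)
  moreover have "0 \<le> norm (a n) * norm x ^ n" by simp
  ultimately show "norm (a n * x ^ n) \<le> (norm (a n))\<^sup>2 + norm x ^ n"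
    unfolding norm_mult norm_power by linarith
qed

text \<open>The function \<open>F\<close> is the boundary function of the power series, cut off outside finitely many
  periods to make it integrable.  Its blocks converge absolutely in mean, so the series of blocks can
  be integrated against the bounded Poisson kernel term by term.  The condition on \<open>t\<close> keeps the
  window \<open>{t - pi..t + pi}\<close> inside the region that is not cut off.\<close>

lemma poisson_representation:
  fixes a :: "nat \<Rightarrow> complex"
  assumes a: "summable (\<lambda>n. (norm (a n))\<^sup>2)"
  obtains F :: "real \<Rightarrow> complex" where "integrable lborel F"
    "\<And>r t. 0 \<le> r \<Longrightarrow> r < 1 \<Longrightarrow> \<bar>t\<bar> \<le> 2 * pi * real M - pi \<Longrightarrow>
      (\<integral>s. indicator {-pi..pi} s *\<^sub>R (of_real (poisson r s) * F (t + s)) \<partial>lborel)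
        = 2 * of_real pi * (\<Sum>n. a n * (of_real r * cis t) ^ n)"
proof -
  define R where "R = 2 * pi * real M"
  obtain N where N: "N 0 = 0" "strict_mono N"
    "\<And>k. k > 0 \<Longrightarrow> (\<Sum>n\<in>{N k..<N (Suc k)}. (norm (a n))\<^sup>2) \<le> ((1/2) ^ k)\<^sup>2"
    using square_summable_blocks[OF a] by blast
  define T where "T k u = (\<Sum>n\<in>{N k..<N (Suc k)}. a n * cis (of_nat n * u))" for k u
  define d where "d k u = indicator {-R..R} u *\<^sub>R T k u" for k u
  have cT: "continuous_on S (T k)" for S k unfolding T_def[abs_def] by (intro continuous_intros)
  have int: "integrable lborel (d k)" for k
    unfolding d_def[abs_def] by (rule integrable_Icc_indicator[OF cT])
  have sum: "summable (\<lambda>k. \<integral>u. norm (d k u) \<partial>lborel)"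
  proof (rule summable_comparison_test'[of "\<lambda>k. 2 * R * (1/2) ^ k" 1])
    show "summable (\<lambda>k. 2 * R * (1/2) ^ k)" by (intro summable_mult summable_geometric) simp
    fix k :: nat assume "k \<ge> 1"
    then have "(\<integral>u. norm (d k u) \<partial>lborel) \<le> 2 * R * (1/2) ^ k"
      unfolding d_def T_def R_def by (intro trigonometric_L1_bound N(3)) auto
    moreover have "0 \<le> (\<integral>u. norm (d k u) \<partial>lborel)" by (rule Bochner_Integration.integral_nonneg) simp
    ultimately show "norm (\<integral>u. norm (d k u) \<partial>lborel) \<le> 2 * R * (1/2) ^ k" by simp
  qed
  have AE: "AE u in lborel. summable (\<lambda>k. norm (d k u))"
    by (rule AE_summable_of_summable_integrals[OF int sum])
  define F where "F u = (\<Sum>k. d k u)" for u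
  have intF: "integrable lborel F"
    unfolding F_def[abs_def] by (rule integrable_suminf[OF int AE sum])
  have "(\<integral>s. indicator {-pi..pi} s *\<^sub>R (of_real (poisson r s) * F (t + s)) \<partial>lborel)
      = 2 * of_real pi * (\<Sum>n. a n * (of_real r * cis t) ^ n)"
    if r: "0 \<le> r" "r < 1" and t: "\<bar>t\<bar> \<le> R - pi" for r t
  proof -
    define K where "K u = indicator {t - pi..t + pi} u *\<^sub>R complex_of_real (poisson r (u - t))" for u
    have cK: "continuous_on {t - pi..t + pi} (\<lambda>u. complex_of_real (poisson r (u - t)))"
      by (intro continuous_intros continuous_on_compose2[OF continuous_on_poisson[OF r, of UNIV]]) auto
    have mK: "K \<in> borel_measurable borel"
      using borel_measurable_integrable[OF integrable_Icc_indicator[OF cK]] by (simp add: K_def[abs_def])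
    obtain C where C: "\<And>u. norm (K u) \<le> C"
    proof -
      have "bounded ((\<lambda>u. complex_of_real (poisson r (u - t))) ` {t - pi..t + pi})"
        by (intro compact_imp_bounded compact_continuous_image cK) simp
      then obtain B where "\<And>u. u \<in> {t - pi..t + pi} \<Longrightarrow> norm (complex_of_real (poisson r (u - t))) \<le> B"
        unfolding bounded_iff by blast
      then have "norm (K u) \<le> max B 0" for u by (auto simp: K_def indicator_def le_max_iff_disj)
      then show ?thesis using that by blast
    qed
    have intK: "integrable lborel (\<lambda>u. K u * f u)" if f: "integrable lborel f" for f
    proof (rule Bochner_Integration.integrable_bound)
      show "integrable lborel (\<lambda>u. of_real C * f u)" by (rule integrable_mult_right[OF f])
      show "(\<lambda>u. K u * f u) \<in> borel_measurable lborel"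
        using mK borel_measurable_integrable[OF f] by simp
      have "norm (K u) * norm (f u) \<le> \<bar>C\<bar> * norm (f u)" for u
        using C[of u] by (intro mult_right_mono) auto
      then show "AE u in lborel. norm (K u * f u) \<le> norm (of_real C * f u)"
        by (simp add: norm_mult)
    qed
    have shift: "(\<integral>u. K u * f u \<partial>lborel) = (\<integral>s. indicator {-pi..pi} s *\<^sub>R (of_real (poisson r s) * f (t + s)) \<partial>lborel)" for f
      by (subst lborel_integral_real_affine[where c = 1 and t = t])
        (auto intro!: Bochner_Integration.integral_cong simp: K_def indicator_def)
    have "(\<lambda>k. \<integral>u. K u * d k u \<partial>lborel) sums (\<integral>u. (\<Sum>k. K u * d k u) \<partial>lborel)"
    proof (rule sums_integral[OF intK[OF int]])
      show "AE u in lborel. summable (\<lambda>k. norm (K u * d k u))"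
        using AE by eventually_elim (simp add: norm_mult summable_mult)
      show "summable (\<lambda>k. \<integral>u. norm (K u * d k u) \<partial>lborel)"
      proof (rule summable_comparison_test')
        show "summable (\<lambda>k. C * (\<integral>u. norm (d k u) \<partial>lborel))" by (rule summable_mult[OF sum])
        fix k
        have "(\<integral>u. norm (K u * d k u) \<partial>lborel) \<le> (\<integral>u. C * norm (d k u) \<partial>lborel)"
          using C by (intro integral_mono integrable_norm intK int integrable_mult_right)
            (auto simp: norm_mult mult_right_mono)
        moreover have "0 \<le> (\<integral>u. norm (K u * d k u) \<partial>lborel)" by (rule Bochner_Integration.integral_nonneg) simp
        ultimately show "norm (\<integral>u. norm (K u * d k u) \<partial>lborel) \<le> C * (\<integral>u. norm (d k u) \<partial>lborel)" by simp
      qed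
    qed
    moreover have "(\<integral>u. (\<Sum>k. K u * d k u) \<partial>lborel) = (\<integral>u. K u * F u \<partial>lborel)"
    proof (rule integral_cong_AE)
      show "(\<lambda>u. \<Sum>k. K u * d k u) \<in> borel_measurable lborel"
        using borel_measurable_integrable[OF intK[OF int]] by (intro borel_measurable_suminf) auto
      show "(\<lambda>u. K u * F u) \<in> borel_measurable lborel"
        by (rule borel_measurable_integrable[OF intK[OF intF]])
      show "AE u in lborel. (\<Sum>k. K u * d k u) = K u * F u"
        using AE by eventually_elim (auto simp: F_def intro!: suminf_mult summable_norm_cancel)
    qed
    moreover have "(\<integral>u. K u * d k u \<partial>lborel) = 2 * of_real pi * (\<Sum>n\<in>{N k..<N (Suc k)}. a n * (of_real r * cis t) ^ n)" for k
    proof -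
      have i: "integrable lborel (\<lambda>s. (a n * cis (of_nat n * t)) * (indicator {-pi..pi} s *\<^sub>R (of_real (poisson r s) * cis (of_nat n * s))))" for n
        using r by (intro integrable_mult_right integrable_Icc_indicator continuous_intros
            continuous_on_poisson)
      have "(\<integral>u. K u * d k u \<partial>lborel) = (\<integral>s. (\<Sum>n\<in>{N k..<N (Suc k)}. (a n * cis (of_nat n * t)) *
          (indicator {-pi..pi} s *\<^sub>R (of_real (poisson r s) * cis (of_nat n * s)))) \<partial>lborel)"
        unfolding shift
      proof (rule Bochner_Integration.integral_cong[OF refl])
        fix s
        show "indicator {-pi..pi} s *\<^sub>R (of_real (poisson r s) * d k (t + s))
            = (\<Sum>n\<in>{N k..<N (Suc k)}. (a n * cis (of_nat n * t)) *
              (indicator {-pi..pi} s *\<^sub>R (of_real (poisson r s) * cis (of_nat n * s))))"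
        proof (cases "s \<in> {-pi..pi}")
          case True
          then have "t + s \<in> {-R..R}" using t by auto
          then show ?thesis
            using True by (simp add: d_def T_def sum_distrib_left distrib_left cis_mult[symmetric] mult_ac)
        qed simp
      qed
      also have "\<dots> = (\<Sum>n\<in>{N k..<N (Suc k)}. (a n * cis (of_nat n * t)) * (2 * of_real pi * of_real (r ^ n)))"
        by (subst Bochner_Integration.integral_sum[OF i]) (simp only: integral_mult_right_zero poisson_fourier[OF r])
      also have "\<dots> = 2 * of_real pi * (\<Sum>n\<in>{N k..<N (Suc k)}. a n * (of_real r * cis t) ^ n)"
        unfolding sum_distrib_left by (rule sum.cong) (auto simp: power_mult_distrib Complex.DeMoivre mult_ac)
      finally show ?thesis .
    qed
    moreover have "(\<lambda>k. 2 * of_real pi * (\<Sum>n\<in>{N k..<N (Suc k)}. a n * (of_real r * cis t) ^ n))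
        sums (2 * of_real pi * (\<Sum>n. a n * (of_real r * cis t) ^ n))"
      by (intro sums_mult sum_blocks[OF N(1,2)] power_series_summable_of_square_summable a)
        (use r in \<open>simp add: norm_mult\<close>)
    ultimately have "(\<integral>u. K u * F u \<partial>lborel) = 2 * of_real pi * (\<Sum>n. a n * (of_real r * cis t) ^ n)"
      using sums_unique2 by simp
    then show ?thesis unfolding shift .
  qed
  then show ?thesis using that intF by (auto simp: R_def)
qed

lemma poisson_minus: "poisson r (- s) = poisson r s"
  by (simp add: poisson_def)

text \<open>At a Lebesgue point \<open>t\<close> of the boundary function \<open>F\<close>, the Poisson integral of
  \<open>F (t + s) - F t\<close> over each half of the period tends to zero, so the radial limit is \<open>F t\<close>.\<close>

theorem fatou_radial_limits:
  fixes a :: "nat \<Rightarrow> complex"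
  assumes a: "summable (\<lambda>n. (norm (a n))\<^sup>2)"
  shows "AE t in lborel. \<exists>l. ((\<lambda>r. \<Sum>n. a n * (of_real r * cis t) ^ n) \<longlongrightarrow> l) (at_left (1::real))"
proof -
  have "AE t in lborel. \<bar>t\<bar> \<le> 2 * pi * real M - pi \<longrightarrow>
      (\<exists>l. ((\<lambda>r. \<Sum>n. a n * (of_real r * cis t) ^ n) \<longlongrightarrow> l) (at_left (1::real)))" for M
  proof -
    obtain F :: "real \<Rightarrow> complex" where F: "integrable lborel F" and rep:
      "\<And>r t. 0 \<le> r \<Longrightarrow> r < 1 \<Longrightarrow> \<bar>t\<bar> \<le> 2 * pi * real M - pi \<Longrightarrow>
        (\<integral>s. indicator {-pi..pi} s *\<^sub>R (of_real (poisson r s) * F (t + s)) \<partial>lborel)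
          = 2 * of_real pi * (\<Sum>n. a n * (of_real r * cis t) ^ n)"
      by (rule poisson_representation[OF a, where M = M]) (rule that; assumption)
    show ?thesis
      using lebesgue_differentiation_right[OF F] lebesgue_differentiation_left[OF F]
    proof eventually_elim
      case (elim t)
      show ?case
      proof
        assume t: "\<bar>t\<bar> \<le> 2 * pi * real M - pi"
        define p where "p s = F (t + s) - F t" for s
        define m where "m s = F (t - s) - F t" for s
        have ip: "integrable lborel (\<lambda>s. indicator {b..c} s *\<^sub>R p s)" for b c
        proof -
          have "integrable lborel (\<lambda>s. indicator {b..c} s *\<^sub>R F (t + s))"
            using lborel_integrable_real_affine[OF F, of 1 t] by (intro integrable_mult_indicator) auto
          moreover have "integrable lborel (\<lambda>s. indicator {b..c} s *\<^sub>R F t)"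
            by (intro integrable_Icc_indicator continuous_intros)
          ultimately show ?thesis unfolding p_def scaleR_diff_right by (rule Bochner_Integration.integrable_diff)
        qed
        have im: "integrable lborel (\<lambda>s. indicator {0..pi} s *\<^sub>R m s)"
        proof -
          have "integrable lborel (\<lambda>s. indicator {-pi..0} (0 + (-1) * s) *\<^sub>R p (0 + (-1) * s))"
            by (rule lborel_integrable_real_affine[OF ip]) simp
          moreover have "indicator {-pi..0} (0 + (-1) * s) *\<^sub>R p (0 + (-1) * s) = indicator {0..pi} s *\<^sub>R m s" for s
            by (auto simp: indicator_def p_def m_def)
          ultimately show ?thesis by simp
        qed
        let ?I = "\<lambda>r h. \<integral>s. indicator {0..pi} s *\<^sub>R (of_real (poisson r s) * h s) \<partial>lborel"
        have eq: "?I r p + ?I r m = 2 * of_real pi * ((\<Sum>n. a n * (of_real r * cis t) ^ n) - F t)"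
          if r: "0 \<le> r" "r < 1" for r
        proof -
          have iP: "integrable lborel (\<lambda>s. indicator {b..c} s *\<^sub>R (of_real (poisson r s) * p s))" for b c
            by (rule integrable_poisson_mult[OF r ip])
          have "(\<integral>s. indicator {-pi..0} s *\<^sub>R (of_real (poisson r s) * p s) \<partial>lborel) = ?I r m"
            by (subst lborel_integral_real_affine[where c = "-1" and t = 0])
              (auto intro!: Bochner_Integration.integral_cong simp: indicator_def poisson_minus p_def m_def)
          then have "?I r p + ?I r m = (\<integral>s. indicator {0..pi} s *\<^sub>R (of_real (poisson r s) * p s)
              + indicator {-pi..0} s *\<^sub>R (of_real (poisson r s) * p s) \<partial>lborel)"
            by (subst Bochner_Integration.integral_add[OF iP iP]) simp
          also have "\<dots> = (\<integral>s. indicator {-pi..pi} s *\<^sub>R (of_real (poisson r s) * p s) \<partial>lborel)"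
          proof (rule integral_cong_AE)
            have "AE s in (lborel :: real measure). s \<noteq> 0" by (rule AE_lborel_singleton)
            then show "AE s in lborel. indicator {0..pi} s *\<^sub>R (of_real (poisson r s) * p s)
                + indicator {-pi..0} s *\<^sub>R (of_real (poisson r s) * p s)
                = indicator {-pi..pi} s *\<^sub>R (of_real (poisson r s) * p s)"
              by eventually_elim (auto simp: indicator_def)
          qed (intro borel_measurable_integrable Bochner_Integration.integrable_add iP)+
          also have "\<dots> = (\<integral>s. indicator {-pi..pi} s *\<^sub>R (of_real (poisson r s) * F (t + s))
              - F t * (indicator {-pi..pi} s *\<^sub>R (of_real (poisson r s) * cis (of_nat 0 * s))) \<partial>lborel)"
            by (rule Bochner_Integration.integral_cong) (auto simp: p_def indicator_def algebra_simps)
          also have "\<dots> = (\<integral>s. indicator {-pi..pi} s *\<^sub>R (of_real (poisson r s) * F (t + s)) \<partial>lborel)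
              - F t * (\<integral>s. indicator {-pi..pi} s *\<^sub>R (of_real (poisson r s) * cis (of_nat 0 * s)) \<partial>lborel)"
          proof -
            have "integrable lborel (\<lambda>s. indicator {-pi..pi} s *\<^sub>R F (t + s))"
              using lborel_integrable_real_affine[OF F, of 1 t] by (intro integrable_mult_indicator) auto
            then have 1: "integrable lborel (\<lambda>s. indicator {-pi..pi} s *\<^sub>R (of_real (poisson r s) * F (t + s)))"
              by (rule integrable_poisson_mult[OF r])
            have 2: "integrable lborel (\<lambda>s. indicator {-pi..pi} s *\<^sub>R (of_real (poisson r s) * cis (of_nat 0 * s)))"
              by (intro integrable_poisson_mult[OF r] integrable_Icc_indicator continuous_intros)
            show ?thesis
              by (simp only: Bochner_Integration.integral_diff[OF 1 integrable_mult_right[OF 2]] integral_mult_right_zero)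
          qed
          also have "\<dots> = 2 * of_real pi * (\<Sum>n. a n * (of_real r * cis t) ^ n) - F t * (2 * of_real pi * of_real (r ^ 0))"
            unfolding rep[OF r t] poisson_fourier[OF r] ..
          finally show ?thesis by (simp add: algebra_simps)
        qed
        have "((\<lambda>r. ?I r p) \<longlongrightarrow> 0) (at_left 1)" "((\<lambda>r. ?I r m) \<longlongrightarrow> 0) (at_left 1)"
          using elim by (intro poisson_one_sided_limit ip im; simp add: p_def m_def)+
        then have "((\<lambda>r. F t + (?I r p + ?I r m) / (2 * of_real pi)) \<longlongrightarrow> F t + (0 + 0) / (2 * of_real pi)) (at_left 1)"
          by (intro tendsto_intros) auto
        moreover have "\<forall>\<^sub>F r in at_left (1::real). F t + (?I r p + ?I r m) / (2 * of_real pi) = (\<Sum>n. a n * (of_real r * cis t) ^ n)"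
          by (rule eventually_at_leftI[of 0]) (auto simp: eq)
        ultimately have "((\<lambda>r. \<Sum>n. a n * (of_real r * cis t) ^ n) \<longlongrightarrow> F t + (0 + 0) / (2 * of_real pi)) (at_left 1)"
          by (rule Lim_transform_eventually)
        then show "\<exists>l. ((\<lambda>r. \<Sum>n. a n * (of_real r * cis t) ^ n) \<longlongrightarrow> l) (at_left (1::real))" by blast
      qed
    qed
  qed
  then have "AE t in lborel. \<forall>M. \<bar>t\<bar> \<le> 2 * pi * real M - pi \<longrightarrow>
      (\<exists>l. ((\<lambda>r. \<Sum>n. a n * (of_real r * cis t) ^ n) \<longlongrightarrow> l) (at_left (1::real)))"
    unfolding AE_all_countable by blast
  then show ?thesis
  proof eventually_elim
    case (elim t)
    obtain M :: nat where "(\<bar>t\<bar> + pi) / (2 * pi) \<le> real M" using real_arch_simple by blast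
    then have "\<bar>t\<bar> \<le> 2 * pi * real M - pi" by (simp add: field_simps)
    then show ?case using elim by blast
  qed
qed


section \<open>Isometric multipliers are inner functions\<close>

lemma bij_betw_const_index: "bij_betw (\<lambda>n (_ :: 1). n :: nat) UNIV UNIV"
  by (rule bij_betwI[where g = "\<lambda>k. k 1"]) (auto simp: fun_eq_iff num1_eq_iff)

lemma Rep_H2_disc_sums:
  fixes h :: "1 H2"
  assumes "norm w < 1"
  shows "(\<lambda>n. H2_coeff h (\<lambda>_. n) * w ^ n) sums Rep_H2 h (\<chi> _. w)"
proof -
  have "(\<chi> _::1. w) \<in> polydisc" using assms by (simp add: polydisc_def)
  from H2_coeff_has_sum[OF this, of h]
  have "((\<lambda>n. zpow (\<chi> _::1. w) (\<lambda>_. n) * H2_coeff h (\<lambda>_. n)) has_sum Rep_H2 h (\<chi> _. w)) UNIV"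
    by (subst has_sum_reindex_bij_betw[OF bij_betw_const_index, where f = "\<lambda>k. zpow (\<chi> _::1. w) k * H2_coeff h k"])
  then have "(\<lambda>n. zpow (\<chi> _::1. w) (\<lambda>_. n) * H2_coeff h (\<lambda>_. n)) sums Rep_H2 h (\<chi> _. w)"
    by (rule has_sum_imp_sums)
  then show ?thesis by (simp add: zpow_def mult.commute)
qed

lemma H2_coeff_disc_square_summable:
  fixes h :: "1 H2"
  shows "summable (\<lambda>n. (norm (H2_coeff h (\<lambda>_. n)))\<^sup>2)"
proof -
  have "(\<lambda>n. (norm (H2_coeff h (\<lambda>_::1. n)))\<^sup>2) summable_on UNIV"
    by (subst summable_on_reindex_bij_betw[OF bij_betw_const_index, where f = "\<lambda>k. (norm (H2_coeff h k))\<^sup>2"])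
      (rule H2_coeff_summable)
  then show ?thesis by (rule summable_on_imp_summable)
qed

text \<open>On a line \<open>\<theta> + t (1, \<dots>, 1)\<close> of angles, a function on the polydisc is a rotation of its
  restriction to a disc, to which the theorem of Fatou applies.\<close>

lemma radial_limits_on_diagonal:
  fixes g :: "'i::finite H2"
  assumes le: "\<And>z. z \<in> polydisc \<Longrightarrow> norm (Rep_H2 g z) \<le> 1"
  shows "AE t in lborel. \<exists>l. ((\<lambda>r. Rep_H2 g (torus_point r (\<chi> i. \<theta> $ i + t))) \<longlongrightarrow> l) (at_left (1::real))"
proof -
  define f where "f z = Rep_H2 g (\<chi> i. z $ 1 * cis (\<theta> $ i))" for z :: "complex^1"
  have pd: "(\<chi> i. w * cis (\<theta> $ i)) \<in> polydisc" if "norm w < 1" for w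
    using that by (simp add: polydisc_def norm_mult)
  have pd1: "norm (z $ 1) < 1" if "z \<in> polydisc" for z :: "complex^1" using that by (simp add: polydisc_def)
  have "f \<in> H_infinity"
  proof -
    have "continuous_on polydisc f"
      unfolding f_def
      by (intro continuous_on_compose2[OF continuous_on_Rep_H2] continuous_on_vec_lambda continuous_intros)
        (use pd pd1 in auto)
    moreover have "(\<lambda>w. f (\<chi> j. if j = i then w else z $ j)) holomorphic_on ball 0 1" for z :: "complex^1" and i
    proof -
      have "(\<lambda>w. Rep_H2 g (\<chi> i. w * cis (\<theta> $ i))) holomorphic_on ball 0 1"
        by (rule holomorphic_on_Rep_H2_compose) (auto intro!: holomorphic_intros pd)
      then show ?thesis by (simp add: f_def num1_eq_iff)
    qed
    moreover have "bounded (f ` polydisc)"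
      unfolding bounded_iff f_def using le[OF pd[OF pd1]] by blast
    ultimately show ?thesis unfolding H_infinity_def by blast
  qed
  then obtain h :: "1 H2" where h: "\<And>z. z \<in> polydisc \<Longrightarrow> Rep_H2 h z = f z" using H_infinity_in_H2 by blast
  show ?thesis
    using fatou_radial_limits[OF H2_coeff_disc_square_summable[of h]]
  proof eventually_elim
    case (elim t)
    then obtain l where l: "((\<lambda>r. \<Sum>n. H2_coeff h (\<lambda>_. n) * (of_real r * cis t) ^ n) \<longlongrightarrow> l) (at_left (1::real))"
      by blast
    have "\<forall>\<^sub>F r in at_left (1::real). (\<Sum>n. H2_coeff h (\<lambda>_. n) * (of_real r * cis t) ^ n) = Rep_H2 g (torus_point r (\<chi> i. \<theta> $ i + t))"
    proof (rule eventually_at_leftI[of 0])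
      fix r :: real assume "r \<in> {0<..<1}"
      then have w: "norm (of_real r * cis t) < 1" by (simp add: norm_mult)
      have "(\<Sum>n. H2_coeff h (\<lambda>_. n) * (of_real r * cis t) ^ n) = Rep_H2 h (\<chi> _. of_real r * cis t)"
        using Rep_H2_disc_sums[OF w, of h] by (simp add: sums_iff)
      also have "\<dots> = f (\<chi> _. of_real r * cis t)" by (rule h) (use w in \<open>simp add: polydisc_def\<close>)
      also have "\<dots> = Rep_H2 g (torus_point r (\<chi> i. \<theta> $ i + t))"
        by (simp add: f_def torus_point_def mult.assoc cis_mult add.commute)
      finally show "(\<Sum>n. H2_coeff h (\<lambda>_. n) * (of_real r * cis t) ^ n) = Rep_H2 g (torus_point r (\<chi> i. \<theta> $ i + t))" .
    qed simp
    then show ?case by (intro exI[of _ l] Lim_transform_eventually[OF l])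
  qed
qed

text \<open>The set of directions with a radial limit is Borel, by the Cauchy criterion restricted to
  rational radii.\<close>

lemma radial_limit_iff_rational_cauchy:
  fixes u :: "real \<Rightarrow> complex"
  assumes cont: "continuous_on {0..<1} u"
  shows "(\<exists>l. (u \<longlongrightarrow> l) (at_left 1)) \<longleftrightarrow>
    (\<forall>k::nat. \<exists>j::nat. \<forall>p\<in>\<rat> \<inter> {0..<1}. \<forall>q\<in>\<rat> \<inter> {0..<1}.
       1 - 1 / real (j + 2) < p \<longrightarrow> 1 - 1 / real (j + 2) < q \<longrightarrow> dist (u p) (u q) \<le> 1 / real (k + 1))"
    (is "?L \<longleftrightarrow> ?R")
proof
  assume ?L
  then obtain l where l: "(u \<longlongrightarrow> l) (at_left 1)" by blast
  show ?R
  proof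
    fix k :: nat
    have "\<forall>\<^sub>F r in at_left 1. dist (u r) l < 1 / (2 * real (k + 1))"
      using l by (rule tendstoD) simp
    then obtain b where b: "b < 1" "\<And>r. b < r \<Longrightarrow> r < 1 \<Longrightarrow> dist (u r) l < 1 / (2 * real (k + 1))"
      by (auto simp: eventually_at_left_field)
    obtain j :: nat where "1 / (1 - b) \<le> real j" using real_arch_simple by blast
    then have j: "b \<le> 1 - 1 / real (j + 2)"
      using b(1) by (simp add: field_simps)
    have "dist (u p) (u q) \<le> 1 / real (k + 1)"
      if "p < 1" "q < 1" "1 - 1 / real (j + 2) < p" "1 - 1 / real (j + 2) < q" for p q
    proof -
      have "dist (u p) (u q) \<le> dist (u p) l + dist (u q) l" by (rule dist_triangle2)
      also have "\<dots> \<le> 1 / (2 * real (k + 1)) + 1 / (2 * real (k + 1))"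
        using b(2)[of p] b(2)[of q] that j by (intro add_mono less_imp_le) auto
      also have "\<dots> = 1 / real (k + 1)" by (simp add: field_simps)
      finally show ?thesis .
    qed
    then show "\<exists>j::nat. \<forall>p\<in>\<rat> \<inter> {0..<1}. \<forall>q\<in>\<rat> \<inter> {0..<1}.
        1 - 1 / real (j + 2) < p \<longrightarrow> 1 - 1 / real (j + 2) < q \<longrightarrow> dist (u p) (u q) \<le> 1 / real (k + 1)"
      by (intro exI[of _ j]) auto
  qed
next
  assume R: ?R
  have all: "\<exists>j::nat. \<forall>p q. 1 - 1 / real (j + 2) < p \<longrightarrow> p < 1 \<longrightarrow> 1 - 1 / real (j + 2) < q \<longrightarrow> q < 1 \<longrightarrow>
      dist (u p) (u q) \<le> 1 / real (k + 1)" for k :: nat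
  proof -
    obtain j :: nat where jj: "\<forall>p\<in>\<rat> \<inter> {0..<1}. \<forall>q\<in>\<rat> \<inter> {0..<1}.
        1 - 1 / real (j + 2) < p \<longrightarrow> 1 - 1 / real (j + 2) < q \<longrightarrow> dist (u p) (u q) \<le> 1 / real (k + 1)"
      using R by blast
    have j: "dist (u p) (u q) \<le> 1 / real (k + 1)"
      if "p \<in> \<rat>" "q \<in> \<rat>" "0 \<le> p" "p < 1" "0 \<le> q" "q < 1"
        "1 - 1 / real (j + 2) < p" "1 - 1 / real (j + 2) < q" for p q
      using jj that by (meson IntI atLeastLessThan_iff)
    let ?b = "1 - 1 / real (j + 2)"
    have b0: "0 \<le> ?b" by (simp add: field_simps)
    have seq: "\<exists>s. (\<forall>n. s n \<in> \<rat> \<and> ?b < s n \<and> s n < 1) \<and> s \<longlonglongrightarrow> p" if p: "?b < p" "p < 1" for p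
    proof -
      have "\<exists>y\<in>\<rat>. max ?b (p - 1 / real (Suc n)) < y \<and> y < p" for n
        by (rule Rats_dense_in_real) (use p in simp)
      then obtain s where s: "\<And>n. s n \<in> \<rat>" "\<And>n. max ?b (p - 1 / real (Suc n)) < s n" "\<And>n. s n < p" by metis
      have "s \<longlonglongrightarrow> p"
      proof (rule tendsto_sandwich[of "\<lambda>n. p - 1 / real (Suc n)" _ _ "\<lambda>_. p"])
        show "(\<lambda>n. p - 1 / real (Suc n)) \<longlonglongrightarrow> p"
          using tendsto_diff[OF tendsto_const LIMSEQ_inverse_real_of_nat, of p] by (simp add: inverse_eq_divide)
      qed (use s in \<open>auto intro!: always_eventually less_imp_le simp: less_imp_le\<close>)
      then show ?thesis using s p by (intro exI[of _ s]) (auto intro: less_trans)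
    qed
    have "dist (u p) (u q) \<le> 1 / real (k + 1)" if p: "?b < p" "p < 1" and q: "?b < q" "q < 1" for p q
    proof -
      obtain s where s: "\<And>n. s n \<in> \<rat>" "\<And>n. ?b < s n" "\<And>n. s n < 1" "s \<longlonglongrightarrow> p" using seq[OF p] by blast
      obtain s' where s': "\<And>n. s' n \<in> \<rat>" "\<And>n. ?b < s' n" "\<And>n. s' n < 1" "s' \<longlonglongrightarrow> q" using seq[OF q] by blast
      have pos: "0 \<le> x" if "?b < x" for x using b0 that by linarith
      have "(\<lambda>n. u (s n)) \<longlonglongrightarrow> u p" "(\<lambda>n. u (s' n)) \<longlonglongrightarrow> u q"
        by (rule continuous_on_tendsto_compose[OF cont]; use s s' p q pos in \<open>auto intro!: always_eventually\<close>)+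
      then have "(\<lambda>n. dist (u (s n)) (u (s' n))) \<longlonglongrightarrow> dist (u p) (u q)" by (rule tendsto_dist)
      moreover have "dist (u (s n)) (u (s' n)) \<le> 1 / real (k + 1)" for n
        by (rule j) (use s s' pos in auto)
      ultimately show ?thesis by (intro LIMSEQ_le_const2) auto
    qed
    then show ?thesis by blast
  qed
  have "Cauchy (\<lambda>n. u (radius_seq n))"
  proof (rule metric_CauchyI)
    fix e :: real assume e: "e > 0"
    obtain k :: nat where k: "1 / real (k + 1) < e" using nat_approx_posE[OF e] by (metis Suc_eq_plus1)
    obtain j :: nat where j: "\<And>p q. 1 - 1 / real (j + 2) < p \<Longrightarrow> p < 1 \<Longrightarrow> 1 - 1 / real (j + 2) < q \<Longrightarrow> q < 1 \<Longrightarrow>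
      dist (u p) (u q) \<le> 1 / real (k + 1)" using all[of k] by blast
    have "dist (u (radius_seq m)) (u (radius_seq n)) < e" if "m \<ge> Suc j" "n \<ge> Suc j" for m n
    proof -
      have "1 - 1 / real (j + 2) < radius_seq i" if "i \<ge> Suc j" for i
        using that by (simp add: radius_seq_def field_simps)
      then show ?thesis using j[of "radius_seq m" "radius_seq n"] that radius_seq(2) k by fastforce
    qed
    then show "\<exists>M. \<forall>m\<ge>M. \<forall>n\<ge>M. dist (u (radius_seq m)) (u (radius_seq n)) < e" by blast
  qed
  then obtain l where l: "(\<lambda>n. u (radius_seq n)) \<longlonglongrightarrow> l" by (auto simp: Cauchy_convergent_iff convergent_def)
  have "(u \<longlongrightarrow> l) (at_left 1)"
  proof (rule tendstoI)
    fix e :: real assume e: "e > 0"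
    obtain k :: nat where k: "1 / real (k + 1) < e" using nat_approx_posE[OF e] by (metis Suc_eq_plus1)
    obtain j :: nat where j: "\<And>p q. 1 - 1 / real (j + 2) < p \<Longrightarrow> p < 1 \<Longrightarrow> 1 - 1 / real (j + 2) < q \<Longrightarrow> q < 1 \<Longrightarrow>
      dist (u p) (u q) \<le> 1 / real (k + 1)" using all[of k] by blast
    have "dist (u r) l \<le> 1 / real (k + 1)" if r: "1 - 1 / real (j + 2) < r" "r < 1" for r
    proof (rule LIMSEQ_le_const2)
      show "(\<lambda>n. dist (u r) (u (radius_seq n))) \<longlonglongrightarrow> dist (u r) l" by (intro tendsto_intros l)
      have "1 - 1 / real (j + 2) < radius_seq i" if "i \<ge> Suc j" for i
        using that by (simp add: radius_seq_def field_simps)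
      then show "\<exists>N. \<forall>n\<ge>N. dist (u r) (u (radius_seq n)) \<le> 1 / real (k + 1)"
        using j[OF r _ radius_seq(2)] by blast
    qed
    then have "\<And>r. r \<in> {1 - 1 / real (j + 2)<..<1} \<Longrightarrow> dist (u r) l < e" using k by fastforce
    moreover have "0 < 1 / real (j + 2)" by simp
    then have "1 - 1 / real (j + 2) < 1" by linarith
    ultimately show "\<forall>\<^sub>F r in at_left 1. dist (u r) l < e"
      by (rule eventually_at_leftI)
  qed
  then show ?L by blast
qed

lemma measurable_radial_limit_set:
  fixes f :: "complex^'i::finite \<Rightarrow> complex"
  assumes f: "continuous_on polydisc f"
  shows "{\<theta> :: real^'i. \<exists>l. ((\<lambda>r. f (torus_point r \<theta>)) \<longlongrightarrow> l) (at_left (1::real))} \<in> sets borel"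
proof -
  have cont: "continuous_on {0..<1} (\<lambda>r. f (torus_point r \<theta>))" for \<theta> :: "real^'i"
  proof (rule continuous_on_compose2[OF f])
    show "continuous_on {0..<1} (\<lambda>r. torus_point r \<theta>)"
      unfolding torus_point_def by (intro continuous_on_vec_lambda continuous_intros)
  qed (auto intro: torus_point_in_polydisc)
  have Q: "countable (\<rat> \<inter> {0..<1 :: real})" by (intro countable_Int1 countable_rat)
  have m: "{\<theta> :: real^'i. dist (f (torus_point p \<theta>)) (f (torus_point q \<theta>)) \<le> c} \<in> sets borel"
    if "p \<in> \<rat> \<inter> {0..<1}" "q \<in> \<rat> \<inter> {0..<1}" for p q c
  proof -
    have [measurable]: "(\<lambda>\<theta> :: real^'i. f (torus_point p \<theta>)) \<in> borel_measurable borel"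
      "(\<lambda>\<theta> :: real^'i. f (torus_point q \<theta>)) \<in> borel_measurable borel"
      using that by (auto intro!: borel_measurable_torus_point f)
    have "(\<lambda>\<theta>. dist (f (torus_point p \<theta>)) (f (torus_point q \<theta>))) -` {..c} \<inter> space borel \<in> sets (borel :: (real^'i) measure)"
      by (rule measurable_sets[OF borel_measurable_dist]) auto
    moreover have "(\<lambda>\<theta>. dist (f (torus_point p \<theta>)) (f (torus_point q \<theta>))) -` {..c} \<inter> space borel
        = {\<theta>. dist (f (torus_point p \<theta>)) (f (torus_point q \<theta>)) \<le> c}" by auto
    ultimately show ?thesis by simp
  qed
  have "{\<theta> :: real^'i. \<exists>l. ((\<lambda>r. f (torus_point r \<theta>)) \<longlongrightarrow> l) (at_left (1::real))}
      = (\<Inter>k::nat. \<Union>j::nat. \<Inter>p\<in>\<rat> \<inter> {0..<1}. \<Inter>q\<in>\<rat> \<inter> {0..<1}.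
          {\<theta>. 1 - 1 / real (j + 2) < p \<longrightarrow> 1 - 1 / real (j + 2) < q \<longrightarrow>
            dist (f (torus_point p \<theta>)) (f (torus_point q \<theta>)) \<le> 1 / real (k + 1)})"
    unfolding radial_limit_iff_rational_cauchy[OF cont]
    by (rule set_eqI) (simp only: mem_Collect_eq INT_iff UN_iff UNIV_I ball_UNIV bex_UNIV)
  also have "\<dots> \<in> sets borel"
  proof -
    have "{\<theta> :: real^'i. 1 - 1 / real (j + 2) < p \<longrightarrow> 1 - 1 / real (j + 2) < q \<longrightarrow>
        dist (f (torus_point p \<theta>)) (f (torus_point q \<theta>)) \<le> 1 / real (k + 1)} \<in> sets borel"
      if "p \<in> \<rat> \<inter> {0..<1}" "q \<in> \<rat> \<inter> {0..<1}" for p q k j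
      using m[OF that, of "1 / real (k + 1)"]
      by (cases "1 - 1 / real (j + 2) < p \<and> 1 - 1 / real (j + 2) < q") auto
    moreover have ne: "\<rat> \<inter> {0..<1 :: real} \<noteq> {}" by (auto intro!: exI[of _ 0])
    ultimately have "(\<Inter>p\<in>\<rat> \<inter> {0..<1}. \<Inter>q\<in>\<rat> \<inter> {0..<1}.
          {\<theta> :: real^'i. 1 - 1 / real (j + 2) < p \<longrightarrow> 1 - 1 / real (j + 2) < q \<longrightarrow>
            dist (f (torus_point p \<theta>)) (f (torus_point q \<theta>)) \<le> 1 / real (k + 1)}) \<in> sets borel" for k j
      by (intro sets.countable_INT'[OF Q ne] image_subsetI)
    then show ?thesis
      by (intro sets.countable_INT'[OF countableI_type UNIV_not_empty] sets.countable_nat_UN image_subsetI)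
  qed
  finally show ?thesis .
qed

text \<open>By Fubini and translation invariance, a Borel set which meets every line in the direction
  \<open>(1, \<dots>, 1)\<close> in a null set is a null set.\<close>

lemma AE_if_AE_on_diagonals:
  fixes P :: "real^'i::finite \<Rightarrow> bool"
  assumes meas: "{\<theta>. P \<theta>} \<in> sets borel"
    and AE: "\<And>\<theta>. AE t in lborel. P (\<chi> i. \<theta> $ i + t)"
  shows "AE \<theta> in lborel. P \<theta>"
proof -
  define A where "A = {\<theta>. \<not> P \<theta>}"
  have A: "A \<in> sets borel" using sets.compl_sets[OF meas] by (simp add: A_def Compl_eq_Diff_UNIV[symmetric] Collect_neg_eq)
  define v :: "real^'i" where "v = (\<chi> i. 1)"
  have v: "(\<chi> i. \<theta> $ i + t) = \<theta> + t *\<^sub>R v" for \<theta> :: "real^'i" and t by (simp add: v_def vec_eq_iff)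
  let ?f = "\<lambda>\<theta> t. indicator {0..1 :: real} t * (indicator A (\<theta> + t *\<^sub>R v) :: ennreal)"
  have mA: "(indicator A :: real^'i \<Rightarrow> ennreal) \<in> borel_measurable borel" using A by simp
  have mf: "(\<lambda>(\<theta>, t). ?f \<theta> t) \<in> borel_measurable (lborel \<Otimes>\<^sub>M lborel)"
  proof -
    have "(\<lambda>p. fst p + snd p *\<^sub>R v) \<in> (lborel \<Otimes>\<^sub>M lborel :: ((real^'i) \<times> real) measure) \<rightarrow>\<^sub>M borel"
      by measurable
    from measurable_compose[OF this mA]
    have "(\<lambda>p. indicator {0..1 :: real} (snd p) * (indicator A (fst p + snd p *\<^sub>R v) :: ennreal)) \<in> borel_measurable (lborel \<Otimes>\<^sub>M lborel)"
      by measurable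
    then show ?thesis by (simp add: case_prod_beta')
  qed
  have z: "(\<integral>\<^sup>+t. ?f \<theta> t \<partial>lborel) = 0" for \<theta>
  proof -
    have "AE t in lborel. ?f \<theta> t = 0"
      using AE[of \<theta>] by eventually_elim (simp add: v A_def)
    then have "(\<integral>\<^sup>+t. ?f \<theta> t \<partial>lborel) = (\<integral>\<^sup>+t. 0 \<partial>(lborel :: real measure))" by (rule nn_integral_cong_AE)
    then show ?thesis by simp
  qed
  have "(\<integral>\<^sup>+t. (\<integral>\<^sup>+\<theta>. ?f \<theta> t \<partial>lborel) \<partial>lborel) = (\<integral>\<^sup>+\<theta>. (\<integral>\<^sup>+t. ?f \<theta> t \<partial>lborel) \<partial>lborel)"
    by (rule lborel_pair.Fubini'[OF mf])
  also have "\<dots> = 0" unfolding z by simp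
  finally have "(\<integral>\<^sup>+t. (\<integral>\<^sup>+\<theta>. ?f \<theta> t \<partial>lborel) \<partial>lborel) = 0" .
  moreover have "(\<integral>\<^sup>+\<theta>. ?f \<theta> t \<partial>lborel) = indicator {0..1} t * emeasure lborel A" for t
  proof -
    have "(\<integral>\<^sup>+\<theta>. indicator A (\<theta> + t *\<^sub>R v) \<partial>lborel) = (\<integral>\<^sup>+\<theta>. (indicator A \<theta> :: ennreal) \<partial>distr lborel borel ((+) (t *\<^sub>R v)))"
      by (subst nn_integral_distr) (use mA in \<open>simp_all add: add.commute\<close>)
    also have "\<dots> = emeasure lborel A"
      unfolding lborel_distr_plus using A by simp
    finally show ?thesis
      by (subst nn_integral_cmult) (use measurable_compose[OF _ mA, of "\<lambda>\<theta>. \<theta> + t *\<^sub>R v"] in simp_all)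
  qed
  ultimately have "(\<integral>\<^sup>+t. indicator {0..1 :: real} t * emeasure (lborel :: (real^'i) measure) A \<partial>lborel) = 0" by simp
  then have "emeasure (lborel :: (real^'i) measure) A = 0"
    by (subst (asm) nn_integral_multc) auto
  then have "A \<in> null_sets lborel" using A by (intro null_setsI) auto
  from AE_not_in[OF this] show ?thesis by eventually_elim (simp add: A_def)
qed

text \<open>The radial limits \<open>L\<close> exist almost everywhere and have modulus at most one.  By Parseval's
  identity the mean of \<open>\<bar>L\<bar>\<^sup>2\<close> over the torus is \<open>\<parallel>\<psi> \<cdot> 1\<parallel>\<^sup>2 = 1\<close>, which forces \<open>\<bar>L\<bar> = 1\<close> almost everywhere.\<close>

theorem isometric_multiplier_imp_inner_function:
  fixes \<psi> :: "complex^'i::finite \<Rightarrow> complex"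
  assumes \<psi>: "isometric_multiplier \<psi>"
  shows "inner_function \<psi>"
proof -
  define g where "g = mult_op \<psi> (monomial (\<lambda>_. 0))"
  have g: "Rep_H2 g z = \<psi> z" if "z \<in> polydisc" for z
    using Rep_mult_op[OF \<psi> that, of "monomial (\<lambda>_. 0)"] Rep_monomial[OF that, of "\<lambda>_. 0"]
    by (simp add: g_def zpow_def)
  have ng: "norm g = 1"
    by (simp add: g_def linear_isometryD(3)[OF linear_isometry_mult_op[OF \<psi>]] norm_monomial)
  have le: "norm (Rep_H2 g z) \<le> 1" if "z \<in> polydisc" for z
    using isometric_multiplier_le_1[OF \<psi> that] by (simp add: g[OF that])
  have coord: "(\<chi> j. if j = i then w else z $ j) \<in> polydisc" if "z \<in> polydisc" "w \<in> ball 0 1" for z :: "complex^'i" and w i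
    using that by (auto simp: polydisc_def)
  have "\<psi> \<in> H_infinity"
  proof -
    have "continuous_on polydisc \<psi>" using continuous_on_Rep_H2[of g] by (rule continuous_on_eq) (rule g)
    moreover have "(\<lambda>w. \<psi> (\<chi> j. if j = i then w else z $ j)) holomorphic_on ball 0 1" if "z \<in> polydisc" for z i
      by (rule holomorphic_transform[OF Rep_H2_holomorphic_coordinate[OF that, of g i]]) (simp add: g coord that)
    moreover have "bounded (\<psi> ` polydisc)" unfolding bounded_iff using isometric_multiplier_le_1[OF \<psi>] by blast
    ultimately show ?thesis unfolding H_infinity_def by blast
  qed
  let ?lim = "\<lambda>\<theta>. \<exists>l. ((\<lambda>r. Rep_H2 g (torus_point r \<theta>)) \<longlongrightarrow> l) (at_left (1::real))"
  have ex: "AE \<theta> in (lborel :: (real^'i) measure). ?lim \<theta>"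
    by (rule AE_if_AE_on_diagonals[OF measurable_radial_limit_set[OF continuous_on_Rep_H2]
          radial_limits_on_diagonal[OF le]])
  define L where "L \<theta> = lim (\<lambda>n. Rep_H2 g (torus_point (radius_seq n) \<theta>))" for \<theta> :: "real^'i"
  have m: "(\<lambda>\<theta>. Rep_H2 g (torus_point (radius_seq n) \<theta>)) \<in> borel_measurable borel" for n
    by (rule borel_measurable_torus_point[OF continuous_on_Rep_H2 radius_seq(1,2)])
  have mL: "L \<in> borel_measurable borel"
    unfolding L_def[abs_def] by (rule borel_measurable_lim_metric[OF m])
  have L: "AE \<theta> in lborel. ((\<lambda>r. Rep_H2 g (torus_point r \<theta>)) \<longlongrightarrow> L \<theta>) (at_left (1::real))"
    using ex
  proof eventually_elim
    case (elim \<theta>)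
    then obtain l where l: "((\<lambda>r. Rep_H2 g (torus_point r \<theta>)) \<longlongrightarrow> l) (at_left (1::real))" by blast
    have "(\<lambda>n. Rep_H2 g (torus_point (radius_seq n) \<theta>)) \<longlonglongrightarrow> l"
      by (rule filterlim_compose[OF l radius_seq_at_left])
    then have "L \<theta> = l" unfolding L_def by (rule limI)
    then show ?case using l by simp
  qed
  have LE: "AE \<theta> in lborel. norm (L \<theta>) \<le> 1"
    using L
  proof eventually_elim
    case (elim \<theta>)
    have "(\<lambda>n. norm (Rep_H2 g (torus_point (radius_seq n) \<theta>))) \<longlonglongrightarrow> norm (L \<theta>)"
      by (intro tendsto_norm filterlim_compose[OF elim radius_seq_at_left])
    then show ?case
      by (rule LIMSEQ_le_const2) (use le torus_point_in_polydisc[OF radius_seq(1,2)] in blast)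
  qed
  have unit: "AE \<theta> in lborel. \<theta> \<in> torus_box a N \<longrightarrow> norm (L \<theta>) = 1" for a N
  proof -
    let ?B = "torus_box a N :: (real^'i) set"
    let ?V = "(2 * pi * real N) ^ CARD('i)"
    let ?f = "\<lambda>n \<theta>. Rep_H2 g (torus_point (radius_seq n) \<theta>) * cnj (Rep_H2 g (torus_point (radius_seq n) \<theta>))"
    have mB: "(indicator ?B :: real^'i \<Rightarrow> real) \<in> borel_measurable borel"
      using borel_measurable_integrable[OF integrable_torus_box] by simp
    have "(\<lambda>n. \<integral>\<theta>. indicator ?B \<theta> *\<^sub>R ?f n \<theta> \<partial>lborel) \<longlonglongrightarrow> (\<integral>\<theta>. indicator ?B \<theta> *\<^sub>R (L \<theta> * cnj (L \<theta>)) \<partial>lborel)"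
    proof (rule torus_integral_dominated_convergence[where C = 1])
      show "(\<lambda>\<theta>. ?f n \<theta>) \<in> borel_measurable borel" "(\<lambda>\<theta>. L \<theta> * cnj (L \<theta>)) \<in> borel_measurable borel" for n
        by (intro borel_measurable_times borel_measurable_cnj' m mL)+
      show "norm (?f n \<theta>) \<le> 1" for n \<theta>
        unfolding norm_mult complex_mod_cnj
        using mult_le_one[OF le _ le] torus_point_in_polydisc[OF radius_seq(1,2), of n \<theta>] by simp
      show "AE \<theta> in lborel. \<theta> \<in> ?B \<longrightarrow> (\<lambda>n. ?f n \<theta>) \<longlonglongrightarrow> L \<theta> * cnj (L \<theta>)"
        using L by eventually_elim (intro impI tendsto_intros filterlim_compose[OF _ radius_seq_at_left])
    qed
    moreover have "(\<lambda>n. \<integral>\<theta>. indicator ?B \<theta> *\<^sub>R ?f n \<theta> \<partial>lborel) \<longlonglongrightarrow> of_real ?V * cinner g g"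
      unfolding torus_parseval[OF radius_seq(1,2)]
      by (intro tendsto_mult tendsto_const tendsto_cinner dilate_tendsto radius_seq radius_seq_tendsto)
    ultimately have eqV: "(\<integral>\<theta>. indicator ?B \<theta> *\<^sub>R (L \<theta> * cnj (L \<theta>)) \<partial>lborel) = of_real ?V * cinner g g"
      using LIMSEQ_unique by blast
    have pt: "indicator ?B \<theta> *\<^sub>R (L \<theta> * cnj (L \<theta>)) = complex_of_real (indicator ?B \<theta> * (norm (L \<theta>))\<^sup>2)" for \<theta>
      by (simp only: complex_norm_square[symmetric] scaleR_conv_of_real of_real_mult)
    have int: "(\<integral>\<theta>. indicator ?B \<theta> * (norm (L \<theta>))\<^sup>2 \<partial>lborel) = ?V"
      using eqV unfolding pt integral_complex_of_real cinner_self ng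
      by (simp only: of_real_mult[symmetric] of_real_eq_iff) simp
    have m2: "(\<lambda>\<theta>. indicator ?B \<theta> * (norm (L \<theta>))\<^sup>2) \<in> borel_measurable borel"
      using mB mL by measurable
    have sq: "AE \<theta> in lborel. (norm (L \<theta>))\<^sup>2 \<le> 1"
      using LE by eventually_elim (simp add: power_le_one)
    have i2: "integrable lborel (\<lambda>\<theta>. indicator ?B \<theta> * (norm (L \<theta>))\<^sup>2)"
      by (rule Bochner_Integration.integrable_bound[OF integrable_torus_box[of a N]])
        (use m2 sq in \<open>auto elim!: eventually_mono simp: indicator_def\<close>)
    have "AE \<theta> in lborel. indicator ?B \<theta> - indicator ?B \<theta> * (norm (L \<theta>))\<^sup>2 = 0"
    proof (subst integral_nonneg_eq_0_iff_AE[symmetric])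
      show "integrable lborel (\<lambda>\<theta>. indicator ?B \<theta> - indicator ?B \<theta> * (norm (L \<theta>))\<^sup>2)"
        by (intro Bochner_Integration.integrable_diff integrable_torus_box i2)
      show "AE \<theta> in lborel. 0 \<le> indicator ?B \<theta> - indicator ?B \<theta> * (norm (L \<theta>))\<^sup>2"
        using sq by eventually_elim (auto simp: indicator_def)
      show "(\<integral>\<theta>. indicator ?B \<theta> - indicator ?B \<theta> * (norm (L \<theta>))\<^sup>2 \<partial>lborel) = 0"
        unfolding Bochner_Integration.integral_diff[OF integrable_torus_box i2] integral_torus_box int by simp
    qed
    then show ?thesis
      by eventually_elim (auto simp: indicator_def abs_square_eq_1)
  qed
  have "AE \<theta> in (lborel :: (real^'i) measure). \<forall>N. \<theta> \<in> torus_box (- (2 * pi * real N)) (2 * N) \<longrightarrow> norm (L \<theta>) = 1"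
    unfolding AE_all_countable by (intro allI unit)
  then have "AE \<theta> in lborel. norm (L \<theta>) = 1"
  proof eventually_elim
    case (elim \<theta>)
    obtain N :: nat where N: "(\<Sum>i\<in>UNIV. \<bar>\<theta> $ i\<bar>) / (2 * pi) \<le> real N" using real_arch_simple by blast
    have "\<theta> \<in> torus_box (- (2 * pi * real N)) (2 * N)"
    proof -
      have "\<bar>\<theta> $ i\<bar> \<le> 2 * pi * real N" for i
        using member_le_sum[of i UNIV "\<lambda>i. \<bar>\<theta> $ i\<bar>"] N by (simp add: field_simps)
      then show ?thesis by (auto simp: torus_box_def abs_le_iff minus_le_iff mult.assoc)
    qed
    then show ?case using elim by blast
  qed
  then have "AE \<theta> in (lborel :: (real^'i) measure).
      \<exists>l. ((\<lambda>r. \<psi> (torus_point r \<theta>)) \<longlongrightarrow> l) (at_left (1::real)) \<and> norm l = 1"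
    using L
  proof eventually_elim
    case (elim \<theta>)
    have "\<forall>\<^sub>F r in at_left (1::real). Rep_H2 g (torus_point r \<theta>) = \<psi> (torus_point r \<theta>)"
      by (rule eventually_at_leftI[of 0]) (auto intro!: g torus_point_in_polydisc)
    from Lim_transform_eventually[OF elim(2) this] elim(1) show ?case by blast
  qed
  then show ?thesis
    unfolding inner_function_def torus_point_def using \<open>\<psi> \<in> H_infinity\<close> by simp
qed

corollary inner_function_iff_isometric_multiplier: "inner_function \<psi> \<longleftrightarrow> isometric_multiplier \<psi>"
  using inner_function_imp_isometric_multiplier isometric_multiplier_imp_inner_function by blast


section \<open>Doubly commuting invariant subspaces\<close>

lemma invariant_subspaceD:
  assumes "invariant_subspace S"
  shows "closed_subspace S" "f \<in> S \<Longrightarrow> shift i f \<in> S"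
  using assms by (auto simp: invariant_subspace_def)

text \<open>The adjoint of the restricted shift is the compression of the backward shift: the projection of
  \<open>backward_shift i f\<close> onto \<open>S\<close> has the defining property of the adjoint.\<close>

lemma
  assumes S: "invariant_subspace S" and f: "f \<in> S"
  shows adjoint_shift_in: "adjoint_on S (shift i) f \<in> S"
    and cinner_adjoint_shift: "g \<in> S \<Longrightarrow> cinner (shift i g) f = cinner g (adjoint_on S (shift i) f)"
proof -
  note cs = invariant_subspaceD(1)[OF S]
  obtain p where p: "p \<in> S" "\<And>y. y \<in> S \<Longrightarrow> cinner (backward_shift i f - p) y = 0"
    using closed_subspace_projection[OF cs] by blast
  have eq: "cinner (shift i g) f = cinner g p" if "g \<in> S" for g
  proof -
    have "cinner (p - backward_shift i f) g = 0"
      using p(2)[OF that] by (simp add: cinner_diff_left)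
    then have "cinner g (p - backward_shift i f) = 0"
      using cinner_commute[of g "p - backward_shift i f"] by simp
    then show ?thesis by (simp add: cinner_shift cinner_diff_right)
  qed
  have "w = p" if w: "w \<in> S" "\<forall>x\<in>S. cinner (shift i x) f = cinner x w" for w
  proof -
    have "w - p \<in> S" by (rule closed_subspace_diff[OF cs w(1) p(1)])
    then have "cinner (w - p) (w - p) = 0"
      using w(2) eq by (simp add: cinner_diff_right)
    then show ?thesis by simp
  qed
  then have "adjoint_on S (shift i) f = p"
    unfolding adjoint_on_def using p(1) eq by (intro the_equality) auto
  then show "adjoint_on S (shift i) f \<in> S"
    and "g \<in> S \<Longrightarrow> cinner (shift i g) f = cinner g (adjoint_on S (shift i) f)"
    using p(1) eq by auto
qed

lemma adjoint_shift_unique: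
  assumes S: "invariant_subspace S" and f: "f \<in> S" and w: "w \<in> S"
    and eq: "\<And>g. g \<in> S \<Longrightarrow> cinner (shift i g) f = cinner g w"
  shows "adjoint_on S (shift i) f = w"
proof -
  let ?d = "adjoint_on S (shift i) f - w"
  have "?d \<in> S"
    by (rule closed_subspace_diff[OF invariant_subspaceD(1)[OF S] adjoint_shift_in[OF S f] w])
  then have "cinner ?d ?d = 0"
    using eq cinner_adjoint_shift[OF S f] by (simp add: cinner_diff_right)
  then show ?thesis by simp
qed

lemma mult_op_shift:
  assumes "isometric_multiplier \<psi>"
  shows "shift i (mult_op \<psi> f) = mult_op \<psi> (shift i f)"
  unfolding shift_eq_mult_op by (intro mult_op_commute assms isometric_multiplier_coordinate)

text \<open>Multiplication by \<open>\<psi>\<close> maps the whole Hardy space unitarily onto \<open>multiples \<psi>\<close> and commutes with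
  the shifts, hence carries backward shifts to adjoints of restricted shifts.  On the whole space,
  shifts and backward shifts in different directions commute.\<close>

theorem multiples_invariant_doubly_commuting:
  assumes \<psi>: "isometric_multiplier \<psi>"
  shows "invariant_subspace (multiples \<psi>)" and "doubly_commuting (multiples \<psi>)"
proof -
  note range = multiples_eq_range[OF \<psi>]
  show S: "invariant_subspace (multiples \<psi>)"
    unfolding invariant_subspace_def
    using closed_subspace_multiples[OF \<psi>] by (auto simp: range mult_op_shift[OF \<psi>])
  have adj: "adjoint_on (multiples \<psi>) (shift i) (mult_op \<psi> f) = mult_op \<psi> (backward_shift i f)" for i f
  proof (rule adjoint_shift_unique[OF S])
    fix g assume "g \<in> multiples \<psi>"
    then obtain h where "g = mult_op \<psi> h" by (auto simp: range)
    then show "cinner (shift i g) (mult_op \<psi> f) = cinner g (mult_op \<psi> (backward_shift i f))"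
      by (simp add: mult_op_shift[OF \<psi>] linear_isometry_cinner[OF linear_isometry_mult_op[OF \<psi>]] cinner_shift)
  qed (auto simp: range)
  show "doubly_commuting (multiples \<psi>)"
    unfolding doubly_commuting_def
  proof (intro allI impI ballI)
    fix i j :: 'a and f assume "i \<noteq> j" "f \<in> multiples \<psi>"
    moreover from this obtain h where "f = mult_op \<psi> h" by (auto simp: range)
    ultimately show "shift i (adjoint_on (multiples \<psi>) (shift j) f) = adjoint_on (multiples \<psi>) (shift j) (shift i f)"
      by (simp add: adj mult_op_shift[OF \<psi>] shift_backward_shift_commute)
  qed
qed

text \<open>The powers of the backward shift are contractions, and each truncation is annihilated after
  finitely many steps.\<close>

lemma backward_shift_power_tendsto: "(\<lambda>n. (backward_shift i ^^ n) f) \<longlonglongrightarrow> 0"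
proof -
  let ?b = "backward_shift i"
  have coeff: "H2_coeff ((?b ^^ n) g) k = H2_coeff g (k(i := k i + n))" for n g k
    by (induction n arbitrary: k) (simp_all add: H2_coeff_backward_shift)
  have lin: "(?b ^^ n) (g + h) = (?b ^^ n) g + (?b ^^ n) h" for n g h
    by (rule H2_coeff_inject) (simp add: fun_eq_iff coeff)
  have le: "norm (?b g) \<le> norm g" for g
  proof -
    have "(norm (?b g))\<^sup>2 = Re (cinner (shift i (?b g)) g)"
      by (simp add: cinner_shift cinner_self)
    also have "\<dots> \<le> norm (shift i (?b g)) * norm g"
      using complex_Re_le_cmod norm_cinner_le order_trans by blast
    also have "\<dots> = norm (?b g) * norm g" by (simp add: linear_isometryD(3)[OF linear_isometry_shift])
    finally show ?thesis by (cases "norm (?b g) = 0") (auto simp: power2_eq_square)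
  qed
  have len: "norm ((?b ^^ n) g) \<le> norm g" for n g
    by (induction n) (auto intro: order_trans[OF le])
  show ?thesis
  proof (rule metric_LIMSEQ_I)
    fix e :: real assume e: "e > 0"
    obtain m where m: "norm (truncate m f - f) < e"
      using LIMSEQ_D[OF truncate_tendsto e, of f] by auto
    have "dist ((?b ^^ n) f) 0 < e" if n: "n \<ge> Suc m" for n
    proof -
      have "(?b ^^ n) (truncate m f) = 0"
      proof (rule H2_coeff_inject, rule ext)
        fix k
        have "k(i := k i + n) \<notin> degree_box m" using n by (auto simp: degree_box_def)
        then show "H2_coeff ((?b ^^ n) (truncate m f)) k = H2_coeff 0 k"
          by (simp add: coeff H2_coeff_truncate)
      qed
      then have "(?b ^^ n) f = (?b ^^ n) (f - truncate m f)"
        using lin[of n "f - truncate m f" "truncate m f"] by simp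
      then show ?thesis using len[of n "f - truncate m f"] m by (simp add: norm_minus_commute)
    qed
    then show "\<exists>N. \<forall>n\<ge>N. dist ((?b ^^ n) f) 0 < e" by blast
  qed
qed

context
  fixes S :: "'i::finite H2 set"
  assumes inv: "invariant_subspace S" and dc: "doubly_commuting S"
begin

abbreviation (input) "adj i \<equiv> adjoint_on S (shift i)"

text \<open>For \<open>B = UNIV\<close> this is the wandering subspace of \<open>S\<close>; the smaller sets \<open>B\<close> serve to treat the
  variables one at a time.\<close>

definition wandering :: "'i set \<Rightarrow> 'i H2 set" where
  "wandering B = {f \<in> S. \<forall>i\<in>B. adj i f = 0}"

lemma S_closed: "closed_subspace S" by (rule invariant_subspaceD(1)[OF inv])

lemma adj_add: "f \<in> S \<Longrightarrow> g \<in> S \<Longrightarrow> adj i (f + g) = adj i f + adj i g"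
  by (rule adjoint_shift_unique[OF inv])
    (simp_all add: closed_subspace_add[OF S_closed] adjoint_shift_in[OF inv] cinner_add_right cinner_adjoint_shift[OF inv])

lemma adj_scaleC: "f \<in> S \<Longrightarrow> adj i (c *\<^sub>C f) = c *\<^sub>C adj i f"
  by (rule adjoint_shift_unique[OF inv])
    (simp_all add: closed_subspace_scaleC[OF S_closed] adjoint_shift_in[OF inv] cinner_scaleC_right cinner_adjoint_shift[OF inv])

lemma adj_diff: "f \<in> S \<Longrightarrow> g \<in> S \<Longrightarrow> adj i (f - g) = adj i f - adj i g"
  by (rule adjoint_shift_unique[OF inv])
    (simp_all add: closed_subspace_diff[OF S_closed] adjoint_shift_in[OF inv] cinner_diff_right cinner_adjoint_shift[OF inv])

lemma adj_shift: "f \<in> S \<Longrightarrow> adj i (shift i f) = f"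
  by (rule adjoint_shift_unique[OF inv])
    (simp_all add: invariant_subspaceD(2)[OF inv] linear_isometry_cinner[OF linear_isometry_shift])

lemma adj_commute: "f \<in> S \<Longrightarrow> adj i (adj j f) = adj j (adj i f)"
  by (rule adjoint_shift_unique[OF inv])
    (simp_all add: adjoint_shift_in[OF inv] cinner_adjoint_shift[OF inv, symmetric]
      invariant_subspaceD(2)[OF inv] shift_commute)

lemma shift_adj_commute: "f \<in> S \<Longrightarrow> i \<noteq> j \<Longrightarrow> shift i (adj j f) = adj j (shift i f)"
  using dc by (auto simp: doubly_commuting_def)

lemma wandering_subset: "wandering B \<subseteq> S" by (auto simp: wandering_def)

lemma wandering_adj: "f \<in> wandering B \<Longrightarrow> adj i f \<in> wandering B"
proof -
  have z: "adj i 0 = 0" for i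
    by (rule adjoint_shift_unique[OF inv]) (simp_all add: closed_subspace_0[OF S_closed])
  assume f: "f \<in> wandering B"
  then have fS: "f \<in> S" by (simp add: wandering_def)
  have "adj j (adj i f) = 0" if "j \<in> B" for j
    using f that by (subst adj_commute[OF fS]) (simp add: wandering_def z)
  then show ?thesis using adjoint_shift_in[OF inv fS] by (simp add: wandering_def)
qed

lemma adj_power_in: "f \<in> S \<Longrightarrow> (adj i ^^ n) f \<in> S"
  by (induction n) (auto intro: adjoint_shift_in[OF inv])

text \<open>As compressions, the powers of the adjoint are dominated by those of the backward shift.\<close>

lemma adj_power_tendsto:
  assumes f: "f \<in> S"
  shows "(\<lambda>n. (adj i ^^ n) f) \<longlonglongrightarrow> 0"
proof -
  have eq: "cinner ((shift i ^^ n) g) h = cinner g ((adj i ^^ n) h)" if "g \<in> S" "h \<in> S" for n g h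
    using that
  proof (induction n arbitrary: g)
    case (Suc n)
    have "cinner ((shift i ^^ Suc n) g) h = cinner ((shift i ^^ n) (shift i g)) h"
      by (simp only: funpow_Suc_right o_apply)
    also have "\<dots> = cinner (shift i g) ((adj i ^^ n) h)"
      by (intro Suc invariant_subspaceD(2)[OF inv])
    also have "\<dots> = cinner g ((adj i ^^ Suc n) h)"
      using Suc.prems by (simp add: cinner_adjoint_shift[OF inv] adj_power_in)
    finally show ?case .
  qed simp
  have eqb: "cinner ((shift i ^^ n) g) h = cinner g ((backward_shift i ^^ n) h)" for n g h
  proof (induction n arbitrary: g)
    case (Suc n)
    have "cinner ((shift i ^^ Suc n) g) h = cinner ((shift i ^^ n) (shift i g)) h"
      by (simp only: funpow_Suc_right o_apply)
    then show ?case by (simp add: Suc cinner_shift)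
  qed simp
  have "norm ((adj i ^^ n) f) \<le> norm ((backward_shift i ^^ n) f)" for n
  proof -
    let ?g = "(adj i ^^ n) f"
    have "(norm ?g)\<^sup>2 = Re (cinner ?g ?g)" by (simp add: cinner_self)
    also have "cinner ?g ?g = cinner ?g ((backward_shift i ^^ n) f)"
      using eq[OF adj_power_in[OF f] f] eqb by metis
    also have "Re \<dots> \<le> norm ?g * norm ((backward_shift i ^^ n) f)"
      using complex_Re_le_cmod norm_cinner_le order_trans by blast
    finally show ?thesis by (cases "norm ?g = 0") (auto simp: power2_eq_square)
  qed
  then have "\<forall>\<^sub>F n in sequentially. norm ((adj i ^^ n) f) \<le> norm ((backward_shift i ^^ n) f)"
    by (rule always_eventually[OF allI])
  then show ?thesis
    by (rule Lim_null_comparison) (rule tendsto_norm_zero[OF backward_shift_power_tendsto])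
qed

text \<open>One step of the Wold decomposition: removing a direction \<open>i\<close>.  A function \<open>f\<close> is the sum of
  \<open>shift i ^^ n\<close> applied to \<open>e n = A ^^ n f - shift i (A ^^ Suc n f)\<close>, where \<open>A\<close> is the adjoint in
  direction \<open>i\<close>; double commutation keeps \<open>e n\<close> in the joint kernel of the other directions.\<close>

lemma wandering_step:
  assumes C: "closed_subspace C" "\<And>f. f \<in> C \<Longrightarrow> shift i f \<in> C"
    and sub: "wandering (insert i B) \<subseteq> C"
  shows "wandering B \<subseteq> C"
proof
  fix f assume f: "f \<in> wandering B"
  then have fS: "f \<in> S" using wandering_subset by blast
  let ?A = "adj i"
  define e where "e n = (?A ^^ n) f - shift i ((?A ^^ Suc n) f)" for n
  have W: "(?A ^^ n) f \<in> wandering B" for n by (induction n) (use f wandering_adj in auto)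
  have eW: "e n \<in> wandering (insert i B)" for n
  proof -
    let ?g = "(?A ^^ n) f"
    have gS: "?g \<in> S" "?A ?g \<in> S" using adj_power_in[OF fS, where i = i and n = n] adjoint_shift_in[OF inv] by auto
    have e: "e n = ?g - shift i (?A ?g)" by (simp add: e_def)
    have sS: "shift i (?A ?g) \<in> S" by (rule invariant_subspaceD(2)[OF inv gS(2)])
    have "adj j (e n) = 0" if j: "j \<in> insert i B" for j
    proof (cases "j = i")
      case True
      then show ?thesis unfolding e by (simp add: adj_diff gS sS adj_shift)
    next
      case False
      have z: "adj j ?g = 0" "adj j (?A ?g) = 0"
        using W[of n] wandering_adj[OF W[of n], of i] j False by (auto simp: wandering_def)
      have "adj j (shift i (?A ?g)) = shift i (adj j (?A ?g))"
        using shift_adj_commute[OF gS(2), of i j] False by simp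
      then show ?thesis unfolding e
        by (simp add: adj_diff gS sS z linear_isometryD(4)[OF linear_isometry_shift])
    qed
    moreover have "e n \<in> S" unfolding e by (rule closed_subspace_diff[OF S_closed gS(1) sS])
    ultimately show ?thesis by (auto simp: wandering_def)
  qed
  have pow: "(shift i ^^ n) g \<in> C" if "g \<in> C" for n g
    by (induction n) (use that C(2) in auto)
  have iso: "linear_isometry (shift i ^^ n)" for n
    by (induction n) (auto simp: linear_isometry_def linear_isometryD[OF linear_isometry_shift])
  have decomp: "f = (\<Sum>n<m. (shift i ^^ n) (e n)) + (shift i ^^ m) ((?A ^^ m) f)" for m
  proof (induction m)
    case (Suc m)
    have "(shift i ^^ m) ((?A ^^ m) f) = (shift i ^^ m) (e m + shift i ((?A ^^ Suc m) f))"
      by (simp add: e_def)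
    also have "\<dots> = (shift i ^^ m) (e m) + (shift i ^^ Suc m) ((?A ^^ Suc m) f)"
      unfolding linear_isometryD(1)[OF iso] by (simp only: funpow_Suc_right o_apply)
    finally show ?case using Suc by (simp add: add.assoc)
  qed simp
  have "(\<lambda>m. \<Sum>n<m. (shift i ^^ n) (e n)) \<longlonglongrightarrow> f"
  proof -
    have "(\<lambda>m. (shift i ^^ m) ((?A ^^ m) f)) \<longlonglongrightarrow> 0"
    proof (rule tendsto_norm_zero_cancel)
      show "(\<lambda>m. norm ((shift i ^^ m) ((?A ^^ m) f))) \<longlonglongrightarrow> 0"
        unfolding linear_isometryD(3)[OF iso] by (rule tendsto_norm_zero[OF adj_power_tendsto[OF fS]])
    qed
    from tendsto_diff[OF tendsto_const[of f] this]
    have "(\<lambda>m. f - (shift i ^^ m) ((?A ^^ m) f)) \<longlonglongrightarrow> f" by simp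
    moreover have "f - (shift i ^^ m) ((?A ^^ m) f) = (\<Sum>n<m. (shift i ^^ n) (e n))" for m
      using decomp[of m] by (metis add_diff_cancel_right')
    ultimately show ?thesis by simp
  qed
  then show "f \<in> C"
  proof (rule closed_subspace_limit[OF C(1), rotated])
    show "(\<Sum>n<m. (shift i ^^ n) (e n)) \<in> C" for m
      by (intro closed_subspace_sum[OF C(1)] pow) (use eW sub in blast)
  qed
qed

text \<open>The variables are removed from \<open>UNIV\<close> one at a time, down to \<open>wandering {} = S\<close>.\<close>

lemma S_generated_by_wandering:
  assumes C: "closed_subspace C" "\<And>i f. f \<in> C \<Longrightarrow> shift i f \<in> C"
    and sub: "wandering UNIV \<subseteq> C"
  shows "S \<subseteq> C"
proof -
  have "wandering (UNIV - D) \<subseteq> C" if "finite D" for D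
    using that
  proof (induction D)
    case (insert i D)
    have "insert i (UNIV - insert i D) = UNIV - D" using insert.hyps by auto
    then have "wandering (insert i (UNIV - insert i D)) \<subseteq> C" using insert.IH by (simp only:)
    moreover have "shift i f \<in> C" if "f \<in> C" for f using that by (rule C(2))
    ultimately show ?case by (intro wandering_step[of C i "UNIV - insert i D"] C(1))
  qed (use sub in simp)
  from this[of UNIV] show ?thesis by (simp add: wandering_def)
qed

abbreviation (input) "mz k \<equiv> mult_op (\<lambda>z. zpow z k)"

lemma mz_shift: "mz (k(i := Suc (k i))) f = shift i (mz k f)"
  by (rule mult_op_eqI) (simp add: Rep_mult_op[OF isometric_multiplier_zpow] zpow_upd)

lemma mz_in: "f \<in> S \<Longrightarrow> mz k f \<in> S"
proof (induction "\<Sum>i\<in>UNIV. k i" arbitrary: k)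
  case 0
  then have "k = (\<lambda>_. 0)" by auto
  then have "mz k f = f" by (intro mult_op_eqI) (simp add: zpow_def)
  with "0.prems" show ?case by (simp only:)
next
  case (Suc n)
  then obtain i where i: "k i \<noteq> 0" by (metis sum.neutral nat.distinct(1))
  define l where "l = k(i := k i - 1)"
  have k: "k = l(i := Suc (l i))" using i by (auto simp: l_def)
  have "(\<Sum>j\<in>UNIV. k j) = Suc (\<Sum>j\<in>UNIV. l j)"
  proof -
    have "(\<Sum>j\<in>UNIV. k j) = k i + (\<Sum>j\<in>UNIV - {i}. k j)" by (rule sum.remove) auto
    moreover have "(\<Sum>j\<in>UNIV. l j) = l i + (\<Sum>j\<in>UNIV - {i}. l j)" by (rule sum.remove) auto
    moreover have "(\<Sum>j\<in>UNIV - {i}. l j) = (\<Sum>j\<in>UNIV - {i}. k j)" by (rule sum.cong) (auto simp: l_def)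
    ultimately show ?thesis using i by (simp add: l_def)
  qed
  then have "n = (\<Sum>i\<in>UNIV. l i)" using Suc.hyps by simp
  then have "mz l f \<in> S" using Suc.hyps(1) Suc.prems by blast
  then show ?case unfolding k mz_shift by (rule invariant_subspaceD(2)[OF inv])
qed

text \<open>If \<open>l i = 0\<close> then \<open>z\<^sup>l\<close> commutes with the adjoint in direction \<open>i\<close>, so \<open>z\<^sup>l g\<close> stays in its
  kernel and is orthogonal to every multiple of \<open>z\<^sub>i\<close>.\<close>

lemma adj_mz_zero:
  assumes g: "g \<in> S" "adj i g = 0" and l: "l i = 0"
  shows "adj i (mz l g) = 0"
  using l
proof (induction "\<Sum>i\<in>UNIV. l i" arbitrary: l)
  case 0
  then have "l = (\<lambda>_. 0)" by auto
  then have "mz l g = g" by (intro mult_op_eqI) (simp add: zpow_def)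
  then show ?case using g by simp
next
  case (Suc n)
  then obtain j where j: "l j \<noteq> 0" by (metis sum.neutral nat.distinct(1))
  define k where "k = l(j := l j - 1)"
  have l: "l = k(j := Suc (k j))" using j by (auto simp: k_def)
  have ij: "j \<noteq> i" using j Suc.prems by auto
  have "(\<Sum>i\<in>UNIV. l i) = Suc (\<Sum>i\<in>UNIV. k i)"
  proof -
    have "(\<Sum>i\<in>UNIV. l i) = l j + (\<Sum>i\<in>UNIV - {j}. l i)" by (rule sum.remove) auto
    moreover have "(\<Sum>i\<in>UNIV. k i) = k j + (\<Sum>i\<in>UNIV - {j}. k i)" by (rule sum.remove) auto
    moreover have "(\<Sum>i\<in>UNIV - {j}. k i) = (\<Sum>i\<in>UNIV - {j}. l i)" by (rule sum.cong) (auto simp: k_def)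
    ultimately show ?thesis using j by (simp add: k_def)
  qed
  then have "adj i (mz k g) = 0" using Suc ij by (intro Suc.hyps(1)) (auto simp: k_def)
  then have "adj i (shift j (mz k g)) = 0"
    using shift_adj_commute[OF mz_in[OF g(1), of k] ij] by (simp add: linear_isometryD(4)[OF linear_isometry_shift])
  then show ?case unfolding l mz_shift .
qed

text \<open>In a direction \<open>i\<close> in which the exponents differ, the common power of \<open>z\<^sub>i\<close> cancels because
  multiplication by it is isometric.  Then one of the two vectors is a multiple of \<open>z\<^sub>i\<close> and the other is
  in the kernel of the adjoint in direction \<open>i\<close>.\<close>

lemma wandering_orthogonal:
  assumes f: "f \<in> wandering UNIV" and g: "g \<in> wandering UNIV" and kl: "k \<noteq> l"
  shows "cinner (mz k f) (mz l g) = 0"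
proof -
  have lt: "cinner (mz k f) (mz l g) = 0"
    if f: "f \<in> S" and g: "g \<in> wandering UNIV" and lt: "l i < k i" for f g k l and i :: 'i
  proof -
    define c where "c j = (if j = i then l i else 0)" for j
    define k' where "k' = k(i := k i - l i - 1)"
    define l' where "l' = l(i := 0)"
    have k: "k = (\<lambda>j. c j + (k'(i := Suc (k' i))) j)" using lt by (auto simp: c_def k'_def fun_eq_iff)
    have l: "l = (\<lambda>j. c j + l' j)" by (auto simp: c_def l'_def fun_eq_iff)
    have split: "mz (\<lambda>j. a j + b j) h = mz a (mz b h)" for a b h
      by (rule mult_op_eqI) (simp add: Rep_mult_op[OF isometric_multiplier_zpow] zpow_add mult.assoc)
    have gS: "g \<in> S" "adj i g = 0" using g by (auto simp: wandering_def)
    have "cinner (mz k f) (mz l g) = cinner (mz c (shift i (mz k' f))) (mz c (mz l' g))"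
      by (subst k, subst l, subst split, subst split, subst mz_shift) rule
    also have "\<dots> = cinner (shift i (mz k' f)) (mz l' g)"
      by (rule linear_isometry_cinner[OF linear_isometry_mult_op[OF isometric_multiplier_zpow]])
    also have "\<dots> = cinner (mz k' f) (adj i (mz l' g))"
      by (intro cinner_adjoint_shift[OF inv] mz_in f gS)
    also have "adj i (mz l' g) = 0" by (rule adj_mz_zero[OF gS]) (simp add: l'_def)
    finally show ?thesis by simp
  qed
  obtain i where "k i \<noteq> l i" using kl by auto
  then consider "l i < k i" | "k i < l i" by linarith
  then show ?thesis
  proof cases
    case 1
    then show ?thesis using lt[of f g l i k] f g wandering_subset by blast
  next
    case 2
    then have "cinner (mz l g) (mz k f) = 0" using lt[of g f k i l] f g wandering_subset by blast
    then show ?thesis using cinner_commute[of "mz k f" "mz l g"] by simp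
  qed
qed

lemma wandering_unit_isometric_multiplier:
  assumes f: "f \<in> wandering UNIV" "norm f = 1"
  shows "isometric_multiplier (Rep_H2 f)"
proof (rule isometric_multiplierI)
  show "Rep_H2 (mz k f) z = Rep_H2 f z * zpow z k" if "z \<in> polydisc" for k z
    by (simp add: Rep_mult_op[OF isometric_multiplier_zpow that])
  show "cinner (mz k f) (mz l f) = (if k = l then 1 else 0)" for k l
    using wandering_orthogonal[OF f(1) f(1)] f(2)
    by (simp add: linear_isometryD(3)[OF linear_isometry_mult_op[OF isometric_multiplier_zpow]] cinner_self)
qed

lemma mult_op_monomial_wandering:
  assumes "isometric_multiplier (Rep_H2 f)"
  shows "mult_op (Rep_H2 f) (monomial k) = mz k f"
  by (rule mult_op_eqI) (simp add: Rep_mult_op[OF isometric_multiplier_zpow] Rep_monomial mult.commute)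

text \<open>Two orthogonal wandering unit vectors \<open>f\<close> and \<open>g\<close> would generate orthogonal ideals \<open>f H\<^sup>2\<close> and
  \<open>g H\<^sup>2\<close>, which nevertheless both contain \<open>f g \<noteq> 0\<close>.\<close>

lemma wandering_not_orthogonal:
  assumes f: "f \<in> wandering UNIV" "norm f = 1" and g: "g \<in> wandering UNIV" "norm g = 1"
  shows "cinner f g \<noteq> 0"
proof
  assume fg: "cinner f g = 0"
  note mf = wandering_unit_isometric_multiplier[OF f] and mg = wandering_unit_isometric_multiplier[OF g]
  note iso = linear_isometry_mult_op[OF mf] linear_isometry_mult_op[OF mg]
  have mono: "cinner (mult_op (Rep_H2 f) (monomial k)) (mult_op (Rep_H2 g) (monomial l)) = 0" for k l
    using wandering_orthogonal[OF f(1) g(1), of k l] fg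
    by (cases "k = l") (simp_all add: mult_op_monomial_wandering mf mg
      linear_isometry_cinner[OF linear_isometry_mult_op[OF isometric_multiplier_zpow]])
  have 1: "cinner (mult_op (Rep_H2 f) p) (mult_op (Rep_H2 g) (monomial l)) = 0" for p l
  proof -
    have "mult_op (Rep_H2 f) ` closed_span (range monomial) \<subseteq> {x. cinner x (mult_op (Rep_H2 g) (monomial l)) = 0}"
      by (rule linear_isometry_closed_span[OF iso(1) closed_subspace_orthogonal]) (use mono in auto)
    then show ?thesis unfolding closed_span_monomials by blast
  qed
  have 2: "cinner (mult_op (Rep_H2 g) q) (mult_op (Rep_H2 f) p) = 0" for p q
  proof -
    have "cinner (mult_op (Rep_H2 g) (monomial l)) (mult_op (Rep_H2 f) p) = 0" for l
      using 1[of p l] cinner_commute[of "mult_op (Rep_H2 g) (monomial l)" "mult_op (Rep_H2 f) p"] by simp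
    then have "mult_op (Rep_H2 g) ` closed_span (range monomial) \<subseteq> {x. cinner x (mult_op (Rep_H2 f) p) = 0}"
      by (intro linear_isometry_closed_span[OF iso(2) closed_subspace_orthogonal]) auto
    then show ?thesis unfolding closed_span_monomials by blast
  qed
  have eq: "mult_op (Rep_H2 f) g = mult_op (Rep_H2 g) f"
    by (rule mult_op_eqI) (simp add: Rep_mult_op[OF mg] mult.commute)
  have "mult_op (Rep_H2 f) g = 0" using 2[of f g] unfolding eq[symmetric] by simp
  then have "norm g = 0" using linear_isometryD(3)[OF iso(1), of g] by simp
  then show False using g(2) by simp
qed

lemma wandering_linear: "f \<in> wandering B \<Longrightarrow> g \<in> wandering B \<Longrightarrow> f + g \<in> wandering B"
  "f \<in> wandering B \<Longrightarrow> c *\<^sub>C f \<in> wandering B" "f \<in> wandering B \<Longrightarrow> g \<in> wandering B \<Longrightarrow> f - g \<in> wandering B"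
  by (auto simp: wandering_def adj_add adj_scaleC adj_diff closed_subspace_add[OF S_closed]
      closed_subspace_scaleC[OF S_closed] closed_subspace_diff[OF S_closed])

text \<open>The wandering subspace is non-zero because it generates \<open>S\<close>, and it has dimension one because
  two of its unit vectors are never orthogonal.  A unit vector in it is an isometric multiplier, and
  its multiples are all of \<open>S\<close>.\<close>

theorem doubly_commuting_imp_multiples:
  assumes ne: "S \<noteq> {0}"
  obtains \<psi> where "isometric_multiplier \<psi>" "S = multiples \<psi>"
proof -
  have "\<exists>f\<in>wandering UNIV. f \<noteq> 0"
  proof (rule ccontr)
    assume "\<not> (\<exists>f\<in>wandering UNIV. f \<noteq> 0)"
    then have "S \<subseteq> {0}"
      by (intro S_generated_by_wandering)
        (auto simp: linear_isometryD(4)[OF linear_isometry_shift] closed_subspace_def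
          complex_vector.subspace_single_0)
    then show False using ne closed_subspace_0[OF S_closed] by blast
  qed
  then obtain f0 where f0: "f0 \<in> wandering UNIV" "f0 \<noteq> 0" by blast
  define f where "f = of_real (1 / norm f0) *\<^sub>C f0"
  have f: "f \<in> wandering UNIV" "norm f = 1"
    unfolding f_def using f0 by (auto intro: wandering_linear simp: norm_scaleC norm_divide)
  note m = wandering_unit_isometric_multiplier[OF f]
  have W: "g = cinner g f *\<^sub>C f" if g: "g \<in> wandering UNIV" for g
  proof (rule ccontr)
    define h where "h = g - cinner g f *\<^sub>C f"
    assume "g \<noteq> cinner g f *\<^sub>C f"
    then have h0: "h \<noteq> 0" by (simp add: h_def)
    have h: "h \<in> wandering UNIV" unfolding h_def by (intro wandering_linear g f)
    define h1 where "h1 = of_real (1 / norm h) *\<^sub>C h"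
    have h1: "h1 \<in> wandering UNIV" "norm h1 = 1"
      unfolding h1_def using h h0 by (auto intro: wandering_linear simp: norm_scaleC norm_divide)
    have "cinner h1 f = 0"
      by (simp add: h1_def h_def cinner_scaleC_left cinner_diff_left cinner_self f(2))
    then show False using wandering_not_orthogonal[OF h1 f] by simp
  qed
  have M: "invariant_subspace (multiples (Rep_H2 f))" by (rule multiples_invariant_doubly_commuting[OF m])
  have "f \<in> multiples (Rep_H2 f)"
  proof -
    have "mz (\<lambda>_. 0) f = f" by (rule mult_op_eqI) (simp add: zpow_def)
    then show ?thesis
      using mult_op_monomial_wandering[OF m, of "\<lambda>_. 0"] by (metis multiples_eq_range[OF m] rangeI)
  qed
  then have "wandering UNIV \<subseteq> multiples (Rep_H2 f)"
    using W closed_subspace_scaleC[OF invariant_subspaceD(1)[OF M]] by (metis subsetI)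
  then have "S \<subseteq> multiples (Rep_H2 f)"
    by (intro S_generated_by_wandering invariant_subspaceD[OF M])
  moreover have "multiples (Rep_H2 f) \<subseteq> S"
  proof -
    have "f \<in> S" using f(1) wandering_subset by blast
    then have "mult_op (Rep_H2 f) ` range monomial \<subseteq> S"
      using mz_in by (auto simp: mult_op_monomial_wandering[OF m])
    then have "mult_op (Rep_H2 f) ` closed_span (range monomial) \<subseteq> S"
      by (rule linear_isometry_closed_span[OF linear_isometry_mult_op[OF m] S_closed])
    then show ?thesis unfolding closed_span_monomials multiples_eq_range[OF m] .
  qed
  ultimately show ?thesis using that m by blast
qed

end


section \<open>Tensor products and slices\<close>

instance complex_hilbert \<subseteq> banach ..

definition join_index :: "(1 \<Rightarrow> nat) \<times> ('m \<Rightarrow> nat) \<Rightarrow> 'm option \<Rightarrow> nat" where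
  "join_index p i = (case i of None \<Rightarrow> fst p 1 | Some j \<Rightarrow> snd p j)"

lemma join_index_simps [simp]: "join_index (a, b) None = a 1" "join_index (a, b) (Some j) = b j"
  by (simp_all add: join_index_def)

lemma bij_join_index: "bij_betw join_index (UNIV \<times> UNIV) UNIV"
  by (rule bij_betwI[where g = "\<lambda>k. (\<lambda>_. k None, \<lambda>j. k (Some j))"])
    (auto simp: join_index_def fun_eq_iff num1_eq_iff split: option.split)

lemma zpow_join_index:
  fixes z :: "complex^('m::finite option)"
  shows "zpow z (join_index (a, b)) = zpow (first_var z) a * zpow (other_vars z) b"
proof -
  have "zpow z (join_index (a, b)) = (\<Prod>i\<in>insert None (range Some). z $ i ^ join_index (a, b) i)"
    by (simp add: zpow_def UNIV_option_conv)
  also have "\<dots> = z $ None ^ a 1 * (\<Prod>i\<in>range Some. z $ i ^ join_index (a, b) i)"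
    by (subst prod.insert) auto
  also have "(\<Prod>i\<in>range Some. z $ i ^ join_index (a, b) i) = (\<Prod>j\<in>UNIV. z $ Some j ^ b j)"
    by (subst prod.reindex) auto
  finally show ?thesis by (simp add: zpow_def first_var_def other_vars_def)
qed

definition tensor :: "1 H2 \<Rightarrow> 'm::finite H2 \<Rightarrow> 'm option H2" where
  "tensor f g = H2_of_coeff (\<lambda>k. H2_coeff f (\<lambda>_. k None) * H2_coeff g (\<lambda>j. k (Some j)))"

lemma const_index: "(\<lambda>_. a 1) = (a :: 1 \<Rightarrow> 'b)"
  by (simp add: fun_eq_iff num1_eq_iff)

lemma H2_coeff_tensor: "H2_coeff (tensor f g) (join_index (a, b)) = H2_coeff f a * H2_coeff g b"
proof -
  let ?c = "\<lambda>k. H2_coeff f (\<lambda>_. k None) * H2_coeff g (\<lambda>j. k (Some j))"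
  have "(\<lambda>p. (norm (H2_coeff f (fst p) * H2_coeff g (snd p)))\<^sup>2) summable_on (UNIV \<times> UNIV)"
  proof (rule summable_on_SigmaI)
    show "((\<lambda>b. (norm (H2_coeff f (fst (a, b)) * H2_coeff g (snd (a, b))))\<^sup>2) has_sum ((norm (H2_coeff f a))\<^sup>2 * (norm g)\<^sup>2)) UNIV" for a
      using has_sum_cmult_right[OF norm_power2_H2[of g], of "(norm (H2_coeff f a))\<^sup>2"]
      by (simp add: norm_mult power_mult_distrib)
    show "(\<lambda>a. (norm (H2_coeff f a))\<^sup>2 * (norm g)\<^sup>2) summable_on UNIV"
      by (intro summable_on_cmult_left H2_coeff_summable)
  qed auto
  then have "(\<lambda>p. (norm (?c (join_index p)))\<^sup>2) summable_on (UNIV \<times> UNIV)"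
    by (simp add: case_prod_unfold join_index_def const_index)
  then have "(\<lambda>k. (norm (?c k))\<^sup>2) summable_on UNIV"
    using summable_on_reindex_bij_betw[OF bij_join_index, of "\<lambda>k. (norm (?c k))\<^sup>2"] by simp
  then have "H2_coeff (tensor f g) = ?c" unfolding tensor_def by (rule H2_coeff_of_coeff)
  then show ?thesis by (simp add: const_index)
qed

lemma first_var_polydisc: "z \<in> polydisc \<Longrightarrow> first_var z \<in> polydisc"
  and other_vars_polydisc: "z \<in> polydisc \<Longrightarrow> other_vars z \<in> polydisc"
  by (auto simp: polydisc_def first_var_def other_vars_def)

lemma has_sum_join_index:
  fixes F :: "(1 \<Rightarrow> nat) \<Rightarrow> complex" and G :: "('m::finite \<Rightarrow> nat) \<Rightarrow> complex"
  assumes "(H has_sum s) UNIV" "\<And>a b. H (join_index (a, b)) = F a * G b"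
    "(F has_sum x) UNIV" "(G has_sum y) UNIV"
  shows "s = x * y"
proof -
  have "((\<lambda>p. H (join_index p)) has_sum s) (UNIV \<times> UNIV)"
    using assms(1) has_sum_reindex_bij_betw[OF bij_join_index, of H s] by simp
  then have "((\<lambda>a. F a * y) has_sum s) UNIV"
    by (rule has_sum_SigmaD) (use has_sum_cmult_right[OF assms(4)] assms(2) in simp)
  then show ?thesis using has_sum_cmult_left[OF assms(3)] has_sum_unique by blast
qed

lemma Rep_tensor:
  assumes "z \<in> polydisc"
  shows "Rep_H2 (tensor f g) z = Rep_H2 f (first_var z) * Rep_H2 g (other_vars z)"
  by (rule has_sum_join_index[OF H2_coeff_has_sum[OF assms] _
        H2_coeff_has_sum[OF first_var_polydisc[OF assms]] H2_coeff_has_sum[OF other_vars_polydisc[OF assms]]])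
    (simp add: zpow_join_index H2_coeff_tensor)

lemma cinner_tensor: "cinner (tensor f g) (tensor f' g') = cinner f f' * cinner g g'"
  by (rule has_sum_join_index[OF cinner_has_sum _ cinner_has_sum cinner_has_sum])
    (simp add: H2_coeff_tensor)

lemma norm_tensor: "norm (tensor f g) = norm f * norm g"
proof -
  have "complex_of_real ((norm (tensor f g))\<^sup>2) = of_real ((norm f * norm g)\<^sup>2)"
    unfolding cinner_self[symmetric] cinner_tensor by (simp add: cinner_self power_mult_distrib)
  then show ?thesis by (simp only: of_real_eq_iff) (simp add: power2_eq_iff_nonneg)
qed

lemma tensor_linear:
  "tensor (f + f') g = tensor f g + tensor f' g" "tensor f (g + g') = tensor f g + tensor f g'"
  "tensor (c *\<^sub>C f) g = c *\<^sub>C tensor f g" "tensor f (c *\<^sub>C g) = c *\<^sub>C tensor f g"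
  by (rule H2_eqI; simp add: Rep_tensor algebra_simps)+

lemma tensor_sum_right: "tensor f (\<Sum>x\<in>A. g x) = (\<Sum>x\<in>A. tensor f (g x))"
proof -
  have "tensor f 0 = 0" using tensor_linear(4)[of f 0 0] by simp
  then show ?thesis by (induction A rule: infinite_finite_induct) (auto simp: tensor_linear)
qed

lemma bounded_linear_tensor_right: "bounded_linear (tensor f)"
  by (rule bounded_linear_intro[of _ "norm f"])
    (auto simp: tensor_linear scaleR_eq_scaleC norm_tensor mult.commute)

lemma shift_tensor:
  "shift None (tensor f g) = tensor (shift 1 f) g" "shift (Some i) (tensor f g) = tensor f (shift i g)"
  by (rule H2_eqI; simp add: Rep_tensor first_var_def other_vars_def)+

lemma monomial_join_index: "monomial (join_index (a, b)) = tensor (monomial a) (monomial b)"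
  by (rule H2_eqI)
    (simp add: Rep_tensor Rep_monomial zpow_join_index first_var_polydisc other_vars_polydisc)

lemma hardy_tensor_eq: "hardy_tensor A B = closed_span {tensor f g | f g. f \<in> A \<and> g \<in> B}"
proof -
  have "{h. \<exists>f\<in>A. \<exists>g\<in>B. \<forall>z\<in>polydisc. Rep_H2 h z = Rep_H2 f (first_var z) * Rep_H2 g (other_vars z)}
      = {tensor f g | f g. f \<in> A \<and> g \<in> B}"
  proof (intro set_eqI iffI)
    fix h assume "h \<in> {h. \<exists>f\<in>A. \<exists>g\<in>B. \<forall>z\<in>polydisc. Rep_H2 h z = Rep_H2 f (first_var z) * Rep_H2 g (other_vars z)}"
    then obtain f g where fg: "f \<in> A" "g \<in> B"
      "\<And>z. z \<in> polydisc \<Longrightarrow> Rep_H2 h z = Rep_H2 f (first_var z) * Rep_H2 g (other_vars z)" by blast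
    then have "h = tensor f g" by (intro H2_eqI) (simp add: Rep_tensor)
    then show "h \<in> {tensor f g | f g. f \<in> A \<and> g \<in> B}" using fg by blast
  next
    fix h assume "h \<in> {tensor f g | f g. f \<in> A \<and> g \<in> B}"
    then show "h \<in> {h. \<exists>f\<in>A. \<exists>g\<in>B. \<forall>z\<in>polydisc. Rep_H2 h z = Rep_H2 f (first_var z) * Rep_H2 g (other_vars z)}"
      using Rep_tensor by blast
  qed
  then show ?thesis by (simp add: hardy_tensor_def)
qed

text \<open>The slice of \<open>G\<close> at \<open>w\<close> is the function obtained by fixing the first variable.  It is the
  adjoint of \<open>x \<mapsto> k\<^sub>w \<otimes> x\<close>, where \<open>k\<^sub>w\<close> is the Szego kernel.\<close>

definition slice :: "complex^1 \<Rightarrow> 'm::finite option H2 \<Rightarrow> 'm H2" where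
  "slice w G = (SOME y. \<forall>x. cinner y x = cinner G (tensor (szego_kernel w) x))"

lemma linear_isometry_adjoint_exists:
  assumes J: "linear_isometry J"
  shows "\<exists>y. \<forall>x. cinner y x = cinner G (J x)"
proof -
  have "closed_subspace (range J)" by (rule linear_isometry_image[OF J closed_subspace_UNIV])
  then obtain p where "p \<in> range J" and orth: "\<And>x. x \<in> range J \<Longrightarrow> cinner (G - p) x = 0"
    by (rule closed_subspace_projection) blast
  then obtain y where p: "p = J y" by blast
  have "cinner y x = cinner G (J x)" for x
    using orth[of "J x"] by (simp add: p cinner_diff_left linear_isometry_cinner[OF J])
  then show ?thesis by blast
qed

lemma cinner_slice:
  fixes G :: "'m::finite option H2"
  shows "cinner (slice w G) x = cinner G (tensor (szego_kernel w) x)"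
proof -
  let ?k = "szego_kernel w"
  have "\<exists>y. \<forall>x. cinner y x = cinner G (tensor ?k x)"
  proof (cases "?k = 0")
    case True
    then have "tensor ?k x = 0" for x :: "'m H2" using norm_tensor[of ?k x] by simp
    then show ?thesis by (intro exI[of _ 0]) simp
  next
    case False
    define c where "c = complex_of_real (norm ?k)"
    have c: "c \<noteq> 0" "cnj c = c" using False by (simp_all add: c_def)
    have "linear_isometry (\<lambda>x. (1 / c) *\<^sub>C tensor ?k x)"
      using False by (auto simp: linear_isometry_def tensor_linear scaleC_add_right scaleC_scaleC norm_scaleC
          norm_tensor c_def norm_divide)
    then obtain y where "\<And>x. cinner y x = cinner G ((1 / c) *\<^sub>C tensor ?k x)"
      using linear_isometry_adjoint_exists by blast
    then show ?thesis
      using c by (intro exI[of _ "c *\<^sub>C y"]) (simp add: cinner_scaleC_left cinner_scaleC_right)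
  qed
  then have "\<forall>x. cinner (slice w G) x = cinner G (tensor ?k x)" unfolding slice_def by (rule someI_ex)
  then show ?thesis by blast
qed

lemma cinner_eqI: "(\<And>x. cinner y x = cinner y' x) \<Longrightarrow> y = y'"
  using cinner_self_eq_0[of "y - y'"] by (simp add: cinner_diff_left)

lemma slice_linear: "slice w (G + G') = slice w G + slice w G'" "slice w (c *\<^sub>C G) = c *\<^sub>C slice w G"
  by (rule cinner_eqI; simp add: cinner_slice cinner_add_left cinner_scaleC_left)+

lemma bounded_linear_slice: "bounded_linear (slice w)"
proof (rule bounded_linear_intro)
  fix G :: "'a option H2"
  have "(norm (slice w G))\<^sup>2 = Re (cinner G (tensor (szego_kernel w) (slice w G)))"
    unfolding cinner_slice[symmetric] by (simp add: cinner_self)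
  also have "\<dots> \<le> norm G * (norm (szego_kernel w) * norm (slice w G))"
    using complex_Re_le_cmod norm_cinner_le order_trans unfolding norm_tensor[symmetric] by blast
  finally show "norm (slice w G) \<le> norm G * norm (szego_kernel w)"
    by (cases "norm (slice w G) = 0") (auto simp: power2_eq_square)
qed (simp_all add: slice_linear scaleR_eq_scaleC)

lemma slice_tensor: "w \<in> polydisc \<Longrightarrow> slice w (tensor h x) = Rep_H2 h w *\<^sub>C x"
  by (rule cinner_eqI) (simp add: cinner_slice cinner_tensor cinner_scaleC_left Rep_H2_eq_cinner)

lemma Rep_slice:
  assumes z: "z \<in> polydisc"
  shows "Rep_H2 (slice (first_var z) G) (other_vars z) = Rep_H2 G z"
proof -
  note p = first_var_polydisc[OF z] other_vars_polydisc[OF z]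
  have "H2_coeff (tensor (szego_kernel (first_var z)) (szego_kernel (other_vars z))) k = H2_coeff (szego_kernel z) k" for k
  proof -
    obtain a b where "k = join_index (a, b)"
      using bij_betw_imp_surj_on[OF bij_join_index] by (metis UNIV_I image_iff surj_pair)
    then show ?thesis by (simp add: H2_coeff_tensor H2_coeff_szego_kernel p z zpow_join_index)
  qed
  then have "tensor (szego_kernel (first_var z)) (szego_kernel (other_vars z)) = szego_kernel z"
    by (intro H2_coeff_inject) auto
  then show ?thesis by (simp add: Rep_H2_eq_cinner p z cinner_slice)
qed

definition join_vars :: "complex^1 \<Rightarrow> complex^'m \<Rightarrow> complex^('m::finite option)" where
  "join_vars w \<zeta> = (\<chi> i. case i of None \<Rightarrow> w $ 1 | Some j \<Rightarrow> \<zeta> $ j)"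

lemma join_vars:
  "first_var (join_vars w \<zeta>) = w" "other_vars (join_vars w \<zeta>) = \<zeta>"
  "w \<in> polydisc \<Longrightarrow> \<zeta> \<in> polydisc \<Longrightarrow> join_vars w \<zeta> \<in> polydisc"
  by (auto simp: join_vars_def first_var_def other_vars_def polydisc_def vec_eq_iff num1_eq_iff split: option.split)

text \<open>Slicing identifies \<open>H\<^sup>2\<close> of the polydisc with the Hardy space of the disc with values in
  \<open>H\<^sup>2\<close> in the other variables.\<close>

lemma has_sum_slice:
  fixes \<eta> :: "(1 \<Rightarrow> nat) \<Rightarrow> 'm::finite H2"
  assumes w: "w \<in> polydisc" and sq: "(\<lambda>a. (norm (\<eta> a))\<^sup>2) summable_on UNIV"
    and G: "\<And>a b. H2_coeff G (join_index (a, b)) = H2_coeff (\<eta> a) b"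
  shows "((\<lambda>a. zpow w a *\<^sub>C \<eta> a) has_sum slice w G) UNIV"
proof -
  have "(\<lambda>a. norm (zpow w a *\<^sub>C \<eta> a)) summable_on UNIV"
  proof (rule summable_on_comparison_test)
    show "(\<lambda>a. (norm (\<eta> a))\<^sup>2 + norm (zpow w a)) summable_on UNIV"
      by (intro summable_on_add sq zpow_summable w)
    fix a
    have 1: "norm (zpow w a) \<le> 1" by (rule zpow_le_1[OF w])
    have "2 * (norm (zpow w a) * norm (\<eta> a)) \<le> (norm (zpow w a))\<^sup>2 + (norm (\<eta> a))\<^sup>2"
      using sum_squares_bound[of "norm (zpow w a)" "norm (\<eta> a)"] by (simp add: mult.assoc)
    moreover have "(norm (zpow w a))\<^sup>2 \<le> norm (zpow w a)" by (rule zpow_square_le[OF w])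
    moreover have "0 \<le> norm (zpow w a) * norm (\<eta> a)" by simp
    ultimately show "norm (zpow w a *\<^sub>C \<eta> a) \<le> (norm (\<eta> a))\<^sup>2 + norm (zpow w a)"
      unfolding norm_scaleC by linarith
  qed auto
  then obtain y where y: "((\<lambda>a. zpow w a *\<^sub>C \<eta> a) has_sum y) UNIV"
    using abs_summable_summable[of "\<lambda>a. zpow w a *\<^sub>C \<eta> a" UNIV] by (auto simp: summable_on_def)
  have "H2_coeff y b = H2_coeff (slice w G) b" for b
  proof -
    have "((\<lambda>a. cinner (zpow w a *\<^sub>C \<eta> a) (monomial b)) has_sum cinner y (monomial b)) UNIV"
      by (rule has_sum_bounded_linear[OF bounded_linear_cinner_left y])
    then have 1: "((\<lambda>a. zpow w a * H2_coeff (\<eta> a) b) has_sum H2_coeff y b) UNIV"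
      by (simp add: cinner_monomial cinner_scaleC_left)
    let ?h = "\<lambda>k. H2_coeff G k * cnj (H2_coeff (tensor (szego_kernel w) (monomial b)) k)"
    have "(?h has_sum cinner G (tensor (szego_kernel w) (monomial b))) UNIV" by (rule cinner_has_sum)
    then have "((\<lambda>p. ?h (join_index p)) has_sum H2_coeff (slice w G) b) (UNIV \<times> UNIV)"
      using has_sum_reindex_bij_betw[OF bij_join_index, of ?h]
      by (simp add: cinner_slice[symmetric] cinner_monomial)
    then have "((\<lambda>a. zpow w a * H2_coeff (\<eta> a) b) has_sum H2_coeff (slice w G) b) UNIV"
    proof (rule has_sum_SigmaD)
      fix a
      show "((\<lambda>b'. ?h (join_index (a, b'))) has_sum (zpow w a * H2_coeff (\<eta> a) b)) UNIV"
        by (rule has_sum_finite_neutralI[of "{b}"])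
          (auto simp: G H2_coeff_tensor H2_coeff_szego_kernel w H2_coeff_monomial mult.commute)
    qed
    then show ?thesis using 1 has_sum_unique by blast
  qed
  then have "y = slice w G" by (intro H2_coeff_inject) auto
  then show ?thesis using y by simp
qed

lemma slices_eq_hardy_space:
  shows slice_in_hardy_space:
      "\<exists>f\<in>hardy_space. \<forall>w\<in>polydisc. f w = slice w (G :: 'm::finite option H2)"
    and hardy_space_is_slice:
      "f \<in> hardy_space \<Longrightarrow> \<exists>G :: 'm option H2. \<forall>w\<in>polydisc. f w = slice w G"
proof -
  have "\<exists>\<eta> :: (1 \<Rightarrow> nat) \<Rightarrow> 'm H2. (\<lambda>a. (norm (\<eta> a))\<^sup>2) summable_on UNIV \<and>
      (\<forall>a b. H2_coeff G (join_index (a, b)) = H2_coeff (\<eta> a) b)"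
  proof -
    have s: "(\<lambda>p. (norm (H2_coeff G (join_index p)))\<^sup>2) summable_on (UNIV \<times> UNIV)"
      using summable_on_reindex_bij_betw[OF bij_join_index, of "\<lambda>k. (norm (H2_coeff G k))\<^sup>2"] H2_coeff_summable[of G]
      by simp
    have sa: "(\<lambda>b. (norm (H2_coeff G (join_index (a, b))))\<^sup>2) summable_on UNIV" for a
    proof -
      have "inj (Pair a :: ('m \<Rightarrow> nat) \<Rightarrow> _)" by (simp add: inj_on_def)
      from summable_on_reindex[OF this, of "\<lambda>p. (norm (H2_coeff G (join_index p)))\<^sup>2"]
        summable_on_subset_banach[OF s, of "range (Pair a)"]
      show ?thesis by (auto simp: o_def)
    qed
    define \<eta> where "\<eta> a = H2_of_coeff (\<lambda>b. H2_coeff G (join_index (a, b)))" for a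
    have c: "H2_coeff (\<eta> a) = (\<lambda>b. H2_coeff G (join_index (a, b)))" for a
      unfolding \<eta>_def by (rule H2_coeff_of_coeff[OF sa])
    have "((\<lambda>p. (norm (H2_coeff G (join_index p)))\<^sup>2) has_sum infsum (\<lambda>p. (norm (H2_coeff G (join_index p)))\<^sup>2) (UNIV \<times> UNIV)) (UNIV \<times> UNIV)"
      by (rule has_sum_infsum[OF s])
    then have "((\<lambda>a. (norm (\<eta> a))\<^sup>2) has_sum infsum (\<lambda>p. (norm (H2_coeff G (join_index p)))\<^sup>2) (UNIV \<times> UNIV)) UNIV"
      by (rule has_sum_SigmaD) (use norm_power2_H2[of "\<eta> _"] c in simp)
    then show ?thesis using c by (intro exI[of _ \<eta>]) (auto intro: has_sum_imp_summable)
  qed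
  then obtain \<eta> :: "(1 \<Rightarrow> nat) \<Rightarrow> 'm H2" where \<eta>: "(\<lambda>a. (norm (\<eta> a))\<^sup>2) summable_on UNIV"
    "\<And>a b. H2_coeff G (join_index (a, b)) = H2_coeff (\<eta> a) b" by blast
  show "\<exists>f\<in>hardy_space. \<forall>w\<in>polydisc. f w = slice w G"
  proof (rule bexI[of _ "\<lambda>w. if w \<in> polydisc then slice w G else 0"])
    show "(\<lambda>w. if w \<in> polydisc then slice w G else 0) \<in> hardy_space"
      unfolding hardy_space_def hardy_coeffs_def using \<eta>(1) has_sum_slice[OF _ \<eta>] by auto
  qed simp
next
  assume "f \<in> hardy_space"
  then obtain \<eta> :: "(1 \<Rightarrow> nat) \<Rightarrow> 'm H2" where \<eta>: "(\<lambda>a. (norm (\<eta> a))\<^sup>2) summable_on UNIV"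
    "\<And>w. w \<in> polydisc \<Longrightarrow> ((\<lambda>a. zpow w a *\<^sub>C \<eta> a) has_sum f w) UNIV"
    by (auto simp: hardy_space_def hardy_coeffs_def)
  let ?c = "\<lambda>k. H2_coeff (\<eta> (\<lambda>_. k None)) (\<lambda>j. k (Some j))"
  have cj: "?c (join_index (a, b)) = H2_coeff (\<eta> a) b" for a b by (simp add: const_index)
  have "(\<lambda>p. (norm (?c (join_index p)))\<^sup>2) summable_on (UNIV \<times> UNIV)"
  proof (rule summable_on_SigmaI)
    show "((\<lambda>b. (norm (?c (join_index (a, b))))\<^sup>2) has_sum (norm (\<eta> a))\<^sup>2) UNIV" for a
      unfolding cj by (rule norm_power2_H2)
  qed (use \<eta>(1) in auto)
  then have "(\<lambda>k. (norm (?c k))\<^sup>2) summable_on UNIV"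
    using summable_on_reindex_bij_betw[OF bij_join_index, of "\<lambda>k. (norm (?c k))\<^sup>2"] by simp
  then have "H2_coeff (H2_of_coeff ?c) = ?c" by (rule H2_coeff_of_coeff)
  then have "\<And>a b. H2_coeff (H2_of_coeff ?c) (join_index (a, b)) = H2_coeff (\<eta> a) b" using cj by simp
  from has_sum_slice[OF _ \<eta>(1) this]
  show "\<exists>G :: 'm option H2. \<forall>w\<in>polydisc. f w = slice w G"
    using \<eta>(2) has_sum_unique by blast
qed

lemma Theta_range_eq:
  "Theta_range \<phi> P = {F. \<exists>G. \<forall>w\<in>polydisc. slice w F = Theta \<phi> P w (slice w G)}"
proof -
  have "(\<forall>z\<in>polydisc. Rep_H2 F z = Rep_H2 (Theta \<phi> P (first_var z) (f (first_var z))) (other_vars z)) \<longleftrightarrow>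
      (\<forall>w\<in>polydisc. slice w F = Theta \<phi> P w (f w))" for F f
  proof
    assume A: "\<forall>z\<in>polydisc. Rep_H2 F z = Rep_H2 (Theta \<phi> P (first_var z) (f (first_var z))) (other_vars z)"
    show "\<forall>w\<in>polydisc. slice w F = Theta \<phi> P w (f w)"
    proof (intro ballI H2_eqI)
      fix w :: "complex^1" and \<zeta> :: "complex^'a" assume "w \<in> polydisc" "\<zeta> \<in> polydisc"
      then show "Rep_H2 (slice w F) \<zeta> = Rep_H2 (Theta \<phi> P w (f w)) \<zeta>"
        using A[rule_format, of "join_vars w \<zeta>"] Rep_slice[of "join_vars w \<zeta>" F] by (simp add: join_vars)
    qed
  next
    assume A: "\<forall>w\<in>polydisc. slice w F = Theta \<phi> P w (f w)"
    show "\<forall>z\<in>polydisc. Rep_H2 F z = Rep_H2 (Theta \<phi> P (first_var z) (f (first_var z))) (other_vars z)"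
      using A Rep_slice[of _ F] first_var_polydisc by metis
  qed
  then have "Theta_range \<phi> P = {F. \<exists>f\<in>hardy_space. \<forall>w\<in>polydisc. slice w F = Theta \<phi> P w (f w)}"
    unfolding Theta_range_def by simp
  also have "\<dots> = {F. \<exists>G. \<forall>w\<in>polydisc. slice w F = Theta \<phi> P w (slice w G)}"
  proof (intro Collect_cong iffI)
    fix F
    assume "\<exists>f\<in>hardy_space. \<forall>w\<in>polydisc. slice w F = Theta \<phi> P w (f w)"
    then obtain f where "f \<in> hardy_space" "\<forall>w\<in>polydisc. slice w F = Theta \<phi> P w (f w)" by blast
    then show "\<exists>G. \<forall>w\<in>polydisc. slice w F = Theta \<phi> P w (slice w G)"
      using hardy_space_is_slice[of f] by metis
  next
    fix F
    assume "\<exists>G. \<forall>w\<in>polydisc. slice w F = Theta \<phi> P w (slice w G)"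
    then obtain G where "\<forall>w\<in>polydisc. slice w F = Theta \<phi> P w (slice w G)" by blast
    then show "\<exists>f\<in>hardy_space. \<forall>w\<in>polydisc. slice w F = Theta \<phi> P w (f w)"
      using slice_in_hardy_space[of G] by metis
  qed
  finally show ?thesis .
qed


section \<open>Complementary projections\<close>

lemma orthogonal_projectionD:
  assumes "orthogonal_projection P"
  shows "P (x + y) = P x + P y" "P (c *\<^sub>C x) = c *\<^sub>C P x" "P (P x) = P x"
    "cinner (P x) y = cinner x (P y)" "P (\<Sum>i\<in>A. f i) = (\<Sum>i\<in>A. P (f i))"
proof -
  have lin: "Vector_Spaces.linear scaleC scaleC P" using assms by (simp add: orthogonal_projection_def)
  then show add: "P (x + y) = P x + P y" and scale: "P (c *\<^sub>C x) = c *\<^sub>C P x" for x y c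
    by (simp_all add: Vector_Spaces.linear_iff)
  show "P (P x) = P x" "cinner (P x) y = cinner x (P y)"
    using assms by (simp_all add: orthogonal_projection_def)
  have "P 0 = 0" using scale[of 0 0] by simp
  then show "P (\<Sum>i\<in>A. f i) = (\<Sum>i\<in>A. P (f i))"
    by (induction A rule: infinite_finite_induct) (auto simp: add)
qed

lemma bounded_linear_orthogonal_projection:
  assumes "orthogonal_projection P"
  shows "bounded_linear P"
proof (rule bounded_linear_intro[of _ 1])
  fix x
  have "(norm (P x))\<^sup>2 = Re (cinner x (P x))"
    using orthogonal_projectionD(3,4)[OF assms, of x] by (metis Re_complex_of_real cinner_self orthogonal_projectionD(4)[OF assms])
  also have "\<dots> \<le> norm x * norm (P x)"
    using complex_Re_le_cmod norm_cinner_le order_trans by blast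
  finally show "norm (P x) \<le> norm x * 1"
    by (cases "norm (P x) = 0") (auto simp: power2_eq_square)
qed (simp_all add: orthogonal_projectionD[OF assms] scaleR_eq_scaleC)

context
  fixes P :: "nat \<Rightarrow> 'a::complex_hilbert \<Rightarrow> 'a"
  assumes P: "complementary_projections P"
begin

lemma proj: "orthogonal_projection (P j)"
  and proj_proj: "P j (P k x) = (if j = k then P k x else 0)"
  and proj_sums: "(\<lambda>j. P j x) sums x"
  using P orthogonal_projectionD(3) by (auto simp: complementary_projections_def)

lemma cinner_proj_proj: "j \<noteq> k \<Longrightarrow> cinner (P j x) (P k y) = 0"
  by (simp add: orthogonal_projectionD(4)[OF proj] proj_proj)

lemma range_sum_eq: "range_sum P j = {x. (\<Sum>k\<le>j. P k x) = x}"
proof (intro set_eqI iffI)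
  fix y assume "y \<in> range_sum P j"
  then obtain x where x: "y = (\<Sum>k\<le>j. x k)" "\<And>k. k \<le> j \<Longrightarrow> x k \<in> range (P k)"
    unfolding range_sum_def by blast
  have Px: "P l (x k) = (if l = k then x k else 0)" if "k \<le> j" for k l
    using x(2)[OF that] by (auto simp: proj_proj)
  have "(\<Sum>l\<le>j. P l y) = (\<Sum>l\<le>j. \<Sum>k\<le>j. if l = k then x k else 0)"
    unfolding x(1) orthogonal_projectionD(5)[OF proj] using Px by (intro sum.cong refl) auto
  also have "\<dots> = y" by (simp add: x(1))
  finally show "y \<in> {x. (\<Sum>k\<le>j. P k x) = x}" by simp
next
  fix y assume "y \<in> {x. (\<Sum>k\<le>j. P k x) = x}"
  then have "y = (\<Sum>k\<le>j. P k y)" by simp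
  then show "y \<in> range_sum P j" unfolding range_sum_def by (intro CollectI exI[of _ "\<lambda>k. P k y"]) auto
qed

lemma closed_subspace_range_sum: "closed_subspace (range_sum P j)"
proof (rule closed_subspaceI)
  fix X x assume X: "\<And>n. X n \<in> range_sum P j" "X \<longlonglongrightarrow> x"
  have "(\<lambda>n. \<Sum>k\<le>j. P k (X n)) \<longlonglongrightarrow> (\<Sum>k\<le>j. P k x)"
    by (intro tendsto_sum bounded_linear.tendsto[OF bounded_linear_orthogonal_projection[OF proj]] X(2))
  then have "X \<longlonglongrightarrow> (\<Sum>k\<le>j. P k x)" using X(1) by (simp add: range_sum_eq)
  then show "x \<in> range_sum P j" using X(2) LIMSEQ_unique unfolding range_sum_eq by blast
next
  have "P k 0 = 0" for k using orthogonal_projectionD(2)[OF proj, of k 0 0] by simp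
  then show "0 \<in> range_sum P j" by (simp add: range_sum_eq)
qed (auto simp: range_sum_eq orthogonal_projectionD[OF proj] sum.distrib complex_vector.scale_sum_right[symmetric])

lemma range_subset_range_sum:
  assumes "k \<le> j"
  shows "P k x \<in> range_sum P j"
  using assms by (simp add: range_sum_eq proj_proj)

lemma range_sum_mono:
  assumes "i \<le> j"
  shows "range_sum P i \<subseteq> range_sum P j"
proof
  fix x assume "x \<in> range_sum P i"
  then have "x = (\<Sum>k\<le>i. P k x)" by (simp add: range_sum_eq)
  moreover have "(\<Sum>k\<le>i. P k x) \<in> range_sum P j"
    using assms by (intro closed_subspace_sum[OF closed_subspace_range_sum] range_subset_range_sum) auto
  ultimately show "x \<in> range_sum P j" by simp
qed

lemma range_sum_strict:
  assumes "P (Suc j) x \<noteq> 0"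
  shows "P (Suc j) x \<notin> range_sum P j"
proof
  assume "P (Suc j) x \<in> range_sum P j"
  then have "P (Suc j) x = (\<Sum>k\<le>j. P k (P (Suc j) x))" by (simp add: range_sum_eq)
  also have "\<dots> = 0" by (simp add: proj_proj)
  finally show False using assms by simp
qed

text \<open>Since the ranges are pairwise orthogonal, a bounded scalar sequence multiplies the expansion
  \<open>x = (\<Sum>j. P j x)\<close> into a convergent series of no larger norm.\<close>

context
  fixes c :: "nat \<Rightarrow> complex"
  assumes c: "\<And>j. norm (c j) \<le> 1"
begin

lemma norm_weighted_sum_le:
  assumes "finite A"
  shows "norm (\<Sum>j\<in>A. c j *\<^sub>C P j x) \<le> norm (\<Sum>j\<in>A. P j x)"
proof -
  have "(norm (\<Sum>j\<in>A. d j *\<^sub>C P j x))\<^sup>2 = (\<Sum>j\<in>A. (norm (d j))\<^sup>2 * (norm (P j x))\<^sup>2)" for d :: "nat \<Rightarrow> complex"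
  proof -
    have "cinner (d j *\<^sub>C P j x) (d k *\<^sub>C P k x)
        = (if k = j then of_real ((norm (d j))\<^sup>2 * (norm (P j x))\<^sup>2) else 0)" for j k
    proof (cases "k = j")
      case True
      then show ?thesis by (simp add: cinner_self norm_scaleC power_mult_distrib)
    qed (simp add: cinner_scaleC_left cinner_scaleC_right cinner_proj_proj)
    then have "cinner (\<Sum>j\<in>A. d j *\<^sub>C P j x) (\<Sum>j\<in>A. d j *\<^sub>C P j x)
        = of_real (\<Sum>j\<in>A. (norm (d j))\<^sup>2 * (norm (P j x))\<^sup>2)"
      using assms by (simp add: cinner_sum_left cinner_sum_right del: of_real_mult of_real_power)
    then show ?thesis unfolding cinner_self of_real_eq_iff .
  qed
  from this[of c] this[of "\<lambda>_. 1"]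
  have "(norm (\<Sum>j\<in>A. c j *\<^sub>C P j x))\<^sup>2 \<le> (norm (\<Sum>j\<in>A. P j x))\<^sup>2"
    using c by (auto intro!: sum_mono mult_left_le_one_le simp: power_le_one)
  then show ?thesis by (simp add: power2_le_iff_abs_le)
qed

lemma summable_weighted: "summable (\<lambda>j. c j *\<^sub>C P j x)"
  unfolding summable_Cauchy
proof (intro allI impI)
  fix e :: real assume "e > 0"
  then obtain N where "\<And>m n. m \<ge> N \<Longrightarrow> norm (\<Sum>j\<in>{m..<n}. P j x) < e"
    using sums_summable[OF proj_sums[of x]] unfolding summable_Cauchy by blast
  then show "\<exists>N. \<forall>m\<ge>N. \<forall>n. norm (\<Sum>j\<in>{m..<n}. c j *\<^sub>C P j x) < e"
    using norm_weighted_sum_le by (meson finite_atLeastLessThan le_less_trans)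
qed

lemma bounded_linear_weighted: "bounded_linear (\<lambda>x. \<Sum>j. c j *\<^sub>C P j x)"
proof (rule bounded_linear_intro[of _ 1])
  fix x y :: 'a and r :: real
  show "(\<Sum>j. c j *\<^sub>C P j (x + y)) = (\<Sum>j. c j *\<^sub>C P j x) + (\<Sum>j. c j *\<^sub>C P j y)"
    by (simp add: orthogonal_projectionD[OF proj] scaleC_add_right suminf_add summable_weighted)
  have "(\<Sum>j. c j *\<^sub>C P j (r *\<^sub>R x)) = (\<Sum>j. r *\<^sub>R (c j *\<^sub>C P j x))"
    by (simp add: scaleR_eq_scaleC orthogonal_projectionD[OF proj] scaleC_scaleC mult.commute)
  then show "(\<Sum>j. c j *\<^sub>C P j (r *\<^sub>R x)) = r *\<^sub>R (\<Sum>j. c j *\<^sub>C P j x)"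
    by (simp add: suminf_scaleR_right[OF summable_weighted])
  have "(\<lambda>n. norm (\<Sum>j<n. c j *\<^sub>C P j x)) \<longlonglongrightarrow> norm (\<Sum>j. c j *\<^sub>C P j x)"
    by (intro tendsto_norm summable_LIMSEQ summable_weighted)
  moreover have "(\<lambda>n. norm (\<Sum>j<n. P j x)) \<longlonglongrightarrow> norm x"
    using proj_sums[of x] by (intro tendsto_norm) (simp add: sums_def)
  ultimately have "norm (\<Sum>j. c j *\<^sub>C P j x) \<le> norm x"
    by (rule LIMSEQ_le) (use norm_weighted_sum_le in blast)
  then show "norm (\<Sum>j. c j *\<^sub>C P j x) \<le> norm x * 1" by simp
qed

lemma weighted_scaleC: "(\<Sum>j. c j *\<^sub>C P j (a *\<^sub>C x)) = a *\<^sub>C (\<Sum>j. c j *\<^sub>C P j x)"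
proof -
  have "(\<Sum>j. c j *\<^sub>C P j (a *\<^sub>C x)) = (\<Sum>j. a *\<^sub>C (c j *\<^sub>C P j x))"
    by (simp add: orthogonal_projectionD[OF proj] scaleC_scaleC mult.commute)
  also have "\<dots> = a *\<^sub>C (\<Sum>j. c j *\<^sub>C P j x)"
    using bounded_linear.suminf[OF bounded_linear_scaleC summable_weighted] by simp
  finally show ?thesis .
qed

lemma weighted_range: "(\<Sum>j. c j *\<^sub>C P j (P k x)) = c k *\<^sub>C P k x"
proof -
  have "(\<lambda>j. c j *\<^sub>C P j (P k x)) sums (\<Sum>j\<in>{k}. c j *\<^sub>C P j (P k x))"
    by (rule sums_finite) (auto simp: proj_proj)
  then show ?thesis by (simp add: sums_iff proj_proj)
qed

end

end


section \<open>The range of the multiplication operator\<close>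

text \<open>If a sequence in the domain converges, then by isometry the corresponding values form a Cauchy
  sequence.\<close>

lemma isometric_relation_domain:
  fixes Q :: "('a::complex_hilbert \<times> 'b::complex_hilbert) set"
  assumes zero: "(0, 0) \<in> Q"
    and add: "\<And>x y x' y'. (x, y) \<in> Q \<Longrightarrow> (x', y') \<in> Q \<Longrightarrow> (x + x', y + y') \<in> Q"
    and scale: "\<And>c x y. (x, y) \<in> Q \<Longrightarrow> (c *\<^sub>C x, c *\<^sub>C y) \<in> Q"
    and lim: "\<And>X x Y y. (\<And>n. (X n, Y n) \<in> Q) \<Longrightarrow> X \<longlonglongrightarrow> x \<Longrightarrow> Y \<longlonglongrightarrow> y \<Longrightarrow> (x, y) \<in> Q"
    and iso: "\<And>x y. (x, y) \<in> Q \<Longrightarrow> norm x = norm y"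
  shows "closed_subspace {x. \<exists>y. (x, y) \<in> Q}"
proof (rule closed_subspaceI)
  fix X x assume "\<And>n. X n \<in> {x. \<exists>y. (x, y) \<in> Q}" and X: "X \<longlonglongrightarrow> x"
  then have "\<forall>n. \<exists>y. (X n, y) \<in> Q" by blast
  then obtain Y where Y: "\<And>n. (X n, Y n) \<in> Q" by metis
  have "(X m - X n, Y m - Y n) \<in> Q" for m n
    using add[OF Y[of m] scale[OF Y[of n], of "-1"]] by simp
  then have "dist (X m) (X n) = dist (Y m) (Y n)" for m n using iso by (simp add: dist_norm)
  then have "Cauchy Y" using LIMSEQ_imp_Cauchy[OF X] by (simp add: Cauchy_def)
  then obtain y where "Y \<longlonglongrightarrow> y" by (auto simp: Cauchy_convergent_iff convergent_def)
  then show "x \<in> {x. \<exists>y. (x, y) \<in> Q}" using lim[OF Y X] by blast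
qed (use zero add scale in blast)+

text \<open>The expansion \<open>x = (\<Sum>j. P j x)\<close> puts all tensors \<open>h \<otimes> x\<close> into the closed span, in particular the
  monomials.\<close>

lemma closed_span_tensors:
  assumes P: "complementary_projections P"
  shows "closed_span {tensor h (P j x) | h j x. True} = (UNIV :: 'm::finite option H2 set)"
proof -
  have total: "G = 0" if orth: "\<And>z. z \<in> {tensor h (P j x) | h j x. True} \<Longrightarrow> cinner z G = 0" for G :: "'m option H2"
  proof -
    have z: "cinner (tensor h x) G = 0" for h x
    proof -
      have "(\<lambda>n. \<Sum>j<n. P j x) \<longlonglongrightarrow> x" using proj_sums[OF P, of x] by (simp add: sums_def)
      then have "(\<lambda>n. cinner (tensor h (\<Sum>j<n. P j x)) G) \<longlonglongrightarrow> cinner (tensor h x) G"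
        by (intro tendsto_cinner bounded_linear.tendsto[OF bounded_linear_tensor_right] tendsto_const)
      moreover have "cinner (tensor h (P j x)) G = 0" for j by (rule orth) blast
      then have "cinner (tensor h (\<Sum>j<n. P j x)) G = 0" for n
        by (simp add: tensor_sum_right cinner_sum_left)
      ultimately show ?thesis by (simp add: LIMSEQ_const_iff)
    qed
    have "H2_coeff G k = 0" for k
    proof -
      obtain a b where k: "k = join_index (a, b)"
        using bij_join_index by (force simp: bij_betw_def)
      have "cinner G (monomial k) = cnj (cinner (tensor (monomial a) (monomial b)) G)"
        unfolding k monomial_join_index by (rule cinner_commute)
      then show ?thesis by (simp add: z cinner_monomial)
    qed
    then show ?thesis by (intro H2_coeff_inject) auto
  qed
  have "cinner x y = 0"
    if y: "\<And>z. z \<in> {tensor h (P j x) | h j x. True} \<Longrightarrow> cinner z y = 0" for x y :: "'m option H2"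
  proof -
    have "y = 0" by (rule total) (rule y)
    then show ?thesis by simp
  qed
  then have "x \<in> closed_span {tensor h (P j x) | h j x. True}" for x :: "'m option H2"
    by (rule in_closed_span_if_orthogonal)
  then show ?thesis by blast
qed

text \<open>Multiplication by \<open>\<Theta>\<close> maps \<open>h \<otimes> x\<close> with \<open>x \<in> Ran P\<^sub>j\<close> to \<open>\<phi>\<^sub>j h \<otimes> x\<close>, and it preserves the inner
  products of these vectors.  As slices depend continuously on the function, the graph \<open>R\<close> of the
  multiplication is a closed relation.  Its part \<open>R2\<close>, on which the multiplication is isometric, has
  closed domain and closed range; so the domain is everything, and the range is the closed span of
  the images.\<close>

lemma Theta_range_eq_closed_span:
  fixes P :: "nat \<Rightarrow> 'm::finite H2 \<Rightarrow> 'm H2"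
  assumes P: "complementary_projections P" and \<phi>: "\<And>j. isometric_multiplier (\<phi> j)"
  shows "Theta_range \<phi> P = closed_span {tensor (mult_op (\<phi> j) h) (P j x) | h j x. True}"
proof -
  define C where "C = closed_span {tensor (mult_op (\<phi> j) h) (P j x) | h j x. True}"
  define R where "R = {(G, F). \<forall>w\<in>polydisc. slice w F = Theta \<phi> P w (slice w G)}"
  have Theta: "bounded_linear (Theta \<phi> P w)" "Theta \<phi> P w (a *\<^sub>C x) = a *\<^sub>C Theta \<phi> P w x"
    "Theta \<phi> P w (P k x) = \<phi> k w *\<^sub>C P k x" if "w \<in> polydisc" for w a x k
  proof -
    have c: "norm (\<phi> j w) \<le> 1" for j by (rule isometric_multiplier_le_1[OF \<phi> that])
    show "bounded_linear (Theta \<phi> P w)"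
      using bounded_linear_weighted[OF P, of "\<lambda>j. \<phi> j w", OF c] by (simp add: Theta_def[abs_def])
    show "Theta \<phi> P w (a *\<^sub>C x) = a *\<^sub>C Theta \<phi> P w x"
      using weighted_scaleC[OF P, of "\<lambda>j. \<phi> j w", OF c] by (simp add: Theta_def)
    show "Theta \<phi> P w (P k x) = \<phi> k w *\<^sub>C P k x"
      using weighted_range[OF P, of "\<lambda>j. \<phi> j w", OF c] by (simp add: Theta_def)
  qed
  have slice0: "slice w 0 = 0" for w using slice_linear(2)[of w 0 0] by simp
  have R0: "(0, 0) \<in> R"
    using linear_simps(3)[OF Theta(1)] by (auto simp: R_def slice0)
  have Radd: "(G + G', F + F') \<in> R" if "(G, F) \<in> R" "(G', F') \<in> R" for G F G' F'
    using that by (auto simp: R_def slice_linear linear_simps(1)[OF Theta(1)])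
  have Rscale: "(a *\<^sub>C G, a *\<^sub>C F) \<in> R" if "(G, F) \<in> R" for G F a
    using that by (auto simp: R_def slice_linear Theta(2))
  have Rlim: "(G, F) \<in> R" if X: "\<And>n. (X n, Y n) \<in> R" "X \<longlonglongrightarrow> G" "Y \<longlonglongrightarrow> F" for X Y G F
  proof -
    have "slice w F = Theta \<phi> P w (slice w G)" if w: "w \<in> polydisc" for w
    proof (rule LIMSEQ_unique)
      show "(\<lambda>n. slice w (Y n)) \<longlonglongrightarrow> slice w F"
        by (rule bounded_linear.tendsto[OF bounded_linear_slice X(3)])
      have "(\<lambda>n. Theta \<phi> P w (slice w (X n))) \<longlonglongrightarrow> Theta \<phi> P w (slice w G)"
        by (rule bounded_linear.tendsto[OF Theta(1)[OF w] bounded_linear.tendsto[OF bounded_linear_slice X(2)]])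
      then show "(\<lambda>n. slice w (Y n)) \<longlonglongrightarrow> Theta \<phi> P w (slice w G)"
        using X(1) w by (simp add: R_def)
    qed
    then show ?thesis by (simp add: R_def)
  qed
  have Runique: "F = F'" if "(G, F) \<in> R" "(G, F') \<in> R" for G F F'
  proof (rule H2_eqI)
    fix z :: "complex^('m option)" assume z: "z \<in> polydisc"
    have "slice (first_var z) F = slice (first_var z) F'"
      using that first_var_polydisc[OF z] by (simp add: R_def)
    then show "Rep_H2 F z = Rep_H2 F' z" using Rep_slice[OF z] by metis
  qed
  \<comment> \<open>\<open>A\<close> is the graph on the generators.  Preservation of inner products is not a linear condition on
    pairs, but it becomes one when the second pair is fixed: \<open>R1\<close> is compatible with all pairs in \<open>A\<close>,
    and \<open>R2\<close> with all pairs in \<open>R1\<close>, hence with itself.\<close>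
  define A where "A = {(tensor h (P j x), tensor (mult_op (\<phi> j) h) (P j x)) | h j x. True}"
  define R1 where "R1 = {(G, F). (G, F) \<in> R \<and> (\<forall>(g, f)\<in>A. cinner F f = cinner G g)}"
  define R2 where "R2 = {(G, F). (G, F) \<in> R1 \<and> (\<forall>(g, f)\<in>R1. cinner F f = cinner G g)}"
  have R1I: "(G, F) \<in> R1" if "(G, F) \<in> R" "\<And>g f. (g, f) \<in> A \<Longrightarrow> cinner F f = cinner G g" for G F
    using that by (auto simp: R1_def)
  have R1D: "(G, F) \<in> R" "(g, f) \<in> A \<Longrightarrow> cinner F f = cinner G g" if "(G, F) \<in> R1" for G F g f
    using that by (auto simp: R1_def)
  have R2I: "(G, F) \<in> R2" if "(G, F) \<in> R1" "\<And>g f. (g, f) \<in> R1 \<Longrightarrow> cinner F f = cinner G g" for G F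
    using that by (auto simp: R2_def)
  have R2D: "(G, F) \<in> R1" "(g, f) \<in> R1 \<Longrightarrow> cinner F f = cinner G g" if "(G, F) \<in> R2" for G F g f
    using that by (auto simp: R2_def)
  have AR: "(g, f) \<in> R" if "(g, f) \<in> A" for g f
    using that by (auto simp: A_def R_def slice_tensor Theta Rep_mult_op[OF \<phi>] scaleC_scaleC mult.commute)
  have Ainner: "cinner f f' = cinner g g'" if "(g, f) \<in> A" "(g', f') \<in> A" for g f g' f'
  proof -
    obtain h j x where 1: "g = tensor h (P j x)" "f = tensor (mult_op (\<phi> j) h) (P j x)"
      using \<open>(g, f) \<in> A\<close> by (auto simp: A_def)
    obtain h' j' x' where 2: "g' = tensor h' (P j' x')" "f' = tensor (mult_op (\<phi> j') h') (P j' x')"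
      using \<open>(g', f') \<in> A\<close> by (auto simp: A_def)
    show ?thesis
      unfolding 1 2 cinner_tensor
      using cinner_proj_proj[OF P, of j j' x x'] linear_isometry_cinner[OF linear_isometry_mult_op[OF \<phi>]]
      by (cases "j = j'") auto
  qed
  have AR1: "(g, f) \<in> R1" if "(g, f) \<in> A" for g f
    using that AR Ainner by (auto simp: R1_def)
  have AR2: "(g, f) \<in> R2" if A: "(g, f) \<in> A" for g f
  proof -
    have "cinner f F = cinner g G" if "(G, F) \<in> R1" for G F
    proof -
      have "cinner F f = cinner G g" using that A by (auto simp: R1_def)
      then show ?thesis using cinner_commute[of f F] cinner_commute[of g G] by simp
    qed
    then show ?thesis using AR1[OF A] by (auto simp: R2_def)
  qed
  have R2_R: "(G, F) \<in> R" if "(G, F) \<in> R2" for G F using that by (simp add: R2_def R1_def)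
  have R2_iso: "norm G = norm F" if "(G, F) \<in> R2" for G F
  proof -
    have "cinner F F = cinner G G" using that by (auto simp: R2_def)
    then show ?thesis by (simp only: cinner_self of_real_eq_iff) (simp add: power2_eq_iff_nonneg)
  qed
  have cl1: "(0, 0) \<in> R1" "(G, F) \<in> R1 \<Longrightarrow> (G', F') \<in> R1 \<Longrightarrow> (G + G', F + F') \<in> R1"
    "(G, F) \<in> R1 \<Longrightarrow> (a *\<^sub>C G, a *\<^sub>C F) \<in> R1" for G F G' F' a
  proof -
    show "(0, 0) \<in> R1" by (rule R1I) (simp_all add: R0)
    show "(G + G', F + F') \<in> R1" if "(G, F) \<in> R1" "(G', F') \<in> R1"
      by (rule R1I) (simp_all add: Radd R1D[OF that(1)] R1D[OF that(2)] cinner_add_left)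
    show "(a *\<^sub>C G, a *\<^sub>C F) \<in> R1" if "(G, F) \<in> R1"
      by (rule R1I) (simp_all add: Rscale R1D[OF that] cinner_scaleC_left)
  qed
  have lim_eq: "cinner F f = cinner G g"
    if "\<And>n. cinner (Y n) f = cinner (X n) g" "X \<longlonglongrightarrow> G" "Y \<longlonglongrightarrow> F" for X Y G F f g
  proof (rule LIMSEQ_unique)
    show "(\<lambda>n. cinner (Y n) f) \<longlonglongrightarrow> cinner F f" by (intro tendsto_cinner tendsto_const that)
    show "(\<lambda>n. cinner (Y n) f) \<longlonglongrightarrow> cinner G g" unfolding that(1) by (intro tendsto_cinner tendsto_const that)
  qed
  have lim1: "(G, F) \<in> R1" if X: "\<And>n. (X n, Y n) \<in> R1" "X \<longlonglongrightarrow> G" "Y \<longlonglongrightarrow> F" for X Y G F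
  proof -
    have "cinner F f = cinner G g" if "(g, f) \<in> A" for g f
      by (rule lim_eq[of Y f X g]) (simp_all add: R1D(2)[OF X(1) that] X(2,3))
    moreover have "(G, F) \<in> R" by (rule Rlim[of X Y]) (simp_all add: R1D(1)[OF X(1)] X(2,3))
    ultimately show ?thesis by (intro R1I)
  qed
  have cl2: "(0, 0) \<in> R2" "(G, F) \<in> R2 \<Longrightarrow> (G', F') \<in> R2 \<Longrightarrow> (G + G', F + F') \<in> R2"
    "(G, F) \<in> R2 \<Longrightarrow> (a *\<^sub>C G, a *\<^sub>C F) \<in> R2" for G F G' F' a
  proof -
    show "(0, 0) \<in> R2" by (rule R2I) (simp_all add: cl1)
    show "(G + G', F + F') \<in> R2" if "(G, F) \<in> R2" "(G', F') \<in> R2"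
      by (rule R2I) (simp_all add: cl1 R2D[OF that(1)] R2D[OF that(2)] cinner_add_left)
    show "(a *\<^sub>C G, a *\<^sub>C F) \<in> R2" if "(G, F) \<in> R2"
      by (rule R2I) (simp_all add: cl1 R2D[OF that] cinner_scaleC_left)
  qed
  have lim2: "(G, F) \<in> R2" if X: "\<And>n. (X n, Y n) \<in> R2" "X \<longlonglongrightarrow> G" "Y \<longlonglongrightarrow> F" for X Y G F
  proof -
    have "cinner F f = cinner G g" if "(g, f) \<in> R1" for g f
      by (rule lim_eq[of Y f X g]) (simp_all add: R2D(2)[OF X(1) that] X(2,3))
    moreover have "(G, F) \<in> R1" by (rule lim1[of X Y]) (simp_all add: R2D(1)[OF X(1)] X(2,3))
    ultimately show ?thesis by (intro R2I)
  qed
  have csC: "closed_subspace C" unfolding C_def by (rule closed_subspace_closed_span)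
  have "closed_subspace {F. \<exists>G. (F, G) \<in> R2\<inverse>}"
    by (rule isometric_relation_domain) (auto intro: cl2 lim2 dest: R2_iso)
  moreover have "{tensor (mult_op (\<phi> j) h) (P j x) | h j x. True} \<subseteq> {F. \<exists>G. (F, G) \<in> R2\<inverse>}"
  proof safe
    fix h j x
    have "(tensor h (P j x), tensor (mult_op (\<phi> j) h) (P j x)) \<in> R2" by (rule AR2) (auto simp: A_def)
    then show "\<exists>G. (tensor (mult_op (\<phi> j) h) (P j x), G) \<in> R2\<inverse>" by blast
  qed
  ultimately have "C \<subseteq> {F. \<exists>G. (F, G) \<in> R2\<inverse>}" unfolding C_def by (intro closed_span_least)
  then have "C \<subseteq> {F. \<exists>G. (G, F) \<in> R}" using R2_R by blast
  then have "C \<subseteq> Theta_range \<phi> P" by (auto simp: Theta_range_eq R_def)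
  moreover have "Theta_range \<phi> P \<subseteq> C"
  proof
    fix F assume "F \<in> Theta_range \<phi> P"
    then obtain G where G: "(G, F) \<in> R" by (auto simp: Theta_range_eq R_def)
    \<comment> \<open>The functions whose image lies in \<open>C\<close> form a closed subspace that contains all generators.\<close>
    have "closed_subspace {G. \<exists>F. (G, F) \<in> {(G, F). (G, F) \<in> R2 \<and> F \<in> C}}"
      by (rule isometric_relation_domain)
        (auto intro: cl2 lim2 closed_subspace_limit[OF csC] simp: closed_subspaceD(1-4)[OF csC] R2_iso)
    moreover have "{tensor h (P j x) | h j x. True} \<subseteq> {G. \<exists>F. (G, F) \<in> {(G, F). (G, F) \<in> R2 \<and> F \<in> C}}"
    proof -
      have "\<exists>F. (tensor h (P j x), F) \<in> R2 \<and> F \<in> C" for h j x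
      proof (intro exI conjI)
        show "(tensor h (P j x), tensor (mult_op (\<phi> j) h) (P j x)) \<in> R2" by (rule AR2) (auto simp: A_def)
        show "tensor (mult_op (\<phi> j) h) (P j x) \<in> C"
          unfolding C_def by (rule subsetD[OF closed_span_superset]) auto
      qed
      then show ?thesis by auto
    qed
    ultimately have "closed_span {tensor h (P j x) | h j x. True} \<subseteq> {G. \<exists>F. (G, F) \<in> {(G, F). (G, F) \<in> R2 \<and> F \<in> C}}"
      by (intro closed_span_least)
    then obtain F' where "(G, F') \<in> R2" "F' \<in> C" unfolding closed_span_tensors[OF P] by auto
    then show "F \<in> C" using Runique[OF G R2_R] by simp
  qed
  ultimately show ?thesis by (simp add: C_def)
qed


section \<open>Spans of tensor products along an increasing inner sequence\<close>

definition tensor_span :: "(nat \<Rightarrow> complex^1 \<Rightarrow> complex) \<Rightarrow> (nat \<Rightarrow> 'm::finite H2 set) \<Rightarrow> 'm option H2 set" where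
  "tensor_span \<phi> M = closed_span (\<Union>j. hardy_tensor (multiples (\<phi> j)) (M j))"

lemma tensor_span_eq:
  assumes \<phi>: "\<And>j. isometric_multiplier (\<phi> j)"
  shows "tensor_span \<phi> M = closed_span {tensor (mult_op (\<phi> j) h) g | j h g. g \<in> M j}"
proof
  have "{tensor f g | f g. f \<in> multiples (\<phi> j) \<and> g \<in> M j} \<subseteq> {tensor (mult_op (\<phi> j) h) g | j h g. g \<in> M j}" for j
    by (auto simp: multiples_eq_range[OF \<phi>])
  then have "hardy_tensor (multiples (\<phi> j)) (M j) \<subseteq> closed_span {tensor (mult_op (\<phi> j) h) g | j h g. g \<in> M j}" for j
    unfolding hardy_tensor_eq by (rule closed_span_mono)
  then show "tensor_span \<phi> M \<subseteq> closed_span {tensor (mult_op (\<phi> j) h) g | j h g. g \<in> M j}"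
    unfolding tensor_span_def by (intro closed_span_least closed_subspace_closed_span) blast
  have "tensor (mult_op (\<phi> j) h) g \<in> hardy_tensor (multiples (\<phi> j)) (M j)" if "g \<in> M j" for j h g
    unfolding hardy_tensor_eq
    by (rule subsetD[OF closed_span_superset]) (use that in \<open>auto simp: multiples_eq_range[OF \<phi>]\<close>)
  then show "closed_span {tensor (mult_op (\<phi> j) h) g | j h g. g \<in> M j} \<subseteq> tensor_span \<phi> M"
    unfolding tensor_span_def by (intro closed_span_mono) blast
qed

lemma increasing_innerD:
  assumes "increasing_inner \<phi>"
  shows "isometric_multiplier (\<phi> j)"
    and "\<exists>q. isometric_multiplier q \<and> \<not> q constant_on polydisc \<and> (\<forall>z\<in>polydisc. \<phi> (Suc j) z = q z * \<phi> j z)"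
  using assms
  by (auto simp: increasing_inner_def nonconstant_inner_quotient_def inner_function_iff_isometric_multiplier)

lemma increasing_inner_divides:
  assumes \<phi>: "increasing_inner \<phi>" and "i \<le> j"
  shows "\<exists>q. isometric_multiplier q \<and> (\<forall>z\<in>polydisc. \<phi> j z = q z * \<phi> i z)"
  using assms(2)
proof (induction j rule: dec_induct)
  case base
  then show ?case using isometric_multiplier_1 by (intro exI[of _ "\<lambda>_. 1"]) auto
next
  case (step j)
  then obtain q where q: "isometric_multiplier q" "\<forall>z\<in>polydisc. \<phi> j z = q z * \<phi> i z" by blast
  obtain q' where q': "isometric_multiplier q'" "\<forall>z\<in>polydisc. \<phi> (Suc j) z = q' z * \<phi> j z"
    using increasing_innerD(2)[OF \<phi>, of j] by blast
  have "isometric_multiplier (\<lambda>z. q' z * q z)" by (rule isometric_multiplier_mult[OF q'(1) q(1)])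
  then show ?case using q(2) q'(2) by (intro exI[of _ "\<lambda>z. q' z * q z"]) auto
qed

lemma mult_op_factor:
  assumes "isometric_multiplier q" "\<forall>z\<in>polydisc. \<phi> z = q z * \<psi> z" "isometric_multiplier \<psi>"
  shows "mult_op \<phi> h = mult_op \<psi> (mult_op q h)"
  by (rule mult_op_eqI) (simp add: assms Rep_mult_op[OF assms(1)] Rep_mult_op[OF assms(3)] mult_ac)

text \<open>Let \<open>q = \<phi> (Suc k) / \<phi> k\<close>.  The vector \<open>u = \<phi> k (1 - cnj (q 0) q)\<close> is orthogonal to
  \<open>\<phi> (Suc k) H\<^sup>2 = \<phi> k q H\<^sup>2\<close>, because \<open>1\<close> represents the evaluation at \<open>0\<close>.  Moreover
  \<open>\<langle>\<phi> k, u\<rangle> = 1 - \<bar>q 0\<bar>\<^sup>2\<close>, which is the squared norm of \<open>q - q 0\<close> and hence non-zero for non-constant \<open>q\<close>.\<close>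

lemma increasing_inner_wandering_vector:
  assumes \<phi>: "increasing_inner \<phi>"
  obtains u :: "1 H2" where "cinner (mult_op (\<phi> k) (monomial (\<lambda>_. 0))) u \<noteq> 0"
    "\<And>j h. k < j \<Longrightarrow> cinner (mult_op (\<phi> j) h) u = 0"
proof -
  note iso = increasing_innerD(1)[OF \<phi>]
  obtain q where q: "isometric_multiplier q" "\<not> q constant_on polydisc"
    "\<forall>z\<in>polydisc. \<phi> (Suc k) z = q z * \<phi> k z"
    using increasing_innerD(2)[OF \<phi>, of k] by blast
  let ?one = "monomial (\<lambda>_. 0) :: 1 H2"
  have pd0: "(0 :: complex^1) \<in> polydisc" by (simp add: polydisc_def)
  have at0: "cinner f ?one = Rep_H2 f 0" for f
  proof -
    have "szego_kernel 0 = ?one"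
    proof (rule H2_coeff_inject, rule ext)
      fix l :: "1 \<Rightarrow> nat"
      have "zpow (0 :: complex^1) l = (if l = (\<lambda>_. 0) then 1 else 0)"
        by (auto simp: zpow_def fun_eq_iff num1_eq_iff)
      then show "H2_coeff (szego_kernel 0) l = H2_coeff ?one l"
        by (simp add: H2_coeff_szego_kernel[OF pd0] H2_coeff_monomial)
    qed
    then show ?thesis by (simp add: Rep_H2_eq_cinner[OF pd0])
  qed
  define Q where "Q = mult_op q ?one"
  have RepQ: "Rep_H2 Q z = q z" if "z \<in> polydisc" for z
    using that by (simp add: Q_def Rep_mult_op[OF q(1)] Rep_monomial zpow_def)
  note isoq = linear_isometry_mult_op[OF q(1)] and isok = linear_isometry_mult_op[OF iso[of k]]
  have nQ: "norm Q = 1" by (simp add: Q_def linear_isometryD(3)[OF isoq] norm_monomial)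
  define v where "v = ?one - cnj (q 0) *\<^sub>C Q"
  define u where "u = mult_op (\<phi> k) v"
  have cQ1: "cinner Q ?one = q 0" by (simp add: at0 RepQ pd0)
  have cQQ: "cinner Q Q = 1" by (simp add: cinner_self nQ)
  have c1Q: "cinner ?one Q = cnj (q 0)" using cinner_commute[of ?one Q] cQ1 by simp
  have "cinner (mult_op (\<phi> k) ?one) u = cinner ?one v"
    unfolding u_def by (rule linear_isometry_cinner[OF isok])
  also have "\<dots> = 1 - q 0 * cnj (q 0)"
    by (simp add: v_def cinner_diff_right cinner_scaleC_right cinner_monomial_monomial c1Q)
  finally have val: "cinner (mult_op (\<phi> k) ?one) u = 1 - q 0 * cnj (q 0)" .
  have "q 0 * cnj (q 0) \<noteq> 1"
  proof
    assume eq: "q 0 * cnj (q 0) = 1"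
    have "cinner (Q - q 0 *\<^sub>C ?one) (Q - q 0 *\<^sub>C ?one) = 1 - q 0 * cnj (q 0)"
      by (simp add: cinner_diff_left cinner_diff_right cinner_scaleC_left cinner_scaleC_right cQ1 c1Q
          cQQ cinner_monomial_monomial mult.commute)
    then have "Q - q 0 *\<^sub>C ?one = 0" using eq by simp
    then have "Q = q 0 *\<^sub>C ?one" by simp
    then have "q z = q 0" if "z \<in> polydisc" for z
      using RepQ[OF that] by (simp add: Rep_monomial[OF that] zpow_def)
    then show False using q(2) by (auto simp: constant_on_def)
  qed
  then have "cinner (mult_op (\<phi> k) ?one) u \<noteq> 0" unfolding val by simp
  moreover have "cinner (mult_op (\<phi> j) h) u = 0" if "k < j" for j h
  proof -
    have "Suc k \<le> j" using that by simp
    from increasing_inner_divides[OF \<phi> this] obtain r where r: "isometric_multiplier r"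
      "\<forall>z\<in>polydisc. \<phi> j z = r z * \<phi> (Suc k) z" by blast
    define g where "g = mult_op r h"
    have "mult_op (\<phi> j) h = mult_op (\<phi> k) (mult_op q g)"
      unfolding g_def using mult_op_factor[OF r iso] mult_op_factor[OF q(1,3) iso] by simp
    then have "cinner (mult_op (\<phi> j) h) u = cinner (mult_op q g) v"
      unfolding u_def by (simp add: linear_isometry_cinner[OF isok])
    also have "\<dots> = cinner (mult_op q g) ?one - q 0 * cinner (mult_op q g) (mult_op q ?one)"
      by (simp add: v_def Q_def cinner_diff_right cinner_scaleC_right)
    also have "\<dots> = Rep_H2 (mult_op q g) 0 - q 0 * Rep_H2 g 0"
      by (simp add: linear_isometry_cinner[OF isoq] at0)
    also have "\<dots> = 0" by (simp add: Rep_mult_op[OF q(1) pd0])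
    finally show ?thesis .
  qed
  ultimately show ?thesis using that by blast
qed

text \<open>Let \<open>u\<close> be orthogonal to \<open>\<phi> j H\<^sup>2\<close> for \<open>j > k\<close> but not to \<open>\<phi> k\<close>, and let \<open>y\<close> be orthogonal to \<open>M k\<close>.
  Then \<open>u \<otimes> y\<close> is orthogonal to the span, through its first factor for \<open>j > k\<close> and through its
  second factor for \<open>j \<le> k\<close>.  So the span determines the subspaces \<open>M k\<close>.\<close>

lemma in_tensor_span_iff:
  assumes \<phi>: "increasing_inner \<phi>" and M: "\<And>j. closed_subspace (M j)" "\<And>i j. i \<le> j \<Longrightarrow> M i \<subseteq> M j"
  shows "tensor (mult_op (\<phi> k) (monomial (\<lambda>_. 0))) f \<in> tensor_span \<phi> M \<longleftrightarrow> f \<in> M k"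
proof
  note iso = increasing_innerD(1)[OF \<phi>]
  let ?\<Phi> = "mult_op (\<phi> k) (monomial (\<lambda>_. 0))"
  assume mem: "tensor ?\<Phi> f \<in> tensor_span \<phi> M"
  obtain u :: "1 H2" where u: "cinner ?\<Phi> u \<noteq> 0" "\<And>j h. k < j \<Longrightarrow> cinner (mult_op (\<phi> j) h) u = 0"
    using increasing_inner_wandering_vector[OF \<phi>] by metis
  show "f \<in> M k"
  proof (rule in_closed_subspace_if_orthogonal[OF M(1)])
    fix y assume y: "\<And>z. z \<in> M k \<Longrightarrow> cinner z y = 0"
    have "cinner (tensor ?\<Phi> f) (tensor u y) = 0"
    proof (rule orthogonal_closed_span)
      show "tensor ?\<Phi> f \<in> closed_span {tensor (mult_op (\<phi> j) h) g | j h g. g \<in> M j}"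
        using mem by (simp only: tensor_span_eq[OF iso])
      fix x assume "x \<in> {tensor (mult_op (\<phi> j) h) g | j h g. g \<in> M j}"
      then obtain j h g where x: "x = tensor (mult_op (\<phi> j) h) g" "g \<in> M j" by blast
      show "cinner x (tensor u y) = 0"
      proof (cases "k < j")
        case True
        then show ?thesis by (simp add: x cinner_tensor u)
      next
        case False
        then have "g \<in> M k" using M(2)[of j k] x(2) by auto
        then show ?thesis by (simp add: x(1) cinner_tensor y)
      qed
    qed
    then show "cinner f y = 0" using u(1) by (simp add: cinner_tensor)
  qed
next
  assume "f \<in> M k"
  then show "tensor (mult_op (\<phi> k) (monomial (\<lambda>_. 0))) f \<in> tensor_span \<phi> M"
    unfolding tensor_span_eq[OF increasing_innerD(1)[OF \<phi>]]
    by (intro subsetD[OF closed_span_superset]) blast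
qed

text \<open>The shift in the first variable acts on the factors \<open>\<phi> j H\<^sup>2\<close> and always preserves the span.
  The other shifts act on the subspaces \<open>M j\<close>, which the span determines.\<close>

lemma invariant_tensor_span_iff:
  assumes \<phi>: "increasing_inner \<phi>" and M: "\<And>j. closed_subspace (M j)" "\<And>i j. i \<le> j \<Longrightarrow> M i \<subseteq> M j"
  shows "invariant_subspace (tensor_span \<phi> M) \<longleftrightarrow> (\<forall>j. invariant_subspace (M j))"
proof
  let ?\<Phi> = "\<lambda>k. mult_op (\<phi> k) (monomial (\<lambda>_. 0))"
  assume inv: "invariant_subspace (tensor_span \<phi> M)"
  note mem = in_tensor_span_iff[where M = M, OF \<phi> M]
  have "shift i f \<in> M k" if "f \<in> M k" for i f k
  proof -
    have "tensor (?\<Phi> k) f \<in> tensor_span \<phi> M" using mem that by blast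
    then have "shift (Some i) (tensor (?\<Phi> k) f) \<in> tensor_span \<phi> M" by (rule invariant_subspaceD(2)[OF inv])
    then have "tensor (?\<Phi> k) (shift i f) \<in> tensor_span \<phi> M" by (simp only: shift_tensor)
    then show ?thesis using mem by blast
  qed
  then show "\<forall>j. invariant_subspace (M j)" using M(1) by (auto simp: invariant_subspace_def)
next
  note iso = increasing_innerD(1)[OF \<phi>]
  assume inv: "\<forall>j. invariant_subspace (M j)"
  let ?X = "{tensor (mult_op (\<phi> j) h) g | j h g. g \<in> M j}"
  have "shift i (tensor (mult_op (\<phi> j) h) g) \<in> ?X" if "g \<in> M j" for i j h g
  proof (cases i)
    case None
    then have "shift i (tensor (mult_op (\<phi> j) h) g) = tensor (mult_op (\<phi> j) (shift 1 h)) g"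
      by (simp add: shift_tensor mult_op_shift[OF iso])
    then show ?thesis using that by blast
  next
    case (Some i')
    then have "shift i (tensor (mult_op (\<phi> j) h) g) = tensor (mult_op (\<phi> j) h) (shift i' g)"
      by (simp add: shift_tensor)
    moreover have "shift i' g \<in> M j" using inv that invariant_subspaceD(2) by blast
    ultimately show ?thesis by blast
  qed
  then have "shift i ` ?X \<subseteq> ?X" for i by (intro image_subsetI) (elim CollectE exE conjE, simp only:)
  then have "shift i ` ?X \<subseteq> closed_span ?X" for i by (rule order_trans[OF _ closed_span_superset])
  then have "shift i ` closed_span ?X \<subseteq> closed_span ?X" for i
    by (intro linear_isometry_closed_span[OF linear_isometry_shift closed_subspace_closed_span])
  then show "invariant_subspace (tensor_span \<phi> M)"
    unfolding invariant_subspace_def tensor_span_eq[OF iso] using closed_subspace_closed_span by blast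
qed

text \<open>For \<open>k \<le> j\<close> the function \<open>\<phi> j\<close> is a multiple of \<open>\<phi> k\<close>, so \<open>\<phi> j H\<^sup>2 \<otimes> Ran P\<^sub>k\<close> is contained in
  \<open>\<phi> k H\<^sup>2 \<otimes> Ran P\<^sub>k\<close>: replacing \<open>Ran P\<^sub>j\<close> by the sum of the ranges up to \<open>j\<close> does not enlarge the span.\<close>

lemma Theta_range_eq_tensor_span:
  fixes P :: "nat \<Rightarrow> 'm::finite H2 \<Rightarrow> 'm H2"
  assumes P: "complementary_projections P" and \<phi>: "increasing_inner \<phi>"
  shows "Theta_range \<phi> P = tensor_span \<phi> (range_sum P)"
proof -
  note iso = increasing_innerD(1)[OF \<phi>]
  let ?Y = "{tensor (mult_op (\<phi> j) h) (P j x) | h j x. True}"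
  have "?Y \<subseteq> {tensor (mult_op (\<phi> j) h) g | j h g. g \<in> range_sum P j}"
    using range_subset_range_sum[OF P order_refl] by blast
  moreover have "{tensor (mult_op (\<phi> j) h) g | j h g. g \<in> range_sum P j} \<subseteq> closed_span ?Y"
  proof safe
    fix j h g assume "g \<in> range_sum P j"
    then have g: "g = (\<Sum>k\<le>j. P k g)" by (simp add: range_sum_eq[OF P])
    have "tensor (mult_op (\<phi> j) h) (P k g) \<in> closed_span ?Y" if k: "k \<le> j" for k
    proof -
      obtain q where "isometric_multiplier q" "\<forall>z\<in>polydisc. \<phi> j z = q z * \<phi> k z"
        using increasing_inner_divides[OF \<phi> k] by blast
      then have "mult_op (\<phi> j) h = mult_op (\<phi> k) (mult_op q h)" by (rule mult_op_factor[OF _ _ iso])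
      then have "tensor (mult_op (\<phi> j) h) (P k g) \<in> ?Y" by auto
      then show ?thesis by (rule subsetD[OF closed_span_superset])
    qed
    then have "(\<Sum>k\<le>j. tensor (mult_op (\<phi> j) h) (P k g)) \<in> closed_span ?Y"
      by (intro closed_subspace_sum[OF closed_subspace_closed_span]) auto
    then show "tensor (mult_op (\<phi> j) h) g \<in> closed_span ?Y"
      unfolding tensor_sum_right[symmetric] g[symmetric] .
  qed
  ultimately show ?thesis
    unfolding Theta_range_eq_closed_span[OF P iso] tensor_span_eq[OF iso]
    by (intro antisym closed_span_mono closed_span_least closed_subspace_closed_span)
qed

text \<open>The quotient is read off from \<open>\<omega> \<cdot> 1 = \<psi> h\<close>.  The function \<open>h\<close> is an isometric multiplier because
  \<open>\<omega>\<close> and \<open>\<psi>\<close> are, and if it were constant, both functions would have the same multiples.\<close>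

lemma nonconstant_inner_quotient_if_multiples_psubset:
  assumes \<psi>: "isometric_multiplier \<psi>" and \<omega>: "isometric_multiplier \<omega>"
    and sub: "multiples \<omega> \<subset> multiples \<psi>"
  shows "nonconstant_inner_quotient \<omega> \<psi>"
proof -
  let ?one = "monomial (\<lambda>_. 0) :: 'a H2"
  note isop = linear_isometry_mult_op[OF \<psi>] and isoo = linear_isometry_mult_op[OF \<omega>]
    and isoz = linear_isometry_mult_op[OF isometric_multiplier_zpow]
  have "mult_op \<omega> ?one \<in> multiples \<psi>" using sub by (auto simp: multiples_eq_range[OF \<omega>])
  then obtain h where h: "mult_op \<omega> ?one = mult_op \<psi> h" by (auto simp: multiples_eq_range[OF \<psi>])
  have eq: "\<omega> z = Rep_H2 h z * \<psi> z" if z: "z \<in> polydisc" for z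
  proof -
    have "Rep_H2 (mult_op \<omega> ?one) z = Rep_H2 (mult_op \<psi> h) z" by (simp only: h)
    then show ?thesis by (simp add: Rep_mult_op[OF \<omega> z] Rep_mult_op[OF \<psi> z] Rep_monomial[OF z] zpow_def mult.commute)
  qed
  have iso: "isometric_multiplier (Rep_H2 h)"
  proof (rule isometric_multiplierI)
    let ?e = "\<lambda>k. mult_op (\<lambda>z. zpow z k) h"
    show "Rep_H2 (?e k) z = Rep_H2 h z * zpow z k" if "z \<in> polydisc" for k z
      by (simp add: Rep_mult_op[OF isometric_multiplier_zpow that])
    have e: "mult_op \<psi> (?e k) = mult_op \<omega> (monomial k)" for k
      by (rule mult_op_eqI)
        (simp add: Rep_mult_op[OF \<omega>] Rep_mult_op[OF isometric_multiplier_zpow] Rep_monomial eq mult_ac)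
    have "cinner (?e k) (?e l) = cinner (mult_op \<omega> (monomial k)) (mult_op \<omega> (monomial l))" for k l
      unfolding e[symmetric] by (rule linear_isometry_cinner[OF isop, symmetric])
    then show "cinner (?e k) (?e l) = (if k = l then 1 else 0)" for k l
      by (simp add: linear_isometry_cinner[OF isoo] cinner_monomial_monomial)
  qed
  have "\<not> Rep_H2 h constant_on polydisc"
  proof
    assume "Rep_H2 h constant_on polydisc"
    then obtain c where c: "\<And>z. z \<in> polydisc \<Longrightarrow> Rep_H2 h z = c" by (auto simp: constant_on_def)
    have "mult_op (Rep_H2 h) ?one = c *\<^sub>C ?one"
      by (rule mult_op_eqI) (simp add: c)
    then have "norm c = 1"
      using linear_isometryD(3)[OF linear_isometry_mult_op[OF iso], of ?one] by (simp add: norm_scaleC norm_monomial)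
    then have c0: "c \<noteq> 0" by auto
    have "mult_op \<psi> f \<in> multiples \<omega>" for f
    proof -
      have "mult_op \<psi> f = mult_op \<omega> ((1 / c) *\<^sub>C f)"
        by (rule mult_op_eqI) (simp add: Rep_mult_op[OF \<omega>] eq c c0)
      then show ?thesis by (auto simp: multiples_eq_range[OF \<omega>])
    qed
    then show False using sub by (auto simp: multiples_eq_range[OF \<psi>])
  qed
  then show ?thesis
    unfolding nonconstant_inner_quotient_def inner_function_iff_isometric_multiplier using iso eq by blast
qed

theorem theorem3p3:
  fixes P :: "nat \<Rightarrow> 'm::finite H2 \<Rightarrow> 'm H2"
    and \<phi> :: "nat \<Rightarrow> complex^1 \<Rightarrow> complex"
  assumes "complementary_projections P"
    and "increasing_inner \<phi>"
  shows "(invariant_subspace (Theta_range \<phi> P) \<longleftrightarrow> (\<forall>j. invariant_subspace (range_sum P j)))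
    \<and> ((\<forall>j. \<exists>x. P j x \<noteq> 0) \<longrightarrow>
         ((\<exists>\<psi> :: nat \<Rightarrow> complex^'m \<Rightarrow> complex.
             decreasing_inner \<psi> \<and>
             Theta_range \<phi> P = closed_span (\<Union>j. hardy_tensor (multiples (\<phi> j)) (multiples (\<psi> j))))
          \<longleftrightarrow> (\<forall>j. invariant_subspace (range_sum P j) \<and> doubly_commuting (range_sum P j))))"
proof (intro conjI impI)
  note P = assms(1) and \<phi> = assms(2)
  note M = closed_subspace_range_sum[OF P] range_sum_mono[OF P]
  note span = Theta_range_eq_tensor_span[OF P \<phi>]
  show "invariant_subspace (Theta_range \<phi> P) \<longleftrightarrow> (\<forall>j. invariant_subspace (range_sum P j))"
    unfolding span by (rule invariant_tensor_span_iff[where M = "range_sum P", OF \<phi> M])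
  assume nz: "\<forall>j. \<exists>x. P j x \<noteq> 0"
  show "(\<exists>\<psi> :: nat \<Rightarrow> complex^'m \<Rightarrow> complex. decreasing_inner \<psi> \<and>
        Theta_range \<phi> P = closed_span (\<Union>j. hardy_tensor (multiples (\<phi> j)) (multiples (\<psi> j))))
      \<longleftrightarrow> (\<forall>j. invariant_subspace (range_sum P j) \<and> doubly_commuting (range_sum P j))"
  proof
    assume "\<exists>\<psi> :: nat \<Rightarrow> complex^'m \<Rightarrow> complex. decreasing_inner \<psi> \<and>
        Theta_range \<phi> P = closed_span (\<Union>j. hardy_tensor (multiples (\<phi> j)) (multiples (\<psi> j)))"
    then obtain \<psi> :: "nat \<Rightarrow> complex^'m \<Rightarrow> complex" where \<psi>: "decreasing_inner \<psi>"
      and eq: "tensor_span \<phi> (range_sum P) = tensor_span \<phi> (\<lambda>j. multiples (\<psi> j))"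
      unfolding span by (auto simp: tensor_span_def)
    have iso: "isometric_multiplier (\<psi> j)" for j
      using \<psi> by (simp add: decreasing_inner_def inner_function_iff_isometric_multiplier)
    have "multiples (\<psi> j) \<subseteq> multiples (\<psi> (Suc j))" for j
    proof -
      have "\<exists>q. isometric_multiplier q \<and> (\<forall>z\<in>polydisc. \<psi> j z = q z * \<psi> (Suc j) z)"
        using \<psi> unfolding decreasing_inner_def nonconstant_inner_quotient_def
          inner_function_iff_isometric_multiplier by blast
      then obtain q where "isometric_multiplier q" "\<forall>z\<in>polydisc. \<psi> j z = q z * \<psi> (Suc j) z" by blast
      then have "mult_op (\<psi> j) h = mult_op (\<psi> (Suc j)) (mult_op q h)" for h
        by (rule mult_op_factor[OF _ _ iso])
      then show ?thesis by (auto simp: multiples_eq_range[OF iso])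
    qed
    then have mono: "multiples (\<psi> i) \<subseteq> multiples (\<psi> j)" if "i \<le> j" for i j
      using that by (rule lift_Suc_mono_le[of "\<lambda>j. multiples (\<psi> j)"])
    \<comment> \<open>Both families of subspaces have the same span, which determines them.\<close>
    have "range_sum P j = multiples (\<psi> j)" for j
      using in_tensor_span_iff[where M = "range_sum P", OF \<phi> M, of j]
        in_tensor_span_iff[where M = "\<lambda>j. multiples (\<psi> j)", OF \<phi> closed_subspace_multiples[OF iso] mono, of j]
      unfolding eq by blast
    then show "\<forall>j. invariant_subspace (range_sum P j) \<and> doubly_commuting (range_sum P j)"
      using multiples_invariant_doubly_commuting[OF iso] by simp
  next
    assume dc: "\<forall>j. invariant_subspace (range_sum P j) \<and> doubly_commuting (range_sum P j)"
    have "\<exists>\<psi>. isometric_multiplier \<psi> \<and> range_sum P j = multiples \<psi>" for j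
    proof -
      obtain x where "P j x \<noteq> 0" using nz by blast
      then have "range_sum P j \<noteq> {0}" using range_subset_range_sum[OF P order_refl, of j x] by auto
      then show ?thesis using doubly_commuting_imp_multiples[of "range_sum P j"] dc by metis
    qed
    then obtain \<psi> where \<psi>: "\<And>j. isometric_multiplier (\<psi> j)" "\<And>j. range_sum P j = multiples (\<psi> j)" by metis
    have "nonconstant_inner_quotient (\<psi> j) (\<psi> (Suc j))" for j
    proof (rule nonconstant_inner_quotient_if_multiples_psubset[OF \<psi>(1) \<psi>(1)])
      \<comment> \<open>A non-zero range of \<open>P (Suc j)\<close> makes the inclusion proper, hence the quotient non-constant.\<close>
      obtain x where "P (Suc j) x \<noteq> 0" using nz by blast
      then have "P (Suc j) x \<in> range_sum P (Suc j)" "P (Suc j) x \<notin> range_sum P j"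
        by (auto intro: range_subset_range_sum[OF P order_refl] dest: range_sum_strict[OF P])
      then show "multiples (\<psi> j) \<subset> multiples (\<psi> (Suc j))"
        unfolding \<psi>(2)[symmetric] using range_sum_mono[OF P, of j "Suc j"] by auto
    qed
    then have "decreasing_inner \<psi>"
      using \<psi>(1) by (simp add: decreasing_inner_def inner_function_iff_isometric_multiplier)
    moreover have "Theta_range \<phi> P = closed_span (\<Union>j. hardy_tensor (multiples (\<phi> j)) (multiples (\<psi> j)))"
      unfolding span tensor_span_def \<psi>(2) ..
    ultimately show "\<exists>\<psi> :: nat \<Rightarrow> complex^'m \<Rightarrow> complex. decreasing_inner \<psi> \<and>
        Theta_range \<phi> P = closed_span (\<Union>j. hardy_tensor (multiples (\<phi> j)) (multiples (\<psi> j)))" by blast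
  qed
qed

end
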